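(* Let $n\ge 2$, let $\Omega\subset\mathbb{R}^n$ be a bounded open set, and let $k\in\mathbb{N}$ with $1\le k<n$. Let $\nu$ be a positive Borel measure on $\Omega$ such that, for some $d\in(0,n]$, (i) there is a constant $C_d'>0$ with $\nu(B(x,r))\le C_d' r^d$ for all $x\in\mathbb{R}^n$ and all $r>0$; (ii) there exist $x_0\in\Omega$, $\varrho_0>0$ and $C_0>0$ such that $C_0\varrho^d\le \nu(B(x_0,\varrho)\cap\Omega)$ for all $0<\varrho\le\varrho_0$. Let $$\beta_{n,k,\infty}=\begin{cases}\frac dn\,\gamma(k)\,\omega_n^{-\frac{n-k}{n}} & \text{if } k \text{ is even},\\[2pt] \frac dn\,\widetilde\gamma(k-1)\,\omega_n^{-\frac{n-k}{n}} & \text{if } k\text{ is odd},\end{cases}$$ and let $\gamma<\beta_{n,k,\infty}$. Then there exists a positive constant $C=C(n,k,\Omega,C_d',\gamma)$ such that $$\int_\Omega \exp\left(\gamma|u(x)|\right)\,d\nu\le C$$ for every $u\in W_0^kL^{\frac nk,\infty}(\Omega)$ with $\|\,|D^k u|\,\|_{L^{\frac nk,\infty}(\Omega)}\le 1$. Moreover, the result is sharp in the sense that for any $\gamma>\beta_{n,k,\infty}$ the integral $\int_\Omega \exp(\gamma|u(x)|)\,d\nu$ cannot be uniformly bounded over all $u\in W_0^kL^{\frac nk,\infty}(\Omega)$ with $\|\,|D^k u|\,\|_{L^{\frac nk,\infty}(\Omega)}\le 1$.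
   Context: $B(x,r)$ is the ball of radius $r$ centered at $x$; $\nu$ is regarded as a measure on $\mathbb{R}^n$ vanishing outside $\Omega$, so $\nu(B(x,r))=\nu(B(x,r)\cap\Omega)$. $|E|$ is the Lebesgue measure of $E$, and $\omega_n$ is the Lebesgue measure of the unit ball of $\mathbb{R}^n$. $C=C(\dots)$ means a constant depending only on the listed quantities (dependence on $C_d'$ being understood together with its exponent $d$). The real number $\gamma$ is not to be confused with the function $\gamma(\alpha)=\frac{\pi^{n/2}2^\alpha\Gamma(\alpha/2)}{\Gamma\left(\frac{n-\alpha}{2}\right)}$, $\alpha\in(0,n)$. For $\alpha\in[0,n)$, $\widetilde\gamma(\alpha)=\alpha\gamma(\alpha)$ if $\alpha>0$ and $\widetilde\gamma(0)=n\omega_n$. $D^ku=\nabla(-\Delta)^{(k-1)/2}u$ if $k$ is odd, and $D^ku=(-\Delta)^{k/2}u$ if $k$ is even; $|D^ku|$ is its Euclidean norm (absolute value for $k$ even). $\nabla^k u$ is the tensor of all $n^k$ partial derivatives of $u$ of order $k$ and $|\nabla^k u|$ is its Euclidean norm in $\mathbb{R}^{n^k}$. For a measurable function $g$ on $\Omega$, its non-increasing rearrangement is $g^*(t)=\inf\{\lambda>0:\ |\{x\in\Omega:|g(x)|>\lambda\}|\le t\}$, $t>0$. For $1\le p<\infty$, $\|g\|_{L^{p,\infty}(\Omega)}=\sup_{0<s<|\Omega|}s^{1/p}g^*(s)$. $W_0^kL^{p,\infty}(\Omega)$ is the set of real-valued functions $u$ on $\Omega$ whose continuation by $0$ outside $\Omega$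 is $k$-times weakly differentiable in the whole of $\mathbb{R}^n$ and which satisfy $\|\,|\nabla^k u|\,\|_{L^{p,\infty}(\Omega)}<\infty$. In integrals against $\nu$, $u$ denotes its precise representative $u(x)=\lim_{r\to0}\frac1{|B(x,r)|}\int_{B(x,r)}u(y)\,dy$ (with $u$ extended by $0$), at the points $x$ where this limit exists. *)

theory Defs
  imports "HOL-Analysis.Analysis"
begin

text \<open>A list of coordinates \<open>[i\<^sub>1, \<dots>, i\<^sub>m]\<close> stands for the partial derivative
  \<open>\<partial>\<^sub>i\<^sub>1 \<dots> \<partial>\<^sub>i\<^sub>m\<close>, so the lists of length \<open>m\<close> enumerate all \<open>n\<^sup>m\<close> partial
  derivatives of order \<open>m\<close>.\<close>

fun partials :: "'n::finite list \<Rightarrow> (real^'n \<Rightarrow> real) \<Rightarrow> real^'n \<Rightarrow> real" where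
  "partials [] f = f"
| "partials (i # is) f = (\<lambda>x. frechet_derivative (partials is f) (at x) (axis i 1))"

definition test_function :: "(real^'n::finite \<Rightarrow> real) \<Rightarrow> bool" where
  "test_function f \<longleftrightarrow>
     (\<forall>is x. partials is f differentiable (at x)) \<and> compact (closure {x. f x \<noteq> 0})"

definition locally_integrable :: "(real^'n::finite \<Rightarrow> real) \<Rightarrow> bool" where
  "locally_integrable f \<longleftrightarrow> (\<forall>K. compact K \<longrightarrow> set_integrable lebesgue K f)"

definition has_weak_deriv ::
  "(real^'n::finite \<Rightarrow> real) \<Rightarrow> 'n list \<Rightarrow> (real^'n \<Rightarrow> real) \<Rightarrow> bool" where
  "has_weak_deriv u is v \<longleftrightarrow> locally_integrable u \<and> locally_integrable v \<and>
     (\<forall>f. test_function f \<longrightarrow>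
        (LINT x|lebesgue. u x * partials is f x) = (-1) ^ length is * (LINT x|lebesgue. v x * f x))"

definition weakly_differentiable :: "nat \<Rightarrow> (real^'n::finite \<Rightarrow> real) \<Rightarrow> bool" where
  "weakly_differentiable k u \<longleftrightarrow> (\<forall>is. length is \<le> k \<longrightarrow> (\<exists>v. has_weak_deriv u is v))"

text \<open>Weak derivatives are unique only up to null sets. The choice of a representative does not
  matter below: weak derivatives are only differentiated weakly again or enter a rearrangement.\<close>

definition weak_deriv :: "'n::finite list \<Rightarrow> (real^'n \<Rightarrow> real) \<Rightarrow> real^'n \<Rightarrow> real" where
  "weak_deriv is u = (SOME v. has_weak_deriv u is v)"

definition weak_gradient :: "(real^'n::finite \<Rightarrow> real) \<Rightarrow> real^'n \<Rightarrow> real^'n" where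
  "weak_gradient u x = (\<chi> i. weak_deriv [i] u x)"

definition neg_laplacian :: "(real^'n::finite \<Rightarrow> real) \<Rightarrow> real^'n \<Rightarrow> real" where
  "neg_laplacian u x = - (\<Sum>i\<in>UNIV. weak_deriv [i, i] u x)"

text \<open>\<open>norm_D k u\<close> is \<open>|D\<^sup>k u|\<close> with \<open>D\<^sup>k u = \<nabla>(-\<Delta>)\<^bsup>(k-1)/2\<^esup> u\<close> for odd \<open>k\<close> and
  \<open>D\<^sup>k u = (-\<Delta>)\<^bsup>k/2\<^esup> u\<close> for even \<open>k\<close>; \<open>norm_nabla k u\<close> is \<open>|\<nabla>\<^sup>k u|\<close>.\<close>

definition norm_D :: "nat \<Rightarrow> (real^'n::finite \<Rightarrow> real) \<Rightarrow> real^'n \<Rightarrow> real" where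
  "norm_D k u x =
     (if odd k then norm (weak_gradient ((neg_laplacian ^^ ((k - 1) div 2)) u) x)
      else \<bar>(neg_laplacian ^^ (k div 2)) u x\<bar>)"

definition norm_nabla :: "nat \<Rightarrow> (real^'n::finite \<Rightarrow> real) \<Rightarrow> real^'n \<Rightarrow> real" where
  "norm_nabla k u x = sqrt (\<Sum>is | length is = k. (weak_deriv is u x)\<^sup>2)"

text \<open>The values lie in \<open>[0, \<infinity>]\<close>; the infimum of the empty set is \<open>\<infinity>\<close>.\<close>

definition rearrangement :: "(real^'n::finite) set \<Rightarrow> (real^'n \<Rightarrow> real) \<Rightarrow> real \<Rightarrow> ennreal" where
  "rearrangement \<Omega> g t =
     Inf {ennreal l |l. 0 < l \<and> emeasure lebesgue {x \<in> \<Omega>. \<bar>g x\<bar> > l} \<le> ennreal t}"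

definition weak_Lp_norm :: "(real^'n::finite) set \<Rightarrow> real \<Rightarrow> (real^'n \<Rightarrow> real) \<Rightarrow> ennreal" where
  "weak_Lp_norm \<Omega> p g =
     (SUP s\<in>{s. 0 < s \<and> ennreal s < emeasure lebesgue \<Omega>}.
        ennreal (s powr (1 / p)) * rearrangement \<Omega> g s)"

text \<open>A function on \<open>\<Omega>\<close> is identified with its continuation by \<open>0\<close>.\<close>

definition W0_weak :: "nat \<Rightarrow> real \<Rightarrow> (real^'n::finite) set \<Rightarrow> (real^'n \<Rightarrow> real) set" where
  "W0_weak k p \<Omega> = {u. (\<forall>x. x \<notin> \<Omega> \<longrightarrow> u x = 0) \<and> weakly_differentiable k u \<and>
     weak_Lp_norm \<Omega> p (norm_nabla k u) < \<infinity>}"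

definition ball_average :: "(real^'n::finite \<Rightarrow> real) \<Rightarrow> real^'n \<Rightarrow> real \<Rightarrow> real" where
  "ball_average u x r = (LINT y:ball x r|lebesgue. u y) / measure lebesgue (ball x r)"

text \<open>The value is \<open>0\<close> at the points where the averages do not converge. For
  \<open>u\<close> in \<open>W0_weak k (n / k) \<Omega>\<close> such points have Hausdorff dimension \<open>0\<close>, hence are null for every
  \<open>\<nu>\<close> with \<open>\<nu>(B(x, r)) \<le> C r\<^sup>d\<close> and \<open>d > 0\<close>.\<close>

definition precise_rep :: "(real^'n::finite \<Rightarrow> real) \<Rightarrow> real^'n \<Rightarrow> real" where
  "precise_rep u x =
     (if \<exists>l. (ball_average u x \<longlongrightarrow> l) (at_right 0) then Lim (at_right 0) (ball_average u x) else 0)"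

definition unit_ball_measure :: "'n::finite itself \<Rightarrow> real" where
  "unit_ball_measure _ = measure lebesgue (ball (0 :: real^'n) 1)"

definition riesz_gamma :: "nat \<Rightarrow> real \<Rightarrow> real" where
  "riesz_gamma n a =
     pi powr (real n / 2) * 2 powr a * Gamma (a / 2) / Gamma ((real n - a) / 2)"

definition riesz_gamma_tilde :: "'n::finite itself \<Rightarrow> real \<Rightarrow> real" where
  "riesz_gamma_tilde N a =
     (if a > 0 then a * riesz_gamma CARD('n) a else real CARD('n) * unit_ball_measure N)"

definition beta_infty :: "'n::finite itself \<Rightarrow> nat \<Rightarrow> real \<Rightarrow> real" where
  "beta_infty N k d =
     d / real CARD('n) *
     (if even k then riesz_gamma CARD('n) (real k) else riesz_gamma_tilde N (real k - 1)) *
     unit_ball_measure N powr (- ((real CARD('n) - real k) / real CARD('n)))"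

text \<open>A Borel measure on \<open>\<Omega>\<close> is regarded as one on the whole space that vanishes outside \<open>\<Omega>\<close>.\<close>

definition borel_measure_on :: "(real^'n::finite) set \<Rightarrow> (real^'n) measure \<Rightarrow> bool" where
  "borel_measure_on \<Omega> \<nu> \<longleftrightarrow> sets \<nu> = sets borel \<and> emeasure \<nu> (- \<Omega>) = 0"

definition upper_growth :: "(real^'n::finite) measure \<Rightarrow> real \<Rightarrow> real \<Rightarrow> bool" where
  "upper_growth \<nu> d C \<longleftrightarrow> (\<forall>x r. 0 < r \<longrightarrow> emeasure \<nu> (ball x r) \<le> ennreal (C * r powr d))"

definition lower_growth :: "(real^'n::finite) set \<Rightarrow> (real^'n) measure \<Rightarrow> real \<Rightarrow> bool" where
  "lower_growth \<Omega> \<nu> d \<longleftrightarrow>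
     (\<exists>x\<^sub>0\<in>\<Omega>. \<exists>\<rho>\<^sub>0>0. \<exists>C\<^sub>0>0. \<forall>\<rho>. 0 < \<rho> \<and> \<rho> \<le> \<rho>\<^sub>0 \<longrightarrow>
        ennreal (C\<^sub>0 * \<rho> powr d) \<le> emeasure \<nu> (ball x\<^sub>0 \<rho> \<inter> \<Omega>))"

end

theory Submission
  imports Defs
begin

text \<open>
  Let \<open>c\<close> be the constant \<open>\<gamma>(k)\<close> for even \<open>k\<close> and its odd counterpart otherwise. For test functions
  \<open>c |u|\<close> is at most the convolution of \<open>f = |D\<^sup>k u|\<close> with \<open>|x|\<^bsup>k-n\<^esup>\<close>. The constant comes from
  regularizing the kernel to \<open>(|x|\<^sup>2 + \<epsilon>)\<^bsup>(k-n)/2\<^esup>\<close>. Mollification carries the bound over to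
  \<open>W\<^sub>0\<^sup>k\<close>, where it is used that weak derivatives vanish almost everywhere on the zero set of a function,
  so that \<open>f\<close> lives on \<open>\<Omega>\<close> although the boundary of \<open>\<Omega>\<close> may have positive measure.

  Split the potential at radius \<open>\<rho>\<close>. By the layer cake formula and the bathtub principle, the weak
  bound \<open>|{f > b}| \<le> b\<^bsup>-n/k\<^esup>\<close> makes the far part at most a constant plus
  \<open>n \<omega>\<^sub>n\<^bsup>(n-k)/n\<^esup> ln (1 / \<rho>)\<close>, with the sharp factor, while the near part is controlled by Young's
  inequality through an energy whose \<open>\<nu>\<close>-integral is small by the growth of \<open>\<nu>\<close>. Choosing \<open>\<rho>\<close>
  from a geometric sequence, depending on the point, gives exponential integrability of the mollified
  functions, and Fatou's lemma passes to the precise representative.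

  Sharpness is tested on \<open>T h(ln (R / |x - x\<^sub>0|) / T)\<close> with a smooth step \<open>h\<close> of slope at most one:
  up to a factor \<open>1 + O(1 / T)\<close>, its \<open>D\<^sup>k\<close> is bounded by the extremal multiple of
  \<open>|x - x\<^sub>0|\<^bsup>-k\<^esup>\<close>, and it equals almost \<open>T\<close> on a ball of radius \<open>R e\<^bsup>-T\<^esup>\<close>.
\<close>

section \<open>Smooth functions and test functions\<close>

text \<open>Membership in the weak space gives no control of the integral of f^(n/k), so the near
  part cannot be handled at this natural exponent. It is handled at \<open>p = (n - e) / k\<close>
  with a small e > 0, where the weak bound on a set of finite measure does give an integral bound.
  This costs a factor r^(-e): at radius r the weighted energy has \<nu>-integral of order r^(d-e).
  At r = exp (-j) the far part is at most A j plus a constant, with A = n omega^((n-k)/n). Hence the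
  set where c |u| exceeds A j + B has \<nu>-measure of order exp (-j (d - e)), and summation over j
  succeeds if \<gamma> A / c < d - e. As e is arbitrary, the threshold is d c / A.

  The exponent \<delta> between e and d is auxiliary: it decides how the two factors in Young's
  inequality share the singularity of the kernel, and it cancels in the end.

  Sharpness needs the same constant from the other side. It rests on |D^k ln (1 / |x|)| being
  exactly c / (n omega) times |x|^(-k), which holds because the Laplacians of the logarithm and the
  constants of the Riesz kernels obey the same recursion.\<close>

inductive_set function_algebra :: "('a \<Rightarrow> real) set \<Rightarrow> ('a \<Rightarrow> real) set" for G where
  const: "(\<lambda>_. c) \<in> function_algebra G"
| gen: "g \<in> G \<Longrightarrow> g \<in> function_algebra G"
| add: "f \<in> function_algebra G \<Longrightarrow> g \<in> function_algebra G \<Longrightarrow> (\<lambda>x. f x + g x) \<in> function_algebra G"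
| mult: "f \<in> function_algebra G \<Longrightarrow> g \<in> function_algebra G \<Longrightarrow> (\<lambda>x. f x * g x) \<in> function_algebra G"

lemma function_algebra_cmult: "g \<in> function_algebra G \<Longrightarrow> (\<lambda>x. c * g x) \<in> function_algebra G"
  using function_algebra.mult[OF function_algebra.const, of g G c] .

lemma function_algebra_prod:
  "(\<And>i. i \<in> I \<Longrightarrow> f i \<in> function_algebra G) \<Longrightarrow> (\<lambda>x. \<Prod>i\<in>I. f i x) \<in> function_algebra G"
  by (induction I rule: infinite_finite_induct)
     (auto intro: function_algebra.const function_algebra.mult)

text \<open>All derivatives are given as one sequence, so that later constructions can name the j-th
  one as \<open>F j\<close> without iterating a derivative operator.\<close>

definition smooth_real :: "(real \<Rightarrow> real) \<Rightarrow> bool" where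
  "smooth_real f \<longleftrightarrow> (\<exists>F. F 0 = f \<and> (\<forall>j t. (F j has_real_derivative F (Suc j) t) (at t)))"

text \<open>If the first derivative of every generator is a polynomial in the generators, the
  algebra is closed under differentiation, and all higher derivatives exist without being computed.
  Most smoothness proofs on the line below only supply a suitable set of generators.\<close>

lemma smooth_real_algebraI:
  assumes G: "\<And>g. g \<in> G \<Longrightarrow> \<exists>g'\<in>function_algebra G. \<forall>t. (g has_real_derivative g' t) (at t)"
    and f: "f \<in> function_algebra G"
  shows "smooth_real f"
proof -
  have A: "\<exists>g'\<in>function_algebra G. \<forall>t. (g has_real_derivative g' t) (at t)"
    if "g \<in> function_algebra G" for g
    using that
  proof induction
    case (const c)
    then show ?case by (intro bexI[of _ "\<lambda>_. 0"]) (auto intro: function_algebra.const)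
  next
    case (gen g)
    then show ?case using G by blast
  next
    case (add f g)
    then obtain f' g' where "f' \<in> function_algebra G" "g' \<in> function_algebra G"
      "\<forall>t. (f has_real_derivative f' t) (at t)" "\<forall>t. (g has_real_derivative g' t) (at t)" by blast
    then show ?case
      by (intro bexI[of _ "\<lambda>t. f' t + g' t"] function_algebra.add) (auto intro!: derivative_intros)
  next
    case (mult f g)
    then obtain f' g' where "f' \<in> function_algebra G" "g' \<in> function_algebra G"
      "\<forall>t. (f has_real_derivative f' t) (at t)" "\<forall>t. (g has_real_derivative g' t) (at t)" by blast
    with mult show ?case
      by (intro bexI[of _ "\<lambda>t. f' t * g t + g' t * f t"] function_algebra.add function_algebra.mult)
         (auto intro!: DERIV_mult)
  qed
  \<comment> \<open>A derivative operator chosen on the algebra; its iterates form the required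
    sequence.\<close>
  then obtain D where D: "\<And>g. g \<in> function_algebra G \<Longrightarrow> D g \<in> function_algebra G"
    "\<And>g t. g \<in> function_algebra G \<Longrightarrow> (g has_real_derivative D g t) (at t)"
    by metis
  have "(D ^^ j) f \<in> function_algebra G" for j
    by (induction j) (auto intro: f D)
  then show ?thesis
    unfolding smooth_real_def by (intro exI[of _ "\<lambda>j. (D ^^ j) f"]) (auto intro: D)
qed

lemma smooth_real_mult:
  assumes "smooth_real f" "smooth_real g"
  shows "smooth_real (\<lambda>t. f t * g t)"
proof -
  obtain F H where F: "F 0 = f" "\<And>j t. (F j has_real_derivative F (Suc j) t) (at t)"
    and H: "H 0 = g" "\<And>j t. (H j has_real_derivative H (Suc j) t) (at t)"
    using assms unfolding smooth_real_def by metis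
  show ?thesis
  proof (rule smooth_real_algebraI[where G = "range F \<union> range H"])
    show "(\<lambda>t. f t * g t) \<in> function_algebra (range F \<union> range H)"
      unfolding F(1)[symmetric] H(1)[symmetric]
      by (rule function_algebra.mult; rule function_algebra.gen; blast)
  next
    fix g assume "g \<in> range F \<union> range H"
    then obtain j where "g = F j \<or> g = H j" by auto
    then show "\<exists>g'\<in>function_algebra (range F \<union> range H). \<forall>t. (g has_real_derivative g' t) (at t)"
      using F(2) H(2) by (metis UnCI function_algebra.gen rangeI)
  qed
qed

lemma smooth_real_affine:
  assumes "smooth_real f"
  shows "smooth_real (\<lambda>t. f (a * t + b))"
proof -
  obtain F where F: "F 0 = f" "\<And>j t. (F j has_real_derivative F (Suc j) t) (at t)"
    using assms unfolding smooth_real_def by metis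
  have "((\<lambda>t. a ^ j * F j (a * t + b)) has_real_derivative a ^ Suc j * F (Suc j) (a * t + b)) (at t)" for j t
    using F(2)[of j "a * t + b"]
    by (auto intro!: derivative_eq_intros DERIV_chain2[where f = "F j"] simp: algebra_simps)
  then show ?thesis
    unfolding smooth_real_def by (intro exI[of _ "\<lambda>j t. a ^ j * F j (a * t + b)"]) (auto simp: F(1))
qed

section \<open>The flat exponential on the line\<close>

definition exp_cutoff :: "real \<Rightarrow> real \<Rightarrow> real" where
  "exp_cutoff a t = (if t > 0 then exp (- a / t) else 0)"

text \<open>With x = 1 / t this is the decay of x^j exp (-a x) at infinity.\<close>

lemma exp_cutoff_pow_tendsto:
  assumes "a > 0"
  shows "((\<lambda>t::real. inverse t ^ j * exp (- a / t)) \<longlongrightarrow> 0) (at_right 0)"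
proof -
  have "((\<lambda>x::real. x ^ j * exp (- a * x)) \<longlongrightarrow> 0) at_top"
  proof -
    have "((\<lambda>x. (a * x) ^ j / exp (a * x)) \<longlongrightarrow> 0) at_top"
      using assms by (intro filterlim_compose[OF tendsto_power_div_exp_0]
          filterlim_tendsto_pos_mult_at_top[OF tendsto_const]) (auto simp: filterlim_ident)
    from tendsto_mult_left[OF this, of "inverse (a ^ j)"]
    show ?thesis using assms
      by (simp add: power_mult_distrib exp_minus field_simps)
  qed
  from filterlim_compose[OF this filterlim_inverse_at_top_right]
  show ?thesis by (simp add: divide_inverse)
qed

lemma smooth_real_exp_cutoff:
  assumes "a > 0"
  shows "smooth_real (exp_cutoff a)"
proof -
  \<comment> \<open>The functions t^(-j) exp (-a / t), cut off at 0, are closed under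
    differentiation up to linear combinations, so they serve as generators; the cutoff itself is
    \<open>e 0\<close>.\<close>
  define e where "e j t = (if t > 0 then inverse t ^ j * exp (- a / t) else (0::real))" for j :: nat and t
  have D: "(e j has_real_derivative (- real j * e (Suc j) t + a * e (j + 2) t)) (at t)" for j t
  proof -
    consider "t > 0" | "t < 0" | "t = 0" by linarith
    then show ?thesis
    proof cases
      case 1
      have "((\<lambda>t. inverse t ^ j * exp (- a / t)) has_real_derivative
          (- real j * (inverse t ^ Suc j * exp (- a / t)) + a * (inverse t ^ (j + 2) * exp (- a / t)))) (at t)"
        using 1 by (auto intro!: derivative_eq_intros simp: field_simps power2_eq_square)
          (cases j; simp add: field_simps)+
      then have "((\<lambda>t. inverse t ^ j * exp (- a / t)) has_real_derivative
          (- real j * e (Suc j) t + a * e (j + 2) t)) (at t)"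
        using 1 by (simp add: e_def)
      then show ?thesis
        by (rule has_field_derivative_transform_within_open[where S = "{0<..}"]) (use 1 in \<open>auto simp: e_def\<close>)
    next
      case 2
      have "((\<lambda>t. 0) has_real_derivative (- real j * e (Suc j) t + a * e (j + 2) t)) (at t)"
        using 2 by (simp add: e_def)
      then show ?thesis
        by (rule has_field_derivative_transform_within_open[where S = "{..<0}"]) (use 2 in \<open>auto simp: e_def\<close>)
    next
      case 3
      \<comment> \<open>At the origin the right difference quotient of \<open>e j\<close> is
        \<open>e (Suc j)\<close>, which tends to 0, and the left one vanishes.\<close>
      have "((\<lambda>h. e j h / h) \<longlongrightarrow> 0) (at 0)"
        unfolding filterlim_split_at
      proof (rule filterlim_split_at[unfolded filterlim_split_at])
        show "((\<lambda>h. e j h / h) \<longlongrightarrow> 0) (at_left 0)"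
          by (rule tendsto_eventually) (auto simp: eventually_at_left_field e_def intro: exI[of _ "-1"])
        show "((\<lambda>h. e j h / h) \<longlongrightarrow> 0) (at_right 0)"
          by (rule Lim_transform_eventually[OF exp_cutoff_pow_tendsto[OF assms, of "Suc j"]])
             (auto simp: eventually_at_right_field e_def field_simps intro: exI[of _ "1"])
      qed
      then show ?thesis
        using 3 by (simp add: DERIV_def e_def)
    qed
  qed
  have "exp_cutoff a = e 0" by (auto simp: e_def exp_cutoff_def fun_eq_iff)
  moreover have "smooth_real (e 0)"
  proof (rule smooth_real_algebraI[where G = "range e"])
    fix g assume "g \<in> range e"
    then obtain j where j: "g = e j" by auto
    show "\<exists>g'\<in>function_algebra (range e). \<forall>t. (g has_real_derivative g' t) (at t)"
      unfolding j
    proof (rule bexI[of _ "\<lambda>t. - real j * e (Suc j) t + a * e (j + 2) t"])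
      show "(\<lambda>t. - real j * e (Suc j) t + a * e (j + 2) t) \<in> function_algebra (range e)"
        by (rule function_algebra.add; rule function_algebra_cmult; rule function_algebra.gen; blast)
    qed (use D in blast)
  qed (auto intro: function_algebra.gen)
  ultimately show ?thesis by simp
qed

lemma exp_cutoff_nonneg [simp]: "0 \<le> exp_cutoff a t"
  by (simp add: exp_cutoff_def)

lemma exp_cutoff_le_1: "a \<ge> 0 \<Longrightarrow> exp_cutoff a t \<le> 1"
  by (simp add: exp_cutoff_def)

text \<open>The parameter of the cutoff exists for this limit: as it tends to 0 the indicator of a
  half-line is approximated, from which smooth approximations of boxes and of a step are
  built.\<close>

lemma exp_cutoff_tendsto_1:
  "((\<lambda>m. exp_cutoff (1 / real (Suc m)) t) \<longlonglongrightarrow> indicator {0<..} t)"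
proof (cases "t > 0")
  case True
  have "(\<lambda>m. 1 / real (Suc m)) \<longlonglongrightarrow> 0"
    using LIMSEQ_inverse_real_of_nat by (simp add: divide_inverse)
  then have "(\<lambda>m. exp (- (1 / real (Suc m)) / t)) \<longlonglongrightarrow> exp (- 0 / t)"
    by (intro tendsto_intros) (use True in auto)
  then show ?thesis using True by (simp add: exp_cutoff_def)
qed (simp add: exp_cutoff_def)

section \<open>Smooth functions of several variables\<close>

definition smooth :: "(real^'n::finite \<Rightarrow> real) \<Rightarrow> bool" where
  "smooth f \<longleftrightarrow> (\<forall>is x. partials is f differentiable (at x))"

lemma test_function_smooth: "test_function f \<Longrightarrow> smooth f"
  by (simp add: test_function_def smooth_def)

lemma partials_append: "partials (is @ js) f = partials is (partials js f)"
  by (induction "is") auto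

lemma smooth_partials: "smooth f \<Longrightarrow> smooth (partials is f)"
  unfolding smooth_def by (metis partials_append)

lemma smooth_differentiable: "smooth f \<Longrightarrow> f differentiable (at x)"
  unfolding smooth_def by (metis partials.simps(1))

lemma smooth_continuous: "smooth f \<Longrightarrow> continuous_on S f"
  by (simp add: continuous_at_imp_continuous_on differentiable_imp_continuous_within smooth_differentiable)

lemma smooth_borel [measurable]: "smooth f \<Longrightarrow> f \<in> borel_measurable borel"
  by (simp add: borel_measurable_continuous_onI smooth_continuous)

lemma linear_vec_expansion:
  fixes L :: "real^'n::finite \<Rightarrow> real"
  assumes "linear L"
  shows "L h = (\<Sum>i\<in>UNIV. h $ i * L (axis i 1))"
proof -
  have "L h = L (\<Sum>i\<in>UNIV. h $ i *\<^sub>R axis i 1)"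
    by (metis basis_expansion scalar_mult_eq_scaleR)
  also have "\<dots> = (\<Sum>i\<in>UNIV. h $ i * L (axis i 1))"
    unfolding linear_sum[OF assms] linear_scale[OF assms] by simp
  finally show ?thesis .
qed

lemma has_derivative_partials:
  assumes "f differentiable (at x)"
  shows "(f has_derivative (\<lambda>h. \<Sum>i\<in>UNIV. h $ i * partials [i] f x)) (at x)"
proof -
  have d: "(f has_derivative frechet_derivative f (at x)) (at x)"
    using assms frechet_derivative_works by blast
  show ?thesis
    by (rule has_derivative_eq_rhs[OF d], rule ext, unfold partials.simps,
        rule linear_vec_expansion[OF has_derivative_linear[OF d]])
qed

lemma partials_eqI:
  assumes "(f has_derivative f') (at x)"
  shows "partials [i] f x = f' (axis i 1)"
  using frechet_derivative_at[OF assms] by simp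

lemma smooth_closedI:
  assumes "\<And>g x. g \<in> A \<Longrightarrow> g differentiable (at x)" "\<And>g i. g \<in> A \<Longrightarrow> partials [i] g \<in> A" "f \<in> A"
  shows "smooth f"
proof -
  have "partials is f \<in> A" for "is"
    using assms(2,3) by (induction "is") auto
  then show ?thesis using assms(1) by (simp add: smooth_def)
qed

lemma partials_add:
  assumes "f differentiable (at x)" "g differentiable (at x)"
  shows "partials [i] (\<lambda>x. f x + g x) x = partials [i] f x + partials [i] g x"
  using partials_eqI[OF has_derivative_add[OF has_derivative_partials has_derivative_partials], OF assms, of i]
    by (simp add: sum.distrib[symmetric] axis_def if_distrib[of "\<lambda>a. a * _"] cong: if_cong)

lemma partials_mult:
  assumes "f differentiable (at x)" "g differentiable (at x)"
  shows "partials [i] (\<lambda>x. f x * g x) x = f x * partials [i] g x + partials [i] f x * g x"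
  using partials_eqI[OF has_derivative_mult[OF has_derivative_partials has_derivative_partials], OF assms, of i]
    by (simp add: axis_def if_distrib[of "\<lambda>a. a * _"] cong: if_cong)

lemma partials_const: "partials [i] (\<lambda>x. c) x = 0"
  using partials_eqI[OF has_derivative_const] .

text \<open>The closure argument of \<open>smooth_real_algebraI\<close> in several variables: the
  sum and product rules keep the algebra invariant under every partial derivative.\<close>

lemma smooth_algebraI:
  fixes G :: "(real^'n::finite \<Rightarrow> real) set"
  assumes d: "\<And>g x. g \<in> G \<Longrightarrow> g differentiable (at x)"
    and p: "\<And>g i. g \<in> G \<Longrightarrow> partials [i] g \<in> function_algebra G"
    and f: "f \<in> function_algebra G"
  shows "smooth f"
proof (rule smooth_closedI[OF _ _ f])
  fix g x assume "g \<in> function_algebra G"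
  then show "g differentiable (at x)"
    by induction (auto intro: d)
next
  fix g i
  have dd: "\<And>x. g differentiable (at x)" if "g \<in> function_algebra G" for g
    using that by induction (auto intro: d)
  assume "g \<in> function_algebra G"
  then show "partials [i] g \<in> function_algebra G"
  proof induction
    case (const c)
    have "partials [i] (\<lambda>_::real^'n. c) = (\<lambda>x. 0)" by (intro ext partials_const)
    then show ?case using function_algebra.const[of 0 G] by simp
  next
    case (gen g)
    then show ?case by (rule p)
  next
    case (add f g)
    have eq: "partials [i] (\<lambda>x. f x + g x) = (\<lambda>x. partials [i] f x + partials [i] g x)"
      using add dd by (intro ext partials_add) auto
    show ?case
      unfolding eq by (rule function_algebra.add[OF add.IH])
  next
    case (mult f g)
    have eq: "partials [i] (\<lambda>x. f x * g x) = (\<lambda>x. f x * partials [i] g x + partials [i] f x * g x)"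
      using mult dd by (intro ext partials_mult) auto
    show ?case
      unfolding eq by (rule function_algebra.add[OF function_algebra.mult[OF mult.hyps(1) mult.IH(2)]
            function_algebra.mult[OF mult.IH(1) mult.hyps(2)]])
  qed
qed

lemma smooth_algebra_smooth:
  assumes "f \<in> function_algebra {g. smooth g}"
  shows "smooth f"
  by (rule smooth_algebraI[OF _ _ assms])
     (auto intro!: smooth_differentiable function_algebra.gen smooth_partials simp del: partials.simps)

lemma smooth_mult: "smooth f \<Longrightarrow> smooth g \<Longrightarrow> smooth (\<lambda>x. f x * g x)"
  by (rule smooth_algebra_smooth) (auto intro: function_algebra.mult function_algebra.gen)

lemma smooth_add: "smooth f \<Longrightarrow> smooth g \<Longrightarrow> smooth (\<lambda>x. f x + g x)"
  by (rule smooth_algebra_smooth) (auto intro: function_algebra.add function_algebra.gen)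

lemma smooth_const: "smooth (\<lambda>x. c)"
  by (rule smooth_algebra_smooth) (auto intro: function_algebra.const)

lemma smooth_prod: "(\<And>i. i \<in> I \<Longrightarrow> smooth (f i)) \<Longrightarrow> smooth (\<lambda>x. \<Prod>i\<in>I. f i x)"
  by (rule smooth_algebra_smooth) (auto intro: function_algebra_prod function_algebra.gen)

lemma smooth_coord: "smooth (\<lambda>x. x $ i)"
proof (rule smooth_algebraI[where G = "{\<lambda>x. x $ i}"])
  fix g :: "real^'a \<Rightarrow> real" and j assume g: "g \<in> {\<lambda>x. x $ i}"
  have d: "((\<lambda>x::real^'a. x $ i) has_derivative (\<lambda>h. h $ i)) (at x)" for x
    by (rule bounded_linear_imp_has_derivative[OF bounded_linear_vec_nth])
  show "g differentiable (at x)" for x using d g by (auto simp: differentiable_def)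
  have "partials [j] g = (\<lambda>x. axis j 1 $ i)" using g d by (auto simp: partials_eqI[OF d] simp del: partials.simps)
  then show "partials [j] g \<in> function_algebra {\<lambda>x. x $ i}" using function_algebra.const by metis
qed (auto intro: function_algebra.gen)

lemma has_derivative_radial:
  fixes x c :: "real^'n::finite"
  assumes "(W has_real_derivative W') (at ((norm (x - c))\<^sup>2))"
  shows "((\<lambda>x. W ((norm (x - c))\<^sup>2)) has_derivative (\<lambda>h. 2 * W' * ((x - c) \<bullet> h))) (at x)"
proof -
  have 1: "((\<lambda>x. (norm (x - c))\<^sup>2) has_derivative (\<lambda>h. 2 * ((x - c) \<bullet> h))) (at x)"
    unfolding power2_norm_eq_inner by (auto intro!: derivative_eq_intros simp: inner_commute)
  from has_derivative_compose[OF 1 assms[unfolded has_field_derivative_def]]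
  show ?thesis by (simp add: mult_ac)
qed

lemma partials_radial:
  fixes x c :: "real^'n::finite"
  assumes "(W has_real_derivative W') (at ((norm (x - c))\<^sup>2))"
  shows "partials [i] (\<lambda>x. W ((norm (x - c))\<^sup>2)) x = 2 * W' * (x - c) $ i"
  by (subst partials_eqI[OF has_derivative_radial[OF assms]]) (simp add: inner_axis)

text \<open>Using the squared distance avoids the singularity of the norm at the centre. The
  derivatives are prescribed only for t \<ge> 0, the range of the squared norm, so that powers of t
  + e with e > 0 qualify.\<close>

lemma smooth_radial:
  fixes c :: "real^'n::finite"
  assumes "\<And>j t. t \<ge> 0 \<Longrightarrow> (F j has_real_derivative F (Suc j) t) (at t)"
  shows "smooth (\<lambda>x. F 0 ((norm (x - c))\<^sup>2))"
proof (rule smooth_algebraI[where G = "range (\<lambda>j x. F j ((norm (x - c))\<^sup>2)) \<union> {g. smooth g}"])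
  fix g :: "real^'n \<Rightarrow> real" and i
  assume "g \<in> range (\<lambda>j x. F j ((norm (x - c))\<^sup>2)) \<union> {g. smooth g}"
  then consider j where "g = (\<lambda>x. F j ((norm (x - c))\<^sup>2))" | "smooth g" by auto
  then have "(\<forall>x. g differentiable at x) \<and> partials [i] g \<in> function_algebra (range (\<lambda>j x. F j ((norm (x - c))\<^sup>2)) \<union> {g. smooth g})"
  proof cases
    case 1
    have "partials [i] g = (\<lambda>x. 2 * F (Suc j) ((norm (x - c))\<^sup>2) * (x $ i + - c $ i))"
      unfolding 1 by (rule ext, subst partials_radial[OF assms]) auto
    moreover have "g differentiable at x" for x
      using has_derivative_radial[OF assms, of x c] unfolding 1 differentiable_def by auto
    moreover have "(\<lambda>x. 2 * F (Suc j) ((norm (x - c))\<^sup>2) * (x $ i + - c $ i)) \<in>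
       function_algebra (range (\<lambda>j x. F j ((norm (x - c))\<^sup>2)) \<union> {g. smooth g})"
      by (intro function_algebra.mult function_algebra.add) (auto intro: function_algebra.const function_algebra.gen smooth_coord)
    ultimately show ?thesis by simp
  next
    case 2
    then show ?thesis using smooth_partials smooth_differentiable
      by (metis (no_types, lifting) UnCI function_algebra.gen mem_Collect_eq)
  qed
  then show "g differentiable at x" "partials [i] g \<in> function_algebra (range (\<lambda>j x. F j ((norm (x - c))\<^sup>2)) \<union> {g. smooth g})" for x
    by auto
qed (auto intro: function_algebra.gen)

lemma smooth_real_coord:
  fixes i :: "'n::finite"
  assumes "smooth_real f"
  shows "smooth (\<lambda>x. f (x $ i))"
proof -
  obtain F where F: "F 0 = f" "\<And>j t. (F j has_real_derivative F (Suc j) t) (at t)"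
    using assms unfolding smooth_real_def by metis
  have d: "((\<lambda>x::real^'n. F j (x $ i)) has_derivative (\<lambda>h. F (Suc j) (x $ i) * h $ i)) (at x)" for j x
  proof -
    have 1: "((\<lambda>x::real^'n. x $ i) has_derivative (\<lambda>h. h $ i)) (at x)"
      by (rule bounded_linear_imp_has_derivative[OF bounded_linear_vec_nth])
    show ?thesis
      by (rule has_derivative_compose[OF 1 F(2)[of j "x $ i", unfolded has_field_derivative_def]])
  qed
  have "smooth (\<lambda>x. F 0 (x $ i))"
  proof (rule smooth_algebraI[where G = "range (\<lambda>j x. F j (x $ i))"])
    fix g :: "real^'n \<Rightarrow> real" and k assume "g \<in> range (\<lambda>j x. F j (x $ i))"
    then obtain j where g: "g = (\<lambda>x. F j (x $ i))" by auto
    show "g differentiable (at x)" for x using d g by (auto simp: differentiable_def)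
    have "partials [k] g = (\<lambda>x. F (Suc j) (x $ i) * axis k 1 $ i)"
      unfolding g using d by (auto simp: partials_eqI[OF d] simp del: partials.simps)
    moreover have "(\<lambda>x. F (Suc j) (x $ i) * axis k 1 $ i) \<in> function_algebra (range (\<lambda>j x. F j (x $ i)))"
      by (rule function_algebra.mult[OF function_algebra.gen function_algebra.const]) blast
    ultimately show "partials [k] g \<in> function_algebra (range (\<lambda>j x. F j (x $ i)))"
      by simp
  qed (auto intro: function_algebra.gen)
  then show ?thesis using F by simp
qed

section \<open>Lebesgue measure under affine maps\<close>

lemma nn_integral_lborel_affine:
  fixes f :: "'a::euclidean_space \<Rightarrow> ennreal"
  assumes [measurable]: "f \<in> borel_measurable borel" and c: "c \<noteq> 0"
  shows "(\<integral>\<^sup>+x. f x \<partial>lborel) = ennreal (\<bar>c\<bar> ^ DIM('a)) * (\<integral>\<^sup>+x. f (t + c *\<^sub>R x) \<partial>lborel)"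
  by (subst lborel_affine[OF c, of t])
     (simp add: nn_integral_density nn_integral_distr nn_integral_cmult)

lemma nn_integral_lborel_translate:
  fixes f :: "'a::euclidean_space \<Rightarrow> ennreal"
  assumes "f \<in> borel_measurable borel"
  shows "(\<integral>\<^sup>+x. f (t + x) \<partial>lborel) = (\<integral>\<^sup>+x. f x \<partial>lborel)"
  using nn_integral_lborel_affine[OF assms, of 1 t] by simp

lemma nn_integral_lborel_reflect:
  fixes f :: "'a::euclidean_space \<Rightarrow> ennreal"
  assumes "f \<in> borel_measurable borel"
  shows "(\<integral>\<^sup>+x. f (t - x) \<partial>lborel) = (\<integral>\<^sup>+x. f x \<partial>lborel)"
  using nn_integral_lborel_affine[OF assms, of "-1" t] by simp

lemma integral_lborel_translate:
  fixes f :: "'a::euclidean_space \<Rightarrow> real"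
  assumes [measurable]: "f \<in> borel_measurable borel"
  shows "(LINT x|lborel. f (t + x)) = (LINT x|lborel. f x)"
  by (subst (2) lborel_distr_plus[of t, symmetric], subst integral_distr) auto

lemma integrable_lborel_translate:
  fixes f :: "'a::euclidean_space \<Rightarrow> real"
  assumes "integrable lborel f"
  shows "integrable lborel (\<lambda>x. f (t + x))"
proof -
  have [measurable]: "f \<in> borel_measurable borel" using assms by auto
  have "integrable (distr lborel borel ((+) t)) f" using assms by (simp add: lborel_distr_plus)
  then show ?thesis by (subst (asm) integrable_distr_eq) auto
qed

lemma lborel_distr_reflect: "distr lborel borel (\<lambda>x::'a::euclidean_space. t - x) = lborel"
  using lborel_affine[of "-1" t] by (simp add: density_1)

lemma integral_lborel_reflect:
  fixes f :: "'a::euclidean_space \<Rightarrow> real"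
  assumes [measurable]: "f \<in> borel_measurable borel"
  shows "(LINT x|lborel. f (t - x)) = (LINT x|lborel. f x)"
  by (subst (2) lborel_distr_reflect[of t, symmetric], subst integral_distr) auto

lemma AE_lborel_translate:
  fixes P :: "'a::euclidean_space \<Rightarrow> bool"
  assumes "AE x in lborel. P x"
  shows "AE x in lborel. P (t + x)"
proof -
  have "AE x in distr lborel borel ((+) t). P x" unfolding lborel_distr_plus by (rule assms)
  from AE_distrD[OF _ this] show ?thesis by simp
qed

section \<open>Test functions and integration by parts\<close>

lemma test_function_iff:
  "test_function f \<longleftrightarrow> smooth f \<and> (\<exists>r. \<forall>x. norm x > r \<longrightarrow> f x = 0)"
proof
  assume f: "test_function f"
  then have "compact (closure {x. f x \<noteq> 0})" by (simp add: test_function_def)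
  then have "bounded {x. f x \<noteq> 0}"
    by (rule bounded_subset[OF compact_imp_bounded closure_subset])
  then obtain r where "\<forall>x\<in>{x. f x \<noteq> 0}. norm x \<le> r" unfolding bounded_iff by blast
  have "f x = 0" if "norm x > r" for x
    using bspec[OF \<open>\<forall>x\<in>{x. f x \<noteq> 0}. norm x \<le> r\<close>, of x] that by (cases "f x = 0") auto
  then have "\<forall>x. norm x > r \<longrightarrow> f x = 0" by blast
  then show "smooth f \<and> (\<exists>r. \<forall>x. norm x > r \<longrightarrow> f x = 0)"
    using f test_function_smooth by blast
next
  assume f: "smooth f \<and> (\<exists>r. \<forall>x. norm x > r \<longrightarrow> f x = 0)"
  then obtain r where "\<forall>x. norm x > r \<longrightarrow> f x = 0" by blast
  then have "bounded {x. f x \<noteq> 0}" unfolding bounded_iff by (intro exI[of _ r]) force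
  then show "test_function f"
    using f by (simp add: test_function_def smooth_def)
qed

lemma test_functionI:
  assumes "smooth f" "\<And>x. norm x > r \<Longrightarrow> f x = 0"
  shows "test_function f"
  using assms test_function_iff by blast

lemma test_function_partials:
  assumes "test_function f"
  shows "test_function (partials is f)"
proof -
  obtain r where r: "\<And>x. norm x > r \<Longrightarrow> f x = 0" and s: "smooth f"
    using assms test_function_iff by metis
  have "partials is f x = 0" if "norm x > r" for x
    using that
  proof (induction "is" arbitrary: x)
    case (Cons i "is")
    have "((\<lambda>x. 0) has_derivative (\<lambda>h. 0)) (at x)" by simp
    then have "(partials is f has_derivative (\<lambda>h. 0)) (at x)"
      by (rule has_derivative_transform_within_open[where s = "{x. norm x > r}"])
         (use Cons in \<open>auto intro!: open_Collect_less continuous_intros\<close>)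
    from partials_eqI[OF this] show ?case by simp
  qed (use r in auto)
  then show ?thesis using s smooth_partials test_function_iff by blast
qed

lemma test_function_mult: "test_function f \<Longrightarrow> smooth g \<Longrightarrow> test_function (\<lambda>x. f x * g x)"
  unfolding test_function_iff using smooth_mult by fastforce

lemma test_function_mult': "test_function f \<Longrightarrow> smooth g \<Longrightarrow> test_function (\<lambda>x. g x * f x)"
  using test_function_mult[of f g] by (simp add: mult.commute)

lemma test_function_add:
  assumes "test_function f" "test_function g"
  shows "test_function (\<lambda>x. f x + g x)"
proof -
  obtain r s where "\<forall>x. norm x > r \<longrightarrow> f x = 0" "\<forall>x. norm x > s \<longrightarrow> g x = 0"
    using assms test_function_iff by metis
  then show ?thesis
    by (intro test_functionI[where r = "max r s", OF smooth_add[OF test_function_smooth test_function_smooth], OF assms]) auto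
qed

lemma test_function_cmult: "test_function f \<Longrightarrow> test_function (\<lambda>x. c * f x)"
  by (rule test_function_mult'[OF _ smooth_const])

lemma test_function_zero: "test_function (\<lambda>x. 0)"
  by (intro test_functionI[where r = 0] smooth_const) auto

lemma test_function_sum:
  "(\<And>i. i \<in> I \<Longrightarrow> test_function (f i)) \<Longrightarrow> test_function (\<lambda>x. \<Sum>i\<in>I. f i x)"
  by (induction I rule: infinite_finite_induct) (auto intro: test_function_zero test_function_add)

lemma test_function_bounded:
  assumes "test_function f"
  obtains B where "B > 0" "\<And>x. \<bar>f x\<bar> \<le> B"
proof -
  obtain r where r: "\<And>x. norm x > r \<Longrightarrow> f x = 0" and s: "smooth f"
    using assms test_function_iff by metis
  have "compact (f ` cball 0 r)"
    by (intro compact_continuous_image smooth_continuous s compact_cball)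
  then obtain B where B: "\<And>x. x \<in> cball 0 r \<Longrightarrow> \<bar>f x\<bar> \<le> B"
    unfolding compact_eq_bounded_closed bounded_iff by (metis imageI real_norm_def)
  have "\<bar>f x\<bar> \<le> \<bar>B\<bar> + 1" for x
    using B[of x] r[of x] by (cases "norm x \<le> r") auto
  then show ?thesis using that[of "\<bar>B\<bar> + 1"] by auto
qed

lemma test_function_borel [measurable]: "test_function f \<Longrightarrow> f \<in> borel_measurable borel"
  by (simp add: smooth_borel test_function_smooth)

lemma integrable_lborel_bounded_support:
  fixes f :: "'a::euclidean_space \<Rightarrow> real"
  assumes [measurable]: "f \<in> borel_measurable borel"
    and "\<And>x. \<bar>f x\<bar> \<le> B" "\<And>x. norm x > r \<Longrightarrow> f x = 0"
  shows "integrable lborel f"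
proof (rule Bochner_Integration.integrable_bound)
  show "integrable lborel (\<lambda>x::'a. B * indicator (cball 0 r) x)"
    by (intro integrable_mult_right integrable_real_indicator) (auto simp: emeasure_lborel_cball_finite[unfolded infinity_ennreal_def])
  show "AE x in lborel. norm (f x) \<le> norm (B * indicator (cball 0 r) x)"
    using assms(2,3) by (auto simp: indicator_def intro: order_trans[OF _ abs_ge_self])
qed simp

lemma integrable_test_function: "test_function f \<Longrightarrow> integrable lborel f"
proof -
  assume f: "test_function f"
  obtain B where B: "\<And>x. \<bar>f x\<bar> \<le> B" using test_function_bounded[OF f] by metis
  obtain r where r: "\<And>x. norm x > r \<Longrightarrow> f x = 0" using f test_function_iff by metis
  show ?thesis using f B r by (intro integrable_lborel_bounded_support) auto
qed

lemma test_function_uniformly_continuous: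
  fixes f :: "real^'n::finite \<Rightarrow> real"
  assumes "test_function f" "e > 0"
  obtains d where "d > 0" "\<And>x h. norm h < d \<Longrightarrow> \<bar>f (x + h) - f x\<bar> < e"
proof -
  obtain r where r: "\<And>x. norm x > r \<Longrightarrow> f x = 0" and s: "smooth f"
    using assms test_function_iff by metis
  have "uniformly_continuous_on (cball 0 (r + 1)) f"
    by (intro compact_uniformly_continuous smooth_continuous s compact_cball)
  then obtain d where d: "d > 0" "\<And>x y. x \<in> cball 0 (r + 1) \<Longrightarrow> y \<in> cball 0 (r + 1) \<Longrightarrow> dist y x < d \<Longrightarrow> dist (f y) (f x) < e"
    unfolding uniformly_continuous_on_def using \<open>e > 0\<close> by metis
  have "\<bar>f (x + h) - f x\<bar> < e" if h: "norm h < min d 1" for x h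
  proof (cases "norm x \<le> r \<or> norm (x + h) \<le> r")
    case True
    have "norm (x + h) \<le> norm x + norm h" "norm x \<le> norm (x + h) + norm h"
      using norm_triangle_ineq[of x h] norm_triangle_ineq4[of "x + h" h] by auto
    with True h have "x \<in> cball 0 (r + 1)" "x + h \<in> cball 0 (r + 1)" by auto
    from d(2)[OF this] show ?thesis using h by (simp add: dist_norm)
  next
    case False
    then show ?thesis using r \<open>e > 0\<close> by auto
  qed
  then show ?thesis using that[of "min d 1"] d(1) by auto
qed

text \<open>The mean value inequality is applied to f minus its linear part frozen at x; its
  derivative is small on a ball of uniform radius because the partial derivatives are uniformly
  continuous. Uniformity in x permits integration of the expansion, first against Lebesgue measure
  and later against a locally integrable function.\<close>

lemma test_function_uniformly_differentiable:
  fixes f :: "real^'n::finite \<Rightarrow> real"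
  assumes f: "test_function f" and e: "e > 0"
  obtains d where "d > 0" "\<And>x h. norm h < d \<Longrightarrow>
    \<bar>f (x + h) - f x - (\<Sum>i\<in>UNIV. h $ i * partials [i] f x)\<bar> \<le> e * norm h"
proof -
  define N where "N = real CARD('n)"
  have N: "N > 0" by (simp add: N_def)
  have "\<exists>d>0. \<forall>x h. norm h < d \<longrightarrow> \<bar>partials [i] f (x + h) - partials [i] f x\<bar> < e / N" for i
    using test_function_uniformly_continuous[OF test_function_partials[OF f, of "[i]"], of "e / N"] e N
    by (metis divide_pos_pos)
  then obtain D where D: "\<And>i. D i > 0"
    "\<And>i x h. norm h < D i \<Longrightarrow> \<bar>partials [i] f (x + h) - partials [i] f x\<bar> < e / N" by metis
  define d where "d = Min (range D)"
  have d: "d > 0" "\<And>i. d \<le> D i" using D(1) by (auto simp: d_def)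
  have "\<bar>f (x + h) - f x - (\<Sum>i\<in>UNIV. h $ i * partials [i] f x)\<bar> \<le> e * norm h" if h: "norm h < d" for x h
  proof -
    define g where "g y = f y - (\<Sum>i\<in>UNIV. y $ i * partials [i] f x)" for y
    have fd: "f differentiable (at y)" for y using f by (simp add: smooth_differentiable test_function_smooth)
    have gd: "(g has_derivative (\<lambda>k. (\<Sum>i\<in>UNIV. k $ i * partials [i] f y) - (\<Sum>i\<in>UNIV. k $ i * partials [i] f x)))
        (at y within ball x d)" for y
      unfolding g_def
      by (intro has_derivative_diff has_derivative_at_withinI[OF has_derivative_partials[OF fd]]
           has_derivative_sum has_derivative_mult_left
           bounded_linear_imp_has_derivative bounded_linear_vec_nth)
    have "norm (g (x + h) - g x) \<le> e * norm (x + h - x)"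
    proof (rule differentiable_bound[OF convex_ball[of x d] gd])
      fix y assume y: "y \<in> ball x d"
      have b: "\<bar>partials [i] f y - partials [i] f x\<bar> \<le> e / N" for i
        using D(2)[of "y - x" i x] d(2)[of i] y by (simp add: dist_norm norm_minus_commute)
      show "onorm (\<lambda>k. (\<Sum>i\<in>UNIV. k $ i * partials [i] f y) - (\<Sum>i\<in>UNIV. k $ i * partials [i] f x)) \<le> e"
      proof (rule onorm_le)
        fix k :: "real^'n"
        have "norm ((\<Sum>i\<in>UNIV. k $ i * partials [i] f y) - (\<Sum>i\<in>UNIV. k $ i * partials [i] f x))
          = \<bar>\<Sum>i\<in>UNIV. k $ i * (partials [i] f y - partials [i] f x)\<bar>"
          by (simp add: sum_subtractf right_diff_distrib)
        also have "\<dots> \<le> (\<Sum>i\<in>UNIV. \<bar>k $ i\<bar> * \<bar>partials [i] f y - partials [i] f x\<bar>)"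
          by (rule order_trans[OF sum_abs]) (simp add: abs_mult)
        also have "\<dots> \<le> (\<Sum>i\<in>(UNIV::'n set). norm k * (e / N))"
          using b by (intro sum_mono mult_mono component_le_norm_cart) auto
        also have "\<dots> = e * norm k" using N by (simp add: N_def)
        finally show "norm ((\<Sum>i\<in>UNIV. k $ i * partials [i] f y) - (\<Sum>i\<in>UNIV. k $ i * partials [i] f x)) \<le> e * norm k" .
      qed
    qed (use h d in \<open>auto simp: dist_norm\<close>)
    moreover have "g (x + h) - g x = f (x + h) - f x - (\<Sum>i\<in>UNIV. h $ i * partials [i] f x)"
      unfolding g_def vector_add_component distrib_right sum.distrib by linarith
    ultimately show ?thesis by simp
  qed
  then show ?thesis using that d(1) by blast
qed

text \<open>Both sides of \<open>\<integral> g (x + h e\<^sub>i) dx = \<integral> g x dx\<close> are compared to first order in \<open>h\<close>.\<close>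

lemma integral_partial_zero:
  fixes g :: "real^'n::finite \<Rightarrow> real"
  assumes g: "test_function g"
  shows "(LINT x|lborel. partials [i] g x) = 0"
proof (rule ccontr)
  define I where "I = (LINT x|lborel. partials [i] g x)"
  assume "(LINT x|lborel. partials [i] g x) \<noteq> 0"
  then have I: "\<bar>I\<bar> > 0" by (simp add: I_def)
  obtain r0 where r0: "\<And>x. norm x > r0 \<Longrightarrow> g x = 0" using g test_function_iff by metis
  obtain r1 where r1: "\<And>x. norm x > r1 \<Longrightarrow> partials [i] g x = 0"
    using test_function_partials[OF g] test_function_iff by metis
  define r where "r = max r0 r1"
  \<comment> \<open>For |h| \<le> 1 the integrand below is supported in the ball of radius r + 1, so
    the total error is at most e t M; the choice of e makes this at most half of t |I|.\<close>
  define M where "M = measure lborel (cball (0::real^'n) (r + 1))"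
  have M: "M \<ge> 0" by (simp add: M_def)
  define e where "e = \<bar>I\<bar> / (2 * (M + 1))"
  have e: "e > 0" using I M by (simp add: e_def)
  obtain d where d: "d > 0" "\<And>x h. norm h < d \<Longrightarrow>
    \<bar>g (x + h) - g x - (\<Sum>i\<in>UNIV. h $ i * partials [i] g x)\<bar> \<le> e * norm h"
    by (rule test_function_uniformly_differentiable[OF g e]) (rule that, assumption, blast)
  define t where "t = min (d / 2) 1"
  have t: "t > 0" "t < d" "t \<le> 1" using d(1) by (auto simp: t_def)
  define h :: "real^'n" where "h = axis i t"
  have nh: "norm h = t" using t by (simp add: h_def norm_eq_sqrt_inner inner_axis_axis)
  have hs: "(\<Sum>j\<in>UNIV. h $ j * partials [j] g x) = t * partials [i] g x" for x
    by (simp add: h_def axis_def if_distrib[of "\<lambda>a. a * _"] cong: if_cong)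
  have int: "integrable lborel g" "integrable lborel (partials [i] g)"
    using integrable_test_function[OF g] integrable_test_function[OF test_function_partials[OF g]] by blast+
  have int': "integrable lborel (\<lambda>x. g (x + h))"
    using integrable_lborel_translate[OF int(1), of h] by (simp add: add.commute)
  have "(LINT x|lborel. g (x + h) - g x - t * partials [i] g x) = (LINT x|lborel. g (x + h)) - (LINT x|lborel. g x) - t * I"
    using int int' by (simp add: I_def del: partials.simps)
  also have "(LINT x|lborel. g (x + h)) = (LINT x|lborel. g x)"
    using integral_lborel_translate[of g h] g by (simp add: add.commute)
  finally have eq: "(LINT x|lborel. g (x + h) - g x - t * partials [i] g x) = - t * I" by simp
  have "\<bar>LINT x|lborel. g (x + h) - g x - t * partials [i] g x\<bar> \<le> (LINT x|lborel. e * t * indicator (cball (0::real^'n) (r + 1)) x)"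
  proof (rule integral_abs_bound_integral)
    fix x
    show "\<bar>g (x + h) - g x - t * partials [i] g x\<bar> \<le> e * t * indicator (cball 0 (r + 1)) x"
    proof (cases "norm x \<le> r + 1")
      case True
      then show ?thesis using d(2)[of h x] t nh hs[of x] by (simp del: partials.simps)
    next
      case False
      have "norm x \<le> norm (x + h) + norm h" using norm_triangle_ineq4[of "x + h" h] by auto
      then have "norm (x + h) > r" "norm x > r" using False nh t by auto
      then show ?thesis using r0 r1 False by (simp add: r_def del: partials.simps)
    qed
  qed (use int int' in \<open>auto intro!: integrable_mult_right integrable_real_indicator simp: emeasure_lborel_cball_finite[unfolded infinity_ennreal_def] simp del: partials.simps\<close>)
  also have "\<dots> = e * t * M" by (simp add: M_def)
  finally have "t * \<bar>I\<bar> \<le> e * t * M" unfolding eq by (simp only: abs_mult abs_minus_cancel abs_of_pos[OF t(1)])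
  then have "t * \<bar>I\<bar> \<le> t * (e * M)" by (simp only: mult_ac)
  then have "\<bar>I\<bar> \<le> e * M" using t(1) mult_le_cancel_left_pos by blast
  also have "\<dots> \<le> e * (M + 1)" using e by simp
  also have "\<dots> = \<bar>I\<bar> / 2"
  proof -
    have "M + 1 \<noteq> 0" using M by linarith
    then show ?thesis unfolding e_def by (metis nonzero_mult_divide_mult_cancel_right times_divide_eq_left mult.commute)
  qed
  finally show False using I by simp
qed

lemma integration_by_parts_partial:
  fixes f g :: "real^'n::finite \<Rightarrow> real"
  assumes f: "test_function f" and g: "smooth g"
  shows "(LINT x|lborel. partials [i] f x * g x) = - (LINT x|lborel. f x * partials [i] g x)"
proof -
  have tf: "test_function (\<lambda>x. f x * partials [i] g x)" "test_function (\<lambda>x. partials [i] f x * g x)"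
    using f g by (auto intro!: test_function_mult smooth_partials test_function_partials simp del: partials.simps)
  have "partials [i] (\<lambda>x. f x * g x) x = f x * partials [i] g x + partials [i] f x * g x" for x
    by (intro partials_mult smooth_differentiable g test_function_smooth f)
  then have "(LINT x|lborel. f x * partials [i] g x + partials [i] f x * g x) = 0"
    using integral_partial_zero[OF test_function_mult[OF f g], of i] by presburger
  then show ?thesis
    using integrable_test_function[OF tf(1)] integrable_test_function[OF tf(2)] by (simp del: partials.simps)
qed

section \<open>Locally integrable functions and weak derivatives\<close>

lemma locally_integrable_cball:
  assumes "locally_integrable f"
  shows "integrable lebesgue (\<lambda>x. indicator (cball a r) x * f x)"
  using assms unfolding locally_integrable_def set_integrable_def by simp

lemma locally_integrable_borel:
  assumes "locally_integrable f"
  shows "f \<in> borel_measurable lebesgue"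
proof (rule borel_measurable_LIMSEQ_real)
  fix m :: nat
  show "(\<lambda>x. indicator (cball 0 (real m)) x * f x) \<in> borel_measurable lebesgue"
    using locally_integrable_cball[OF assms] by blast
next
  fix x :: "real^'a"
  obtain N :: nat where N: "norm x \<le> real N" using real_arch_simple by blast
  have "eventually (\<lambda>m. indicator (cball 0 (real m)) x * f x = f x) sequentially"
    using eventually_ge_at_top[of N]
  proof eventually_elim
    case (elim m)
    then have "norm x \<le> real m" using N by linarith
    then show ?case by simp
  qed
  then show "(\<lambda>m. indicator (cball 0 (real m)) x * f x) \<longlonglongrightarrow> f x"
    by (rule tendsto_eventually)
qed

text \<open>Weak derivatives are only Lebesgue measurable, while Fubini and the translation lemmas
  are applied to Borel functions; the passage is made through such representatives.\<close>

lemma lebesgue_borel_representative: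
  fixes f :: "'a::euclidean_space \<Rightarrow> real"
  assumes "f \<in> borel_measurable lebesgue"
  obtains g where "g \<in> borel_measurable borel" "AE x in lebesgue. f x = g x"
  using completion_ex_borel_measurable_real[OF assms] AE_completion by auto

lemma locally_integrableI_integrable:
  assumes "integrable lebesgue f"
  shows "locally_integrable f"
  unfolding locally_integrable_def set_integrable_def
  using integrable_mult_indicator[OF _ assms] by (auto dest: lmeasurable_compact simp: fmeasurableD)

lemma integrable_lebesgue_mult_bounded:
  fixes f :: "real^'n::finite \<Rightarrow> real"
  assumes f: "locally_integrable f" and g: "g \<in> borel_measurable lebesgue"
    and b: "\<And>x. \<bar>g x\<bar> \<le> B" "\<And>x. norm x > r \<Longrightarrow> g x = 0"
  shows "integrable lebesgue (\<lambda>x. f x * g x)"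
proof (rule Bochner_Integration.integrable_bound)
  show "integrable lebesgue (\<lambda>x. B * (indicator (cball 0 r) x * f x))"
    using locally_integrable_cball[OF f] by simp
  show "(\<lambda>x. f x * g x) \<in> borel_measurable lebesgue"
    using locally_integrable_borel[OF f] g by measurable
  have "norm (f x * g x) \<le> norm (B * (indicator (cball 0 r) x * f x))" for x
  proof (cases "norm x \<le> r")
    case True
    have "\<bar>f x\<bar> * \<bar>g x\<bar> \<le> \<bar>f x\<bar> * \<bar>B\<bar>"
      using b(1)[of x] by (intro mult_left_mono) auto
    then show ?thesis using True by (simp add: abs_mult mult.commute)
  qed (use b(2) in auto)
  then show "AE x in lebesgue. norm (f x * g x) \<le> norm (B * (indicator (cball 0 r) x * f x))" by simp
qed

lemma borel_imp_lebesgue: "f \<in> borel_measurable borel \<Longrightarrow> f \<in> borel_measurable lebesgue"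
  by (simp add: measurable_completion)

lemma integrable_lebesgue_mult_test:
  assumes f: "locally_integrable f" and g: "test_function g"
  shows "integrable lebesgue (\<lambda>x. f x * g x)"
proof -
  obtain B where B: "\<And>x. \<bar>g x\<bar> \<le> B" using test_function_bounded[OF g] by blast
  obtain r where r: "\<And>x. norm x > r \<Longrightarrow> g x = 0" using g test_function_iff by blast
  show ?thesis
    using integrable_lebesgue_mult_bounded[OF f borel_imp_lebesgue[OF test_function_borel[OF g]] B r] .
qed

lemma locally_integrable_add:
  "locally_integrable f \<Longrightarrow> locally_integrable g \<Longrightarrow> locally_integrable (\<lambda>x. f x + g x)"
  unfolding locally_integrable_def by (auto intro: set_integral_add)

lemma locally_integrable_cmult:
  "locally_integrable f \<Longrightarrow> locally_integrable (\<lambda>x. c * f x)"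
  unfolding locally_integrable_def by (auto intro: set_integrable_mult_right)

lemma locally_integrable_zero: "locally_integrable (\<lambda>x. 0)"
  by (simp add: locally_integrable_def set_integrable_def)

lemma locally_integrable_sum:
  "(\<And>i. i \<in> I \<Longrightarrow> locally_integrable (f i)) \<Longrightarrow> locally_integrable (\<lambda>x. \<Sum>i\<in>I. f i x)"
  by (induction I rule: infinite_finite_induct) (auto intro: locally_integrable_zero locally_integrable_add)

lemma test_function_locally_integrable:
  assumes "test_function f"
  shows "locally_integrable f"
  by (rule locally_integrableI_integrable) (use integrable_test_function[OF assms] in \<open>simp add: integrable_completion test_function_borel[OF assms]\<close>)

section \<open>The fundamental lemma and uniqueness of weak derivatives\<close>

definition box_cutoff :: "real^'n::finite \<Rightarrow> real^'n \<Rightarrow> nat \<Rightarrow> real^'n \<Rightarrow> real" where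
  "box_cutoff a b m x = (\<Prod>i\<in>UNIV. exp_cutoff (1 / real (Suc m)) (x $ i - a $ i) * exp_cutoff (1 / real (Suc m)) (b $ i - x $ i))"

lemma box_cutoff_support: "x \<notin> box a b \<Longrightarrow> box_cutoff a b m x = 0"
  by (auto simp: box_cutoff_def mem_box_cart exp_cutoff_def intro!: prod_zero)

lemma box_cutoff_bounds: "0 \<le> box_cutoff a b m x" "box_cutoff a b m x \<le> 1"
  unfolding box_cutoff_def by (auto intro!: prod_nonneg prod_le_1 mult_le_one exp_cutoff_le_1)

lemma box_cutoff_test: "test_function (box_cutoff a b m)"
proof -
  have c: "smooth (\<lambda>x. exp_cutoff (1 / real (Suc m)) (1 * (x $ i) + c))"
    "smooth (\<lambda>x. exp_cutoff (1 / real (Suc m)) ((- 1) * (x $ i) + c))" for c and i :: 'a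
    by (rule smooth_real_coord[OF smooth_real_affine[OF smooth_real_exp_cutoff]]; simp)+
  have "smooth (\<lambda>x. \<Prod>i\<in>(UNIV::'a set). exp_cutoff (1 / real (Suc m)) (1 * (x $ i) + - a $ i) * exp_cutoff (1 / real (Suc m)) ((- 1) * (x $ i) + b $ i))"
    by (rule smooth_prod, rule smooth_mult; rule c)
  moreover have "box_cutoff a b m = (\<lambda>x. \<Prod>i\<in>(UNIV::'a set). exp_cutoff (1 / real (Suc m)) (1 * (x $ i) + - a $ i) * exp_cutoff (1 / real (Suc m)) ((- 1) * (x $ i) + b $ i))"
    by (simp add: box_cutoff_def fun_eq_iff)
  ultimately have s: "smooth (box_cutoff a b m)" by simp
  obtain r where "\<forall>x\<in>box a b. norm x \<le> r" using bounded_box[of a b] unfolding bounded_iff by blast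
  then have "box_cutoff a b m x = 0" if "norm x > r" for x
    using box_cutoff_support[of x a b m] that by force
  then show ?thesis using s test_functionI by blast
qed

lemma box_cutoff_tendsto: "(\<lambda>m. box_cutoff a b m x) \<longlonglongrightarrow> indicator (box a b) x"
proof -
  have "(\<lambda>m. box_cutoff a b m x) \<longlonglongrightarrow> (\<Prod>i\<in>UNIV. indicator {0<..} (x $ i - a $ i) * indicator {0<..} (b $ i - x $ i))"
    unfolding box_cutoff_def by (intro tendsto_prod tendsto_mult exp_cutoff_tendsto_1)
  also have "(\<Prod>i\<in>UNIV. indicator {0<..} (x $ i - a $ i) * indicator {0<..} (b $ i - x $ i)) = (indicator (box a b) x :: real)"
  proof (cases "x \<in> box a b")
    case True
    then show ?thesis by (auto simp: mem_box_cart intro!: prod.neutral)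
  next
    case False
    then obtain i where "\<not> (a $ i < x $ i \<and> x $ i < b $ i)" by (auto simp: mem_box_cart)
    then have "indicat_real {0<..} (x $ i - a $ i) * indicat_real {0<..} (b $ i - x $ i) = 0" by auto
    then have "(\<Prod>i\<in>UNIV. indicat_real {0<..} (x $ i - a $ i) * indicator {0<..} (b $ i - x $ i)) = 0"
      by (intro prod_zero) auto
    then show ?thesis using False by simp
  qed
  finally show ?thesis .
qed

text \<open>Test functions supported in the box converge boundedly to its indicator; the restriction
  of w to a ball containing the box is the majorant.\<close>

lemma integral_box_zero:
  assumes w: "locally_integrable w" and z: "\<And>f. test_function f \<Longrightarrow> (LINT x|lebesgue. w x * f x) = 0"
  shows "(LINT x|lebesgue. w x * indicator (box a b) x) = 0"
proof -
  obtain r where r: "\<forall>x\<in>box a b. norm x \<le> r" using bounded_box[of a b] unfolding bounded_iff by blast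
  have "(\<lambda>m. LINT x|lebesgue. w x * box_cutoff a b m x) \<longlonglongrightarrow> (LINT x|lebesgue. w x * indicator (box a b) x)"
  proof (rule integral_dominated_convergence)
    show "integrable lebesgue (\<lambda>x. norm (indicator (cball 0 r) x * w x))"
      using locally_integrable_cball[OF w] by (rule integrable_norm)
    show "(\<lambda>x. w x * indicator (box a b) x) \<in> borel_measurable lebesgue"
      by (rule borel_measurable_times[OF locally_integrable_borel[OF w] borel_imp_lebesgue]) simp
    show "(\<lambda>x. w x * box_cutoff a b m x) \<in> borel_measurable lebesgue" for m
      using locally_integrable_borel[OF w] borel_imp_lebesgue[OF test_function_borel[OF box_cutoff_test[of a b m]]]
      by measurable
    show "AE x in lebesgue. (\<lambda>m. w x * box_cutoff a b m x) \<longlonglongrightarrow> w x * indicator (box a b) x"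
      by (intro AE_I2 tendsto_mult tendsto_const box_cutoff_tendsto)
    fix m
    have "norm (w x * box_cutoff a b m x) \<le> norm (indicator (cball 0 r) x * w x)" for x
    proof (cases "x \<in> box a b")
      case True
      then show ?thesis using r box_cutoff_bounds[of a b m x] by (simp add: abs_mult mult_left_le)
    next
      case False
      then show ?thesis by (simp add: box_cutoff_support)
    qed
    then show "AE x in lebesgue. norm (w x * box_cutoff a b m x) \<le> norm (indicator (cball 0 r) x * w x)" by simp
  qed
  then show ?thesis by (simp add: z[OF box_cutoff_test] LIMSEQ_const_iff)
qed

text \<open>Open boxes are stable under intersection and generate the Borel sets, so a Dynkin system
  argument gives zero integrals over all Borel sets. The vanishing total integral serves the step to
  complements.\<close>

lemma AE_zero_if_integral_box_zero:
  fixes w :: "'a::euclidean_space \<Rightarrow> real"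
  assumes w: "integrable lborel w" and z: "\<And>a b. (LINT x|lborel. w x * indicator (box a b) x) = 0"
    and t: "(LINT x|lborel. w x) = 0"
  shows "AE x in lborel. w x = 0"
proof (rule sigma_finite_measure.density_zero[OF sigma_finite_lborel w])
  have si: "integrable lborel (\<lambda>x. w x * indicator A x)" if "A \<in> sets borel" for A :: "'a set"
    using integrable_mult_indicator[of A lborel w] w that by (simp add: mult.commute)
  fix A :: "'a set" assume "A \<in> sets lborel"
  then have "A \<in> sigma_sets UNIV (range (\<lambda>(a, b). box a b))"
    by (simp add: borel_eq_box)
  then have "(LINT x|lborel. w x * indicator A x) = 0"
  proof (induction rule: sigma_sets_induct_disjoint[rotated 2, consumes 1, case_names basic empty compl union Int space])
    case (basic A)
    then show ?case using z by auto
  next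
    case (compl A)
    then have A: "A \<in> sets borel" by (simp add: borel_eq_box)
    have "(\<lambda>x. w x * indicator (UNIV - A) x) = (\<lambda>x. w x - w x * indicator A x)"
      by (auto simp: indicator_def fun_eq_iff)
    then show ?case using compl si[OF A] w t by simp
  next
    case (union A)
    have A: "A i \<in> sets borel" for i using union by (auto simp: borel_eq_box)
    have "(LINT x|lborel. w x * indicator (\<Union>i. A i) x) = (LINT x:(\<Union>i. A i)|lborel. w x)"
      by (simp add: set_lebesgue_integral_def mult.commute)
    also have "\<dots> = (\<Sum>i. LINT x:A i|lborel. w x)"
    proof (rule lebesgue_integral_countable_add)
      show "set_integrable lborel (\<Union>i. A i) w"
        using si[of "\<Union>i. A i"] A by (auto simp: set_integrable_def mult.commute)
    qed (use A union in \<open>auto simp: disjoint_family_on_def\<close>)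
    also have "\<dots> = 0"
      using union by (simp add: set_lebesgue_integral_def mult.commute)
    finally show ?case .
  next
    case Int
    show ?case by (auto simp: Int_stable_def box_Int_box)
  qed auto
  then show "(LINT x:A|lborel. w x) = 0" by (simp add: set_lebesgue_integral_def mult.commute)
qed

theorem fundamental_lemma:
  fixes w :: "real^'n::finite \<Rightarrow> real"
  assumes w: "locally_integrable w" and z: "\<And>f. test_function f \<Longrightarrow> (LINT x|lebesgue. w x * f x) = 0"
  shows "AE x in lebesgue. w x = 0"
proof -
  obtain v where v[measurable]: "v \<in> borel_measurable borel" and wv: "AE x in lebesgue. w x = v x"
    using lebesgue_borel_representative[OF locally_integrable_borel[OF w]] by blast
  \<comment> \<open>A locally integrable function need not be integrable, so it is cut to cubes. On
    a cube, integrals over boxes are again integrals over boxes, because boxes intersect in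
    boxes.\<close>
  define Q where "Q m = box (- (\<chi> i. real m)) (\<chi> i::'n. real m)" for m :: nat
  have b: "(LINT x|lborel. v x * indicator (box a b) x) = 0" for a b
  proof -
    have "(LINT x|lborel. v x * indicator (box a b) x) = (LINT x|lebesgue. v x * indicator (box a b) x)"
      by (rule integral_completion[symmetric]) simp
    also have "\<dots> = (LINT x|lebesgue. w x * indicator (box a b) x)"
    proof (rule integral_cong_AE)
      show "AE x in lebesgue. v x * indicator (box a b) x = w x * indicator (box a b) x"
        using wv by eventually_elim simp
      show "(\<lambda>x. v x * indicator (box a b) x) \<in> borel_measurable lebesgue"
        by (rule borel_imp_lebesgue) simp
      show "(\<lambda>x. w x * indicator (box a b) x) \<in> borel_measurable lebesgue"
        by (rule borel_measurable_times[OF locally_integrable_borel[OF w] borel_imp_lebesgue]) simp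
    qed
    finally show ?thesis using integral_box_zero[OF w z] by simp
  qed
  have 1: "(LINT x|lborel. v x * indicator (Q m) x) = 0" for m unfolding Q_def by (rule b)
  have 2: "(LINT x|lborel. v x * indicator (Q m) x * indicator (box a b) x) = 0" for m a b
  proof -
    have "(\<lambda>x. v x * indicator (Q m) x * indicator (box a b) x) = (\<lambda>x. v x * indicator (Q m \<inter> box a b) x)"
      by (auto simp: indicator_def)
    then show ?thesis unfolding Q_def by (simp add: box_Int_box b)
  qed
  have 3: "integrable lborel (\<lambda>x. v x * indicator (Q m) x)" for m
  proof -
    obtain r where r: "\<And>x. x \<in> Q m \<Longrightarrow> norm x \<le> r" using bounded_box unfolding bounded_iff Q_def by blast
    have "integrable lebesgue (\<lambda>x. w x * indicator (Q m) x)"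
      by (rule integrable_lebesgue_mult_bounded[OF w, where B = 1 and r = r])
         (use r in \<open>auto simp: Q_def indicator_def not_le[symmetric] intro!: borel_imp_lebesgue\<close>)
    then have "integrable lebesgue (\<lambda>x. v x * indicator (Q m) x)"
    proof (rule integrable_cong_AE_imp)
      show "AE x in lebesgue. w x * indicator (Q m) x = v x * indicator (Q m) x"
        using wv by eventually_elim simp
      show "(\<lambda>x. v x * indicator (Q m) x) \<in> borel_measurable lebesgue"
        unfolding Q_def by (rule borel_imp_lebesgue) simp
    qed
    moreover have "(\<lambda>x. v x * indicator (Q m) x) \<in> borel_measurable lborel" by (simp add: Q_def)
    ultimately show ?thesis by (simp add: integrable_completion)
  qed
  have "AE x in lborel. \<forall>m. v x * indicator (Q m) x = 0"
    unfolding AE_all_countable using AE_zero_if_integral_box_zero[OF 3 2 1] by blast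
  then have "AE x in lborel. v x = 0"
  proof eventually_elim
    case (elim x)
    obtain N :: nat where N: "norm x < real N" using reals_Archimedean2 by blast
    have "\<bar>x $ i\<bar> < real N" for i
      by (rule le_less_trans[OF component_le_norm_cart N])
    then have "- real N < x $ i \<and> x $ i < real N" for i
      by (meson abs_less_iff minus_less_iff)
    then have "x \<in> Q N"
      by (simp add: Q_def mem_box_cart)
    then show ?case using elim[rule_format, of N] by simp
  qed
  then have "AE x in lebesgue. v x = 0" by (rule AE_completion)
  then show ?thesis using wv by eventually_elim simp
qed

lemma has_weak_deriv_unique:
  assumes "has_weak_deriv u is v" "has_weak_deriv u is w"
  shows "AE x in lebesgue. v x = w x"
proof -
  have v: "locally_integrable v" and w: "locally_integrable w"
    using assms by (auto simp: has_weak_deriv_def)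
  have "AE x in lebesgue. v x + (- 1) * w x = 0"
  proof (rule fundamental_lemma)
    show "locally_integrable (\<lambda>x. v x + (- 1) * w x)"
      by (intro locally_integrable_add v locally_integrable_cmult w)
    fix f :: "real^'a \<Rightarrow> real" assume f: "test_function f"
    have "(- 1) ^ length is * (LINT x|lebesgue. v x * f x) = (- 1) ^ length is * (LINT x|lebesgue. w x * f x)"
      using assms[unfolded has_weak_deriv_def, THEN conjunct2, THEN conjunct2, rule_format, OF f] by linarith
    then have "(LINT x|lebesgue. v x * f x) = (LINT x|lebesgue. w x * f x)" by simp
    then show "(LINT x|lebesgue. (v x + (- 1) * w x) * f x) = 0"
      using integrable_lebesgue_mult_test[OF v f] integrable_lebesgue_mult_test[OF w f]
      by (simp add: left_diff_distrib)
  qed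
  then show ?thesis by simp
qed

lemma has_weak_deriv_weak_deriv: "has_weak_deriv u is v \<Longrightarrow> has_weak_deriv u is (weak_deriv is u)"
  unfolding weak_deriv_def by (rule someI[of "has_weak_deriv u is"])

lemma weak_deriv_AE_eq: "has_weak_deriv u is v \<Longrightarrow> AE x in lebesgue. weak_deriv is u x = v x"
  using has_weak_deriv_unique has_weak_deriv_weak_deriv by blast

section \<open>Riesz potentials of test functions\<close>

definition omega :: "'n::finite itself \<Rightarrow> real" where
  "omega N = measure lborel (ball (0 :: real^'n) 1)"

lemma omega_eq: "omega TYPE('n::finite) = unit_ball_vol (real CARD('n))"
  unfolding omega_def by (simp add: content_ball)

lemma omega_pos: "omega TYPE('n::finite) > 0"
  by (simp add: omega_eq)

lemma unit_ball_measure_eq: "unit_ball_measure TYPE('n::finite) = omega TYPE('n)"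
  by (simp add: unit_ball_measure_def omega_def)

lemma emeasure_lborel_ball:
  "r \<ge> 0 \<Longrightarrow> emeasure lborel (ball (c :: real^'n::finite) r) = ennreal (omega TYPE('n) * r ^ CARD('n))"
  using emeasure_ball[of r c] by (simp add: omega_eq)

lemma emeasure_lborel_norm_le:
  assumes "r \<ge> 0"
  shows "emeasure lborel {x :: real^'n::finite. norm x \<le> r} = ennreal (omega TYPE('n) * r ^ CARD('n))"
proof -
  have "{x :: real^'n. norm x \<le> r} = cball 0 r" by (auto simp: dist_norm)
  then show ?thesis using emeasure_cball[OF assms, of "0::real^'n"] by (simp add: omega_eq)
qed

text \<open>Polar coordinates without a surface measure: on the half-line \<open>{..r}\<close> both
  measures give the volume of the ball of radius r, and these half-lines form a generator stable
  under intersection.\<close>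

lemma distr_norm_lborel:
  "distr lborel borel (norm :: real^'n::finite \<Rightarrow> real)
    = density lborel (\<lambda>r. ennreal (indicator {0..} r * (real CARD('n) * omega TYPE('n) * r ^ (CARD('n) - 1))))"
    (is "?M = ?N")
proof -
  have fM: "emeasure ?M {..r} = ennreal (omega TYPE('n) * max r 0 ^ CARD('n))" for r
  proof -
    have "emeasure ?M {..r} = emeasure lborel {x :: real^'n. norm x \<le> r}"
      by (subst emeasure_distr) (auto intro!: arg_cong[where f = "emeasure lborel"])
    also have "\<dots> = ennreal (omega TYPE('n) * max r 0 ^ CARD('n))"
    proof (cases "r \<ge> 0")
      case False
      then have "{x :: real^'n. norm x \<le> r} = {}" by (auto simp: not_le intro: less_le_trans[OF _ norm_ge_zero])
      then show ?thesis using False by (simp add: max_def power_0_left)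
    qed (simp add: emeasure_lborel_norm_le max_def)
    finally show ?thesis .
  qed
  have fN: "emeasure ?N {..r} = ennreal (omega TYPE('n) * max r 0 ^ CARD('n))" for r
  proof -
    have "emeasure ?N {..r} = (\<integral>\<^sup>+x. ennreal (real CARD('n) * omega TYPE('n) * x ^ (CARD('n) - 1)) * indicator {0..max r 0} x \<partial>lborel)"
      by (subst emeasure_density, simp, simp, rule nn_integral_cong_AE)
         (use AE_lborel_singleton[of 0] in \<open>eventually_elim, auto simp: indicator_def max_def\<close>)
    also have "\<dots> = ennreal (omega TYPE('n) * max r 0 ^ CARD('n) - omega TYPE('n) * 0 ^ CARD('n))"
    proof (rule nn_integral_FTC_Icc)
      fix x :: real assume x: "x \<in> {0..max r 0}"
      show "((\<lambda>x. omega TYPE('n) * x ^ CARD('n)) has_real_derivative real CARD('n) * omega TYPE('n) * x ^ (CARD('n) - 1)) (at x)"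
        by (auto intro!: derivative_eq_intros)
      show "0 \<le> real CARD('n) * omega TYPE('n) * x ^ (CARD('n) - 1)"
        using x omega_pos[where 'n='n] by simp
    qed auto
    finally show ?thesis by (simp add: power_0_left)
  qed
  show ?thesis
  proof (rule measure_eqI_generator_eq[where E = "range atMost" and \<Omega> = UNIV and A = "\<lambda>i. {..real i}"])
    show "Int_stable (range (atMost :: real \<Rightarrow> real set))"
      by (auto simp: Int_stable_def)
    show "emeasure ?M X = emeasure ?N X" if "X \<in> range atMost" for X
      using that fM fN by auto
    show "sets ?M = sigma_sets UNIV (range atMost)" "sets ?N = sigma_sets UNIV (range atMost)"
      by (auto simp: borel_eq_atMost)
    show "(\<Union>i. {..real i}) = (UNIV :: real set)"
      using real_arch_simple by auto
  qed (auto simp: fM)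
qed

lemma nn_integral_radial:
  assumes [measurable]: "h \<in> borel_measurable borel"
  shows "(\<integral>\<^sup>+x. h (norm (x :: real^'n::finite)) \<partial>lborel) =
    (\<integral>\<^sup>+r. ennreal (indicator {0..} r * (real CARD('n) * omega TYPE('n) * r ^ (CARD('n) - 1))) * h r \<partial>lborel)"
proof -
  have "(\<integral>\<^sup>+x. h (norm (x :: real^'n)) \<partial>lborel) = (\<integral>\<^sup>+r. h r \<partial>distr lborel borel (norm :: real^'n \<Rightarrow> real))"
    by (subst nn_integral_distr) auto
  also have "\<dots> = (\<integral>\<^sup>+r. ennreal (indicator {0..} r * (real CARD('n) * omega TYPE('n) * r ^ (CARD('n) - 1))) * h r \<partial>lborel)"
    unfolding distr_norm_lborel by (subst nn_integral_density) auto
  finally show ?thesis .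
qed

lemma nn_integral_ball_powr:
  assumes a: "a > 0" and R: "R > 0"
  shows "(\<integral>\<^sup>+x. ennreal (norm x powr (a - real CARD('n))) * indicator (ball 0 R) (x :: real^'n::finite) \<partial>lborel)
    = ennreal (real CARD('n) * omega TYPE('n) * R powr a / a)"
proof -
  define n where "n = CARD('n)"
  have n: "n > 0" by (simp add: n_def)
  define c where "c = real n * omega TYPE('n)"
  have c: "c > 0" using n omega_pos[where 'n='n] by (simp add: c_def)
  define h where "h r = ennreal (r powr (a - real n)) * indicator {..<R} r" for r :: real
  have [measurable]: "h \<in> borel_measurable borel" unfolding h_def by measurable
  have "(\<integral>\<^sup>+x. ennreal (norm x powr (a - real n)) * indicator (ball 0 R) (x :: real^'n) \<partial>lborel)
    = (\<integral>\<^sup>+x. h (norm (x :: real^'n)) \<partial>lborel)"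
    by (rule nn_integral_cong) (auto simp: h_def indicator_def)
  also have "\<dots> = (\<integral>\<^sup>+r. ennreal (indicator {0..} r * (c * r ^ (n - 1))) * h r \<partial>lborel)"
    by (subst nn_integral_radial) (simp_all add: n_def c_def)
  also have "\<dots> = (\<integral>\<^sup>+r. ennreal (c * r powr (a - 1)) * indicator {0..R} r \<partial>lborel)"
  proof (rule nn_integral_cong_AE)
    have eq: "r \<noteq> 0 \<Longrightarrow> r \<noteq> R \<Longrightarrow> ennreal (indicator {0..} r * (c * r ^ (n - 1))) * h r = ennreal (c * r powr (a - 1)) * indicator {0..R} r" for r
    proof (cases "0 < r \<and> r < R")
      case True
      have "r ^ (n - 1) * r powr (a - real n) = r powr (a - 1)"
        using True n by (simp add: powr_realpow[symmetric] powr_add[symmetric] of_nat_diff)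
      then show ?thesis using True c by (simp add: h_def ennreal_mult[symmetric] mult.assoc)
    qed (auto simp: h_def indicator_def)
    show "AE r in lborel. ennreal (indicator {0..} r * (c * r ^ (n - 1))) * h r = ennreal (c * r powr (a - 1)) * indicator {0..R} r"
      using AE_lborel_singleton[of 0] AE_lborel_singleton[of R] by eventually_elim (rule eq)
  qed
  also have "\<dots> = ennreal (c * (R powr a / a))"
  proof -
    have i: "((\<lambda>r. r powr (a - 1)) has_integral (R powr (a - 1 + 1) / (a - 1 + 1))) {0..R}"
      using has_integral_powr_from_0[of "a - 1" R] a R by simp
    have "(\<integral>\<^sup>+r. ennreal (r powr (a - 1) * indicator {0..R} r) \<partial>lborel) = ennreal (R powr a / a)"
    proof (rule nn_integral_has_integral_lborel)
      show "((\<lambda>r. r powr (a - 1) * indicator {0..R} r) has_integral R powr a / a) UNIV"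
        using i by (simp add: has_integral_restrict_UNIV[of "{0..R}", symmetric] indicator_def of_bool_def if_distrib cong: if_cong)
    qed auto
    then have "(\<integral>\<^sup>+r. ennreal c * ennreal (r powr (a - 1) * indicator {0..R} r) \<partial>lborel) = ennreal c * ennreal (R powr a / a)"
      by (subst nn_integral_cmult) auto
    moreover have "ennreal (c * r powr (a - 1)) * indicator {0..R} r = ennreal c * ennreal (r powr (a - 1) * indicator {0..R} r)" for r
      using c by (simp add: indicator_def ennreal_mult)
    ultimately show ?thesis using c a by (simp add: ennreal_mult[symmetric])
  qed
  finally show ?thesis by (simp add: n_def c_def mult.assoc)
qed

text \<open>The radial integrand has the antiderivative \<open>\<omega> r\<^sup>n (1 + r\<^sup>2)\<^bsup>-n/2\<^esup>\<close>.\<close>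

lemma nn_integral_poisson_kernel:
  "(\<integral>\<^sup>+x. ennreal (real CARD('n) * (1 + (norm (x :: real^'n::finite))\<^sup>2) powr (- real CARD('n) / 2 - 1)) \<partial>lborel)
    = ennreal (real CARD('n) * omega TYPE('n))"
proof -
  define n where "n = CARD('n)"
  have n: "n > 0" by (simp add: n_def)
  define c where "c = real n * omega TYPE('n)"
  have c: "c > 0" using n omega_pos[where 'n='n] by (simp add: c_def)
  define h where "h r = ennreal (real n * (1 + r\<^sup>2) powr (- real n / 2 - 1))" for r :: real
  have [measurable]: "h \<in> borel_measurable borel" unfolding h_def by measurable
  define F where "F r = c * (r ^ n * (1 + r\<^sup>2) powr (- real n / 2))" for r :: real
  have "(\<integral>\<^sup>+x. ennreal (real n * (1 + (norm (x :: real^'n))\<^sup>2) powr (- real n / 2 - 1)) \<partial>lborel)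
    = (\<integral>\<^sup>+x. h (norm (x :: real^'n)) \<partial>lborel)"
    by (simp add: h_def)
  also have "\<dots> = (\<integral>\<^sup>+r. ennreal (indicator {0..} r * (c * r ^ (n - 1))) * h r \<partial>lborel)"
    by (subst nn_integral_radial) (simp_all add: n_def c_def)
  also have "\<dots> = (\<integral>\<^sup>+r. ennreal (c * r ^ (n - 1) * (real n * (1 + r\<^sup>2) powr (- real n / 2 - 1))) * indicator {0..} r \<partial>lborel)"
    using c by (intro nn_integral_cong) (auto simp: h_def indicator_def ennreal_mult[symmetric])
  also have "\<dots> = ennreal (c - F 0)"
  proof (rule nn_integral_FTC_atLeast)
    fix r :: real assume r: "0 \<le> r"
    show "0 \<le> c * r ^ (n - 1) * (real n * (1 + r\<^sup>2) powr (- real n / 2 - 1))" using r c by simp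
    have p: "1 + r\<^sup>2 > 0" by (simp add: add_pos_nonneg)
    have e: "(1 + r\<^sup>2) powr (- real n / 2) = (1 + r\<^sup>2) * (1 + r\<^sup>2) powr (- real n / 2 - 1)"
      using p by (simp add: powr_diff)
    have rn: "r ^ n = r * r ^ (n - 1)" using n by (cases n) auto
    have "(F has_real_derivative c * (real n * r ^ (n - 1) * (1 + r\<^sup>2) powr (- real n / 2)
        + r ^ n * ((- real n / 2) * (1 + r\<^sup>2) powr (- real n / 2 - 1) * (2 * r)))) (at r)"
      unfolding F_def using p by (auto intro!: derivative_eq_intros simp: powr_diff field_simps)
    also have "c * (real n * r ^ (n - 1) * (1 + r\<^sup>2) powr (- real n / 2)
        + r ^ n * ((- real n / 2) * (1 + r\<^sup>2) powr (- real n / 2 - 1) * (2 * r)))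
      = c * r ^ (n - 1) * (real n * (1 + r\<^sup>2) powr (- real n / 2 - 1))"
      unfolding e rn by (simp add: algebra_simps power2_eq_square)
    finally show "(F has_real_derivative c * r ^ (n - 1) * (real n * (1 + r\<^sup>2) powr (- real n / 2 - 1))) (at r)" .
  next
    have "((\<lambda>r::real. (1 + (inverse r)\<^sup>2) powr (- real n / 2)) \<longlongrightarrow> (1 + 0\<^sup>2) powr (- real n / 2)) at_top"
      by (intro tendsto_intros tendsto_inverse_0_at_top filterlim_ident) auto
    then have "((\<lambda>r::real. c * (1 + (inverse r)\<^sup>2) powr (- real n / 2)) \<longlongrightarrow> c * 1) at_top"
      by (intro tendsto_mult tendsto_const) simp
    moreover have "eventually (\<lambda>r. c * (1 + (inverse r)\<^sup>2) powr (- real n / 2) = F r) at_top"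
      using eventually_gt_at_top[of 0]
    proof eventually_elim
      case (elim r)
      have q: "1 + (inverse r)\<^sup>2 > 0" by (simp add: add_pos_nonneg)
      have "1 + r\<^sup>2 = r powr 2 * (1 + (inverse r)\<^sup>2)"
        using elim by (simp add: powr_numeral field_simps)
      then have "(1 + r\<^sup>2) powr (- real n / 2) = (r powr 2) powr (- real n / 2) * (1 + (inverse r)\<^sup>2) powr (- real n / 2)"
        using elim q by (simp add: powr_mult)
      also have "(r powr 2) powr (- real n / 2) = r powr (- real n)"
        unfolding powr_powr by simp
      also have "r powr (- real n) = inverse (r ^ n)"
        using elim by (simp add: powr_minus powr_realpow)
      finally show ?case using elim by (simp add: F_def)
    qed
    ultimately show "(F \<longlongrightarrow> c) at_top" by (simp add: filterlim_cong[OF refl refl])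
  qed auto
  also have "F 0 = 0" using n by (simp add: F_def)
  finally show ?thesis by (simp add: n_def c_def)
qed

section \<open>Riesz kernels and the Euler operator\<close>

definition neg_lap :: "(real^'n::finite \<Rightarrow> real) \<Rightarrow> real^'n \<Rightarrow> real" where
  "neg_lap f x = - (\<Sum>i\<in>UNIV. partials [i, i] f x)"

text \<open>The Euler operator, the scalar product of x with the gradient. It is bounded by |x|
  times the length of the gradient, and this extra factor |x| turns the kernel of order k - 1 into
  the kernel of order k when k is odd.\<close>

definition radial_deriv :: "(real^'n::finite \<Rightarrow> real) \<Rightarrow> real^'n \<Rightarrow> real" where
  "radial_deriv f x = (\<Sum>i\<in>UNIV. x $ i * partials [i] f x)"

lemma test_function_neg_lap: "test_function f \<Longrightarrow> test_function (neg_lap f)"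
proof -
  assume f: "test_function f"
  have "neg_lap f = (\<lambda>x. (- 1) * (\<Sum>i\<in>UNIV. partials [i, i] f x))"
    by (simp add: neg_lap_def fun_eq_iff del: partials.simps)
  then show ?thesis
    by (simp only:) (intro test_function_cmult test_function_sum test_function_partials f)
qed

lemma test_function_neg_lap_funpow: "test_function f \<Longrightarrow> test_function ((neg_lap ^^ m) f)"
  by (induction m) (auto intro: test_function_neg_lap)

lemma test_function_radial_deriv: "test_function f \<Longrightarrow> test_function (radial_deriv f)"
proof -
  assume f: "test_function f"
  have "radial_deriv f = (\<lambda>x. \<Sum>i\<in>UNIV. x $ i * partials [i] f x)"
    by (simp add: radial_deriv_def fun_eq_iff del: partials.simps)
  moreover have "test_function (\<lambda>x. \<Sum>i\<in>UNIV. x $ i * partials [i] f x)"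
    by (rule test_function_sum, rule test_function_mult'[OF test_function_partials[OF f] smooth_coord])
  ultimately show ?thesis by simp
qed

lemma integrable_norm_powr_ball:
  assumes "a > 0"
  shows "integrable lborel (\<lambda>x :: real^'n::finite. norm x powr (a - real CARD('n)) * indicator (ball 0 R) x)"
proof (cases "R > 0")
  case True
  show ?thesis
  proof (rule integrableI_bounded)
    have "(\<integral>\<^sup>+x. ennreal (norm (norm x powr (a - real CARD('n)) * indicator (ball 0 R) (x :: real^'n))) \<partial>lborel)
      = (\<integral>\<^sup>+x. ennreal (norm x powr (a - real CARD('n))) * indicator (ball 0 R) (x :: real^'n) \<partial>lborel)"
      by (intro nn_integral_cong) (auto simp: indicator_def)
    then show "(\<integral>\<^sup>+x. ennreal (norm (norm x powr (a - real CARD('n)) * indicator (ball 0 R) (x :: real^'n))) \<partial>lborel) < \<infinity>"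
      using nn_integral_ball_powr[OF assms True, where 'n='n] by simp
    have [measurable]: "ball 0 R \<in> sets (borel :: (real^'n) measure)" by simp
    show "(\<lambda>x :: real^'n. norm x powr (a - real CARD('n)) * indicator (ball 0 R) x) \<in> borel_measurable lborel"
      by measurable
  qed
next
  case False
  then have e: "ball (0::real^'n) R = {}" by simp
  show ?thesis unfolding e by simp
qed

lemma integrable_riesz_kernel:
  fixes p :: "real^'n::finite \<Rightarrow> real"
  assumes a: "a > 0" and p[measurable]: "p \<in> borel_measurable borel"
    and b: "\<And>x. norm x powr (- c) * \<bar>p x\<bar> \<le> B * norm x powr (a - real CARD('n))" "\<And>x. norm x > r \<Longrightarrow> p x = 0"
  shows "integrable lborel (\<lambda>x. norm x powr (- c) * p x)"
proof (rule Bochner_Integration.integrable_bound)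
  show "integrable lborel (\<lambda>x :: real^'n. B * (norm x powr (a - real CARD('n)) * indicator (ball 0 (r + 1)) x))"
    by (intro integrable_mult_right integrable_norm_powr_ball a)
  have "norm (norm x powr (- c) * p x) \<le> norm (B * (norm x powr (a - real CARD('n)) * indicator (ball 0 (r + 1)) x))" for x
  proof (cases "norm x \<le> r")
    case True
    then show ?thesis using b(1)[of x] by (simp add: abs_mult) (metis abs_ge_self abs_mult abs_of_nonneg order_trans powr_ge_zero)
  qed (use b(2) in auto)
  then show "AE x in lborel. norm (norm x powr (- c) * p x) \<le> norm (B * (norm x powr (a - real CARD('n)) * indicator (ball 0 (r + 1)) x))"
    by simp
qed measurable

lemma integrable_riesz_test:
  fixes g :: "real^'n::finite \<Rightarrow> real"
  assumes g: "test_function g" and a: "a > 0"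
  shows "integrable lborel (\<lambda>x. norm x powr (a - real CARD('n)) * g x)"
proof -
  obtain B where B: "\<And>x. \<bar>g x\<bar> \<le> B" using test_function_bounded[OF g] by blast
  obtain r where r: "\<And>x. norm x > r \<Longrightarrow> g x = 0" using g test_function_iff by blast
  have "norm x powr (- (real CARD('n) - a)) * \<bar>g x\<bar> \<le> B * norm x powr (a - real CARD('n))" for x :: "real^'n"
    using mult_right_mono[OF B[of x], of "norm x powr (a - real CARD('n))"] by (simp add: mult.commute)
  from integrable_riesz_kernel[OF a test_function_borel[OF g] this r] show ?thesis by simp
qed

lemma radial_deriv_bound:
  fixes g :: "real^'n::finite \<Rightarrow> real"
  assumes g: "test_function g"
  obtains B where "\<And>x. \<bar>radial_deriv g x\<bar> \<le> B * norm x"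
proof -
  have "\<exists>B. \<forall>x. \<bar>partials [i] g x\<bar> \<le> B" for i
    using test_function_bounded[OF test_function_partials[OF g]] by metis
  then obtain B where B: "\<And>i x. \<bar>partials [i] g x\<bar> \<le> B i" by metis
  have "\<bar>radial_deriv g x\<bar> \<le> (\<Sum>i\<in>UNIV. B i) * norm x" for x
  proof -
    have "\<bar>radial_deriv g x\<bar> \<le> (\<Sum>i\<in>UNIV. \<bar>x $ i\<bar> * \<bar>partials [i] g x\<bar>)"
      unfolding radial_deriv_def by (rule order_trans[OF sum_abs]) (simp add: abs_mult del: partials.simps)
    also have "\<dots> \<le> (\<Sum>i\<in>UNIV. norm x * B i)"
      using B by (intro sum_mono mult_mono component_le_norm_cart) auto
    finally show ?thesis by (simp add: sum_distrib_left mult.commute)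
  qed
  then show ?thesis using that by blast
qed

text \<open>Since the Euler operator produces a factor |x|, all orders above -1 are admissible.
  Order 0, with the kernel |x|^(-n), is the one that recovers point values.\<close>

lemma integrable_riesz_radial_deriv:
  fixes g :: "real^'n::finite \<Rightarrow> real"
  assumes g: "test_function g" and a: "a > - 1"
  shows "integrable lborel (\<lambda>x. norm x powr (a - real CARD('n)) * radial_deriv g x)"
proof -
  obtain B where B: "\<And>x. \<bar>radial_deriv g x\<bar> \<le> B * norm x" using radial_deriv_bound[OF g] by blast
  obtain r where r: "\<And>x. norm x > r \<Longrightarrow> radial_deriv g x = 0"
    using test_function_radial_deriv[OF g] test_function_iff by blast
  have "norm x powr (- (real CARD('n) - a)) * \<bar>radial_deriv g x\<bar> \<le> B * norm x powr (a + 1 - real CARD('n))" for x :: "real^'n"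
  proof (cases "x = 0")
    case False
    then have "norm x powr (a + 1 - real CARD('n)) = norm x * norm x powr (a - real CARD('n))"
      using powr_add[of "norm x" 1 "a - real CARD('n)"] by (simp add: algebra_simps)
    then show ?thesis
      using mult_right_mono[OF B[of x], of "norm x powr (a - real CARD('n))"] by (simp add: mult_ac)
  qed simp
  from integrable_riesz_kernel[OF _ test_function_borel[OF test_function_radial_deriv[OF g]] this r] a
  show ?thesis by simp
qed

lemma smooth_regularized_power:
  fixes e a :: real
  assumes "e > 0"
  shows "smooth (\<lambda>x :: real^'n::finite. ((norm x)\<^sup>2 + e) powr a)"
proof -
  \<comment> \<open>The falling factorial a (a - 1) ... (a - j + 1) from differentiating the power j
    times.\<close>
  define c where "c j = (\<Prod>i<j. a - real i)" for j
  define F where "F j t = c j * (t + e) powr (a - real j)" for j and t :: real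
  have "(F j has_real_derivative F (Suc j) t) (at t)" if "t \<ge> 0" for j t
  proof -
    have "((\<lambda>t. (t + e) powr (a - real j)) has_real_derivative (a - real j) * (t + e) powr (a - real j - 1)) (at t)"
      using that assms by (auto intro!: derivative_eq_intros)
    from DERIV_cmult[OF this, of "c j"]
    have "((\<lambda>t. c j * (t + e) powr (a - real j)) has_real_derivative F (Suc j) t) (at t)"
      by (simp add: F_def c_def algebra_simps)
    moreover have "F j = (\<lambda>t. c j * (t + e) powr (a - real j))" by (simp add: F_def fun_eq_iff)
    ultimately show ?thesis by simp
  qed
  from smooth_radial[of F 0, OF this] show ?thesis by (simp add: F_def c_def)
qed

lemma partials_regularized_power:
  fixes e a :: real and x :: "real^'n::finite"
  assumes "e > 0"
  shows "partials [i] (\<lambda>x. ((norm x)\<^sup>2 + e) powr a) x = 2 * a * x $ i * ((norm x)\<^sup>2 + e) powr (a - 1)"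
proof -
  have "((\<lambda>t. (t + e) powr a) has_real_derivative a * ((norm (x - 0))\<^sup>2 + e) powr (a - 1)) (at ((norm (x - 0))\<^sup>2))"
    using assms by (auto intro!: derivative_eq_intros simp: add_nonneg_pos)
  from partials_radial[OF this, of i] show ?thesis by (simp add: mult_ac)
qed

text \<open>Integration by parts with the vector field x (|x|^2 + e)^(-b). Its divergence is
  arranged so that the remainder 2 b e (|x|^2 + e)^(-b-1) stands apart: as e tends to 0 it
  disappears for b < n / 2 and concentrates at the origin for b = n / 2.\<close>

lemma regularized_divergence:
  fixes g :: "real^'n::finite \<Rightarrow> real"
  assumes g: "test_function g" and e: "e > 0"
  shows "(LINT x|lborel. ((norm x)\<^sup>2 + e) powr (- b) * (- radial_deriv g x)) =
    (LINT x|lborel. ((real CARD('n) - 2 * b) * ((norm x)\<^sup>2 + e) powr (- b)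
       + 2 * b * (e * ((norm x)\<^sup>2 + e) powr (- b - 1))) * g x)"
proof -
  define K where "K x = ((norm x)\<^sup>2 + e) powr (- b)" for x :: "real^'n"
  define K' where "K' x = ((norm x)\<^sup>2 + e) powr (- b - 1)" for x :: "real^'n"
  have sK: "smooth K" "smooth K'" unfolding K_def K'_def by (rule smooth_regularized_power[OF e])+
  have sxK: "smooth (\<lambda>x. x $ i * K x)" for i by (rule smooth_mult[OF smooth_coord sK(1)])
  have pK: "partials [i] (\<lambda>x. x $ i * K x) x = K x - 2 * b * (x $ i)\<^sup>2 * K' x" for i x
  proof -
    have "partials [i] (\<lambda>x. x $ i * K x) x = x $ i * partials [i] K x + partials [i] (\<lambda>x. x $ i) x * K x"
      by (intro partials_mult smooth_differentiable smooth_coord sK)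
    also have "partials [i] (\<lambda>x. x $ i) x = 1"
      using partials_eqI[OF bounded_linear_imp_has_derivative[OF bounded_linear_vec_nth], of i i x] by simp
    also have "partials [i] K x = 2 * (- b) * x $ i * K' x"
      unfolding K_def K'_def by (rule partials_regularized_power[OF e])
    finally show ?thesis by (simp add: power2_eq_square algebra_simps)
  qed
  have tf1: "test_function (\<lambda>x. partials [i] g x * (x $ i * K x))" for i
    by (rule test_function_mult[OF test_function_partials[OF g] sxK])
  have tf2: "test_function (\<lambda>x. g x * partials [i] (\<lambda>x. x $ i * K x) x)" for i
    by (rule test_function_mult[OF g smooth_partials[OF sxK]])
  have "(LINT x|lborel. K x * (- radial_deriv g x)) = (LINT x|lborel. (\<Sum>i\<in>UNIV. - (partials [i] g x * (x $ i * K x))))"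
    by (intro arg_cong[where f = "lebesgue_integral lborel"] ext)
       (simp add: radial_deriv_def sum_distrib_left sum_negf mult_ac del: partials.simps)
  also have "\<dots> = (\<Sum>i\<in>UNIV. LINT x|lborel. - (partials [i] g x * (x $ i * K x)))"
    by (rule Bochner_Integration.integral_sum) (intro integrable_minus integrable_test_function tf1)
  also have "\<dots> = (\<Sum>i\<in>UNIV. LINT x|lborel. g x * partials [i] (\<lambda>x. x $ i * K x) x)"
    by (rule sum.cong[OF refl]) (simp add: integration_by_parts_partial[OF g sxK] del: partials.simps)
  also have "\<dots> = (LINT x|lborel. (\<Sum>i\<in>UNIV. g x * partials [i] (\<lambda>x. x $ i * K x) x))"
    by (rule Bochner_Integration.integral_sum[symmetric]) (intro integrable_test_function tf2)
  also have "\<dots> = (LINT x|lborel. ((real CARD('n) - 2 * b) * K x + 2 * b * (e * K' x)) * g x)"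
  proof (intro arg_cong[where f = "lebesgue_integral lborel"] ext)
    fix x :: "real^'n"
    have s: "(\<Sum>i\<in>UNIV. (x $ i)\<^sup>2) = (norm x)\<^sup>2"
      by (simp add: norm_vec_def L2_set_def sum_nonneg)
    have p: "(norm x)\<^sup>2 + e > 0" using e by (simp add: add_nonneg_pos)
    have KK: "K x = ((norm x)\<^sup>2 + e) * K' x"
      unfolding K_def K'_def using p by (simp add: powr_diff)
    have "(\<Sum>i\<in>UNIV. g x * partials [i] (\<lambda>x. x $ i * K x) x) = g x * (real CARD('n) * K x - 2 * b * (norm x)\<^sup>2 * K' x)"
      unfolding pK sum_distrib_left[symmetric] sum_subtractf s[symmetric] by (simp add: sum_distrib_left sum_distrib_right)
    also have "\<dots> = ((real CARD('n) - 2 * b) * K x + 2 * b * (e * K' x)) * g x"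
      unfolding KK by (simp add: algebra_simps)
    finally show "(\<Sum>i\<in>UNIV. g x * partials [i] (\<lambda>x. x $ i * K x) x) = ((real CARD('n) - 2 * b) * K x + 2 * b * (e * K' x)) * g x" .
  qed
  finally show ?thesis by (simp add: K_def K'_def)
qed

text \<open>One integration by parts pairs the gradient of g with that of the kernel, which points
  along x and hence yields the Euler operator.\<close>

lemma regularized_laplacian:
  fixes g :: "real^'n::finite \<Rightarrow> real"
  assumes g: "test_function g" and e: "e > 0"
  shows "(LINT x|lborel. ((norm x)\<^sup>2 + e) powr a * neg_lap g x) =
    2 * a * (LINT x|lborel. ((norm x)\<^sup>2 + e) powr (a - 1) * radial_deriv g x)"
proof -
  define K where "K x = ((norm x)\<^sup>2 + e) powr a" for x :: "real^'n"
  define K' where "K' x = ((norm x)\<^sup>2 + e) powr (a - 1)" for x :: "real^'n"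
  have sK: "smooth K" unfolding K_def by (rule smooth_regularized_power[OF e])
  have pK: "partials [i] K x = 2 * a * x $ i * K' x" for i x
    unfolding K_def K'_def by (rule partials_regularized_power[OF e])
  have tf1: "test_function (\<lambda>x. partials [i] (partials [i] g) x * K x)" for i
    by (intro test_function_mult sK) (intro test_function_partials g)
  have tf2: "test_function (\<lambda>x. partials [i] g x * partials [i] K x)" for i
    by (rule test_function_mult[OF test_function_partials[OF g] smooth_partials[OF sK]])
  have "(LINT x|lborel. K x * neg_lap g x) = (LINT x|lborel. (\<Sum>i\<in>UNIV. - (partials [i] (partials [i] g) x * K x)))"
    by (intro arg_cong[where f = "lebesgue_integral lborel"] ext)
       (simp add: neg_lap_def sum_distrib_left sum_negf mult_ac)
  also have "\<dots> = (\<Sum>i\<in>UNIV. LINT x|lborel. - (partials [i] (partials [i] g) x * K x))"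
    by (rule Bochner_Integration.integral_sum) (intro integrable_minus integrable_test_function tf1)
  also have "\<dots> = (\<Sum>i\<in>UNIV. LINT x|lborel. partials [i] g x * partials [i] K x)"
    by (rule sum.cong[OF refl]) (simp add: integration_by_parts_partial[OF test_function_partials[OF g] sK] del: partials.simps)
  also have "\<dots> = (LINT x|lborel. (\<Sum>i\<in>UNIV. partials [i] g x * partials [i] K x))"
    by (rule Bochner_Integration.integral_sum[symmetric]) (intro integrable_test_function tf2)
  also have "\<dots> = (LINT x|lborel. 2 * a * (K' x * radial_deriv g x))"
    unfolding pK
    by (intro arg_cong[where f = "lebesgue_integral lborel"] ext)
       (simp add: radial_deriv_def sum_distrib_left mult_ac del: partials.simps)
  also have "\<dots> = 2 * a * (LINT x|lborel. K' x * radial_deriv g x)" by simp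
  finally show ?thesis by (simp add: K_def K'_def)
qed

lemma inverse_Suc_pos: "0 < 1 / real (Suc m)"
  by simp

lemma LIMSEQ_inverse_Suc_add: "(\<lambda>m. c + 1 / real (Suc m)) \<longlonglongrightarrow> c"
  using tendsto_add[OF tendsto_const[of c] LIMSEQ_inverse_real_of_nat] by (simp add: divide_inverse)

lemma norm_powr_minus_double: "norm x powr (- (2 * b)) = ((norm x)\<^sup>2) powr (- b)"
proof -
  have "norm x powr (- (2 * b)) = (norm x powr 2) powr (- b)" unfolding powr_powr by simp
  then show ?thesis by simp
qed

lemma regularized_power_le:
  assumes "x \<noteq> 0" "e > 0" "b \<ge> 0"
  shows "((norm x)\<^sup>2 + e) powr (- b) \<le> norm x powr (- (2 * b))"
  using assms by (simp add: norm_powr_minus_double powr_mono2')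

lemma regularized_integral_tendsto:
  fixes p :: "real^'n::finite \<Rightarrow> real"
  assumes b: "b \<ge> 0" and p[measurable]: "p \<in> borel_measurable borel"
    and i: "integrable lborel (\<lambda>x. norm x powr (- (2 * b)) * p x)"
  shows "(\<lambda>m. LINT x|lborel. ((norm x)\<^sup>2 + 1 / real (Suc m)) powr (- b) * p x) \<longlonglongrightarrow>
    (LINT x|lborel. norm x powr (- (2 * b)) * p x)"
proof (rule integral_dominated_convergence)
  show "integrable lborel (\<lambda>x. norm (norm x powr (- (2 * b)) * p x))" using i by (rule integrable_norm)
  show "AE x in lborel. (\<lambda>m. ((norm x)\<^sup>2 + 1 / real (Suc m)) powr (- b) * p x) \<longlonglongrightarrow> norm x powr (- (2 * b)) * p x"
    using AE_lborel_singleton[of 0]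
  proof eventually_elim
    case (elim x)
    show ?case unfolding norm_powr_minus_double
      by (intro tendsto_mult tendsto_const tendsto_powr LIMSEQ_inverse_Suc_add) (use elim in auto)
  qed
  show "AE x in lborel. norm (((norm x)\<^sup>2 + 1 / real (Suc m)) powr (- b) * p x) \<le> norm (norm x powr (- (2 * b)) * p x)" for m
    using AE_lborel_singleton[of 0]
  proof eventually_elim
    case (elim x)
    then show ?case
      using mult_right_mono[OF regularized_power_le[OF elim _ b, of "1 / real (Suc m)"], of "\<bar>p x\<bar>"]
      by (simp add: abs_mult)
  qed
qed measurable

text \<open>In the limit the divergence of x |x|^(a-n) is a |x|^(a-n), with no mass at the origin
  because a > 0.\<close>

lemma radial_deriv_riesz:
  fixes g :: "real^'n::finite \<Rightarrow> real"
  assumes g: "test_function g" and a: "a > 0" "a \<le> real CARD('n)"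
  shows "(LINT x|lborel. norm x powr (a - real CARD('n)) * (- radial_deriv g x)) =
    a * (LINT x|lborel. norm x powr (a - real CARD('n)) * g x)"
proof -
  define b where "b = (real CARD('n) - a) / 2"
  have b: "b \<ge> 0" "- (2 * b) = a - real CARD('n)" "real CARD('n) - 2 * b = a" using a by (auto simp: b_def field_simps)
  note [measurable] = test_function_borel[OF g] test_function_borel[OF test_function_radial_deriv[OF g]]
  have ig: "integrable lborel (\<lambda>x. norm x powr (- (2 * b)) * g x)"
    unfolding b by (rule integrable_riesz_test[OF g a(1)])
  have ir: "integrable lborel (\<lambda>x. norm x powr (- (2 * b)) * (- radial_deriv g x))"
    unfolding b using integrable_riesz_radial_deriv[OF g, of a] a by simp
  have L: "(\<lambda>m. LINT x|lborel. ((norm x)\<^sup>2 + 1 / real (Suc m)) powr (- b) * (- radial_deriv g x)) \<longlonglongrightarrow>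
    (LINT x|lborel. norm x powr (- (2 * b)) * (- radial_deriv g x))"
    by (rule regularized_integral_tendsto[OF b(1) _ ir]) simp
  have "(\<lambda>m. LINT x|lborel. (a * ((norm x)\<^sup>2 + 1 / real (Suc m)) powr (- b)
       + 2 * b * (1 / real (Suc m) * ((norm x)\<^sup>2 + 1 / real (Suc m)) powr (- b - 1))) * g x) \<longlonglongrightarrow>
    (LINT x|lborel. (a * norm x powr (- (2 * b)) + 2 * b * 0) * g x)"
  proof (rule integral_dominated_convergence)
    show "integrable lborel (\<lambda>x. (a + 2 * b) * norm (norm x powr (- (2 * b)) * g x))"
      by (intro integrable_mult_right integrable_norm ig)
    show "AE x in lborel. (\<lambda>m. (a * ((norm x)\<^sup>2 + 1 / real (Suc m)) powr (- b)
       + 2 * b * (1 / real (Suc m) * ((norm x)\<^sup>2 + 1 / real (Suc m)) powr (- b - 1))) * g x) \<longlonglongrightarrow>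
      (a * norm x powr (- (2 * b)) + 2 * b * 0) * g x"
      using AE_lborel_singleton[of 0]
    proof eventually_elim
      case (elim x)
      have z: "(\<lambda>m. 1 / real (Suc m) * ((norm x)\<^sup>2 + 1 / real (Suc m)) powr (- b - 1)) \<longlonglongrightarrow> 0 * ((norm x)\<^sup>2) powr (- b - 1)"
        by (intro tendsto_mult tendsto_powr tendsto_const LIMSEQ_inverse_Suc_add
              LIMSEQ_inverse_Suc_add[of 0, simplified add_0]) (use elim in auto)
      show ?case unfolding norm_powr_minus_double
        by (intro tendsto_mult tendsto_add tendsto_const tendsto_powr LIMSEQ_inverse_Suc_add)
           (use elim z in auto)
    qed
    show "AE x in lborel. norm ((a * ((norm x)\<^sup>2 + 1 / real (Suc m)) powr (- b)
       + 2 * b * (1 / real (Suc m) * ((norm x)\<^sup>2 + 1 / real (Suc m)) powr (- b - 1))) * g x)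
      \<le> (a + 2 * b) * norm (norm x powr (- (2 * b)) * g x)" for m
      using AE_lborel_singleton[of 0]
    proof eventually_elim
      case (elim x)
      define e where "e = 1 / real (Suc m)"
      define k where "k = ((norm x)\<^sup>2 + e) powr (- b)"
      define k' where "k' = e * ((norm x)\<^sup>2 + e) powr (- b - 1)"
      define K where "K = norm x powr (- (2 * b))"
      have e: "e > 0" by (simp add: e_def)
      have p: "(norm x)\<^sup>2 + e > 0" using e by (simp add: add_nonneg_pos)
      have k: "0 \<le> k" "k \<le> K" unfolding k_def K_def using regularized_power_le[OF elim e b(1)] by auto
      \<comment> \<open>The remainder is the kernel times e / (|x|^2 + e) \<le> 1, so one majorant
        serves for both terms.\<close>
      have kk: "k' = k * (e / ((norm x)\<^sup>2 + e))" unfolding k'_def k_def using p by (simp add: powr_diff)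
      have "e / ((norm x)\<^sup>2 + e) \<le> 1" "0 \<le> e / ((norm x)\<^sup>2 + e)" using p e by auto
      then have k': "0 \<le> k'" "k' \<le> K" unfolding kk
        using k mult_nonneg_nonneg[of k "e / ((norm x)\<^sup>2 + e)"] mult_left_le[of "e / ((norm x)\<^sup>2 + e)" k] by linarith+
      have "\<bar>a * k + 2 * b * k'\<bar> \<le> (a + 2 * b) * K"
        using k k' a b(1) by (simp add: distrib_right add_mono mult_left_mono)
      then have le: "\<bar>a * k + 2 * b * k'\<bar> * \<bar>g x\<bar> \<le> (a + 2 * b) * K * \<bar>g x\<bar>" by (rule mult_right_mono) simp
      have K0: "0 \<le> K" by (simp add: K_def)
      show ?case unfolding e_def[symmetric] k_def[symmetric] k'_def[symmetric] K_def[symmetric]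
        using le by (simp add: abs_mult mult.assoc abs_of_nonneg[OF K0])
    qed
  qed measurable
  with L have "(LINT x|lborel. norm x powr (- (2 * b)) * (- radial_deriv g x)) = (LINT x|lborel. (a * norm x powr (- (2 * b)) + 2 * b * 0) * g x)"
    unfolding regularized_divergence[OF g inverse_Suc_pos] b(3) by (rule LIMSEQ_unique)
  then show ?thesis unfolding b by (simp add: mult.assoc)
qed


lemma integral_lborel_scale:
  fixes f :: "'a::euclidean_space \<Rightarrow> real"
  assumes [measurable]: "f \<in> borel_measurable borel" and c: "c \<noteq> 0"
  shows "(LINT x|lborel. f x) = \<bar>c\<bar> ^ DIM('a) * (LINT x|lborel. f (c *\<^sub>R x))"
  by (subst lborel_affine[OF c, of 0], subst integral_density, simp, simp, simp, subst integral_distr) auto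

lemma poisson_kernel_integral:
  "integrable lborel (\<lambda>x :: real^'n::finite. real CARD('n) * (1 + (norm x)\<^sup>2) powr (- real CARD('n) / 2 - 1))"
  "(LINT x|lborel. real CARD('n) * (1 + (norm (x :: real^'n::finite))\<^sup>2) powr (- real CARD('n) / 2 - 1))
    = real CARD('n) * omega TYPE('n)"
proof -
  have h: "has_bochner_integral lborel (\<lambda>x :: real^'n::finite. real CARD('n) * (1 + (norm x)\<^sup>2) powr (- real CARD('n) / 2 - 1))
    (real CARD('n) * omega TYPE('n))"
    by (rule has_bochner_integral_nn_integral[OF _ _ _ nn_integral_poisson_kernel])
       (use omega_pos[where 'n='n] in auto)
  from h show "integrable lborel (\<lambda>x :: real^'n::finite. real CARD('n) * (1 + (norm x)\<^sup>2) powr (- real CARD('n) / 2 - 1))"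
    by (simp add: has_bochner_integral_iff)
  from h show "(LINT x|lborel. real CARD('n) * (1 + (norm (x :: real^'n::finite))\<^sup>2) powr (- real CARD('n) / 2 - 1))
    = real CARD('n) * omega TYPE('n)"
    by (simp add: has_bochner_integral_iff)
qed

text \<open>Under x = sqrt e y all powers of e cancel and the kernel e (|x|^2 + e)^(-n/2-1) becomes
  one fixed profile. With the factor n it is an approximate identity of mass n omega, by
  \<open>poisson_kernel_integral\<close>.\<close>

lemma poisson_approximation:
  fixes g :: "real^'n::finite \<Rightarrow> real"
  assumes g: "test_function g"
  shows "(\<lambda>m. LINT x|lborel. real CARD('n) * (1 / real (Suc m) * ((norm x)\<^sup>2 + 1 / real (Suc m)) powr (- real CARD('n) / 2 - 1)) * g x)
    \<longlonglongrightarrow> real CARD('n) * omega TYPE('n) * g 0"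
proof -
  note [measurable] = test_function_borel[OF g]
  define n where "n = real CARD('n)"
  define P where "P x = n * (1 + (norm x)\<^sup>2) powr (- n / 2 - 1)" for x :: "real^'n"
  have [measurable]: "P \<in> borel_measurable borel" unfolding P_def by measurable
  have P: "integrable lborel P" "(LINT x|lborel. P x) = n * omega TYPE('n)" "\<And>x. P x \<ge> 0"
    using poisson_kernel_integral[where 'n='n] by (auto simp: P_def[abs_def] n_def)
  have scale: "(LINT x|lborel. n * (e * ((norm x)\<^sup>2 + e) powr (- n / 2 - 1)) * g x) = (LINT x|lborel. P x * g (sqrt e *\<^sub>R x))"
    if e: "e > 0" for e
  proof -
    have "(LINT x|lborel. n * (e * ((norm x)\<^sup>2 + e) powr (- n / 2 - 1)) * g x)
      = \<bar>sqrt e\<bar> ^ DIM(real^'n) * (LINT x|lborel. n * (e * ((norm (sqrt e *\<^sub>R x))\<^sup>2 + e) powr (- n / 2 - 1)) * g (sqrt e *\<^sub>R x))"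
      using e by (intro integral_lborel_scale) auto
    also have "\<dots> = (LINT x|lborel. \<bar>sqrt e\<bar> ^ DIM(real^'n) * (n * (e * ((norm (sqrt e *\<^sub>R x))\<^sup>2 + e) powr (- n / 2 - 1)) * g (sqrt e *\<^sub>R x)))"
      by simp
    also have "\<dots> = (LINT x|lborel. P x * g (sqrt e *\<^sub>R x))"
    proof (intro arg_cong[where f = "lebesgue_integral lborel"] ext)
      fix x :: "real^'n"
      have p: "1 + (norm x)\<^sup>2 > 0" by (simp add: add_pos_nonneg)
      have "(norm (sqrt e *\<^sub>R x))\<^sup>2 + e = e * (1 + (norm x)\<^sup>2)"
        using e by (simp add: power_mult_distrib algebra_simps)
      then have "e * ((norm (sqrt e *\<^sub>R x))\<^sup>2 + e) powr (- n / 2 - 1) = (e * e powr (- n / 2 - 1)) * (1 + (norm x)\<^sup>2) powr (- n / 2 - 1)"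
        using e p by (simp add: powr_mult)
      also have "e * e powr (- n / 2 - 1) = e powr (- n / 2)"
        using e by (simp add: powr_diff)
      finally have 1: "e * ((norm (sqrt e *\<^sub>R x))\<^sup>2 + e) powr (- n / 2 - 1) = e powr (- n / 2) * (1 + (norm x)\<^sup>2) powr (- n / 2 - 1)" .
      have 2: "\<bar>sqrt e\<bar> ^ DIM(real^'n) = e powr (n / 2)"
      proof -
        have "\<bar>sqrt e\<bar> ^ DIM(real^'n) = (e powr (1 / 2)) powr n"
          using e by (simp add: n_def powr_half_sqrt powr_realpow)
        then show ?thesis by (simp only: powr_powr) simp
      qed
      have 3: "e powr (n / 2) * e powr (- n / 2) = 1" using e by (simp add: powr_add[symmetric])
      show "\<bar>sqrt e\<bar> ^ DIM(real^'n) * (n * (e * ((norm (sqrt e *\<^sub>R x))\<^sup>2 + e) powr (- n / 2 - 1)) * g (sqrt e *\<^sub>R x)) = P x * g (sqrt e *\<^sub>R x)"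
        unfolding 1 2 P_def using 3 by (simp add: algebra_simps)
    qed
    finally show ?thesis .
  qed
  obtain B where B: "\<And>x. \<bar>g x\<bar> \<le> B" using test_function_bounded[OF g] by blast
  have "(\<lambda>m. LINT x|lborel. P x * g (sqrt (1 / real (Suc m)) *\<^sub>R x)) \<longlonglongrightarrow> (LINT x|lborel. P x * g 0)"
  proof (rule integral_dominated_convergence)
    show "integrable lborel (\<lambda>x. B * P x)" using P by simp
    show "AE x in lborel. (\<lambda>m. P x * g (sqrt (1 / real (Suc m)) *\<^sub>R x)) \<longlonglongrightarrow> P x * g 0"
    proof (intro AE_I2 tendsto_mult tendsto_const)
      fix x :: "real^'n"
      have c: "isCont g 0" using smooth_continuous[OF test_function_smooth[OF g], of UNIV]
        by (simp add: continuous_on_eq_continuous_at)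
      have "(\<lambda>m. sqrt (1 / real (Suc m)) *\<^sub>R x) \<longlonglongrightarrow> sqrt 0 *\<^sub>R x"
        by (intro tendsto_scaleR tendsto_real_sqrt tendsto_const LIMSEQ_inverse_Suc_add[of 0, simplified add_0])
      then show "(\<lambda>m. g (sqrt (1 / real (Suc m)) *\<^sub>R x)) \<longlonglongrightarrow> g 0"
        using isCont_tendsto_compose[OF c] by simp
    qed
    show "AE x in lborel. norm (P x * g (sqrt (1 / real (Suc m)) *\<^sub>R x)) \<le> B * P x" for m
      using mult_right_mono[OF B P(3)] P(3) by (intro AE_I2) (simp add: abs_mult mult.commute)
  qed measurable
  then show ?thesis
    using P(2) unfolding n_def[symmetric] scale[OF inverse_Suc_pos] by simp
qed

text \<open>Here b = n / 2, where the main term of the divergence has the coefficient 0 and only the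
  concentrating remainder survives.\<close>

lemma radial_deriv_fundamental:
  fixes g :: "real^'n::finite \<Rightarrow> real"
  assumes g: "test_function g"
  shows "(LINT x|lborel. norm x powr (- real CARD('n)) * (- radial_deriv g x)) = real CARD('n) * omega TYPE('n) * g 0"
proof -
  note [measurable] = test_function_borel[OF g] test_function_borel[OF test_function_radial_deriv[OF g]]
  define b where "b = real CARD('n) / 2"
  have b: "b \<ge> 0" "- (2 * b) = 0 - real CARD('n)" "real CARD('n) - 2 * b = 0" by (auto simp: b_def)
  have "(\<lambda>m. LINT x|lborel. ((norm x)\<^sup>2 + 1 / real (Suc m)) powr (- b) * (- radial_deriv g x)) \<longlonglongrightarrow>
    (LINT x|lborel. norm x powr (- (2 * b)) * (- radial_deriv g x))"
  proof (rule regularized_integral_tendsto[OF b(1)])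
    show "integrable lborel (\<lambda>x. norm x powr (- (2 * b)) * (- radial_deriv g x))"
      unfolding b using integrable_riesz_radial_deriv[OF g, of 0] by simp
  qed simp
  moreover have "(LINT x|lborel. ((norm x)\<^sup>2 + 1 / real (Suc m)) powr (- b) * (- radial_deriv g x))
    = (LINT x|lborel. real CARD('n) * (1 / real (Suc m) * ((norm x)\<^sup>2 + 1 / real (Suc m)) powr (- real CARD('n) / 2 - 1)) * g x)" for m
    unfolding regularized_divergence[OF g inverse_Suc_pos] b(3) by (simp add: b_def)
  ultimately have "(LINT x|lborel. norm x powr (- (2 * b)) * (- radial_deriv g x)) = real CARD('n) * omega TYPE('n) * g 0"
    using poisson_approximation[OF g] LIMSEQ_unique by simp
  then show ?thesis by (simp add: b_def)
qed

text \<open>Trades a Laplacian for an Euler operator and lowers the order by 2. The case a = 2 is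
  included because the Euler operator can be paired with |x|^(-n).\<close>

lemma laplacian_riesz:
  fixes g :: "real^'n::finite \<Rightarrow> real"
  assumes g: "test_function g" and a: "a \<ge> 2" "a \<le> real CARD('n)"
  shows "(LINT x|lborel. norm x powr (a - real CARD('n)) * neg_lap g x) =
    (real CARD('n) - a) * (LINT x|lborel. norm x powr (a - 2 - real CARD('n)) * (- radial_deriv g x))"
proof -
  note [measurable] = test_function_borel[OF test_function_neg_lap[OF g]] test_function_borel[OF test_function_radial_deriv[OF g]]
  define b where "b = (real CARD('n) - a) / 2"
  have b: "b \<ge> 0" "- (2 * b) = a - real CARD('n)" "- (2 * (b + 1)) = a - 2 - real CARD('n)" "- b - 1 = - (b + 1)"
    using a by (auto simp: b_def field_simps)
  have "(\<lambda>m. LINT x|lborel. ((norm x)\<^sup>2 + 1 / real (Suc m)) powr (- b) * neg_lap g x) \<longlonglongrightarrow>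
    (LINT x|lborel. norm x powr (- (2 * b)) * neg_lap g x)"
  proof (rule regularized_integral_tendsto[OF b(1)])
    show "integrable lborel (\<lambda>x. norm x powr (- (2 * b)) * neg_lap g x)"
      unfolding b using integrable_riesz_test[OF test_function_neg_lap[OF g], of a] a by simp
  qed simp
  moreover have "(\<lambda>m. LINT x|lborel. ((norm x)\<^sup>2 + 1 / real (Suc m)) powr (- (b + 1)) * radial_deriv g x) \<longlonglongrightarrow>
    (LINT x|lborel. norm x powr (- (2 * (b + 1))) * radial_deriv g x)"
  proof (rule regularized_integral_tendsto)
    show "integrable lborel (\<lambda>x. norm x powr (- (2 * (b + 1))) * radial_deriv g x)"
      unfolding b using integrable_riesz_radial_deriv[OF g, of "a - 2"] a by simp
  qed (use b in simp_all)
  ultimately have "(LINT x|lborel. norm x powr (- (2 * b)) * neg_lap g x)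
    = 2 * (- b) * (LINT x|lborel. norm x powr (- (2 * (b + 1))) * radial_deriv g x)"
    unfolding regularized_laplacian[OF g inverse_Suc_pos] b(4)
    by (intro LIMSEQ_unique[OF _ tendsto_mult[OF tendsto_const]])
  then show ?thesis unfolding b by (simp add: b_def)
qed

section \<open>Recursions for the constants and the representation formulas\<close>

lemma unit_ball_measure_Gamma:
  "omega TYPE('n::finite) = pi powr (real CARD('n) / 2) / Gamma (real CARD('n) / 2 + 1)"
  by (simp add: omega_eq unit_ball_vol_def)

lemma riesz_gamma_2:
  assumes "CARD('n::finite) > 2"
  shows "riesz_gamma CARD('n) 2 = (real CARD('n) - 2) * (real CARD('n) * omega TYPE('n))"
proof -
  define h where "h = real CARD('n) / 2"
  have h: "h > 1" using assms by (simp add: h_def)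
  have "Gamma (h + 1) = h * Gamma h" using h by (intro Gamma_plus1) (auto elim!: nonpos_Ints_cases)
  also have "Gamma h = (h - 1) * Gamma (h - 1)"
    using Gamma_plus1[of "h - 1"] nonpos_Ints_nonpos[of "h - 1"] h by auto
  finally have G: "Gamma (h + 1) = h * ((h - 1) * Gamma (h - 1))" .
  have pos: "Gamma (h - 1) > 0" using h by (intro Gamma_real_pos) simp
  have n: "real CARD('n) = 2 * h" by (simp add: h_def)
  have "riesz_gamma CARD('n) 2 = pi powr h * 4 / Gamma (h - 1)"
    by (simp add: riesz_gamma_def n diff_divide_distrib)
  also have "\<dots> = (2 * h - 2) * (2 * h * (pi powr h / (h * ((h - 1) * Gamma (h - 1)))))"
  proof -
    have "P * 4 / G = 2 * q * (2 * h * (P / (h * (q * G))))" if "G > 0" "q > 0" for P G q :: real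
      using that h by (simp add: field_simps)
    from this[OF pos, of "h - 1" "pi powr h"] show ?thesis using h by (simp add: right_diff_distrib)
  qed
  finally show ?thesis unfolding unit_ball_measure_Gamma n G[symmetric] by simp
qed

text \<open>The factor is the product of those in \<open>laplacian_riesz\<close> at order a + 2 and
  in \<open>radial_deriv_riesz\<close> at order a.\<close>

lemma riesz_gamma_add_2:
  assumes "0 < a" "a + 2 < real n"
  shows "riesz_gamma n (a + 2) = (real n - a - 2) * (a * riesz_gamma n a)"
proof -
  define q where "q = (real n - a - 2) / 2"
  have q: "q > 0" "(real n - a) / 2 = q + 1" "(real n - (a + 2)) / 2 = q" "real n - a - 2 = 2 * q"
    using assms by (auto simp: q_def field_simps)
  have "Gamma (a / 2 + 1) = a / 2 * Gamma (a / 2)" using assms by (intro Gamma_plus1) (auto elim!: nonpos_Ints_cases)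
  moreover have "Gamma (q + 1) = q * Gamma q" using q by (intro Gamma_plus1) (auto elim!: nonpos_Ints_cases)
  moreover have "(2::real) powr (a + 2) = 4 * 2 powr a" by (simp add: powr_add)
  moreover have "(a + 2) / 2 = a / 2 + 1" by simp
  ultimately have 1: "riesz_gamma n (a + 2) = pi powr (real n / 2) * (4 * 2 powr a) * (a / 2 * Gamma (a / 2)) / Gamma q"
    and 2: "riesz_gamma n a = pi powr (real n / 2) * 2 powr a * Gamma (a / 2) / (q * Gamma q)"
    unfolding riesz_gamma_def q by metis+
  have G: "Gamma q > 0" using q by (intro Gamma_real_pos)
  have "P * (4 * T) * (a / 2 * A) / G = 2 * q * (a * (P * T * A / (q * G)))" if "G > 0" for P T A G :: real
    using that q(1) by (simp add: field_simps)
  from this[OF G] show ?thesis unfolding 1 2 q(4) .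
qed

text \<open>Each Laplacian is removed by \<open>laplacian_riesz\<close> followed by
  \<open>radial_deriv_riesz\<close>. For the last one the order drops to 0, and
  \<open>radial_deriv_fundamental\<close> takes the place of the second lemma.\<close>

theorem riesz_representation_even:
  fixes g :: "real^'n::finite \<Rightarrow> real"
  assumes g: "test_function g" and m: "m \<ge> 1" "2 * m < CARD('n)"
  shows "(LINT x|lborel. norm x powr (real (2 * m) - real CARD('n)) * (neg_lap ^^ m) g x) = riesz_gamma CARD('n) (real (2 * m)) * g 0"
  using m
proof (induction m)
  case (Suc m)
  define h where "h = (neg_lap ^^ m) g"
  have h: "test_function h" unfolding h_def by (rule test_function_neg_lap_funpow[OF g])
  have "(LINT x|lborel. norm x powr (real (2 * Suc m) - real CARD('n)) * (neg_lap ^^ Suc m) g x)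
    = (LINT x|lborel. norm x powr (real (2 * Suc m) - real CARD('n)) * neg_lap h x)"
    by (simp add: h_def)
  also have "\<dots> = (real CARD('n) - real (2 * Suc m)) * (LINT x|lborel. norm x powr (real (2 * Suc m) - 2 - real CARD('n)) * (- radial_deriv h x))"
    using Suc.prems by (intro laplacian_riesz h) auto
  also have "real (2 * Suc m) - 2 - real CARD('n) = real (2 * m) - real CARD('n)" by simp
  finally have *: "(LINT x|lborel. norm x powr (real (2 * Suc m) - real CARD('n)) * (neg_lap ^^ Suc m) g x)
    = (real CARD('n) - real (2 * Suc m)) * (LINT x|lborel. norm x powr (real (2 * m) - real CARD('n)) * (- radial_deriv h x))" .
  show ?case
  proof (cases "m = 0")
    case True
    have X: "(LINT x|lborel. norm x powr (real (2 * m) - real CARD('n)) * (- radial_deriv h x)) = real CARD('n) * omega TYPE('n) * h 0"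
      using radial_deriv_fundamental[OF h] True by simp
    show ?thesis using *[unfolded X] riesz_gamma_2[where 'n='n] Suc.prems True
      by (simp add: h_def)
  next
    case False
    have "(LINT x|lborel. norm x powr (real (2 * m) - real CARD('n)) * (- radial_deriv h x)) = real (2 * m) * (riesz_gamma CARD('n) (real (2 * m)) * g 0)"
      using radial_deriv_riesz[OF h, of "real (2 * m)"] Suc False by (simp add: h_def)
    note X = this
    have R: "riesz_gamma CARD('n) (real (2 * m) + 2) = (real CARD('n) - real (2 * m) - 2) * (real (2 * m) * riesz_gamma CARD('n) (real (2 * m)))"
      using Suc.prems False by (intro riesz_gamma_add_2) auto
    have S: "real (2 * Suc m) = real (2 * m) + 2" by simp
    show ?thesis using * unfolding X S R by (simp only: diff_diff_eq mult.assoc)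
  qed
qed simp

text \<open>The last Euler operator is kept, so that the gradient of the iterated Laplacian remains
  in the integrand. For m > 0 its removal contributes the factor 2 m, by which
  \<open>riesz_gamma_tilde\<close> differs from \<open>riesz_gamma\<close>.\<close>

theorem riesz_representation_odd:
  fixes g :: "real^'n::finite \<Rightarrow> real"
  assumes g: "test_function g" and m: "2 * m < CARD('n)"
  shows "(LINT x|lborel. norm x powr (real (2 * m) - real CARD('n)) * (- radial_deriv ((neg_lap ^^ m) g) x))
    = riesz_gamma_tilde TYPE('n) (real (2 * m)) * g 0"
proof (cases "m = 0")
  case True
  then show ?thesis using radial_deriv_fundamental[OF g] by (simp add: riesz_gamma_tilde_def unit_ball_measure_eq)
next
  case False
  then show ?thesis
    using radial_deriv_riesz[OF test_function_neg_lap_funpow[OF g], of "real (2 * m)" m] riesz_representation_even[OF g, of m] m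
    by (simp add: riesz_gamma_tilde_def)
qed

section \<open>Mollification\<close>

definition mollifier :: "real \<Rightarrow> real^'n::finite \<Rightarrow> real" where
  "mollifier e x = exp_cutoff 1 (e\<^sup>2 - (norm x)\<^sup>2) / (LINT y|lborel. exp_cutoff 1 (e\<^sup>2 - (norm (y::real^'n))\<^sup>2))"

lemma test_function_bump:
  assumes "e > 0"
  shows "test_function (\<lambda>x :: real^'n::finite. exp_cutoff 1 (e\<^sup>2 - (norm x)\<^sup>2))"
proof (rule test_functionI[where r = e])
  have "smooth_real (\<lambda>t. exp_cutoff 1 ((- 1) * t + e\<^sup>2))"
    by (rule smooth_real_affine[OF smooth_real_exp_cutoff]) simp
  then obtain F where F: "F 0 = (\<lambda>t. exp_cutoff 1 ((- 1) * t + e\<^sup>2))" "\<And>j t. (F j has_real_derivative F (Suc j) t) (at t)"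
    unfolding smooth_real_def by metis
  from smooth_radial[of F 0, OF F(2)] show "smooth (\<lambda>x :: real^'n. exp_cutoff 1 (e\<^sup>2 - (norm x)\<^sup>2))"
    by (simp add: F(1))
  fix x :: "real^'n" assume "norm x > e"
  then have "e\<^sup>2 < (norm x)\<^sup>2" using assms by (intro power_strict_mono) auto
  then show "exp_cutoff 1 (e\<^sup>2 - (norm x)\<^sup>2) = 0" by (simp add: exp_cutoff_def)
qed

lemma bump_mass_pos:
  assumes "e > 0"
  shows "(LINT x|lborel. exp_cutoff 1 (e\<^sup>2 - (norm (x::real^'n::finite))\<^sup>2)) > 0"
proof -
  define g where "g = (\<lambda>x :: real^'n. exp_cutoff 1 (e\<^sup>2 - (norm x)\<^sup>2))"
  have tg: "test_function g" unfolding g_def by (rule test_function_bump[OF assms])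
  have i: "integrable lborel g" by (rule integrable_test_function[OF tg])
  have nn: "g x \<ge> 0" for x by (simp add: g_def)
  have "(LINT x|lborel. g x) \<noteq> 0"
  proof
    assume "(LINT x|lborel. g x) = 0"
    then have "AE x in lborel. g x = 0"
      using integral_nonneg_eq_0_iff_AE[OF i] nn by simp
    moreover have "g x \<noteq> 0" if "x \<in> ball 0 e" for x
    proof -
      have "(norm x)\<^sup>2 < e\<^sup>2" using that by (intro power_strict_mono) auto
      then show ?thesis by (simp add: g_def exp_cutoff_def)
    qed
    ultimately have "AE x in lborel. x \<notin> ball (0::real^'n) e" by (auto elim: eventually_mono)
    then have "emeasure lborel (ball (0::real^'n) e) = 0"
      using AE_iff_null_sets[of "ball (0::real^'n) e" lborel] by (simp add: null_sets_def)
    then show False using assms omega_pos[where 'n='n] by (simp add: emeasure_lborel_ball)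
  qed
  moreover have "(LINT x|lborel. g x) \<ge> 0" using nn by simp
  ultimately show ?thesis unfolding g_def by linarith
qed

lemma test_function_mollifier: "e > 0 \<Longrightarrow> test_function (mollifier e :: real^'n::finite \<Rightarrow> real)"
  using test_function_cmult[OF test_function_bump[where 'n='n], of e "1 / (LINT y|lborel. exp_cutoff 1 (e\<^sup>2 - (norm (y::real^'n))\<^sup>2))"]
  by (simp add: mollifier_def[abs_def])

lemma mollifier_nonneg: "e > 0 \<Longrightarrow> mollifier e x \<ge> 0"
  using bump_mass_pos[where 'n='a, of e] by (simp add: mollifier_def)

lemma mollifier_borel [measurable]: "mollifier e \<in> borel_measurable borel"
  unfolding mollifier_def exp_cutoff_def by measurable

lemma integral_mollifier: "e > 0 \<Longrightarrow> (LINT x|lborel. mollifier e (x :: real^'n::finite)) = 1"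
  using bump_mass_pos[where 'n='n, of e] by (simp add: mollifier_def)

lemma nn_integral_mollifier: "e > 0 \<Longrightarrow> (\<integral>\<^sup>+x. ennreal (mollifier e (x :: real^'n::finite)) \<partial>lborel) = 1"
  using nn_integral_eq_integral[OF integrable_test_function[OF test_function_mollifier[where 'n='n]], of e]
  by (simp add: mollifier_nonneg integral_mollifier)

text \<open>The mollifier is a decreasing function of the norm, hence a superposition of indicators
  of centred balls of radius at most e. This is the link between mollification and ball
  averages.\<close>

lemma mollifier_superlevel:
  fixes t :: real
  assumes e: "e > 0" and t: "t \<ge> 0"
  obtains r where "0 \<le> r" "r \<le> e" "{x :: real^'n::finite. mollifier e x > t} = ball 0 r"
proof -
  define Z where "Z = (LINT y|lborel. exp_cutoff 1 (e\<^sup>2 - (norm (y::real^'n))\<^sup>2))"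
  have Z: "Z > 0" unfolding Z_def by (rule bump_mass_pos[OF e])
  define c where "c = t * Z"
  have c: "c \<ge> 0" using t Z by (simp add: c_def)
  have m: "mollifier e x > t \<longleftrightarrow> exp_cutoff 1 (e\<^sup>2 - (norm x)\<^sup>2) > c" for x :: "real^'n"
    using Z by (simp add: mollifier_def Z_def[symmetric] c_def field_simps)
  \<comment> \<open>The equation exp (-1 / (e^2 - s)) = c is solved by s = e^2 + 1 / ln c. For c = 0
    the whole ball is obtained, for c \<ge> 1 the empty set.\<close>
  define q where "q = (if c = 0 then e\<^sup>2 else if c \<ge> 1 then 0 else e\<^sup>2 + 1 / ln c)"
  have k: "exp_cutoff 1 (e\<^sup>2 - s) > c \<longleftrightarrow> s < q" if s: "s \<ge> 0" for s
  proof -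
    consider "c = 0" | "c \<ge> 1" | "0 < c" "c < 1" using c by linarith
    then show ?thesis
    proof cases
      case 1
      then show ?thesis by (auto simp: exp_cutoff_def q_def)
    next
      case 2
      then show ?thesis using s exp_cutoff_le_1[of 1 "e\<^sup>2 - s"] by (auto simp: q_def not_less)
    next
      case 3
      have l: "ln c < 0" using 3 by simp
      show ?thesis
      proof (cases "s < e\<^sup>2")
        case True
        have "exp_cutoff 1 (e\<^sup>2 - s) > c \<longleftrightarrow> exp (ln c) < exp (- 1 / (e\<^sup>2 - s))"
          using True 3 by (simp add: exp_cutoff_def)
        also have "\<dots> \<longleftrightarrow> ln c < - 1 / (e\<^sup>2 - s)" by (simp only: exp_less_cancel_iff)
        also have "\<dots> \<longleftrightarrow> s < e\<^sup>2 + 1 / ln c"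
          using True l by (simp add: field_simps)
        finally show ?thesis using 3 by (simp add: q_def)
      next
        case False
        have "1 / ln c < 0" using l by simp
        then have "\<not> s < e\<^sup>2 + 1 / ln c" using False by linarith
        then show ?thesis using False 3 by (simp add: exp_cutoff_def q_def)
      qed
    qed
  qed
  have qe: "q \<le> e\<^sup>2"
    using c by (auto simp: q_def divide_nonpos_neg)
  define r where "r = sqrt (max q 0)"
  have "{x :: real^'n. mollifier e x > t} = ball 0 r"
  proof (intro set_eqI)
    fix x :: "real^'n"
    have "x \<in> ball 0 r \<longleftrightarrow> norm x < r" by simp
    also have "\<dots> \<longleftrightarrow> (norm x)\<^sup>2 < max q 0"
      unfolding r_def by (metis norm_ge_zero real_less_rsqrt real_sqrt_less_iff real_sqrt_abs abs_norm_cancel)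
    also have "\<dots> \<longleftrightarrow> (norm x)\<^sup>2 < q" by (auto simp: less_max_iff_disj not_less[symmetric])
    finally show "x \<in> {x :: real^'n. mollifier e x > t} \<longleftrightarrow> x \<in> ball 0 r" using m k[of "(norm x)\<^sup>2"] by simp
  qed
  moreover have "r \<le> e" "0 \<le> r" unfolding r_def using qe e by (auto intro!: real_le_lsqrt)
  ultimately show ?thesis using that by blast
qed

section \<open>Convolution with test functions\<close>

definition convolution :: "(real^'n::finite \<Rightarrow> real) \<Rightarrow> (real^'n \<Rightarrow> real) \<Rightarrow> real^'n \<Rightarrow> real" where
  "convolution u f x = (LINT y|lebesgue. u y * f (x - y))"

lemma smooth_reflect:
  assumes "smooth f"
  shows "smooth (\<lambda>y. f (c - y))" "partials is (\<lambda>y. f (c - y)) y = (- 1) ^ length is * partials is f (c - y)"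
proof -
  have d: "((\<lambda>y. g (c - y)) has_derivative (\<lambda>h. - (\<Sum>i\<in>UNIV. h $ i * partials [i] g (c - y)))) (at y)"
    if "smooth g" for g y
  proof -
    have "((\<lambda>y. c - y) has_derivative (\<lambda>h. - h)) (at y)" by (auto intro!: derivative_eq_intros)
    from has_derivative_compose[OF this has_derivative_partials[OF smooth_differentiable[OF that]]]
    show ?thesis by (simp add: sum_negf del: partials.simps)
  qed
  have p: "partials [i] (\<lambda>y. g (c - y)) y = - partials [i] g (c - y)" if "smooth g" for g y i
    unfolding partials_eqI[OF d[OF that]]
    by (simp add: axis_def if_distrib[of "\<lambda>a. a * _"] del: partials.simps cong: if_cong)
  show *: "partials is (\<lambda>y. f (c - y)) y = (- 1) ^ length is * partials is f (c - y)" for "is" y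
  proof (induction "is" arbitrary: y)
    case (Cons i js)
    have "partials (i # js) (\<lambda>y. f (c - y)) y = partials [i] (partials js (\<lambda>y. f (c - y))) y" by simp
    also have "partials js (\<lambda>y. f (c - y)) = (\<lambda>y. (- 1) ^ length js * partials js f (c - y))"
      using Cons.IH by (intro ext)
    also have "partials [i] (\<lambda>y. (- 1) ^ length js * partials js f (c - y)) y
       = (- 1) ^ length js * partials [i] (\<lambda>y. partials js f (c - y)) y + partials [i] (\<lambda>y. (- 1) ^ length js) y * partials js f (c - y)"
      using d[OF smooth_partials[OF assms]] by (intro partials_mult) (auto simp: differentiable_def)
    also have "\<dots> = (- 1) ^ length js * (- partials [i] (partials js f) (c - y))"
      by (simp only: partials_const p[OF smooth_partials[OF assms]] mult_zero_left add_0_right)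
    finally show ?case by simp
  qed simp
  show "smooth (\<lambda>y. f (c - y))"
    unfolding smooth_def
  proof (intro allI)
    fix "is" y
    have "partials is (\<lambda>y. f (c - y)) = (\<lambda>y. (- 1) ^ length is * partials is f (c - y))" using * by (intro ext)
    moreover have "(\<lambda>y. partials is f (c - y)) differentiable (at y)"
      using d[OF smooth_partials[OF assms]] unfolding differentiable_def by blast
    ultimately show "partials is (\<lambda>y. f (c - y)) differentiable (at y)" by simp
  qed
qed

lemma test_function_reflect:
  assumes "test_function f"
  shows "test_function (\<lambda>y. f (c - y))"
proof -
  obtain r where r: "\<And>x. norm x > r \<Longrightarrow> f x = 0" using assms test_function_iff by blast
  have "f (c - y) = 0" if "norm y > r + norm c" for y
    using r[of "c - y"] norm_triangle_ineq4[of c "c - y"] that by auto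
  then show ?thesis using test_functionI[OF smooth_reflect(1)[OF test_function_smooth[OF assms]]] by blast
qed

lemma integrable_convolution:
  assumes "locally_integrable u" "test_function f"
  shows "integrable lebesgue (\<lambda>y. u y * f (x - y))"
  by (rule integrable_lebesgue_mult_test[OF assms(1) test_function_reflect[OF assms(2)]])

text \<open>Differentiation under the integral: the uniform first-order expansion of f is integrated
  against |u| over a ball containing all the supports involved.\<close>

lemma has_derivative_convolution:
  fixes f :: "real^'n::finite \<Rightarrow> real"
  assumes u: "locally_integrable u" and f: "test_function f"
  shows "(convolution u f has_derivative (\<lambda>h. \<Sum>i\<in>UNIV. h $ i * convolution u (partials [i] f) x)) (at x)"
  unfolding has_derivative_at_alt
proof (intro conjI allI impI)
  show "bounded_linear (\<lambda>h. \<Sum>i\<in>UNIV. h $ i * convolution u (partials [i] f) x)"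
    by (intro bounded_linear_sum bounded_linear_mult_const bounded_linear_vec_nth)
  fix e :: real assume e: "e > 0"
  obtain r0 where r0: "\<And>x. norm x > r0 \<Longrightarrow> f x = 0" using f test_function_iff by blast
  have "\<exists>r. \<forall>x. norm x > r \<longrightarrow> partials [i] f x = 0" for i
    using test_function_partials[OF f] test_function_iff by blast
  then obtain ri where ri: "\<And>i x. norm x > ri i \<Longrightarrow> partials [i] f x = 0" by metis
  define r where "r = max r0 (Max (range ri))"
  have r: "f y = 0" "partials [i] f y = 0" if "norm y > r" for i y
  proof -
    have "norm y > ri i" using that Max_ge[of "range ri" "ri i"] by (simp add: r_def)
    then show "partials [i] f y = 0" by (rule ri)
    show "f y = 0" using that r0 by (simp add: r_def)
  qed
  \<comment> \<open>If |y| > R, then both x - y and z - y are longer than r for every z at distance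
    less than 1 from x.\<close>
  define R where "R = norm x + r + 1"
  define M where "M = (LINT y|lebesgue. indicator (cball 0 R) y * \<bar>u y\<bar>)"
  have iM: "integrable lebesgue (\<lambda>y. indicator (cball 0 R) y * \<bar>u y\<bar>)"
    using integrable_abs[OF locally_integrable_cball[OF u, of 0 R]] by (simp add: abs_mult)
  have M: "M \<ge> 0" unfolding M_def by simp
  define e' where "e' = e / (M + 1)"
  have e': "e' > 0" using e M by (simp add: e'_def)
  obtain d where d: "d > 0" "\<And>x h. norm h < d \<Longrightarrow>
    \<bar>f (x + h) - f x - (\<Sum>i\<in>UNIV. h $ i * partials [i] f x)\<bar> \<le> e' * norm h"
    by (rule test_function_uniformly_differentiable[OF f e']) (rule that, assumption, blast)
  show "\<exists>d>0. \<forall>y. norm (y - x) < d \<longrightarrow> norm (convolution u f y - convolution u f x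
     - (\<Sum>i\<in>UNIV. (y - x) $ i * convolution u (partials [i] f) x)) \<le> e * norm (y - x)"
  proof (intro exI[of _ "min d 1"] conjI allI impI)
    show "min d 1 > 0" using d by simp
    fix z assume z: "norm (z - x) < min d 1"
    define h where "h = z - x"
    have h: "norm h < d" "norm h < 1" "z = x + h" using z by (auto simp: h_def)
    define q where "q y = f (z - y) - f (x - y) - (\<Sum>i\<in>UNIV. h $ i * partials [i] f (x - y))" for y
    have i1: "integrable lebesgue (\<lambda>y. u y * f (z - y))" "integrable lebesgue (\<lambda>y. u y * f (x - y))"
      by (rule integrable_convolution[OF u f])+
    have i2: "integrable lebesgue (\<lambda>y. h $ i * (u y * partials [i] f (x - y)))" for i
      by (intro integrable_mult_right integrable_convolution[OF u test_function_partials[OF f]])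
    have uq: "u y * q y = u y * f (z - y) - u y * f (x - y) - (\<Sum>i\<in>UNIV. h $ i * (u y * partials [i] f (x - y)))" for y
      by (simp add: q_def right_diff_distrib sum_distrib_left mult_ac del: partials.simps)
    have iq: "integrable lebesgue (\<lambda>y. u y * q y)"
      unfolding uq by (intro Bochner_Integration.integrable_diff Bochner_Integration.integrable_sum i1 i2)
    have "(LINT y|lebesgue. u y * q y) = convolution u f z - convolution u f x
       - (\<Sum>i\<in>UNIV. h $ i * convolution u (partials [i] f) x)"
      unfolding uq convolution_def using i1 i2
      by (simp add: Bochner_Integration.integral_sum Bochner_Integration.integrable_sum del: partials.simps)
    then have "norm (convolution u f z - convolution u f x - (\<Sum>i\<in>UNIV. h $ i * convolution u (partials [i] f) x))
      = \<bar>LINT y|lebesgue. u y * q y\<bar>" by simp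
    also have "\<dots> \<le> (LINT y|lebesgue. e' * norm h * (indicator (cball 0 R) y * \<bar>u y\<bar>))"
    proof (rule integral_abs_bound_integral[OF iq])
      show "integrable lebesgue (\<lambda>y. e' * norm h * (indicator (cball 0 R) y * \<bar>u y\<bar>))"
        by (intro integrable_mult_right iM)
      fix y
      show "\<bar>u y * q y\<bar> \<le> e' * norm h * (indicator (cball 0 R) y * \<bar>u y\<bar>)"
      proof (cases "norm y \<le> R")
        case True
        have "\<bar>q y\<bar> \<le> e' * norm h"
          using d(2)[of h "x - y"] h by (simp add: q_def algebra_simps del: partials.simps)
        then have "\<bar>u y\<bar> * \<bar>q y\<bar> \<le> \<bar>u y\<bar> * (e' * norm h)" by (rule mult_left_mono) simp
        then show ?thesis using True by (simp add: abs_mult mult_ac)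
      next
        case False
        have "norm y \<le> norm x + norm (x - y)" "norm y \<le> norm z + norm (z - y)" "norm z \<le> norm x + norm h"
          using norm_triangle_ineq4[of x "x - y"] norm_triangle_ineq4[of z "z - y"] norm_triangle_ineq[of x h] h by auto
        then have "norm (x - y) > r" "norm (z - y) > r" using False h unfolding R_def by linarith+
        then have "q y = 0" using r by (simp add: q_def del: partials.simps)
        then show ?thesis using e' by simp
      qed
    qed
    also have "\<dots> = e' * norm h * M" by (simp add: M_def)
    also have "\<dots> \<le> e * norm h"
    proof -
      have "e' * M \<le> e' * (M + 1)" using e' by simp
      also have "\<dots> = e" using M by (simp add: e'_def)
      finally have "e' * M \<le> e" .
      from mult_right_mono[OF this, of "norm h"] show ?thesis by (simp add: mult_ac)
    qed
    finally show "norm (convolution u f z - convolution u f x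
     - (\<Sum>i\<in>UNIV. (z - x) $ i * convolution u (partials [i] f) x)) \<le> e * norm (z - x)" unfolding h_def .
  qed
qed

lemma partials_convolution:
  assumes u: "locally_integrable u" and f: "test_function f"
  shows "partials is (convolution u f) = convolution u (partials is f)"
proof (induction "is")
  case (Cons i js)
  show ?case
  proof
    fix x
    have "partials (i # js) (convolution u f) x = partials [i] (convolution u (partials js f)) x"
      using Cons by simp
    also have "\<dots> = convolution u (partials [i] (partials js f)) x"
      unfolding partials_eqI[OF has_derivative_convolution[OF u test_function_partials[OF f]]]
      by (simp add: axis_def if_distrib[of "\<lambda>a. a * _"] del: partials.simps cong: if_cong)
    finally show "partials (i # js) (convolution u f) x = convolution u (partials (i # js) f) x" by simp
  qed
qed simp

lemma smooth_convolution:
  assumes u: "locally_integrable u" and f: "test_function f"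
  shows "smooth (convolution u f)"
  unfolding smooth_def partials_convolution[OF assms]
  using has_derivative_convolution[OF u test_function_partials[OF f]] unfolding differentiable_def by blast

text \<open>y \<mapsto> f (x - y) is itself a test function, and the sign from the reflection
  cancels the sign in the definition of the weak derivative.\<close>

lemma convolution_weak_deriv:
  assumes v: "has_weak_deriv u is v" and f: "test_function f"
  shows "partials is (convolution u f) x = convolution v f x"
proof -
  have u: "locally_integrable u" using v by (simp add: has_weak_deriv_def)
  have "(LINT y|lebesgue. u y * partials is (\<lambda>y. f (x - y)) y) = (- 1) ^ length is * (LINT y|lebesgue. v y * f (x - y))"
    using v test_function_reflect[OF f] unfolding has_weak_deriv_def by blast
  moreover have "(LINT y|lebesgue. u y * partials is (\<lambda>y. f (x - y)) y) = (- 1) ^ length is * (LINT y|lebesgue. u y * partials is f (x - y))"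
    unfolding smooth_reflect(2)[OF test_function_smooth[OF f]] mult.left_commute[of "u _" "(- 1) ^ length is"]
    by simp
  ultimately have "(LINT y|lebesgue. u y * partials is f (x - y)) = (LINT y|lebesgue. v y * f (x - y))"
    by simp
  then show ?thesis unfolding partials_convolution[OF u f] by (simp add: convolution_def)
qed

lemma test_function_convolution:
  assumes u: "locally_integrable u" and f: "test_function f" and b: "\<And>x. norm x > r \<Longrightarrow> u x = 0"
  shows "test_function (convolution u f)"
proof -
  obtain r' where r': "\<And>x. norm x > r' \<Longrightarrow> f x = 0" using f test_function_iff by blast
  have "convolution u f x = 0" if x: "norm x > r + r'" for x
  proof -
    have "u y * f (x - y) = 0" for y
      using b[of y] r'[of "x - y"] norm_triangle_ineq[of y "x - y"] x by (cases "norm y > r") auto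
    then have "(\<lambda>y. u y * f (x - y)) = (\<lambda>_. 0)" by blast
    then show ?thesis unfolding convolution_def by simp
  qed
  then show ?thesis using test_functionI[OF smooth_convolution[OF u f]] by blast
qed

section \<open>Mollification as a mean of ball averages\<close>

lemma layer_cake_convolution:
  fixes w g :: "'a::euclidean_space \<Rightarrow> real"
  assumes [measurable]: "w \<in> borel_measurable borel" "g \<in> borel_measurable borel"
    and nn: "\<And>y. g y \<ge> 0" and i: "integrable lborel (\<lambda>y. w y * g y)"
  shows "integrable lborel (\<lambda>t. LINT y|lborel. w y * indicator {0..<g y} t)"
    and "(LINT y|lborel. w y * g y) = (LINT t|lborel. LINT y|lborel. w y * indicator {0..<g y} t)"
proof -
  define f where "f = (\<lambda>(y, t). w y * indicator {0..<g y} t)"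
  have [measurable]: "f \<in> borel_measurable (lborel \<Otimes>\<^sub>M lborel)"
  proof -
    have eq: "f = (\<lambda>p. w (fst p) * (if 0 \<le> snd p \<and> snd p < g (fst p) then 1 else 0))"
      by (auto simp: f_def fun_eq_iff indicator_def)
    show ?thesis unfolding eq by measurable
  qed
  have inner: "(\<integral>\<^sup>+t. ennreal \<bar>w y * indicator {0..<g y} t\<bar> \<partial>lborel) = ennreal \<bar>w y * g y\<bar>" for y
  proof -
    have "(\<integral>\<^sup>+t. ennreal \<bar>w y * indicator {0..<g y} t\<bar> \<partial>lborel) = (\<integral>\<^sup>+t. ennreal \<bar>w y\<bar> * indicator {0..<g y} t \<partial>lborel)"
      by (intro nn_integral_cong) (auto simp: indicator_def)
    also have "\<dots> = ennreal \<bar>w y\<bar> * ennreal (g y)"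
      by (subst nn_integral_cmult_indicator) (auto simp: nn)
    finally show ?thesis by (simp add: nn ennreal_mult abs_mult)
  qed
  have intf: "integrable (lborel \<Otimes>\<^sub>M lborel) f"
  proof (rule integrableI_bounded)
    have "(\<integral>\<^sup>+p. ennreal (norm (f p)) \<partial>(lborel \<Otimes>\<^sub>M lborel)) = (\<integral>\<^sup>+y. \<integral>\<^sup>+t. ennreal (norm (f (y, t))) \<partial>lborel \<partial>lborel)"
      by (rule lborel.nn_integral_fst[symmetric]) measurable
    also have "\<dots> = (\<integral>\<^sup>+y. ennreal \<bar>w y * g y\<bar> \<partial>lborel)" using inner by (simp add: f_def)
    also have "\<dots> < \<infinity>" using i by (simp add: integrable_iff_bounded)
    finally show "(\<integral>\<^sup>+p. ennreal (norm (f p)) \<partial>(lborel \<Otimes>\<^sub>M lborel)) < \<infinity>" .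
  qed measurable
  show "integrable lborel (\<lambda>t. LINT y|lborel. w y * indicator {0..<g y} t)"
    using lborel_pair.integrable_snd[OF intf[unfolded f_def]] by simp
  have "(LINT t|lborel. LINT y|lborel. w y * indicator {0..<g y} t) = (LINT y|lborel. LINT t|lborel. w y * indicator {0..<g y} t)"
    by (rule lborel_pair.Fubini_integral[OF intf[unfolded f_def]])
  also have "\<dots> = (LINT y|lborel. w y * g y)"
    using nn by (intro Bochner_Integration.integral_cong refl) simp
  finally show "(LINT y|lborel. w y * g y) = (LINT t|lborel. LINT y|lborel. w y * indicator {0..<g y} t)" by simp
qed

lemma lebesgue_integral_AE_borel:
  fixes f :: "'a::euclidean_space \<Rightarrow> real"
  assumes "f \<in> borel_measurable lebesgue" "g \<in> borel_measurable borel" "AE x in lebesgue. f x = g x"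
  shows "(LINT x|lebesgue. f x) = (LINT x|lborel. g x)"
proof -
  have "g \<in> borel_measurable lebesgue" using assms(2) by (simp add: measurable_completion)
  from integral_cong_AE[OF assms(1) this assms(3)] assms(2) show ?thesis
    by (simp add: integral_completion)
qed

lemma integrable_AE_borel:
  fixes f :: "'a::euclidean_space \<Rightarrow> real"
  assumes "integrable lebesgue f" "g \<in> borel_measurable borel" "AE x in lebesgue. f x = g x"
  shows "integrable lborel g"
  using integrable_cong_AE_imp[OF assms(1) _ assms(3)] assms(2)
  by (simp add: integrable_completion measurable_completion)

text \<open>By the layer cake formula the mollification at x is a weighted mean of ball averages
  over radii at most e. Its convergence at x thus follows from that of the ball averages alone, at
  exactly the points where the precise representative is given by a limit.\<close>

lemma convolution_mollifier_near:
  fixes u :: "real^'n::finite \<Rightarrow> real"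
  assumes u: "locally_integrable u" and e: "e > 0" and c: "c \<ge> 0"
    and avg: "\<And>r. 0 < r \<Longrightarrow> r \<le> e \<Longrightarrow> \<bar>ball_average u x r - l\<bar> \<le> c"
  shows "\<bar>convolution u (mollifier e) x - l\<bar> \<le> c"
proof -
  obtain v where [measurable]: "v \<in> borel_measurable borel" and uv: "AE y in lebesgue. u y = v y"
    using lebesgue_borel_representative[OF locally_integrable_borel[OF u]] by blast
  define g where "g y = mollifier e (x - y)" for y :: "real^'n"
  have tg: "test_function g" unfolding g_def by (rule test_function_reflect[OF test_function_mollifier[OF e]])
  note [measurable] = test_function_borel[OF tg]
  have g0: "g y \<ge> 0" for y by (simp add: g_def mollifier_nonneg[OF e])
  have ig: "integrable lborel g" by (rule integrable_test_function[OF tg])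
  have g1: "(LINT y|lborel. g y) = 1"
    unfolding g_def using integral_lborel_reflect[of "mollifier e" x] integral_mollifier[OF e, where 'n='n] by simp
  have uvg: "AE y in lebesgue. u y * g y = v y * g y" using uv by eventually_elim simp
  have iu: "integrable lebesgue (\<lambda>y. u y * g y)" by (rule integrable_lebesgue_mult_test[OF u tg])
  have iv: "integrable lborel (\<lambda>y. v y * g y)" by (rule integrable_AE_borel[OF iu _ uvg]) simp
  define w where "w y = v y - l" for y
  have [measurable]: "w \<in> borel_measurable borel" unfolding w_def by simp
  have iw: "integrable lborel (\<lambda>y. w y * g y)"
    unfolding w_def left_diff_distrib by (intro Bochner_Integration.integrable_diff iv integrable_mult_right ig)
  have "convolution u (mollifier e) x = (LINT y|lborel. v y * g y)"
    unfolding convolution_def g_def[symmetric]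
    by (rule lebesgue_integral_AE_borel[OF borel_measurable_integrable[OF iu] _ uvg]) simp
  then have "convolution u (mollifier e) x - l = (LINT y|lborel. w y * g y)"
    unfolding w_def left_diff_distrib using iv ig g1 by simp
  also have "\<dots> = (LINT t|lborel. LINT y|lborel. w y * indicator {0..<g y} t)"
    by (rule layer_cake_convolution(2)[OF _ _ g0 iw]) simp_all
  finally have eq: "convolution u (mollifier e) x - l = (LINT t|lborel. LINT y|lborel. w y * indicator {0..<g y} t)" .
  have i1: "integrable lborel (\<lambda>y. 1 * g y)" using ig by simp
  have "\<bar>LINT t|lborel. LINT y|lborel. w y * indicator {0..<g y} t\<bar> \<le> (LINT t|lborel. c * (LINT y|lborel. 1 * indicator {0..<g y} t))"
  proof (rule integral_abs_bound_integral)
    show "integrable lborel (\<lambda>t. LINT y|lborel. w y * indicator {0..<g y} t)"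
      by (rule layer_cake_convolution(1)[OF _ _ g0 iw]) simp_all
    show "integrable lborel (\<lambda>t. c * (LINT y|lborel. 1 * indicator {0..<g y} t))"
      by (intro integrable_mult_right layer_cake_convolution(1)[OF _ _ g0 i1]) simp_all
    fix t :: real
    show "\<bar>LINT y|lborel. w y * indicator {0..<g y} t\<bar> \<le> c * (LINT y|lborel. 1 * indicator {0..<g y} t)"
    proof (cases "t \<ge> 0")
      case False
      then have "(\<lambda>y. w y * indicator {0..<g y} t) = (\<lambda>_. 0)" by (auto simp: fun_eq_iff)
      then show ?thesis using c by (simp add: integral_nonneg_AE)
    next
      case True
      obtain r where r: "0 \<le> r" "r \<le> e" "{z :: real^'n. mollifier e z > t} = ball 0 r"
        using mollifier_superlevel[OF e True] by blast
      have ind: "indicator {0..<g y} t = (indicator (ball x r) y :: real)" for y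
      proof -
        have "t < g y \<longleftrightarrow> x - y \<in> ball 0 r" unfolding r(3)[symmetric] by (simp add: g_def)
        also have "\<dots> \<longleftrightarrow> y \<in> ball x r" by (simp add: dist_norm norm_minus_commute)
        finally show ?thesis using True by (simp add: indicator_def)
      qed
      have ibl: "integrable lebesgue (\<lambda>y. u y * indicator (ball x r) y)"
        by (rule integrable_lebesgue_mult_bounded[OF u, where B = 1 and r = "norm x + r"])
           (use norm_triangle_ineq4 in \<open>auto intro!: borel_imp_lebesgue simp: indicator_def dist_norm, smt (verit) norm_minus_commute norm_triangle_sub\<close>)
      have ubv: "AE y in lebesgue. u y * indicator (ball x r) y = v y * indicator (ball x r) y" using uv by eventually_elim simp
      have ibv: "integrable lborel (\<lambda>y. v y * indicator (ball x r) y)" by (rule integrable_AE_borel[OF ibl _ ubv], intro borel_measurable_times borel_measurable_indicator) auto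
      have ib1: "integrable lborel (\<lambda>y. indicator (ball x r) y :: real)"
        by (intro integrable_real_indicator) (auto simp: emeasure_lborel_ball_finite[unfolded infinity_ennreal_def])
      define V where "V = measure lborel (ball x r)"
      have "(LINT y|lborel. w y * indicator (ball x r) y) = (LINT y|lborel. v y * indicator (ball x r) y) - l * V"
        unfolding w_def left_diff_distrib using ibv ib1 by (simp add: V_def)
      also have "(LINT y|lborel. v y * indicator (ball x r) y) = (LINT y:ball x r|lebesgue. u y)"
        using lebesgue_integral_AE_borel[OF borel_measurable_integrable[OF ibl] borel_measurable_integrable[OF ibv, simplified] ubv]
        by (simp add: set_lebesgue_integral_def mult.commute)
      also have "(LINT y:ball x r|lebesgue. u y) - l * V = V * (ball_average u x r - l)"
      proof (cases "r = 0")
        case True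
        then show ?thesis by (simp add: V_def set_lebesgue_integral_def)
      next
        case False
        then have "V > 0" using r(1) content_ball_pos[of r x] by (simp add: V_def)
        then show ?thesis by (simp add: ball_average_def V_def field_simps)
      qed
      finally have "\<bar>LINT y|lborel. w y * indicator (ball x r) y\<bar> = V * \<bar>ball_average u x r - l\<bar>"
        by (simp add: abs_mult V_def)
      also have "\<dots> \<le> c * V"
      proof (cases "r = 0")
        case True
        then show ?thesis by (simp add: V_def)
      next
        case False
        then show ?thesis using avg[of r] r by (simp add: V_def mult.commute mult_right_mono)
      qed
      finally show ?thesis unfolding ind by (simp add: V_def)
    qed
  qed
  also have "\<dots> = c * (LINT y|lborel. 1 * g y)"
    using layer_cake_convolution(2)[OF _ _ g0 i1] by simp
  finally show ?thesis unfolding eq using g1 by simp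
qed

lemma convolution_mollifier_tendsto:
  fixes u :: "real^'n::finite \<Rightarrow> real"
  assumes u: "locally_integrable u" and l: "(ball_average u x \<longlongrightarrow> l) (at_right 0)"
  shows "(\<lambda>m. convolution u (mollifier (1 / real (Suc m))) x) \<longlonglongrightarrow> l"
proof (rule LIMSEQ_I)
  fix c :: real assume c: "c > 0"
  have "eventually (\<lambda>r. dist (ball_average u x r) l < c / 2) (at_right 0)"
    using l c by (intro tendstoD) auto
  then obtain d where d: "d > 0" "\<And>r. 0 < r \<Longrightarrow> r < d \<Longrightarrow> \<bar>ball_average u x r - l\<bar> < c / 2"
    unfolding eventually_at_right_field dist_real_def by auto
  obtain N where N: "1 / real (Suc N) < d" using d(1) reals_Archimedean by (metis inverse_eq_divide)
  show "\<exists>N. \<forall>m\<ge>N. norm (convolution u (mollifier (1 / real (Suc m))) x - l) < c"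
  proof (intro exI[of _ N] allI impI)
    fix m assume "m \<ge> N"
    then have "1 / real (Suc m) \<le> 1 / real (Suc N)" by (simp add: frac_le)
    then have m: "1 / real (Suc m) < d" using N by linarith
    have "\<bar>convolution u (mollifier (1 / real (Suc m))) x - l\<bar> \<le> c / 2"
    proof (rule convolution_mollifier_near[OF u inverse_Suc_pos])
      fix r :: real assume "0 < r" "r \<le> 1 / real (Suc m)"
      then show "\<bar>ball_average u x r - l\<bar> \<le> c / 2" using d(2)[of r] m by linarith
    qed (use c in simp)
    then show "norm (convolution u (mollifier (1 / real (Suc m))) x - l) < c" using c by simp
  qed
qed

lemma precise_rep_eqI:
  assumes "(ball_average u x \<longlongrightarrow> l) (at_right 0)"
  shows "precise_rep u x = l"
  using assms tendsto_Lim[OF _ assms] unfolding precise_rep_def by auto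

section \<open>Continuity of translations in the mean\<close>

definition L1_continuous :: "('a::euclidean_space \<Rightarrow> real) \<Rightarrow> bool" where
  "L1_continuous g \<longleftrightarrow> (\<forall>e>0. \<exists>d>0. \<forall>h. norm h < d \<longrightarrow> (LINT x|lborel. \<bar>g (x + h) - g x\<bar>) < e)"

text \<open>A is replaced by a slightly larger open set U. If x + h is outside A, it is outside U or
  in U - A; the first becomes rare by openness and dominated convergence, the second has the small
  measure of U - A for every h.\<close>

lemma translate_indicator_tendsto:
  fixes A :: "'a::euclidean_space set"
  assumes A: "A \<in> sets borel" and fin: "emeasure lborel A < \<infinity>" and e: "e > 0"
  shows "\<exists>d>0. \<forall>h. norm h < d \<longrightarrow> measure lborel {x\<in>A. x + h \<notin> A} < e"
proof (rule ccontr)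
  assume "\<not> ?thesis"
  then have "\<forall>m. \<exists>h. norm h < 1 / real (Suc m) \<and> \<not> measure lborel {x\<in>A. x + h \<notin> A} < e"
    by (meson inverse_Suc_pos)
  then obtain h where h: "\<And>m. norm (h m) < 1 / real (Suc m)" "\<And>m. \<not> measure lborel {x\<in>A. x + h m \<notin> A} < e"
    by metis
  have h0: "h \<longlonglongrightarrow> 0"
    by (rule Lim_null_comparison[OF _ LIMSEQ_inverse_Suc_add[of 0, simplified add_0]])
       (use h(1) in \<open>auto intro!: always_eventually less_imp_le\<close>)
  have "A \<in> sets lebesgue" using A by simp
  then obtain U where U: "open U" "A \<subseteq> U" "U - A \<in> lmeasurable" "emeasure lebesgue (U - A) < ennreal (e / 2)"
    using sets_lebesgue_outer_open[of A "e / 2"] e by auto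
  note [measurable] = A
  have [measurable]: "U \<in> sets borel" using U(1) by simp
  have UA: "emeasure lborel (U - A) < ennreal (e / 2)" using U(4) by simp
  then have UAfin: "emeasure lborel (U - A) < \<infinity>" by (rule order.strict_trans) simp
  from UA have UAm: "measure lborel (U - A) < e / 2"
    using e by (metis Sigma_Algebra.measure_def enn2real_less_iff ennreal_enn2real_if ennreal_less_top less_top measure_def half_gt_zero infinity_ennreal_def ennreal_lessI less_ennreal.rep_eq emeasure_eq_ennreal_measure ennreal_less_iff measure_nonneg order.strict_trans top.not_eq_extremum)
  have "emeasure lborel U \<le> emeasure lborel A + emeasure lborel (U - A)"
    using emeasure_subadditive[of A lborel "U - A"] U(2) by (simp add: Un_absorb1)
  also have "\<dots> < \<infinity>" using fin UAfin by (simp add: less_top[symmetric])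
  finally have finU: "emeasure lborel U < \<infinity>" .
  have iU: "integrable lborel (indicator U :: 'a \<Rightarrow> real)" using finU by (intro integrable_real_indicator) auto
  have "(\<lambda>m. LINT x|lborel. indicator U x * indicator (- U) (x + h m)) \<longlonglongrightarrow> (LINT x|(lborel :: 'a measure). (0::real))"
  proof (rule integral_dominated_convergence[where w = "indicat_real U"])
    show "integrable lborel (indicat_real U)" by (rule iU)
    show "AE x in lborel. (\<lambda>m. indicat_real U x * indicator (- U) (x + h m)) \<longlonglongrightarrow> 0"
    proof (intro AE_I2)
      fix x
      show "(\<lambda>m. indicat_real U x * indicator (- U) (x + h m)) \<longlonglongrightarrow> 0"
      proof (cases "x \<in> U")
        case True
        have "(\<lambda>m. x + h m) \<longlonglongrightarrow> x + 0" by (intro tendsto_add tendsto_const h0)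
        then have "eventually (\<lambda>m. x + h m \<in> U) sequentially"
          using topological_tendstoD[OF _ U(1)] True by fastforce
        then have "eventually (\<lambda>m. indicat_real U x * indicator (- U) (x + h m) = 0) sequentially"
          by (rule eventually_mono) simp
        then show ?thesis by (rule tendsto_eventually)
      qed simp
    qed
  qed (auto simp: indicator_def)
  then have "eventually (\<lambda>m. dist (LINT x|lborel. indicat_real U x * indicator (- U) (x + h m)) 0 < e / 2) sequentially"
    using e by (intro tendstoD) auto
  then obtain m where m: "\<bar>LINT x|lborel. indicat_real U x * indicator (- U) (x + h m)\<bar> < e / 2"
    by (auto simp: eventually_sequentially)
  have "measure lborel {x\<in>A. x + h m \<notin> A} = (LINT x|lborel. indicat_real {x\<in>A. x + h m \<notin> A} x)"
    by simp
  also have "\<dots> \<le> (LINT x|lborel. indicat_real U x * indicator (- U) (x + h m) + indicat_real (U - A) (h m + x))"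
  proof (rule integral_mono)
    have iUA: "integrable lborel (indicator (U - A) :: 'a \<Rightarrow> real)"
      using UAfin by (intro integrable_real_indicator) auto
    show "integrable lborel (indicat_real {x \<in> A. x + h m \<notin> A})"
      by (rule Bochner_Integration.integrable_bound[OF iU]) (use U(2) in \<open>auto simp: indicator_def\<close>)
    show "integrable lborel (\<lambda>x. indicat_real U x * indicator (- U) (x + h m) + indicat_real (U - A) (h m + x))"
    proof (rule Bochner_Integration.integrable_add)
      show "integrable lborel (\<lambda>x. indicat_real U x * indicator (- U) (x + h m))"
        by (rule Bochner_Integration.integrable_bound[OF iU]) (auto simp: indicator_def)
      show "integrable lborel (\<lambda>x. indicat_real (U - A) (h m + x))"
        by (rule integrable_lborel_translate[OF iUA])
    qed
    show "indicat_real {x \<in> A. x + h m \<notin> A} x \<le> indicat_real U x * indicator (- U) (x + h m) + indicat_real (U - A) (h m + x)" for x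
      using U(2) by (auto simp: indicator_def add.commute)
  qed
  also have "\<dots> = (LINT x|lborel. indicat_real U x * indicator (- U) (x + h m)) + (LINT x|lborel. indicat_real (U - A) (h m + x))"
  proof (rule Bochner_Integration.integral_add)
    show "integrable lborel (\<lambda>x. indicat_real U x * indicator (- U) (x + h m))"
      by (rule Bochner_Integration.integrable_bound[OF iU]) (auto simp: indicator_def)
    show "integrable lborel (\<lambda>x. indicat_real (U - A) (h m + x))"
      using UAfin by (intro integrable_lborel_translate integrable_real_indicator) auto
  qed
  also have "(LINT x|lborel. indicat_real (U - A) (h m + x)) = measure lborel (U - A)"
    by (subst integral_lborel_translate) auto
  finally have "measure lborel {x\<in>A. x + h m \<notin> A} < e" using m UAm by linarith
  then show False using h(2) by blast
qed

lemma L1_continuous_indicator: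
  fixes A :: "'a::euclidean_space set"
  assumes A: "A \<in> sets borel" and fin: "emeasure lborel A < \<infinity>"
  shows "L1_continuous (\<lambda>x. c * indicator A x)"
  unfolding L1_continuous_def
proof (intro allI impI)
  fix e :: real assume e: "e > 0"
  note [measurable] = A
  define e' where "e' = e / (2 * (\<bar>c\<bar> + 1))"
  have e': "e' > 0" using e by (simp add: e'_def)
  obtain d where d: "d > 0" "\<And>h. norm h < d \<Longrightarrow> measure lborel {x\<in>A. x + h \<notin> A} < e'"
    using translate_indicator_tendsto[OF A fin e'] by blast
  show "\<exists>d>0. \<forall>h. norm h < d \<longrightarrow> (LINT x|lborel. \<bar>c * indicator A (x + h) - c * indicator A x\<bar>) < e"
  proof (intro exI[of _ d] conjI allI impI d(1))
    fix h :: 'a assume h: "norm h < d"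
    have iA: "integrable lborel (indicator A :: 'a \<Rightarrow> real)" using fin by (intro integrable_real_indicator) auto
    have i1: "integrable lborel (indicat_real {x\<in>A. x + k \<notin> A})" for k
      by (rule Bochner_Integration.integrable_bound[OF iA]) (auto simp: indicator_def)
    have "(LINT x|lborel. \<bar>c * indicator A (x + h) - c * indicator A x\<bar>)
      = (LINT x|lborel. \<bar>c\<bar> * indicat_real {x\<in>A. x + h \<notin> A} x + \<bar>c\<bar> * indicat_real {x\<in>A. x + - h \<notin> A} (h + x))"
      by (intro arg_cong[where f = "lebesgue_integral lborel"] ext) (auto simp: indicator_def add.commute)
    also have "\<dots> = \<bar>c\<bar> * measure lborel {x\<in>A. x + h \<notin> A} + \<bar>c\<bar> * (LINT x|lborel. indicat_real {x\<in>A. x + - h \<notin> A} (h + x))"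
      using i1 integrable_lborel_translate[OF i1[of "- h"], of h] by simp
    also have "(LINT x|lborel. indicat_real {x\<in>A. x + - h \<notin> A} (h + x)) = measure lborel {x\<in>A. x + - h \<notin> A}"
      by (subst integral_lborel_translate) auto
    also have "\<bar>c\<bar> * measure lborel {x\<in>A. x + h \<notin> A} + \<bar>c\<bar> * measure lborel {x\<in>A. x + - h \<notin> A} \<le> \<bar>c\<bar> * e' + \<bar>c\<bar> * e'"
      using d(2)[OF h] d(2)[of "- h"] h by (intro add_mono mult_left_mono) auto
    also have "\<dots> < (\<bar>c\<bar> + 1) * e' + (\<bar>c\<bar> + 1) * e'" using e' by simp
    also have "\<dots> = e"
    proof -
      have "K * (e / (2 * K)) + K * (e / (2 * K)) = e" if "K \<noteq> 0" for K :: real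
        using that by (simp add: field_simps)
      from this[of "\<bar>c\<bar> + 1"] show ?thesis by (simp add: e'_def)
    qed
    finally show "(LINT x|lborel. \<bar>c * indicator A (x + h) - c * indicator A x\<bar>) < e" .
  qed
qed

lemma integrable_translate_diff:
  fixes f :: "'a::euclidean_space \<Rightarrow> real"
  assumes "integrable lborel f"
  shows "integrable lborel (\<lambda>x. \<bar>f (x + h) - f x\<bar>)"
  using integrable_lborel_translate[OF assms, of h] assms by (simp add: add.commute)

text \<open>Approximation by simple functions, for which indicators suffice; translating the
  approximation error does not change its norm.\<close>

theorem L1_continuous_integrable:
  fixes f :: "'a::euclidean_space \<Rightarrow> real"
  assumes "integrable lborel f"
  shows "L1_continuous f"
  using assms
proof (induction rule: integrable_induct)
  case (base A c)
  then show ?case using L1_continuous_indicator[of A c] by (simp add: mult.commute)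
next
  case (add f g)
  show ?case unfolding L1_continuous_def
  proof (intro allI impI)
    fix e :: real assume e: "e > 0"
    obtain d1 where d1: "d1 > 0" "\<And>h. norm h < d1 \<Longrightarrow> (LINT x|lborel. \<bar>f (x + h) - f x\<bar>) < e / 2"
      using add.IH(1) e unfolding L1_continuous_def by (meson half_gt_zero)
    obtain d2 where d2: "d2 > 0" "\<And>h. norm h < d2 \<Longrightarrow> (LINT x|lborel. \<bar>g (x + h) - g x\<bar>) < e / 2"
      using add.IH(2) e unfolding L1_continuous_def by (meson half_gt_zero)
    have "(LINT x|lborel. \<bar>f (x + h) + g (x + h) - (f x + g x)\<bar>) < e" if h: "norm h < min d1 d2" for h
    proof -
      have "(LINT x|lborel. \<bar>f (x + h) + g (x + h) - (f x + g x)\<bar>) \<le> (LINT x|lborel. \<bar>f (x + h) - f x\<bar> + \<bar>g (x + h) - g x\<bar>)"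
        by (rule integral_mono[OF integrable_translate_diff[OF Bochner_Integration.integrable_add[OF add.hyps]]
              Bochner_Integration.integrable_add[OF integrable_translate_diff integrable_translate_diff, OF add.hyps]])
           linarith
      also have "\<dots> = (LINT x|lborel. \<bar>f (x + h) - f x\<bar>) + (LINT x|lborel. \<bar>g (x + h) - g x\<bar>)"
        by (intro Bochner_Integration.integral_add integrable_translate_diff add.hyps)
      also have "\<dots> < e / 2 + e / 2" using d1(2)[of h] d2(2)[of h] h by auto
      finally show ?thesis by simp
    qed
    then show "\<exists>d>0. \<forall>h. norm h < d \<longrightarrow> (LINT x|lborel. \<bar>f (x + h) + g (x + h) - (f x + g x)\<bar>) < e"
      using d1(1) d2(1) by (intro exI[of _ "min d1 d2"]) auto
  qed
next
  case (lim f s)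
  show ?case unfolding L1_continuous_def
  proof (intro allI impI)
    fix e :: real assume e: "e > 0"
    note [measurable] = borel_measurable_integrable[OF lim.hyps(1)] borel_measurable_integrable[OF lim.hyps(4)]
    have "(\<lambda>i. LINT x|lborel. \<bar>s i x - f x\<bar>) \<longlonglongrightarrow> (LINT x|(lborel::'a measure). 0)"
    proof (rule integral_dominated_convergence)
      show "integrable lborel (\<lambda>x. 3 * norm (f x))" using lim.hyps(4) by simp
      show "AE x in lborel. (\<lambda>i. \<bar>s i x - f x\<bar>) \<longlonglongrightarrow> 0"
        using lim.hyps(2) by (intro AE_I2 tendsto_rabs_zero LIM_zero) simp
      show "AE x in lborel. norm \<bar>s i x - f x\<bar> \<le> 3 * norm (f x)" for i
      proof (intro AE_I2)
        fix x
        have "norm (s i x) \<le> 2 * norm (f x)" using lim.hyps(3)[of x i] by simp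
        then show "norm \<bar>s i x - f x\<bar> \<le> 3 * norm (f x)" using abs_triangle_ineq4[of "s i x" "f x"] by simp
      qed
    qed measurable
    then have "eventually (\<lambda>i. dist (LINT x|lborel. \<bar>s i x - f x\<bar>) 0 < e / 4) sequentially"
      using e by (intro tendstoD) auto
    then obtain i where i: "(LINT x|lborel. \<bar>s i x - f x\<bar>) < e / 4"
      by (auto simp: eventually_sequentially)
    have e4: "e / 4 > 0" using e by simp
    obtain d where d: "d > 0" "\<And>h. norm h < d \<Longrightarrow> (LINT x|lborel. \<bar>s i (x + h) - s i x\<bar>) < e / 4"
      using lim.IH[of i, unfolded L1_continuous_def, rule_format, OF e4] by blast
    have isf: "integrable lborel (\<lambda>x. \<bar>s i x - f x\<bar>)" using lim.hyps(1)[of i] lim.hyps(4) by simp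
    have isf': "integrable lborel (\<lambda>x. \<bar>s i (x + h) - f (x + h)\<bar>)" for h
      using integrable_lborel_translate[OF isf, of h] by (simp add: add.commute)
    have "(LINT x|lborel. \<bar>f (x + h) - f x\<bar>) < e" if h: "norm h < d" for h
    proof -
      have "(LINT x|lborel. \<bar>f (x + h) - f x\<bar>) \<le> (LINT x|lborel. \<bar>s i (x + h) - f (x + h)\<bar> + \<bar>s i (x + h) - s i x\<bar> + \<bar>s i x - f x\<bar>)"
        by (rule integral_mono[OF integrable_translate_diff[OF lim.hyps(4)]
              Bochner_Integration.integrable_add[OF Bochner_Integration.integrable_add[OF isf' integrable_translate_diff[OF lim.hyps(1)]] isf]])
           linarith
      also have "\<dots> = (LINT x|lborel. \<bar>s i (x + h) - f (x + h)\<bar>) + (LINT x|lborel. \<bar>s i (x + h) - s i x\<bar>) + (LINT x|lborel. \<bar>s i x - f x\<bar>)"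
        by (simp only: Bochner_Integration.integral_add[OF Bochner_Integration.integrable_add[OF isf' integrable_translate_diff[OF lim.hyps(1)]] isf]
            Bochner_Integration.integral_add[OF isf' integrable_translate_diff[OF lim.hyps(1)]])
      also have "(LINT x|lborel. \<bar>s i (x + h) - f (x + h)\<bar>) = (LINT x|lborel. \<bar>s i x - f x\<bar>)"
        using integral_lborel_translate[of "\<lambda>x. \<bar>s i x - f x\<bar>" h] by (simp add: add.commute)
      finally show ?thesis using i d(2)[OF h] e by linarith
    qed
    then show "\<exists>d>0. \<forall>h. norm h < d \<longrightarrow> (LINT x|lborel. \<bar>f (x + h) - f x\<bar>) < e"
      using d(1) by blast
  qed
qed


section \<open>Locality of weak derivatives\<close>

lemma smooth_exterior_cutoff:
  fixes r :: real
  defines "s \<equiv> \<lambda>x :: real^'n::finite. exp_cutoff 1 ((norm x)\<^sup>2 - r\<^sup>2)"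
  assumes "r \<ge> 0"
  shows "smooth s" "norm x \<le> r \<Longrightarrow> s x = 0" "norm x > r \<Longrightarrow> s x > 0"
proof -
  have "smooth_real (\<lambda>t. exp_cutoff 1 (1 * t + - r\<^sup>2))"
    by (rule smooth_real_affine[OF smooth_real_exp_cutoff]) simp
  then obtain F where F: "F 0 = (\<lambda>t. exp_cutoff 1 (1 * t + - r\<^sup>2))" "\<And>j t. (F j has_real_derivative F (Suc j) t) (at t)"
    unfolding smooth_real_def by metis
  from smooth_radial[of F 0, OF F(2)] show "smooth s"
    by (simp add: F(1) s_def)
  show "s x = 0" if "norm x \<le> r"
  proof -
    have "(norm x)\<^sup>2 \<le> r\<^sup>2" using that by (intro power_mono) auto
    then show ?thesis by (simp add: s_def exp_cutoff_def)
  qed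
  show "s x > 0" if "norm x > r"
  proof -
    have "r\<^sup>2 < (norm x)\<^sup>2" using that assms by (intro power_strict_mono) auto
    then show ?thesis by (simp add: s_def exp_cutoff_def)
  qed
qed

lemma partials_zero_open:
  assumes "open U" "\<And>x. x \<in> U \<Longrightarrow> f x = 0" "x \<in> U"
  shows "partials is f x = 0"
  using assms(3)
proof (induction "is" arbitrary: x)
  case (Cons i "is")
  have "((\<lambda>x. 0) has_derivative (\<lambda>h. 0)) (at x)" by simp
  then have "(partials is f has_derivative (\<lambda>h. 0)) (at x)"
    by (rule has_derivative_transform_within_open[where s = U]) (use Cons assms(1) in auto)
  from partials_eqI[OF this] show ?case by simp
qed (use assms(2) in auto)

text \<open>Testing against \<open>s f\<close> with a smooth \<open>s\<close> that is positive exactly outside the ball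
  localizes the fundamental lemma.\<close>

lemma weak_deriv_zero_outside_ball:
  fixes u :: "real^'n::finite \<Rightarrow> real"
  assumes v: "has_weak_deriv u is v" and r: "r \<ge> 0" and u0: "AE x in lebesgue. norm x \<ge> r \<longrightarrow> u x = 0"
  shows "AE x in lebesgue. norm x > r \<longrightarrow> v x = 0"
proof -
  define s where "s = (\<lambda>x :: real^'n. exp_cutoff 1 ((norm x)\<^sup>2 - r\<^sup>2))"
  have s: "smooth s" "\<And>x. norm x \<le> r \<Longrightarrow> s x = 0" "\<And>x. norm x > r \<Longrightarrow> s x > 0"
    using smooth_exterior_cutoff[OF r, where 'n='n] by (auto simp: s_def)
  have s1: "\<bar>s x\<bar> \<le> 1" for x using exp_cutoff_le_1[of 1] by (simp add: s_def)
  have lv: "locally_integrable v" and lu: "locally_integrable u" using v by (auto simp: has_weak_deriv_def)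
  have lvs: "locally_integrable (\<lambda>x. v x * s x)"
    unfolding locally_integrable_def set_integrable_def
  proof (intro allI impI)
    fix K :: "(real^'n) set" assume K: "compact K"
    have iK: "integrable lebesgue (\<lambda>x. indicat_real K x * v x)"
      using lv K unfolding locally_integrable_def set_integrable_def by simp
    show "integrable lebesgue (\<lambda>x. indicat_real K x *\<^sub>R (v x * s x))"
    proof (rule Bochner_Integration.integrable_bound[OF iK])
      have "(\<lambda>x. (indicat_real K x * v x) * s x) \<in> borel_measurable lebesgue"
        by (intro borel_measurable_times borel_measurable_integrable[OF iK] borel_imp_lebesgue smooth_borel s)
      then show "(\<lambda>x. indicat_real K x *\<^sub>R (v x * s x)) \<in> borel_measurable lebesgue" by (simp add: mult.assoc)
      show "AE x in lebesgue. norm (indicat_real K x *\<^sub>R (v x * s x)) \<le> norm (indicat_real K x * v x)"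
        using s1 by (intro AE_I2) (auto simp: abs_mult indicator_def intro: mult_left_le)
    qed
  qed
  have "AE x in lebesgue. v x * s x = 0"
  proof (rule fundamental_lemma[OF lvs])
    fix f :: "real^'n \<Rightarrow> real" assume f: "test_function f"
    have t: "test_function (\<lambda>x. s x * f x)" by (rule test_function_mult'[OF f s(1)])
    have "(LINT x|lebesgue. u x * partials is (\<lambda>x. s x * f x) x) = 0"
    proof (rule integral_eq_zero_AE)
      show "AE x in lebesgue. u x * partials is (\<lambda>x. s x * f x) x = 0"
        using u0
      proof eventually_elim
        case (elim x)
        show ?case
        \<comment> \<open>Inside the ball s f vanishes on an open set, so all its derivatives do; on
          the sphere and beyond it u itself vanishes.\<close>
        proof (cases "norm x < r")
          case True
          have "partials is (\<lambda>x. s x * f x) x = 0"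
            by (rule partials_zero_open[where U = "ball 0 r"]) (use s(2) True in auto)
          then show ?thesis by simp
        qed (use elim in auto)
      qed
    qed
    then have "(LINT x|lebesgue. v x * (s x * f x)) = 0"
      using v t unfolding has_weak_deriv_def by auto
    then show "(LINT x|lebesgue. v x * s x * f x) = 0" by (simp add: mult.assoc)
  qed
  then show ?thesis
  proof eventually_elim
    case (elim x)
    then show ?case using s(3)[of x] by auto
  qed
qed

lemma integrable_lebesgue_bounded_support:
  assumes v: "locally_integrable v" and z: "AE x in lebesgue. norm x > r \<longrightarrow> v x = 0"
  shows "integrable lebesgue v"
proof (rule integrable_cong_AE_imp[OF locally_integrable_cball[OF v, of 0 r] locally_integrable_borel[OF v]])
  show "AE x in lebesgue. indicat_real (cball 0 r) x * v x = v x"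
    using z by eventually_elim (auto simp: indicator_def)
qed

text \<open>For a test function \<open>f\<close> the function \<open>t \<mapsto> \<integral> w (x + t e\<^sub>i) f x dx\<close> has the derivative
  \<open>\<integral> v (x + t e\<^sub>i) f x dx\<close>; integrate over \<open>[0, h]\<close> and apply the fundamental lemma.\<close>

lemma weak_deriv_difference:
  fixes w v :: "real^'n::finite \<Rightarrow> real"
  assumes wv: "has_weak_deriv w [i] v"
    and [measurable]: "w' \<in> borel_measurable borel" "v' \<in> borel_measurable borel"
    and w': "AE x in lebesgue. w x = w' x" and v': "AE x in lebesgue. v x = v' x"
    and iw: "integrable lborel w'" and iv: "integrable lborel v'" and h: "h > 0"
  shows "integrable lborel (\<lambda>x. LINT t|lborel. v' (x + t *\<^sub>R axis i 1) * indicator {0..h} t)"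
    and "AE x in lborel. w' (x + h *\<^sub>R axis i 1) - w' x = (LINT t|lborel. v' (x + t *\<^sub>R axis i 1) * indicator {0..h} t)"
proof -
  define e :: "real^'n" where "e = axis i 1"
  have [measurable]: "(\<lambda>p. v' (fst p + snd p *\<^sub>R e)) \<in> borel_measurable (lborel \<Otimes>\<^sub>M lborel)" by measurable
  have pair: "integrable (lborel \<Otimes>\<^sub>M lborel) (\<lambda>(x, t). v' (x + t *\<^sub>R e) * indicator {0..h} t * g x)"
    if g[measurable]: "g \<in> borel_measurable borel" and gB: "\<And>x. \<bar>g x\<bar> \<le> B" for g :: "real^'n \<Rightarrow> real" and B
  proof (rule integrableI_bounded)
    show "(\<lambda>(x, t). v' (x + t *\<^sub>R e) * indicator {0..h} t * g x) \<in> borel_measurable (lborel \<Otimes>\<^sub>M lborel)"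
      by measurable
    have B: "B \<ge> 0" using gB[of 0] by linarith
    have "(\<integral>\<^sup>+p. ennreal (norm (case p of (x, t) \<Rightarrow> v' (x + t *\<^sub>R e) * indicator {0..h} t * g x)) \<partial>(lborel \<Otimes>\<^sub>M lborel))
      = (\<integral>\<^sup>+t. \<integral>\<^sup>+x. ennreal \<bar>v' (x + t *\<^sub>R e) * indicator {0..h} t * g x\<bar> \<partial>lborel \<partial>lborel)"
    proof -
      have "(\<lambda>p. ennreal (norm (case p of (x, t) \<Rightarrow> v' (x + t *\<^sub>R e) * indicator {0..h} t * g x))) \<in> borel_measurable (lborel \<Otimes>\<^sub>M lborel)"
        by measurable
      from lborel_pair.nn_integral_snd[OF this] show ?thesis by simp
    qed
    also have "\<dots> \<le> (\<integral>\<^sup>+t. (ennreal B * (\<integral>\<^sup>+x. ennreal \<bar>v' x\<bar> \<partial>lborel)) * indicator {0..h} t \<partial>lborel)"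
    proof (rule nn_integral_mono)
      fix t :: real
      have "(\<integral>\<^sup>+x. ennreal \<bar>v' (x + t *\<^sub>R e) * indicator {0..h} t * g x\<bar> \<partial>lborel)
        \<le> (\<integral>\<^sup>+x. (ennreal B * ennreal \<bar>v' (t *\<^sub>R e + x)\<bar>) * indicator {0..h} t \<partial>lborel)"
        using gB B by (intro nn_integral_mono)
          (auto simp: indicator_def abs_mult ennreal_mult[symmetric] add.commute mult.commute intro!: ennreal_leI mult_mono)
      also have "\<dots> = (ennreal B * (\<integral>\<^sup>+x. ennreal \<bar>v' x\<bar> \<partial>lborel)) * indicator {0..h} t"
        using nn_integral_lborel_translate[of "\<lambda>x. ennreal \<bar>v' x\<bar>" "t *\<^sub>R e"]
        by (auto simp: indicator_def nn_integral_cmult)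
      finally show "(\<integral>\<^sup>+x. ennreal \<bar>v' (x + t *\<^sub>R e) * indicator {0..h} t * g x\<bar> \<partial>lborel)
        \<le> (ennreal B * (\<integral>\<^sup>+x. ennreal \<bar>v' x\<bar> \<partial>lborel)) * indicator {0..h} t" .
    qed
    also have "\<dots> < \<infinity>"
      using iv h by (simp add: nn_integral_cmult integrable_iff_bounded ennreal_mult_less_top)
    finally show "(\<integral>\<^sup>+p. ennreal (norm (case p of (x, t) \<Rightarrow> v' (x + t *\<^sub>R e) * indicator {0..h} t * g x)) \<partial>(lborel \<Otimes>\<^sub>M lborel)) < \<infinity>" .
  qed
  define V where "V x = (LINT t|lborel. v' (x + t *\<^sub>R e) * indicator {0..h} t)" for x
  show iV: "integrable lborel (\<lambda>x. LINT t|lborel. v' (x + t *\<^sub>R axis i 1) * indicator {0..h} t)"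
    using lborel_pair.integrable_fst[OF pair[of "\<lambda>_. 1" 1]] by (simp add: e_def)
  then have iV': "integrable lborel V" by (simp add: V_def[abs_def] e_def)
  note [measurable] = borel_measurable_integrable[OF iV']
  define D where "D x = w' (h *\<^sub>R e + x) - w' x - V x" for x
  have iD: "integrable lborel D"
    unfolding D_def by (intro Bochner_Integration.integrable_diff integrable_lborel_translate iw iV')
  have "AE x in lebesgue. D x = 0"
  proof (rule fundamental_lemma)
    show "locally_integrable D"
      by (rule locally_integrableI_integrable) (use iD in \<open>simp add: integrable_completion borel_measurable_integrable\<close>)
    fix f :: "real^'n \<Rightarrow> real" assume f: "test_function f"
    note [measurable] = test_function_borel[OF f]
    obtain B where B: "\<And>x. \<bar>f x\<bar> \<le> B" using test_function_bounded[OF f] by blast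
    \<comment> \<open>With the reflected test function g, the integral of u (x + t e) f x is the
      convolution of u with g at the point t e, so the results on convolutions supply its derivative
      in t.\<close>
    define g where "g z = f (0 - z)" for z
    have tg: "test_function g" unfolding g_def by (rule test_function_reflect[OF f])
    have lw: "locally_integrable w" and lv: "locally_integrable v" using wv by (auto simp: has_weak_deriv_def)
    have conv: "convolution u g (t *\<^sub>R e) = (LINT x|lborel. u' (x + t *\<^sub>R e) * f x)"
      if lu: "locally_integrable u" and [measurable]: "u' \<in> borel_measurable borel"
        and uu: "AE x in lebesgue. u x = u' x" for u u' t
    proof -
      have "convolution u g (t *\<^sub>R e) = (LINT y|lborel. u' y * g (t *\<^sub>R e - y))"
        unfolding convolution_def
      proof (rule lebesgue_integral_AE_borel[OF borel_measurable_integrable[OF integrable_convolution[OF lu tg]]])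
        show "(\<lambda>y. u' y * g (t *\<^sub>R e - y)) \<in> borel_measurable borel" unfolding g_def by measurable
        show "AE x in lebesgue. u x * g (t *\<^sub>R e - x) = u' x * g (t *\<^sub>R e - x)" using uu by eventually_elim simp
      qed
      also have "\<dots> = (LINT x|lborel. u' (t *\<^sub>R e + x) * f x)"
        by (subst integral_lborel_translate[where t = "t *\<^sub>R e", symmetric]) (auto simp: g_def)
      finally show ?thesis by (simp add: add.commute)
    qed
    have der: "((\<lambda>t. convolution w g (t *\<^sub>R e)) has_real_derivative convolution v g (t *\<^sub>R e)) (at t)" for t
    proof -
      have 1: "((\<lambda>t. t *\<^sub>R e) has_derivative (\<lambda>s. s *\<^sub>R e)) (at t)"
        by (auto intro!: derivative_eq_intros)
      have "((\<lambda>t. convolution w g (t *\<^sub>R e)) has_derivative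
        (\<lambda>s. \<Sum>j\<in>UNIV. (s *\<^sub>R e) $ j * convolution w (partials [j] g) (t *\<^sub>R e))) (at t)"
        by (rule has_derivative_compose[OF 1 has_derivative_convolution[OF lw tg]])
      moreover have "(\<Sum>j\<in>UNIV. (s *\<^sub>R e) $ j * convolution w (partials [j] g) (t *\<^sub>R e)) = convolution v g (t *\<^sub>R e) * s" for s
      proof -
        have "convolution w (partials [i] g) (t *\<^sub>R e) = convolution v g (t *\<^sub>R e)"
          using convolution_weak_deriv[OF wv tg, of "t *\<^sub>R e"] by (simp only: partials_convolution[OF lw tg])
        then show ?thesis
          by (simp add: e_def axis_def if_distrib[of "\<lambda>a. a * _"] if_distrib[of "\<lambda>a. _ * a"] del: partials.simps cong: if_cong)
      qed
      ultimately show ?thesis by (simp add: has_field_derivative_def mult_commute_abs)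
    qed
    have cont: "continuous_on UNIV (\<lambda>t. convolution v g (t *\<^sub>R e))"
      by (rule continuous_on_compose2[OF smooth_continuous[OF smooth_convolution[OF lv tg], of UNIV]]) (auto intro!: continuous_intros)
    have "(LINT t|lborel. indicator {0..h} t *\<^sub>R convolution v g (t *\<^sub>R e)) = convolution w g (h *\<^sub>R e) - convolution w g (0 *\<^sub>R e)"
    proof (rule integral_FTC_Icc)
      show "0 \<le> h" using h by simp
      show "((\<lambda>t. convolution w g (t *\<^sub>R e)) has_vector_derivative convolution v g (x *\<^sub>R e)) (at x within {0..h})" for x
        using der[of x] by (simp add: has_real_derivative_iff_has_vector_derivative has_vector_derivative_at_within)
      show "continuous_on {0..h} (\<lambda>t. convolution v g (t *\<^sub>R e))" using cont continuous_on_subset by blast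
    qed
    then have FTC: "convolution w g (h *\<^sub>R e) - convolution w g (0 *\<^sub>R e)
        = (LINT t|lborel. LINT x|lborel. v' (x + t *\<^sub>R e) * indicator {0..h} t * f x)"
    proof -
      have "(LINT x|lborel. v' (x + t *\<^sub>R e) * indicator {0..h} t * f x) = indicator {0..h} t *\<^sub>R convolution v g (t *\<^sub>R e)" for t
        unfolding conv[OF lv \<open>v' \<in> borel_measurable borel\<close> v'] by (cases "t \<in> {0..h}") auto
      then show ?thesis
        using \<open>(LINT t|lborel. indicator {0..h} t *\<^sub>R convolution v g (t *\<^sub>R e)) = _\<close> by simp
    qed
    have "(LINT t|lborel. LINT x|lborel. v' (x + t *\<^sub>R e) * indicator {0..h} t * f x)
      = (LINT x|lborel. LINT t|lborel. v' (x + t *\<^sub>R e) * indicator {0..h} t * f x)"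
      by (rule lborel_pair.Fubini_integral[OF pair[OF _ B]]) simp
    also have "\<dots> = (LINT x|lborel. V x * f x)" by (simp add: V_def)
    finally have VF: "convolution w g (h *\<^sub>R e) - convolution w g (0 *\<^sub>R e) = (LINT x|lborel. V x * f x)" using FTC by simp
    have bnd: "integrable lborel (\<lambda>x. q x * f x)" if q: "integrable lborel q" for q
    proof (rule Bochner_Integration.integrable_bound)
      show "integrable lborel (\<lambda>x. B * q x)" using q by simp
      show "(\<lambda>x. q x * f x) \<in> borel_measurable lborel" using borel_measurable_integrable[OF q] by measurable
      show "AE x in lborel. norm (q x * f x) \<le> norm (B * q x)"
        using B order_trans[OF B abs_ge_self] by (intro AE_I2) (auto simp: abs_mult mult.commute intro!: mult_right_mono)
    qed
    have "(LINT x|lebesgue. D x * f x) = (LINT x|lborel. D x * f x)"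
      by (rule integral_completion) (use borel_measurable_integrable[OF bnd[OF iD]] in simp)
    also have "\<dots> = (LINT x|lborel. w' (h *\<^sub>R e + x) * f x) - (LINT x|lborel. w' x * f x) - (LINT x|lborel. V x * f x)"
      unfolding D_def left_diff_distrib
      using bnd[OF integrable_lborel_translate[OF iw, of "h *\<^sub>R e"]] bnd[OF iw] bnd[OF iV'] by simp
    also have "\<dots> = 0"
      using VF conv[OF lw _ w', of h] conv[OF lw _ w', of 0] by (simp add: add.commute)
    finally show "(LINT x|lebesgue. D x * f x) = 0" .
  qed
  then have "AE x in lborel. D x = 0"
    using borel_measurable_integrable[OF iD] by (simp add: AE_completion_iff)
  then show "AE x in lborel. w' (x + h *\<^sub>R axis i 1) - w' x = (LINT t|lborel. v' (x + t *\<^sub>R axis i 1) * indicator {0..h} t)"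
    by eventually_elim (simp add: D_def V_def e_def add.commute)
qed


text \<open>For almost every x such that x and x + h e both lie in E, the mean of v over the segment
  between them is 0, so |v x| is at most the mean of |v (x + t e) - v x|, which is small in L^1. The
  remaining points of E, those with x + h e outside E, are controlled by translating the restriction
  of v to E.\<close>

theorem weak_deriv_zero_on_zero_set:
  fixes w v :: "real^'n::finite \<Rightarrow> real"
  assumes wv: "has_weak_deriv w [i] v"
    and iw: "integrable lebesgue w" and iv: "integrable lebesgue v"
    and E[measurable]: "E \<in> sets borel" and w0: "AE x in lebesgue. x \<in> E \<longrightarrow> w x = 0"
  shows "AE x in lebesgue. x \<in> E \<longrightarrow> v x = 0"
proof -
  define e :: "real^'n" where "e = axis i 1"
  have ne: "norm e = 1" by (simp add: e_def)
  obtain w' where [measurable]: "w' \<in> borel_measurable borel" and w': "AE x in lebesgue. w x = w' x"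
    using lebesgue_borel_representative[OF borel_measurable_integrable[OF iw]] by blast
  obtain v' where [measurable]: "v' \<in> borel_measurable borel" and v': "AE x in lebesgue. v x = v' x"
    using lebesgue_borel_representative[OF borel_measurable_integrable[OF iv]] by blast
  have iw': "integrable lborel w'" by (rule integrable_AE_borel[OF iw _ w']) simp
  have iv': "integrable lborel v'" by (rule integrable_AE_borel[OF iv _ v']) simp
  have "AE x in lebesgue. x \<in> E \<longrightarrow> w' x = 0" using w0 w' by eventually_elim simp
  then have w'0: "AE x in lborel. x \<in> E \<longrightarrow> w' x = 0" by (simp add: AE_completion_iff)
  define g where "g x = v' x * indicator E x" for x
  have ig: "integrable lborel g"
    unfolding g_def by (rule Bochner_Integration.integrable_bound[OF iv']) (auto simp: indicator_def)
  have small: "(LINT x|lborel. \<bar>g x\<bar>) \<le> 2 * c" if c: "c > 0" for c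
  proof -
    obtain d1 where d1: "d1 > 0" "\<And>h. norm h < d1 \<Longrightarrow> (LINT x|lborel. \<bar>v' (x + h) - v' x\<bar>) < c"
      using L1_continuous_integrable[OF iv', unfolded L1_continuous_def, rule_format, OF c] by blast
    obtain d2 where d2: "d2 > 0" "\<And>h. norm h < d2 \<Longrightarrow> (LINT x|lborel. \<bar>g (x + h) - g x\<bar>) < c"
      using L1_continuous_integrable[OF ig, unfolded L1_continuous_def, rule_format, OF c] by blast
    define h where "h = min d1 d2 / 2"
    have h: "h > 0" "h < d1" "h < d2" using d1(1) d2(1) by (auto simp: h_def)
    define V where "V x = (LINT t|lborel. v' (x + t *\<^sub>R e) * indicator {0..h} t)" for x
    have iV: "integrable lborel V"
      using weak_deriv_difference(1)[OF wv _ _ w' v' iw' iv' h(1)] by (simp add: V_def[abs_def] e_def)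
    have wV: "AE x in lborel. w' (x + h *\<^sub>R e) - w' x = V x"
      using weak_deriv_difference(2)[OF wv _ _ w' v' iw' iv' h(1)] by (simp add: V_def e_def)
    note [measurable] = borel_measurable_integrable[OF iV]
    define f where "f = (\<lambda>(x, t). \<bar>v' (x + t *\<^sub>R e) - v' x\<bar> * indicator {0..h} t)"
    have inner: "(\<integral>\<^sup>+x. ennreal \<bar>v' (x + t *\<^sub>R e) - v' x\<bar> \<partial>lborel) \<le> ennreal c" if "t \<in> {0..h}" for t
    proof -
      have "(\<integral>\<^sup>+x. ennreal \<bar>v' (x + t *\<^sub>R e) - v' x\<bar> \<partial>lborel) = ennreal (LINT x|lborel. \<bar>v' (x + t *\<^sub>R e) - v' x\<bar>)"
        by (rule nn_integral_eq_integral[OF integrable_translate_diff[OF iv']]) simp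
      also have "\<dots> \<le> ennreal c" using d1(2)[of "t *\<^sub>R e"] that h ne by (intro ennreal_leI less_imp_le) auto
      finally show ?thesis .
    qed
    have bound: "ennreal (h * \<bar>v' x\<bar>) \<le> (\<integral>\<^sup>+t. ennreal (f (x, t)) \<partial>lborel)" if V0: "V x = 0" for x
    proof (cases "integrable lborel (\<lambda>t. v' (x + t *\<^sub>R e) * indicator {0..h} t)")
      case True
      have ih: "integrable lborel (\<lambda>t. v' x * indicator {0..h} t)"
        using h by (intro integrable_mult_right integrable_real_indicator) auto
      have id: "integrable lborel (\<lambda>t. v' (x + t *\<^sub>R e) * indicator {0..h} t - v' x * indicator {0..h} t)"
        using True ih by (rule Bochner_Integration.integrable_diff)
      have "(LINT t|lborel. v' (x + t *\<^sub>R e) * indicator {0..h} t - v' x * indicator {0..h} t) = V x - h * v' x"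
        using True ih h(1) by (simp add: V_def)
      then have "ennreal (h * \<bar>v' x\<bar>) = ennreal (norm (LINT t|lborel. v' (x + t *\<^sub>R e) * indicator {0..h} t - v' x * indicator {0..h} t))"
        using V0 h(1) by (simp add: abs_mult)
      also have "\<dots> \<le> (\<integral>\<^sup>+t. ennreal (norm (v' (x + t *\<^sub>R e) * indicator {0..h} t - v' x * indicator {0..h} t)) \<partial>lborel)"
        by (rule integral_norm_bound_ennreal[OF id])
      also have "\<dots> = (\<integral>\<^sup>+t. ennreal (f (x, t)) \<partial>lborel)"
        by (intro nn_integral_cong) (auto simp: f_def indicator_def)
      finally show ?thesis .
    next
      \<comment> \<open>If the slice is not integrable, \<open>V x\<close> is 0 only by the default
        value of the integral, but then the right-hand side is infinite.\<close>
      case False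
      have "(\<integral>\<^sup>+t. ennreal (f (x, t)) \<partial>lborel) = \<infinity>"
      proof (rule ccontr)
        assume "\<not> ?thesis"
        then have "integrable lborel (\<lambda>t. (v' (x + t *\<^sub>R e) - v' x) * indicator {0..h} t)"
          by (intro integrableI_bounded) (auto simp: f_def abs_mult less_top)
        moreover have "integrable lborel (\<lambda>t. v' x * indicator {0..h} t)"
          using h by (intro integrable_mult_right integrable_real_indicator) auto
        ultimately have "integrable lborel (\<lambda>t. (v' (x + t *\<^sub>R e) - v' x) * indicator {0..h} t + v' x * indicator {0..h} t)"
          by (rule Bochner_Integration.integrable_add)
        then show False using False by (simp add: left_diff_distrib)
      qed
      then show ?thesis by simp
    qed
    have fm[measurable]: "f \<in> borel_measurable (lborel \<Otimes>\<^sub>M lborel)" unfolding f_def by measurable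
    define A where "A = {x \<in> E. x + h *\<^sub>R e \<in> E}"
    have [measurable]: "A \<in> sets borel" unfolding A_def by measurable
    have "AE x in lborel. h *\<^sub>R e + x \<in> E \<longrightarrow> w' (h *\<^sub>R e + x) = 0"
      by (rule AE_lborel_translate[OF w'0])
    then have "AE x in lborel. ennreal (h * \<bar>v' x\<bar>) * indicator A x \<le> (\<integral>\<^sup>+t. ennreal (f (x, t)) \<partial>lborel)"
      using w'0 wV
    proof eventually_elim
      case (elim x)
      show ?case
      proof (cases "x \<in> A")
        case True
        then have "V x = 0" using elim by (auto simp: A_def add.commute)
        from bound[OF this] True show ?thesis by simp
      qed simp
    qed
    then have "(\<integral>\<^sup>+x. ennreal (h * \<bar>v' x\<bar>) * indicator A x \<partial>lborel) \<le> (\<integral>\<^sup>+x. \<integral>\<^sup>+t. ennreal (f (x, t)) \<partial>lborel \<partial>lborel)"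
      by (rule nn_integral_mono_AE)
    also have "\<dots> = (\<integral>\<^sup>+t. \<integral>\<^sup>+x. ennreal (f (x, t)) \<partial>lborel \<partial>lborel)"
      using lborel_pair.Fubini'[of "\<lambda>x t. ennreal (f (x, t))"] by simp
    also have "\<dots> \<le> (\<integral>\<^sup>+t. ennreal c * indicator {0..h} t \<partial>lborel)"
    proof (rule nn_integral_mono)
      fix t
      show "(\<integral>\<^sup>+x. ennreal (f (x, t)) \<partial>lborel) \<le> ennreal c * indicator {0..h} t"
        using inner[of t] by (auto simp: f_def indicator_def)
    qed
    also have "\<dots> = ennreal (h * c)" using h(1) c by (simp add: nn_integral_cmult_indicator ennreal_mult mult.commute)
    finally have nnA: "(\<integral>\<^sup>+x. ennreal (h * \<bar>v' x\<bar>) * indicator A x \<partial>lborel) \<le> ennreal (h * c)" .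
    have iA: "integrable lborel (\<lambda>x. \<bar>v' x\<bar> * indicator A x)"
      by (rule Bochner_Integration.integrable_bound[OF iv']) (auto simp: indicator_def)
    have "(\<integral>\<^sup>+x. ennreal (h * \<bar>v' x\<bar>) * indicator A x \<partial>lborel) = (\<integral>\<^sup>+x. ennreal (h * (\<bar>v' x\<bar> * indicator A x)) \<partial>lborel)"
      by (intro nn_integral_cong) (auto simp: indicator_def)
    also have "\<dots> = ennreal (LINT x|lborel. h * (\<bar>v' x\<bar> * indicator A x))"
      using h(1) by (intro nn_integral_eq_integral integrable_mult_right iA) auto
    finally have "h * (LINT x|lborel. \<bar>v' x\<bar> * indicator A x) \<le> h * c"
      using nnA h(1) c by (simp add: ennreal_le_iff)
    then have A: "(LINT x|lborel. \<bar>v' x\<bar> * indicator A x) \<le> c" using h(1) by simp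
    have "(LINT x|lborel. \<bar>g x\<bar>) \<le> (LINT x|lborel. \<bar>v' x\<bar> * indicator A x + \<bar>g (x + h *\<^sub>R e) - g x\<bar>)"
    proof (rule integral_mono)
      show "integrable lborel (\<lambda>x. \<bar>g x\<bar>)" using ig by simp
      show "integrable lborel (\<lambda>x. \<bar>v' x\<bar> * indicator A x + \<bar>g (x + h *\<^sub>R e) - g x\<bar>)"
        by (intro Bochner_Integration.integrable_add iA integrable_translate_diff ig)
      \<comment> \<open>For x in E outside A, g vanishes at x + h e, so the translation difference
        is all of |g x|.\<close>
      show "\<bar>g x\<bar> \<le> \<bar>v' x\<bar> * indicator A x + \<bar>g (x + h *\<^sub>R e) - g x\<bar>" for x
        by (auto simp: g_def A_def indicator_def)
    qed
    also have "\<dots> = (LINT x|lborel. \<bar>v' x\<bar> * indicator A x) + (LINT x|lborel. \<bar>g (x + h *\<^sub>R e) - g x\<bar>)"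
      by (intro Bochner_Integration.integral_add iA integrable_translate_diff ig)
    also have "\<dots> \<le> c + c" using A d2(2)[of "h *\<^sub>R e"] h ne by (intro add_mono less_imp_le) auto
    finally show ?thesis by simp
  qed
  have "(LINT x|lborel. \<bar>g x\<bar>) \<le> 0"
  proof (rule field_le_epsilon)
    fix c :: real assume "c > 0"
    then show "(LINT x|lborel. \<bar>g x\<bar>) \<le> 0 + c" using small[of "c / 2"] by simp
  qed
  moreover have "(LINT x|lborel. \<bar>g x\<bar>) \<ge> 0" by simp
  ultimately have "(LINT x|lborel. \<bar>g x\<bar>) = 0" by linarith
  then have "AE x in lborel. g x = 0"
    using integral_nonneg_eq_0_iff_AE[of lborel "\<lambda>x. \<bar>g x\<bar>"] ig by simp
  then have "AE x in lebesgue. g x = 0" by (rule AE_completion)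
  then show ?thesis using v' by eventually_elim (auto simp: g_def indicator_def split: if_splits)
qed

section \<open>Mollified representation in the weak setting\<close>

lemma has_weak_deriv_Nil: "locally_integrable u \<Longrightarrow> has_weak_deriv u [] u"
  by (simp add: has_weak_deriv_def)

text \<open>Testing u against \<open>partials js\<close> of the test function
  \<open>partials is f\<close> moves the front part of the list onto u; what remains is the test of
  v against \<open>partials is f\<close>.\<close>

lemma has_weak_deriv_append:
  assumes v: "has_weak_deriv u js v" and z: "has_weak_deriv u (js @ is) z"
  shows "has_weak_deriv v is z"
  unfolding has_weak_deriv_def
proof (intro conjI allI impI)
  show "locally_integrable v" "locally_integrable z" using v z by (auto simp: has_weak_deriv_def)
  fix f :: "real^'a \<Rightarrow> real" assume f: "test_function f"
  have 1: "(LINT x|lebesgue. u x * partials js (partials is f) x) = (- 1) ^ length js * (LINT x|lebesgue. v x * partials is f x)"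
    using v test_function_partials[OF f] unfolding has_weak_deriv_def by blast
  have 2: "(LINT x|lebesgue. u x * partials js (partials is f) x) = (- 1) ^ length (js @ is) * (LINT x|lebesgue. z x * f x)"
    using z f unfolding has_weak_deriv_def partials_append by blast
  have s: "(- 1) ^ length js * (- 1) ^ length js = (1 :: real)"
    by (simp add: power_add[symmetric] mult_2[symmetric])
  have "(LINT x|lebesgue. v x * partials is f x) = (- 1) ^ length js * ((- 1) ^ length js * (LINT x|lebesgue. v x * partials is f x))"
    unfolding mult.assoc[symmetric] s by simp
  also have "\<dots> = (- 1) ^ length js * ((- 1) ^ length js * ((- 1) ^ length is * (LINT x|lebesgue. z x * f x)))"
    unfolding 1[symmetric] 2 by (simp add: power_add)
  also have "\<dots> = (- 1) ^ length is * (LINT x|lebesgue. z x * f x)"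
    unfolding mult.assoc[symmetric] s by simp
  finally show "(LINT x|lebesgue. v x * partials is f x) = (- 1) ^ length is * (LINT x|lebesgue. z x * f x)" .
qed

lemma has_weak_deriv_cmult_sum:
  fixes u v :: "'i \<Rightarrow> real^'n::finite \<Rightarrow> real"
  assumes "\<And>i. i \<in> I \<Longrightarrow> has_weak_deriv (u i) is (v i)"
  shows "has_weak_deriv (\<lambda>x. c * (\<Sum>i\<in>I. u i x)) is (\<lambda>x. c * (\<Sum>i\<in>I. v i x))"
  unfolding has_weak_deriv_def
proof (intro conjI allI impI)
  have l: "locally_integrable (u i)" "locally_integrable (v i)" if "i \<in> I" for i
    using assms[OF that] by (auto simp: has_weak_deriv_def)
  show "locally_integrable (\<lambda>x. c * (\<Sum>i\<in>I. u i x))" "locally_integrable (\<lambda>x. c * (\<Sum>i\<in>I. v i x))"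
    by (intro locally_integrable_cmult locally_integrable_sum l; assumption)+
  fix f :: "real^'n \<Rightarrow> real" assume f: "test_function f"
  have lin: "(LINT x|lebesgue. c * (\<Sum>i\<in>I. w i x) * g x) = c * (\<Sum>i\<in>I. LINT x|lebesgue. w i x * g x)"
    if g: "test_function g" and w: "\<And>i. i \<in> I \<Longrightarrow> locally_integrable (w i)" for g w
  proof -
    have "(LINT x|lebesgue. c * (\<Sum>i\<in>I. w i x) * g x) = (LINT x|lebesgue. c * (\<Sum>i\<in>I. w i x * g x))"
      by (simp add: sum_distrib_right mult.assoc)
    also have "\<dots> = c * (LINT x|lebesgue. (\<Sum>i\<in>I. w i x * g x))" by simp
    also have "(LINT x|lebesgue. (\<Sum>i\<in>I. w i x * g x)) = (\<Sum>i\<in>I. LINT x|lebesgue. w i x * g x)"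
      by (rule Bochner_Integration.integral_sum) (rule integrable_lebesgue_mult_test[OF w g])
    finally show ?thesis .
  qed
  have "(LINT x|lebesgue. u i x * partials is f x) = (- 1) ^ length is * (LINT x|lebesgue. v i x * f x)" if "i \<in> I" for i
    using assms[OF that] f unfolding has_weak_deriv_def by blast
  then show "(LINT x|lebesgue. c * (\<Sum>i\<in>I. u i x) * partials is f x) = (- 1) ^ length is * (LINT x|lebesgue. c * (\<Sum>i\<in>I. v i x) * f x)"
  proof -
    assume eq: "\<And>i. i \<in> I \<Longrightarrow> (LINT x|lebesgue. u i x * partials is f x) = (- 1) ^ length is * (LINT x|lebesgue. v i x * f x)"
    have "(LINT x|lebesgue. c * (\<Sum>i\<in>I. u i x) * partials is f x) = c * (\<Sum>i\<in>I. (- 1) ^ length is * (LINT x|lebesgue. v i x * f x))"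
      by (subst lin[OF test_function_partials[OF f]]) (auto intro: l simp: eq)
    also have "\<dots> = (- 1) ^ length is * (c * (\<Sum>i\<in>I. (LINT x|lebesgue. v i x * f x)))"
      by (simp add: sum_distrib_left mult.left_commute)
    also have "c * (\<Sum>i\<in>I. (LINT x|lebesgue. v i x * f x)) = (LINT x|lebesgue. c * (\<Sum>i\<in>I. v i x) * f x)"
      by (rule lin[OF f, symmetric]) (rule l(2))
    finally show ?thesis .
  qed
qed

lemma weakly_differentiable_weak_deriv:
  "weakly_differentiable k u \<Longrightarrow> length is \<le> k \<Longrightarrow> has_weak_deriv u is (weak_deriv is u)"
  unfolding weakly_differentiable_def using has_weak_deriv_weak_deriv by blast

lemma weakly_differentiable_locally_integrable:
  "weakly_differentiable k u \<Longrightarrow> locally_integrable u"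
  using weakly_differentiable_weak_deriv[of k u "[]"] by (simp add: has_weak_deriv_def)

lemma neg_laplacian_eq: "neg_laplacian u = (\<lambda>x. (- 1) * (\<Sum>i\<in>UNIV. weak_deriv [i, i] u x))"
  by (simp add: neg_laplacian_def fun_eq_iff)

lemma weakly_differentiable_neg_laplacian:
  assumes "weakly_differentiable (k + 2) u"
  shows "weakly_differentiable k (neg_laplacian u)"
  unfolding weakly_differentiable_def
proof (intro allI impI)
  fix "is" :: "'a list" assume l: "length is \<le> k"
  have "has_weak_deriv (weak_deriv [i, i] u) is (weak_deriv ([i, i] @ is) u)" for i
    by (rule has_weak_deriv_append[OF weakly_differentiable_weak_deriv weakly_differentiable_weak_deriv, OF assms _ assms])
       (use l in auto)
  then show "\<exists>v. has_weak_deriv (neg_laplacian u) is v"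
    unfolding neg_laplacian_eq by (intro exI, rule has_weak_deriv_cmult_sum)
qed

text \<open>The condition is imposed only almost everywhere: the chosen weak derivatives are
  determined up to null sets, although u itself vanishes at every point outside \<Omega>.\<close>

definition null_off :: "'a::euclidean_space set \<Rightarrow> ('a \<Rightarrow> real) \<Rightarrow> bool" where
  "null_off \<Omega> u \<longleftrightarrow> (AE x in lebesgue. x \<notin> \<Omega> \<longrightarrow> u x = 0)"

text \<open>The boundary of \<open>\<Omega>\<close> may have positive measure, so locality of weak derivatives is not enough.\<close>

lemma weak_deriv_null_off:
  fixes u :: "real^'n::finite \<Rightarrow> real"
  assumes \<Omega>: "open \<Omega>" "bounded \<Omega>" and u: "weakly_differentiable k u" "null_off \<Omega> u"
  shows "length is \<le> k \<Longrightarrow> null_off \<Omega> (weak_deriv is u)"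
proof (induction "is" rule: rev_induct)
  case Nil
  have "AE x in lebesgue. weak_deriv [] u x = u x"
    by (rule weak_deriv_AE_eq[OF has_weak_deriv_Nil[OF weakly_differentiable_locally_integrable[OF u(1)]]])
  then show ?case using u(2) unfolding null_off_def by eventually_elim simp
next
  case (snoc i js)
  obtain r0 where "\<And>x. x \<in> \<Omega> \<Longrightarrow> norm x \<le> r0" using \<Omega>(2) unfolding bounded_iff by blast
  then have r: "\<And>x. x \<in> \<Omega> \<Longrightarrow> norm x < \<bar>r0\<bar> + 1" by fastforce
  have "AE x in lebesgue. norm x \<ge> \<bar>r0\<bar> + 1 \<longrightarrow> u x = 0"
    using u(2) unfolding null_off_def by eventually_elim (use r in force)
  note int = integrable_lebesgue_bounded_support[OF _ weak_deriv_zero_outside_ball[OF _ _ this]]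
  have wd: "has_weak_deriv u js (weak_deriv js u)" "has_weak_deriv u (js @ [i]) (weak_deriv (js @ [i]) u)"
    using snoc.prems by (auto intro!: weakly_differentiable_weak_deriv[OF u(1)])
  have i1: "integrable lebesgue (weak_deriv js u)"
    by (rule int[OF _ wd(1)]) (use wd in \<open>auto simp: has_weak_deriv_def\<close>)
  have i2: "integrable lebesgue (weak_deriv (js @ [i]) u)"
    by (rule int[OF _ wd(2)]) (use wd in \<open>auto simp: has_weak_deriv_def\<close>)
  \<comment> \<open>The zero set is taken to be the whole complement of \<Omega>, boundary included.
    Integrability of both functions comes from their bounded support.\<close>
  have "AE x in lebesgue. x \<in> - \<Omega> \<longrightarrow> weak_deriv (js @ [i]) u x = 0"
    by (rule weak_deriv_zero_on_zero_set[OF has_weak_deriv_append[OF wd] i1 i2])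
       (use \<Omega>(1) snoc in \<open>auto simp: null_off_def\<close>)
  then show ?case by (simp add: null_off_def)
qed

lemma null_off_neg_laplacian:
  fixes u :: "real^'n::finite \<Rightarrow> real"
  assumes \<Omega>: "open \<Omega>" "bounded \<Omega>" and u: "weakly_differentiable (k + 2) u" "null_off \<Omega> u"
  shows "null_off \<Omega> (neg_laplacian u)"
proof -
  have "AE x in lebesgue. x \<notin> \<Omega> \<longrightarrow> weak_deriv [i, i] u x = 0" for i
    using weak_deriv_null_off[OF \<Omega> u, of "[i, i]"] by (simp add: null_off_def)
  then have "AE x in lebesgue. \<forall>i\<in>UNIV. x \<notin> \<Omega> \<longrightarrow> weak_deriv [i, i] u x = 0"
    by (intro AE_finite_allI) auto
  then show ?thesis
    unfolding null_off_def neg_laplacian_def by eventually_elim simp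
qed

lemma neg_lap_convolution:
  fixes u :: "real^'n::finite \<Rightarrow> real"
  assumes u: "weakly_differentiable (k + 2) u" and f: "test_function f"
  shows "neg_lap (convolution u f) = convolution (neg_laplacian u) f"
proof
  fix x
  have wd: "has_weak_deriv u [i, i] (weak_deriv [i, i] u)" for i
    by (rule weakly_differentiable_weak_deriv[OF u]) simp
  have "convolution (neg_laplacian u) f x = (LINT y|lebesgue. - (\<Sum>i\<in>UNIV. weak_deriv [i, i] u y * f (x - y)))"
    unfolding convolution_def neg_laplacian_def by (simp add: sum_distrib_right)
  also have "\<dots> = - (\<Sum>i\<in>UNIV. LINT y|lebesgue. weak_deriv [i, i] u y * f (x - y))"
    by (subst Bochner_Integration.integral_minus, subst Bochner_Integration.integral_sum)
       (use wd in \<open>auto intro!: integrable_convolution f simp: has_weak_deriv_def\<close>)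
  also have "\<dots> = neg_lap (convolution u f) x"
    unfolding neg_lap_def convolution_weak_deriv[OF wd f] by (simp add: convolution_def)
  finally show "neg_lap (convolution u f) x = convolution (neg_laplacian u) f x" by simp
qed

text \<open>The three claims go through one induction: each further Laplacian uses the
  differentiability left over by the previous ones, both to vanish off \<Omega> and to pass under
  the convolution.\<close>

lemma neg_laplacian_funpow:
  fixes u :: "real^'n::finite \<Rightarrow> real"
  assumes \<Omega>: "open \<Omega>" "bounded \<Omega>" and u: "weakly_differentiable k u" "null_off \<Omega> u" and f: "test_function f"
  shows "2 * m \<le> k \<Longrightarrow> weakly_differentiable (k - 2 * m) ((neg_laplacian ^^ m) u) \<and> null_off \<Omega> ((neg_laplacian ^^ m) u)
    \<and> (neg_lap ^^ m) (convolution u f) = convolution ((neg_laplacian ^^ m) u) f"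
proof (induction m)
  case (Suc m)
  define w where "w = (neg_laplacian ^^ m) u"
  have e: "k - 2 * m = (k - 2 * Suc m) + 2" using Suc.prems by simp
  have w: "weakly_differentiable ((k - 2 * Suc m) + 2) w" "null_off \<Omega> w" "(neg_lap ^^ m) (convolution u f) = convolution w f"
    using Suc unfolding w_def e[symmetric] by auto
  then show ?case
    using weakly_differentiable_neg_laplacian[OF w(1)] null_off_neg_laplacian[OF \<Omega> w(1,2)] neg_lap_convolution[OF w(1) f]
    by (simp add: w_def)
qed (use u in simp)

lemma partials_translate:
  assumes "smooth f"
  shows "smooth (\<lambda>y. f (c + y))" "partials is (\<lambda>y. f (c + y)) y = partials is f (c + y)"
proof -
  have r: "(\<lambda>y. f (c + y)) = (\<lambda>y. (\<lambda>z. f (c - z)) (0 - y))" by simp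
  note s = smooth_reflect[OF assms, where c = c]
  show "smooth (\<lambda>y. f (c + y))" unfolding r by (rule smooth_reflect(1)[OF s(1)])
  show "partials is (\<lambda>y. f (c + y)) y = partials is f (c + y)"
    unfolding r smooth_reflect(2)[OF s(1)] s(2)
    by (simp add: mult.assoc[symmetric] power_add[symmetric] mult_2[symmetric])
qed

lemma test_function_translate:
  assumes "test_function f"
  shows "test_function (\<lambda>y. f (c + y))"
  using test_function_reflect[OF test_function_reflect[OF assms, of c], of 0] by simp

lemma neg_lap_funpow_translate:
  assumes f: "test_function f"
  shows "(neg_lap ^^ m) (\<lambda>y. f (c + y)) = (\<lambda>y. (neg_lap ^^ m) f (c + y))"
proof (induction m)
  case (Suc m)
  have s: "smooth ((neg_lap ^^ m) f)" by (rule test_function_smooth[OF test_function_neg_lap_funpow[OF f]])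
  have "neg_lap (\<lambda>y. (neg_lap ^^ m) f (c + y)) = (\<lambda>y. neg_lap ((neg_lap ^^ m) f) (c + y))"
    by (rule ext) (simp only: neg_lap_def[of "\<lambda>y. (neg_lap ^^ m) f (c + y)"] neg_lap_def[of "(neg_lap ^^ m) f"] partials_translate(2)[OF s])
  then show ?case by (simp add: Suc)
qed simp

text \<open>If f is not integrable, the left side is 0 by the default value of the integral, so the
  bound holds for every f.\<close>

lemma abs_integral_le_nn_integral:
  fixes f :: "'a \<Rightarrow> real"
  shows "ennreal \<bar>LINT x|M. f x\<bar> \<le> (\<integral>\<^sup>+x. ennreal \<bar>f x\<bar> \<partial>M)"
proof (cases "integrable M f")
  case True
  then show ?thesis using integral_norm_bound_ennreal[OF True] by simp
qed (simp add: not_integrable_integral_eq)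

lemma norm_D_borel:
  fixes u :: "real^'n::finite \<Rightarrow> real"
  assumes \<Omega>: "open \<Omega>" "bounded \<Omega>" and u: "weakly_differentiable k u" "null_off \<Omega> u"
  shows "norm_D k u \<in> borel_measurable lebesgue" "null_off \<Omega> (norm_D k u)"
proof -
  have "norm_D k u \<in> borel_measurable lebesgue \<and> null_off \<Omega> (norm_D k u)"
  proof (cases "odd k")
    case True
    define m where "m = (k - 1) div 2"
    define w where "w = (neg_laplacian ^^ m) u"
    have k: "2 * m \<le> k" "k - 2 * m = 1" using True by (auto simp: m_def elim: oddE)
    have w: "weakly_differentiable 1 w" "null_off \<Omega> w"
      using neg_laplacian_funpow[OF \<Omega> u test_function_zero, of m] k by (auto simp: w_def)
    have D: "norm_D k u = (\<lambda>x. sqrt (\<Sum>i\<in>UNIV. (weak_deriv [i] w x)\<^sup>2))"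
      using True by (simp add: norm_D_def fun_eq_iff w_def m_def weak_gradient_def norm_vec_def L2_set_def)
    have wd: "has_weak_deriv w [i] (weak_deriv [i] w)" for i by (rule weakly_differentiable_weak_deriv[OF w(1)]) simp
    then have [measurable]: "weak_deriv [i] w \<in> borel_measurable lebesgue" for i
      by (auto intro!: locally_integrable_borel simp: has_weak_deriv_def)
    have "AE x in lebesgue. x \<notin> \<Omega> \<longrightarrow> weak_deriv [i] w x = 0" for i
      using weak_deriv_null_off[OF \<Omega> w, of "[i]"] by (simp add: null_off_def)
    then have "AE x in lebesgue. \<forall>i\<in>UNIV. x \<notin> \<Omega> \<longrightarrow> weak_deriv [i] w x = 0"
      by (intro AE_finite_allI) auto
    then have "null_off \<Omega> (norm_D k u)"
      unfolding null_off_def D by eventually_elim simp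
    moreover have "norm_D k u \<in> borel_measurable lebesgue" unfolding D by measurable
    ultimately show ?thesis by simp
  next
    case False
    then obtain m where k: "k = 2 * m" by (auto elim: evenE)
    have D: "norm_D k u = (\<lambda>x. \<bar>(neg_laplacian ^^ m) u x\<bar>)"
      using False by (simp add: norm_D_def fun_eq_iff k)
    have w: "weakly_differentiable 0 ((neg_laplacian ^^ m) u)" "null_off \<Omega> ((neg_laplacian ^^ m) u)"
      using neg_laplacian_funpow[OF \<Omega> u test_function_zero, of m] k by auto
    have [measurable]: "(neg_laplacian ^^ m) u \<in> borel_measurable lebesgue"
      by (rule locally_integrable_borel[OF weakly_differentiable_locally_integrable[OF w(1)]])
    show ?thesis using w(2) unfolding D null_off_def by (auto elim: eventually_mono)
  qed
  then show "norm_D k u \<in> borel_measurable lebesgue" "null_off \<Omega> (norm_D k u)" by auto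
qed

definition riesz_const :: "'n::finite itself \<Rightarrow> nat \<Rightarrow> real" where
  "riesz_const N k = (if even k then riesz_gamma CARD('n) (real k) else riesz_gamma_tilde N (real k - 1))"

text \<open>The representation formula is applied to the mollified function translated to x, whose
  D^k is the mollification of D^k u. Exchanging integrals leaves a mean over w of potentials of f at
  x - w, so any bound that is uniform in the base point carries over.\<close>

lemma riesz_potential_bound_mollified:
  fixes u f :: "real^'n::finite \<Rightarrow> real"
  assumes \<Omega>: "open \<Omega>" "bounded \<Omega>" and u: "weakly_differentiable k u" "null_off \<Omega> u"
    and k: "1 \<le> k" "k < CARD('n)" and e: "e > 0"
    and f[measurable]: "f \<in> borel_measurable borel" and Df: "AE x in lebesgue. norm_D k u x = f x" and f0: "\<And>x. f x \<ge> 0"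
  shows "ennreal \<bar>riesz_const TYPE('n) k * convolution u (mollifier e) x\<bar> \<le>
    (\<integral>\<^sup>+w. ennreal (mollifier e w) * (\<integral>\<^sup>+y. ennreal (norm y powr (real k - real CARD('n))) * ennreal (f (x - w + y)) \<partial>lborel) \<partial>lborel)"
proof -
  define \<eta> where "\<eta> = (mollifier e :: real^'n \<Rightarrow> real)"
  have \<eta>: "test_function \<eta>" unfolding \<eta>_def by (rule test_function_mollifier[OF e])
  note [measurable] = test_function_borel[OF \<eta>]
  have \<eta>0: "\<eta> y \<ge> 0" for y unfolding \<eta>_def by (rule mollifier_nonneg[OF e])
  define N where "N = real CARD('n)"
  define F where "F = convolution u \<eta>"
  have lu: "locally_integrable u" by (rule weakly_differentiable_locally_integrable[OF u(1)])
  obtain r where r: "\<And>x. x \<in> \<Omega> \<Longrightarrow> norm x \<le> r" using \<Omega>(2) unfolding bounded_iff by blast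
  have F: "test_function F"
  proof -
    \<comment> \<open>u vanishes outside \<Omega> only almost everywhere. The truncation has the
      same convolution and vanishes at every point of the complement, which makes F a test
      function.\<close>
    define u' where "u' x = indicator \<Omega> x * u x" for x
    have "AE x in lebesgue. u x = u' x" using u(2) unfolding null_off_def u'_def by eventually_elim (auto simp: indicator_def)
    have lu': "locally_integrable u'"
      unfolding locally_integrable_def set_integrable_def
    proof (intro allI impI)
      fix K :: "(real^'n) set" assume "compact K"
      then have iK: "integrable lebesgue (\<lambda>x. indicat_real K x *\<^sub>R u x)"
        using lu unfolding locally_integrable_def set_integrable_def by simp
      have "(\<lambda>x. indicat_real \<Omega> x * (indicat_real K x *\<^sub>R u x)) \<in> borel_measurable lebesgue"
        using \<Omega>(1) by (intro borel_measurable_times borel_measurable_integrable[OF iK] borel_imp_lebesgue borel_measurable_indicator) auto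
      then have m: "(\<lambda>x. indicat_real K x *\<^sub>R u' x) \<in> borel_measurable lebesgue" by (simp add: u'_def mult_ac)
      show "integrable lebesgue (\<lambda>x. indicat_real K x *\<^sub>R u' x)"
        by (rule Bochner_Integration.integrable_bound[OF iK m]) (auto simp: u'_def indicator_def)
    qed
    have "F = convolution u' \<eta>"
      unfolding F_def convolution_def
    proof (intro ext integral_cong_AE)
      show "(\<lambda>y. u y * \<eta> (x - y)) \<in> borel_measurable lebesgue" for x
        by (rule borel_measurable_integrable[OF integrable_convolution[OF lu \<eta>]])
      show "(\<lambda>y. u' y * \<eta> (x - y)) \<in> borel_measurable lebesgue" for x
        by (rule borel_measurable_integrable[OF integrable_convolution[OF lu' \<eta>]])
      show "AE y in lebesgue. u y * \<eta> (x - y) = u' y * \<eta> (x - y)" for x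
        using \<open>AE x in lebesgue. u x = u' x\<close> by eventually_elim simp
    qed
    moreover have "test_function (convolution u' \<eta>)"
      by (rule test_function_convolution[OF lu' \<eta>, of r]) (use r in \<open>auto simp: u'_def indicator_def dest!: r\<close>)
    ultimately show ?thesis by simp
  qed
  define g where "g y = F (x + y)" for y
  have g: "test_function g" unfolding g_def by (rule test_function_translate[OF F])
  \<comment> \<open>Serves both parities: q is the iterated Laplacian of u with c = 1, or the scalar
    product of y with its gradient and c = |y|.\<close>
  have conv_bound: "ennreal \<bar>LINT z|lebesgue. q z * \<eta> (y - z)\<bar> \<le> ennreal c * (\<integral>\<^sup>+z. ennreal (f z * \<eta> (y - z)) \<partial>lborel)"
    if q: "AE z in lebesgue. \<bar>q z\<bar> \<le> c * f z" and c: "c \<ge> 0" for q y c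
  proof -
    have "ennreal \<bar>LINT z|lebesgue. q z * \<eta> (y - z)\<bar> \<le> (\<integral>\<^sup>+z. ennreal \<bar>q z * \<eta> (y - z)\<bar> \<partial>lebesgue)"
      by (rule abs_integral_le_nn_integral)
    also have "\<dots> \<le> (\<integral>\<^sup>+z. ennreal c * ennreal (f z * \<eta> (y - z)) \<partial>lebesgue)"
    proof (rule nn_integral_mono_AE)
      show "AE z in lebesgue. ennreal \<bar>q z * \<eta> (y - z)\<bar> \<le> ennreal c * ennreal (f z * \<eta> (y - z))"
        using q
      proof eventually_elim
        case (elim z)
        then have "\<bar>q z\<bar> * \<eta> (y - z) \<le> c * f z * \<eta> (y - z)" using \<eta>0 by (rule mult_right_mono)
        then show ?case using c f0 \<eta>0 by (simp add: abs_mult ennreal_mult[symmetric] mult.assoc)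
      qed
    qed
    also have "\<dots> = ennreal c * (\<integral>\<^sup>+z. ennreal (f z * \<eta> (y - z)) \<partial>lborel)"
      by (simp add: nn_integral_completion nn_integral_cmult)
    finally show ?thesis .
  qed
  have main: "ennreal \<bar>riesz_const TYPE('n) k * F x\<bar> \<le> (\<integral>\<^sup>+y. ennreal (norm y powr (real k - N)) * (\<integral>\<^sup>+z. ennreal (f z * \<eta> (x + y - z)) \<partial>lborel) \<partial>lborel)"
  proof (cases "odd k")
    case False
    then obtain m where m: "k = 2 * m" by (auto elim: evenE)
    define w where "w = (neg_laplacian ^^ m) u"
    have w: "(neg_lap ^^ m) F = convolution w \<eta>"
      using neg_laplacian_funpow[OF \<Omega> u \<eta>, of m] m by (simp add: F_def w_def)
    have "riesz_const TYPE('n) k * F x = (LINT y|lborel. norm y powr (real k - N) * (neg_lap ^^ m) g y)"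
      using riesz_representation_even[OF g, of m] k m by (simp add: riesz_const_def g_def N_def)
    also have "\<dots> = (LINT y|lborel. norm y powr (real k - N) * convolution w \<eta> (x + y))"
      unfolding g_def neg_lap_funpow_translate[OF F] w ..
    finally have "ennreal \<bar>riesz_const TYPE('n) k * F x\<bar> \<le> (\<integral>\<^sup>+y. ennreal \<bar>norm y powr (real k - N) * convolution w \<eta> (x + y)\<bar> \<partial>lborel)"
      using abs_integral_le_nn_integral by metis
    also have "\<dots> \<le> (\<integral>\<^sup>+y. ennreal (norm y powr (real k - N)) * (\<integral>\<^sup>+z. ennreal (f z * \<eta> (x + y - z)) \<partial>lborel) \<partial>lborel)"
    proof (rule nn_integral_mono)
      fix y
      have "AE z in lebesgue. \<bar>w z\<bar> \<le> 1 * f z"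
        using Df by eventually_elim (simp add: norm_D_def m w_def)
      from conv_bound[OF this, of "x + y"]
      have "ennreal \<bar>convolution w \<eta> (x + y)\<bar> \<le> (\<integral>\<^sup>+z. ennreal (f z * \<eta> (x + y - z)) \<partial>lborel)"
        by (simp add: convolution_def)
      then show "ennreal \<bar>norm y powr (real k - N) * convolution w \<eta> (x + y)\<bar> \<le> ennreal (norm y powr (real k - N)) * (\<integral>\<^sup>+z. ennreal (f z * \<eta> (x + y - z)) \<partial>lborel)"
        by (simp add: abs_mult ennreal_mult mult_left_mono)
    qed
    finally show ?thesis .
  next
    case True
    then obtain m where m: "k = 2 * m + 1" by (auto elim: oddE)
    define w where "w = (neg_laplacian ^^ m) u"
    have w: "(neg_lap ^^ m) F = convolution w \<eta>" "weakly_differentiable 1 w"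
      using neg_laplacian_funpow[OF \<Omega> u \<eta>, of m] m by (auto simp add: F_def w_def)
    have wd: "has_weak_deriv w [i] (weak_deriv [i] w)" for i by (rule weakly_differentiable_weak_deriv[OF w(2)]) simp
    have lw: "locally_integrable (weak_deriv [i] w)" for i using wd by (simp add: has_weak_deriv_def)
    have "riesz_const TYPE('n) k * F x = (LINT y|lborel. norm y powr (real (2 * m) - N) * (- radial_deriv ((neg_lap ^^ m) g) y))"
      using riesz_representation_odd[OF g, of m] k m True by (simp add: riesz_const_def g_def N_def)
    then have "ennreal \<bar>riesz_const TYPE('n) k * F x\<bar> \<le> (\<integral>\<^sup>+y. ennreal \<bar>norm y powr (real (2 * m) - N) * (- radial_deriv ((neg_lap ^^ m) g) y)\<bar> \<partial>lborel)"
      using abs_integral_le_nn_integral by metis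
    also have "\<dots> \<le> (\<integral>\<^sup>+y. ennreal (norm y powr (real k - N)) * (\<integral>\<^sup>+z. ennreal (f z * \<eta> (x + y - z)) \<partial>lborel) \<partial>lborel)"
    proof (rule nn_integral_mono)
      fix y :: "real^'n"
      have sm: "smooth (convolution w \<eta>)"
        using test_function_smooth[OF test_function_neg_lap_funpow[OF F, of m]] w by simp
      have "radial_deriv ((neg_lap ^^ m) g) y = (\<Sum>i\<in>UNIV. y $ i * partials [i] (convolution w \<eta>) (x + y))"
        unfolding radial_deriv_def g_def neg_lap_funpow_translate[OF F] w partials_translate(2)[OF sm] ..
      also have "\<dots> = (\<Sum>i\<in>UNIV. y $ i * (LINT z|lebesgue. weak_deriv [i] w z * \<eta> (x + y - z)))"
        unfolding convolution_weak_deriv[OF wd \<eta>] by (simp add: convolution_def)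
      also have "\<dots> = (LINT z|lebesgue. (\<Sum>i\<in>UNIV. y $ i * (weak_deriv [i] w z * \<eta> (x + y - z))))"
        by (subst Bochner_Integration.integral_sum) (auto intro!: integrable_mult_right integrable_convolution lw \<eta>)
      also have "\<dots> = (LINT z|lebesgue. (y \<bullet> weak_gradient w z) * \<eta> (x + y - z))"
        by (simp add: inner_vec_def weak_gradient_def sum_distrib_right mult.assoc)
      finally have rd: "radial_deriv ((neg_lap ^^ m) g) y = (LINT z|lebesgue. (y \<bullet> weak_gradient w z) * \<eta> (x + y - z))" .
      have "AE z in lebesgue. \<bar>y \<bullet> weak_gradient w z\<bar> \<le> norm y * f z"
        using Df
      proof eventually_elim
        case (elim z)
        then have "f z = norm (weak_gradient w z)" using True by (simp add: norm_D_def m w_def)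
        then show ?case using Cauchy_Schwarz_ineq2 by metis
      qed
      from conv_bound[OF this, of "x + y"]
      have b: "ennreal \<bar>radial_deriv ((neg_lap ^^ m) g) y\<bar> \<le> ennreal (norm y) * (\<integral>\<^sup>+z. ennreal (f z * \<eta> (x + y - z)) \<partial>lborel)"
        unfolding rd by simp
      \<comment> \<open>The factor |y| from the Euler operator raises the exponent from 2 m - n to k
        - n. At y = 0 both sides are 0 by the convention for \<open>powr\<close>.\<close>
      have p: "norm y powr (real (2 * m) - N) * norm y = norm y powr (real k - N)"
      proof (cases "y = 0")
        case False
        then show ?thesis using powr_add[of "norm y" "real (2 * m) - N" 1] by (simp add: m algebra_simps)
      qed simp
      have "ennreal \<bar>norm y powr (real (2 * m) - N) * (- radial_deriv ((neg_lap ^^ m) g) y)\<bar>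
        = ennreal (norm y powr (real (2 * m) - N)) * ennreal \<bar>radial_deriv ((neg_lap ^^ m) g) y\<bar>"
        by (simp add: abs_mult ennreal_mult)
      also have "\<dots> \<le> ennreal (norm y powr (real (2 * m) - N)) * (ennreal (norm y) * (\<integral>\<^sup>+z. ennreal (f z * \<eta> (x + y - z)) \<partial>lborel))"
        by (rule mult_left_mono[OF b]) simp
      also have "\<dots> = ennreal (norm y powr (real k - N)) * (\<integral>\<^sup>+z. ennreal (f z * \<eta> (x + y - z)) \<partial>lborel)"
        unfolding p[symmetric] by (simp add: ennreal_mult mult.assoc)
      finally show "ennreal \<bar>norm y powr (real (2 * m) - N) * (- radial_deriv ((neg_lap ^^ m) g) y)\<bar>
        \<le> ennreal (norm y powr (real k - N)) * (\<integral>\<^sup>+z. ennreal (f z * \<eta> (x + y - z)) \<partial>lborel)" .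
    qed
    finally show ?thesis .
  qed
  also have "\<dots> = (\<integral>\<^sup>+y. \<integral>\<^sup>+w. ennreal (norm y powr (real k - N)) * (ennreal (\<eta> w) * ennreal (f (x - w + y))) \<partial>lborel \<partial>lborel)"
  proof (rule nn_integral_cong)
    fix y :: "real^'n"
    have "(\<integral>\<^sup>+z. ennreal (f z * \<eta> (x + y - z)) \<partial>lborel) = (\<integral>\<^sup>+w. ennreal (f (x + y - w) * \<eta> (x + y - (x + y - w))) \<partial>lborel)"
      by (rule nn_integral_lborel_reflect[symmetric]) measurable
    also have "\<dots> = (\<integral>\<^sup>+w. ennreal (\<eta> w) * ennreal (f (x - w + y)) \<partial>lborel)"
      using f0 \<eta>0 by (intro nn_integral_cong) (simp add: ennreal_mult[symmetric] algebra_simps)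
    finally show "ennreal (norm y powr (real k - N)) * (\<integral>\<^sup>+z. ennreal (f z * \<eta> (x + y - z)) \<partial>lborel)
      = (\<integral>\<^sup>+w. ennreal (norm y powr (real k - N)) * (ennreal (\<eta> w) * ennreal (f (x - w + y))) \<partial>lborel)"
      by (simp add: nn_integral_cmult)
  qed
  also have "\<dots> = (\<integral>\<^sup>+w. \<integral>\<^sup>+y. ennreal (norm y powr (real k - N)) * (ennreal (\<eta> w) * ennreal (f (x - w + y))) \<partial>lborel \<partial>lborel)"
    by (rule lborel_pair.Fubini') measurable
  also have "\<dots> = (\<integral>\<^sup>+w. ennreal (\<eta> w) * (\<integral>\<^sup>+y. ennreal (norm y powr (real k - N)) * ennreal (f (x - w + y)) \<partial>lborel) \<partial>lborel)"
  proof (rule nn_integral_cong)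
    fix w :: "real^'n"
    show "(\<integral>\<^sup>+y. ennreal (norm y powr (real k - N)) * (ennreal (\<eta> w) * ennreal (f (x - w + y))) \<partial>lborel)
      = ennreal (\<eta> w) * (\<integral>\<^sup>+y. ennreal (norm y powr (real k - N)) * ennreal (f (x - w + y)) \<partial>lborel)"
      by (subst nn_integral_cmult[symmetric]) (auto simp: mult_ac)
  qed
  finally show ?thesis by (simp add: F_def \<eta>_def N_def)
qed

section \<open>Exponential integrability below the threshold\<close>

lemma riesz_gamma_pos: "0 < a \<Longrightarrow> a < real n \<Longrightarrow> riesz_gamma n a > 0"
  by (simp add: riesz_gamma_def Gamma_real_pos)

lemma riesz_const_pos:
  assumes "1 \<le> k" "k < CARD('n::finite)"
  shows "riesz_const TYPE('n) k > 0"
proof (cases "even k")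
  case True
  then show ?thesis using assms by (auto simp: riesz_const_def intro!: riesz_gamma_pos)
next
  case False
  show ?thesis
  proof (cases "k = 1")
    case True
    then show ?thesis using omega_pos[where 'n='n] by (simp add: riesz_const_def riesz_gamma_tilde_def unit_ball_measure_eq)
  next
    case k: False
    then have "riesz_gamma CARD('n) (real k - 1) > 0" using assms by (intro riesz_gamma_pos) auto
    then show ?thesis using False k assms by (simp add: riesz_const_def riesz_gamma_tilde_def)
  qed
qed

text \<open>The form in which the threshold arises: d times the constant of the representation,
  divided by the slope of the far part in the logarithm of the inverse radius.\<close>

lemma beta_infty_eq:
  "beta_infty TYPE('n::finite) k d = d * riesz_const TYPE('n) k /
     (real CARD('n) * omega TYPE('n) powr ((real CARD('n) - real k) / real CARD('n)))"
  unfolding beta_infty_def riesz_const_def unit_ball_measure_eq powr_minus by (simp add: divide_inverse)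

text \<open>The ball B has at least the measure of S. The value c of the kernel on its boundary
  sphere separates the values inside from those outside, so exchanging S - B for B - S can only
  increase the integral.\<close>

lemma riesz_bathtub:
  fixes S :: "(real^'n::finite) set"
  assumes S[measurable]: "S \<in> sets borel" and \<rho>: "\<rho> > 0" and a: "a > 0" "a \<le> real CARD('n)"
    and m: "emeasure lborel S \<le> ennreal (omega TYPE('n) * \<rho> ^ CARD('n))"
  shows "(\<integral>\<^sup>+y. ennreal (norm y powr (a - real CARD('n))) * indicator S y \<partial>lborel) \<le> ennreal (real CARD('n) * omega TYPE('n) * \<rho> powr a / a)"
proof -
  define K where "K y = ennreal (norm y powr (a - real CARD('n)))" for y :: "real^'n"
  have [measurable]: "K \<in> borel_measurable borel" unfolding K_def by measurable
  define B where "B = ball (0::real^'n) \<rho>"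
  have [measurable]: "B \<in> sets borel" by (simp add: B_def)
  define c where "c = ennreal (\<rho> powr (a - real CARD('n)))"
  have mB: "emeasure lborel B = ennreal (omega TYPE('n) * \<rho> ^ CARD('n))"
    using \<rho> by (simp add: B_def emeasure_lborel_ball)
  have eS: "emeasure lborel S = emeasure lborel (S - B) + emeasure lborel (S \<inter> B)"
    by (subst plus_emeasure) (auto intro: arg_cong[where f = "emeasure lborel"])
  have eB: "emeasure lborel B = emeasure lborel (B - S) + emeasure lborel (S \<inter> B)"
    by (subst plus_emeasure) (auto intro: arg_cong[where f = "emeasure lborel"])
  have fin: "emeasure lborel (S \<inter> B) \<noteq> \<infinity>"
    using emeasure_mono[of "S \<inter> B" B lborel] mB by (auto simp: top_unique)
  have le: "emeasure lborel (S - B) \<le> emeasure lborel (B - S)"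
    using m fin unfolding mB[symmetric] eS eB
    by (simp add: add.commute[of _ "emeasure lborel (S \<inter> B)"] ennreal_add_left_cancel_le)
  have "(\<integral>\<^sup>+y. K y * indicator S y \<partial>lborel) \<le> (\<integral>\<^sup>+y. K y * indicator (S \<inter> B) y + c * indicator (S - B) y \<partial>lborel)"
  proof (rule nn_integral_mono)
    fix y :: "real^'n"
    have "K y \<le> c" if "y \<notin> B"
      using that \<rho> a unfolding K_def c_def B_def by (intro ennreal_leI powr_mono2') auto
    then show "K y * indicator S y \<le> K y * indicator (S \<inter> B) y + c * indicator (S - B) y"
      by (auto simp: indicator_def)
  qed
  also have "\<dots> = (\<integral>\<^sup>+y. K y * indicator (S \<inter> B) y \<partial>lborel) + c * emeasure lborel (S - B)"
    by (subst nn_integral_add) (auto simp: nn_integral_cmult_indicator)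
  also have "\<dots> \<le> (\<integral>\<^sup>+y. K y * indicator (S \<inter> B) y \<partial>lborel) + c * emeasure lborel (B - S)"
    by (intro add_left_mono mult_left_mono le) simp
  also have "\<dots> = (\<integral>\<^sup>+y. K y * indicator (S \<inter> B) y + c * indicator (B - S) y \<partial>lborel)"
    by (subst nn_integral_add) (auto simp: nn_integral_cmult_indicator)
  also have "\<dots> \<le> (\<integral>\<^sup>+y. K y * indicator B y \<partial>lborel)"
  proof (rule nn_integral_mono_AE)
    show "AE y in lborel. K y * indicator (S \<inter> B) y + c * indicator (B - S) y \<le> K y * indicator B y"
      using AE_lborel_singleton[of 0]
    proof eventually_elim
      case (elim y)
      have "c \<le> K y" if "y \<in> B"
        using that elim \<rho> a unfolding K_def c_def B_def by (intro ennreal_leI powr_mono2') auto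
      then show ?case by (auto simp: indicator_def)
    qed
  qed
  also have "\<dots> = ennreal (real CARD('n) * omega TYPE('n) * \<rho> powr a / a)"
    unfolding K_def B_def by (rule nn_integral_ball_powr[OF a(1) \<rho>])
  finally show ?thesis unfolding K_def .
qed

lemma layer_cake_ennreal: "a \<ge> 0 \<Longrightarrow> ennreal a = (\<integral>\<^sup>+b. indicator {0<..<a} (b::real) \<partial>lborel)"
  by simp

text \<open>Layer cake in the level b of f, with three ranges. For b \<le> 1 the finite measure of
  the support gives a constant. For 1 \<le> b \<le> r^(-a) the bathtub bound c2 / b integrates to
  the logarithm. Above r^(-a) the kernel is at most r^(a-n), and the tail of b^(-n/a) contributes a
  constant free of r.\<close>

lemma riesz_far_bound:
  fixes f :: "real^'n::finite \<Rightarrow> real"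
  assumes f[measurable]: "f \<in> borel_measurable borel" and f0: "\<And>x. f x \<ge> 0"
    and a: "0 < a" "a < real CARD('n)" and M: "M \<ge> 0"
    and fM: "\<And>b. b > 0 \<Longrightarrow> emeasure lborel {x. f x > b} \<le> ennreal M"
    and fb: "\<And>b. b > 0 \<Longrightarrow> emeasure lborel {x. f x > b} \<le> ennreal (b powr (- real CARD('n) / a))"
    and r: "0 < r" "r \<le> 1"
  shows "(\<integral>\<^sup>+y. ennreal (norm y powr (a - real CARD('n))) * indicator (- ball 0 r) y * ennreal (f (z + y)) \<partial>lborel)
    \<le> ennreal (real CARD('n) * omega TYPE('n) powr ((real CARD('n) - a) / real CARD('n)) * ln (1 / r)
        + (real CARD('n) * omega TYPE('n) / a + M + a / (real CARD('n) - a)))"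
proof -
  define n where "n = real CARD('n)"
  have n: "n > 0" by (simp add: n_def)
  define w where "w = omega TYPE('n)"
  have w: "w > 0" by (simp add: w_def omega_pos)
  define K where "K y = ennreal (norm y powr (a - n))" for y :: "real^'n"
  have [measurable]: "K \<in> borel_measurable borel" unfolding K_def by measurable
  have [measurable]: "ball (0::real^'n) s \<in> sets borel" for s by simp
  define S where "S b = {y. f (z + y) > b}" for b
  have [measurable]: "S b \<in> sets borel" for b unfolding S_def by measurable
  have mS: "emeasure lborel (S b) = emeasure lborel {x. f x > b}" for b
  proof -
    have "emeasure lborel {x. f x > b} = emeasure (distr lborel borel ((+) z)) {x. f x > b}"
      by (simp only: lborel_distr_plus)
    also have "\<dots> = emeasure lborel ((+) z -` {x. f x > b} \<inter> space lborel)"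
      by (rule emeasure_distr) measurable
    also have "(+) z -` {x. f x > b} \<inter> space lborel = S b" by (auto simp: S_def)
    finally show ?thesis by simp
  qed
  define h where "h b = (\<integral>\<^sup>+y. K y * indicator (- ball 0 r) y * indicator (S b) y \<partial>lborel)" for b
  have "(\<integral>\<^sup>+y. K y * indicator (- ball 0 r) y * ennreal (f (z + y)) \<partial>lborel)
    = (\<integral>\<^sup>+y. \<integral>\<^sup>+b. K y * indicator (- ball 0 r) y * indicator {0<..<f (z + y)} b \<partial>lborel \<partial>lborel)"
    by (intro nn_integral_cong, subst layer_cake_ennreal[OF f0], subst nn_integral_cmult) auto
  also have "\<dots> = (\<integral>\<^sup>+b. \<integral>\<^sup>+y. K y * indicator (- ball 0 r) y * indicator {0<..<f (z + y)} b \<partial>lborel \<partial>lborel)"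
  proof (rule lborel_pair.Fubini'[symmetric])
    have "(\<lambda>(x, y). K x * indicator (- ball 0 r) x * indicator {0<..<f (z + x)} y)
      = (\<lambda>p. K (fst p) * indicator (- ball 0 r) (fst p) * (if 0 < snd p \<and> snd p < f (z + fst p) then 1 else 0))"
      by (auto simp: fun_eq_iff indicator_def)
    then show "(\<lambda>(x, y). K x * indicator (- ball 0 r) x * indicator {0<..<f (z + x)} y) \<in> borel_measurable (lborel \<Otimes>\<^sub>M lborel)"
      by simp
  qed
  also have "\<dots> = (\<integral>\<^sup>+b. h b * indicator {0<..} b \<partial>lborel)"
  proof (rule nn_integral_cong)
    fix b :: real
    have "K y * indicator (- ball 0 r) y * indicator {0<..<f (z + y)} b = K y * indicator (- ball 0 r) y * indicator (S b) y * indicator {0<..} b" for y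
      by (auto simp: S_def indicator_def)
    then show "(\<integral>\<^sup>+y. K y * indicator (- ball 0 r) y * indicator {0<..<f (z + y)} b \<partial>lborel) = h b * indicator {0<..} b"
      by (simp add: h_def nn_integral_multc)
  qed
  finally have eq: "(\<integral>\<^sup>+y. K y * indicator (- ball 0 r) y * ennreal (f (z + y)) \<partial>lborel) = (\<integral>\<^sup>+b. h b * indicator {0<..} b \<partial>lborel)" .
  define c1 where "c1 = n * w / a + M"
  define c2 where "c2 = n * w powr ((n - a) / n) / a"
  define p where "p = n / a"
  have p: "p > 1" using a by (simp add: p_def n_def)
  \<comment> \<open>At this level the weak bound allows a superlevel set of measure r^n; beyond it
    the truncation of the kernel is the better estimate.\<close>
  define \<beta> where "\<beta> = r powr (- a)"
  have \<beta>: "\<beta> \<ge> 1" using r a powr_mono2'[of "- a" r 1] by (simp add: \<beta>_def)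
  have h1: "h b \<le> ennreal c1" if b: "b > 0" for b
  proof -
    have "h b \<le> (\<integral>\<^sup>+y. K y * indicator (ball 0 1) y + indicator (S b) y \<partial>lborel)"
      unfolding h_def
    proof (rule nn_integral_mono)
      fix y :: "real^'n"
      have "K y \<le> 1" if "norm y \<ge> 1"
        using that a powr_mono2'[of "a - n" 1 "norm y"] unfolding K_def by (simp add: n_def)
      then show "K y * indicator (- ball 0 r) y * indicator (S b) y \<le> K y * indicator (ball 0 1) y + indicator (S b) y"
        by (cases "norm y < 1") (auto simp: indicator_def)
    qed
    also have "\<dots> = (\<integral>\<^sup>+y. K y * indicator (ball 0 1) y \<partial>lborel) + emeasure lborel (S b)"
      by (subst nn_integral_add) auto
    also have "(\<integral>\<^sup>+y. K y * indicator (ball 0 1) y \<partial>lborel) = ennreal (n * w / a)"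
      using nn_integral_ball_powr[OF a(1), of 1, where 'n='n] by (simp add: K_def n_def w_def)
    also have "ennreal (n * w / a) + emeasure lborel (S b) \<le> ennreal (n * w / a) + ennreal M"
      using fM[OF b] mS by (intro add_left_mono) simp
    also have "\<dots> = ennreal c1" using n w a M by (simp add: c1_def ennreal_plus[symmetric] del: ennreal_plus)
    finally show ?thesis .
  qed
  have h2: "h b \<le> ennreal (c2 * (1 / b))" if b: "b > 0" for b
  proof -
    \<comment> \<open>The radius of the ball of volume b^(-n/a), the largest measure that the weak
      bound allows.\<close>
    define \<rho> where "\<rho> = b powr (- 1 / a) * w powr (- 1 / n)"
    have \<rho>: "\<rho> > 0" using b w by (simp add: \<rho>_def)
    have "h b \<le> (\<integral>\<^sup>+y. K y * indicator (S b) y \<partial>lborel)"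
      unfolding h_def by (intro nn_integral_mono) (auto simp: indicator_def)
    also have "\<dots> \<le> ennreal (real CARD('n) * omega TYPE('n) * \<rho> powr a / a)"
      unfolding K_def n_def
    proof (rule riesz_bathtub[OF _ \<rho> a(1)])
      have "\<rho> ^ CARD('n) = \<rho> powr n" using \<rho> by (simp add: n_def powr_realpow)
      also have "\<dots> = b powr (- n / a) * w powr (- 1)"
        using n unfolding \<rho>_def by (simp add: powr_mult powr_powr)
      finally have "omega TYPE('n) * \<rho> ^ CARD('n) = b powr (- n / a)"
        using w unfolding w_def[symmetric] by (simp add: powr_minus)
      then show "emeasure lborel (S b) \<le> ennreal (omega TYPE('n) * \<rho> ^ CARD('n))"
        using fb[OF b] mS by (simp add: n_def)
    qed (use a in simp_all)
    also have "real CARD('n) * omega TYPE('n) * \<rho> powr a / a = c2 * (1 / b)"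
    proof -
      have "\<rho> powr a = b powr (- 1) * w powr (- a / n)"
        using a unfolding \<rho>_def by (simp add: powr_mult powr_powr)
      also have "b powr (- 1) = 1 / b" using b by (simp add: powr_minus divide_inverse)
      finally have "w * \<rho> powr a = (w powr 1 * w powr (- a / n)) * (1 / b)" using w by simp
      also have "w powr 1 * w powr (- a / n) = w powr ((n - a) / n)"
        unfolding powr_add[symmetric] using n by (simp add: diff_divide_distrib)
      finally show ?thesis by (simp add: c2_def n_def w_def mult.assoc)
    qed
    finally show ?thesis .
  qed
  have h3: "h b \<le> ennreal (r powr (a - n) * b powr (- p))" if b: "b > 0" for b
  proof -
    have "h b \<le> (\<integral>\<^sup>+y. ennreal (r powr (a - n)) * indicator (S b) y \<partial>lborel)"
      unfolding h_def
    proof (rule nn_integral_mono)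
      fix y :: "real^'n"
      have "K y \<le> ennreal (r powr (a - n))" if "norm y \<ge> r"
        using that r a powr_mono2'[of "a - n" r "norm y"] unfolding K_def by (intro ennreal_leI) (simp add: n_def)
      then show "K y * indicator (- ball 0 r) y * indicator (S b) y \<le> ennreal (r powr (a - n)) * indicator (S b) y"
        by (auto simp: indicator_def)
    qed
    also have "\<dots> = ennreal (r powr (a - n)) * emeasure lborel (S b)" by (simp add: nn_integral_cmult_indicator)
    also have "\<dots> \<le> ennreal (r powr (a - n)) * ennreal (b powr (- p))"
      using fb[OF b] mS by (intro mult_left_mono) (simp_all add: p_def n_def)
    finally show ?thesis by (simp add: ennreal_mult)
  qed
  have c1: "c1 \<ge> 0" using n w a M by (simp add: c1_def)
  have c2: "c2 \<ge> 0" using n w a by (simp add: c2_def)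
  have "(\<integral>\<^sup>+b. h b * indicator {0<..} b \<partial>lborel) \<le> (\<integral>\<^sup>+b. ennreal c1 * indicator {0..1} b + (ennreal (c2 * (1 / b)) * indicator {1..\<beta>} b
      + ennreal (r powr (a - n) * b powr (- p)) * indicator {\<beta>..} b) \<partial>lborel)"
  proof (rule nn_integral_mono)
    fix b :: real
    consider "b \<le> 0" | "0 < b" "b \<le> 1" | "1 < b" "b \<le> \<beta>" | "\<beta> < b" by linarith
    then show "h b * indicator {0<..} b \<le> ennreal c1 * indicator {0..1} b + (ennreal (c2 * (1 / b)) * indicator {1..\<beta>} b
      + ennreal (r powr (a - n) * b powr (- p)) * indicator {\<beta>..} b)"
    proof cases
      case 2
      then have "h b * indicator {0<..} b \<le> ennreal c1 * indicator {0..1} b" using h1[of b] by simp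
      then show ?thesis by (rule add_increasing2[OF zero_le])
    next
      case 3
      then have "h b * indicator {0<..} b \<le> ennreal (c2 * (1 / b)) * indicator {1..\<beta>} b" using h2[of b] by simp
      then show ?thesis by (intro add_increasing[OF zero_le] add_increasing2[OF zero_le])
    next
      case 4
      then have "h b * indicator {0<..} b \<le> ennreal (r powr (a - n) * b powr (- p)) * indicator {\<beta>..} b"
        using h3[of b] \<beta> by simp
      then show ?thesis by (intro add_increasing[OF zero_le])
    qed simp
  qed
  also have "\<dots> = ennreal c1 + ((\<integral>\<^sup>+b. ennreal (c2 * (1 / b)) * indicator {1..\<beta>} b \<partial>lborel)
      + (\<integral>\<^sup>+b. ennreal (r powr (a - n) * b powr (- p)) * indicator {\<beta>..} b \<partial>lborel))"
    by (simp add: nn_integral_add nn_integral_cmult_indicator)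
  also have "(\<integral>\<^sup>+b. ennreal (c2 * (1 / b)) * indicator {1..\<beta>} b \<partial>lborel) = ennreal (c2 * ln \<beta> - c2 * ln 1)"
    using \<beta> c2 by (intro nn_integral_FTC_Icc[where F = "\<lambda>b. c2 * ln b"]) (auto intro!: derivative_eq_intros)
  also have "(\<integral>\<^sup>+b. ennreal (r powr (a - n) * b powr (- p)) * indicator {\<beta>..} b \<partial>lborel)
    = ennreal (0 - (- (r powr (a - n) * (\<beta> powr (1 - p) / (p - 1)))))"
  proof (rule nn_integral_FTC_atLeast[where F = "\<lambda>b. - (r powr (a - n) * (b powr (1 - p) / (p - 1)))"])
    show "((\<lambda>b. - (r powr (a - n) * (b powr (1 - p) / (p - 1)))) has_real_derivative r powr (a - n) * b powr (- p)) (at b)" if "\<beta> \<le> b" for b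
    proof -
      have "((\<lambda>b. b powr (1 - p)) has_real_derivative (1 - p) * b powr (1 - p - 1)) (at b)"
        using that \<beta> by (intro has_real_derivative_powr) simp
      from DERIV_cmult[OF this, of "- (r powr (a - n) / (p - 1))"]
      have "((\<lambda>b. - (r powr (a - n) * (b powr (1 - p) / (p - 1)))) has_real_derivative
          - (r powr (a - n) / (p - 1)) * ((1 - p) * b powr (- p))) (at b)" by simp
      moreover have "- (R / (p - 1)) * ((1 - p) * X) = R * X" for R X :: real
        using p by (simp add: field_simps)
      ultimately show ?thesis by simp
    qed
    have "((\<lambda>b. b powr (1 - p)) \<longlongrightarrow> 0) at_top"
      by (rule tendsto_neg_powr) (use p in \<open>auto simp: filterlim_ident\<close>)
    then have "((\<lambda>b. - (r powr (a - n) * (b powr (1 - p) / (p - 1)))) \<longlongrightarrow> - (r powr (a - n) * (0 / (p - 1)))) at_top"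
      by (intro tendsto_intros) (use p in auto)
    then show "((\<lambda>b. - (r powr (a - n) * (b powr (1 - p) / (p - 1)))) \<longlongrightarrow> 0) at_top" by simp
  qed auto
  also have "0 - (- (r powr (a - n) * (\<beta> powr (1 - p) / (p - 1)))) = a / (n - a)"
  proof -
    have "\<beta> powr (1 - p) = r powr (n - a)"
    proof -
      have "- a * (1 - n / a) = n - a" using a by (simp add: field_simps)
      then show ?thesis unfolding \<beta>_def p_def powr_powr by simp
    qed
    then have "r powr (a - n) * \<beta> powr (1 - p) = 1" using r by (simp add: powr_add[symmetric])
    moreover have "1 / (p - 1) = a / (n - a)" using a by (simp add: p_def n_def field_simps)
    ultimately show ?thesis by (metis add.inverse_inverse diff_0 times_divide_eq_right)
  qed
  \<comment> \<open>ln \<beta> = a ln (1 / r) cancels the 1 / a in c2, which leaves the sharp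
    slope.\<close>
  also have "c2 * ln \<beta> - c2 * ln 1 = n * w powr ((n - a) / n) * ln (1 / r)"
    using r a by (simp add: \<beta>_def c2_def ln_powr ln_div)
  finally have "(\<integral>\<^sup>+b. h b * indicator {0<..} b \<partial>lborel) \<le> ennreal c1 + (ennreal (n * w powr ((n - a) / n) * ln (1 / r)) + ennreal (a / (n - a)))" .
  also have "\<dots> = ennreal (n * w powr ((n - a) / n) * ln (1 / r) + (c1 + a / (n - a)))"
    using c1 n a r by (simp add: ennreal_plus[symmetric] n_def del: ennreal_plus)
  finally show ?thesis unfolding eq[symmetric] K_def by (simp add: n_def w_def c1_def)
qed

text \<open>If t \<le> s^(p-1) the product is at most s^p, otherwise it is at most t^(p/(p-1)).
  Coefficients 1 suffice, since the near part affects only the additive constant and the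
  energy.\<close>

lemma young_crude:
  fixes s t p :: real
  assumes "s \<ge> 0" "t \<ge> 0" "p > 1"
  shows "s * t \<le> s powr p + t powr (p / (p - 1))"
proof (cases "t \<le> s powr (p - 1)")
  case True
  then have "s * t \<le> s * s powr (p - 1)" using assms by (intro mult_left_mono)
  also have "\<dots> \<le> s powr p"
    using assms by (cases "s = 0") (auto simp: powr_diff)
  finally show ?thesis by (simp add: add_increasing2)
next
  case False
  then have t: "t > 0" using assms by (simp add: not_le order.strict_trans1[OF powr_ge_zero])
  have "s \<le> t powr (1 / (p - 1))"
  proof (cases "s = 0")
    case False
    then have "s = (s powr (p - 1)) powr (1 / (p - 1))" using assms by (simp add: powr_powr)
    also have "\<dots> \<le> t powr (1 / (p - 1))" using \<open>\<not> t \<le> s powr (p - 1)\<close> assms by (intro powr_mono2) auto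
    finally show ?thesis .
  qed simp
  then have "s * t \<le> t powr (1 / (p - 1)) * t" using assms by (intro mult_right_mono)
  also have "\<dots> = t powr (1 / (p - 1) + 1)" using t by (simp add: powr_add)
  also have "1 / (p - 1) + 1 = p / (p - 1)" using assms by (simp add: field_simps)
  finally show ?thesis by (simp add: add_increasing)
qed

text \<open>Young's inequality for kernel times f written as s t, where s carries |y|^(-\<delta>/p)
  f and t the rest of the kernel. The weights r^\<sigma> and r^(-\<sigma>) are balanced so that t
  contributes a constant independent of r, while s contributes the energy with the factor
  r^(\<delta>-e).\<close>

lemma riesz_near_bound:
  fixes f :: "real^'n::finite \<Rightarrow> real"
  assumes f[measurable]: "f \<in> borel_measurable borel" and f0: "\<And>x. f x \<ge> 0"
    and a: "0 < a" "a < real CARD('n)" and e: "0 < e" "e < real CARD('n) - a" "e < \<delta>"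
    and p: "p = (real CARD('n) - e) / a" and r: "0 < r"
  shows "(\<integral>\<^sup>+y. ennreal (norm y powr (a - real CARD('n))) * indicator (ball 0 r) y * ennreal (f (z + y)) \<partial>lborel)
    \<le> ennreal (real CARD('n) * omega TYPE('n) * (p - 1) / (\<delta> - e))
      + ennreal (r powr (\<delta> - e)) * (\<integral>\<^sup>+y. ennreal (norm y powr (- \<delta>)) * indicator (ball 0 r) y * ennreal (f (z + y) powr p) \<partial>lborel)"
proof -
  define n where "n = real CARD('n)"
  have n: "n > 0" by (simp add: n_def)
  have p1: "p > 1" using a e by (simp add: p n_def field_simps)
  have [measurable]: "ball (0::real^'n) r \<in> sets borel" by simp
  define q where "q = p / (p - 1)"
  \<comment> \<open>\<sigma> p = \<delta> - e, and \<sigma> q is the exponent A that the integral of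
    t^q over the ball produces, so the powers of r cancel there.\<close>
  define \<sigma> where "\<sigma> = (\<delta> - e) / p"
  have q: "q > 0" using p1 by (simp add: q_def)
  have ap: "a * p = n - e" using a by (simp add: p n_def)
  define A where "A = \<sigma> * q"
  have Aeq: "A = (\<delta> - e) / (p - 1)" using p1 by (simp add: A_def \<sigma>_def q_def)
  have A: "A > 0" using e p1 by (simp add: Aeq)
  \<comment> \<open>Because a p = n - e, the conjugate power of the remaining kernel is |y|^(A-n),
    which is integrable at the origin since A > 0.\<close>
  have pw: "(a - n + \<delta> / p) * q = A - n"
  proof -
    have "(a - n + \<delta> / p) * q = (a * p - n * p + \<delta>) / (p - 1)" using p1 by (simp add: q_def field_simps)
    also have "\<dots> = A - n" using p1 by (simp add: ap Aeq field_simps)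
    finally show ?thesis .
  qed
  have pt: "ennreal (norm y powr (a - n)) * indicator (ball 0 r) y * ennreal (f (z + y))
    \<le> ennreal (r powr (- A)) * (ennreal (norm y powr (A - n)) * indicator (ball 0 r) y)
      + ennreal (r powr (\<delta> - e)) * (ennreal (norm y powr (- \<delta>)) * indicator (ball 0 r) y * ennreal (f (z + y) powr p))" if y0: "y \<noteq> 0" for y
  proof (cases "y \<in> ball 0 r")
    case True
    define s where "s = r powr \<sigma> * norm y powr (- \<delta> / p) * f (z + y)"
    define t where "t = r powr (- \<sigma>) * norm y powr (a - n + \<delta> / p)"
    have st: "s \<ge> 0" "t \<ge> 0" using f0 by (auto simp: s_def t_def)
    have "s * t = (r powr \<sigma> * r powr (- \<sigma>)) * (norm y powr (- \<delta> / p) * norm y powr (a - n + \<delta> / p)) * f (z + y)"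
      by (simp add: s_def t_def)
    also have "r powr \<sigma> * r powr (- \<sigma>) = 1" using r by (simp add: powr_add[symmetric])
    also have "norm y powr (- \<delta> / p) * norm y powr (a - n + \<delta> / p) = norm y powr (a - n)"
      by (simp add: powr_add[symmetric])
    finally have 1: "norm y powr (a - n) * f (z + y) = s * t" by simp
    have 2: "s powr p = r powr (\<delta> - e) * norm y powr (- \<delta>) * f (z + y) powr p"
      using p1 f0 by (simp add: s_def powr_mult powr_powr \<sigma>_def)
    have 3: "t powr q = r powr (- A) * norm y powr (A - n)"
      by (simp add: t_def powr_mult powr_powr pw A_def)
    have "norm y powr (a - n) * f (z + y) \<le> r powr (- A) * norm y powr (A - n) + r powr (\<delta> - e) * (norm y powr (- \<delta>) * f (z + y) powr p)"
      unfolding 1 using young_crude[OF st p1] unfolding 2 3[unfolded q_def] by (simp add: mult.assoc add.commute)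
    then show ?thesis using True f0 by (simp add: ennreal_mult[symmetric] ennreal_plus[symmetric] del: ennreal_plus)
  qed simp
  have "(\<integral>\<^sup>+y. ennreal (norm y powr (a - n)) * indicator (ball 0 r) y * ennreal (f (z + y)) \<partial>lborel)
    \<le> (\<integral>\<^sup>+y. ennreal (r powr (- A)) * (ennreal (norm y powr (A - n)) * indicator (ball 0 r) y)
      + ennreal (r powr (\<delta> - e)) * (ennreal (norm y powr (- \<delta>)) * indicator (ball 0 r) y * ennreal (f (z + y) powr p)) \<partial>lborel)"
  proof (rule nn_integral_mono_AE)
    show "AE y in lborel. ennreal (norm y powr (a - n)) * indicator (ball 0 r) y * ennreal (f (z + y))
      \<le> ennreal (r powr (- A)) * (ennreal (norm y powr (A - n)) * indicator (ball 0 r) y)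
        + ennreal (r powr (\<delta> - e)) * (ennreal (norm y powr (- \<delta>)) * indicator (ball 0 r) y * ennreal (f (z + y) powr p))"
      using AE_lborel_singleton[of 0] by eventually_elim (rule pt)
  qed
  also have "\<dots> = ennreal (r powr (- A)) * (\<integral>\<^sup>+y. ennreal (norm y powr (A - n)) * indicator (ball 0 r) (y::real^'n) \<partial>lborel)
      + ennreal (r powr (\<delta> - e)) * (\<integral>\<^sup>+y. ennreal (norm y powr (- \<delta>)) * indicator (ball 0 r) y * ennreal (f (z + y) powr p) \<partial>lborel)"
    by (subst nn_integral_add) (auto simp: nn_integral_cmult)
  also have "(\<integral>\<^sup>+y. ennreal (norm y powr (A - n)) * indicator (ball 0 r) (y::real^'n) \<partial>lborel) = ennreal (n * omega TYPE('n) * r powr A / A)"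
    unfolding n_def by (rule nn_integral_ball_powr[OF A r])
  also have "ennreal (r powr (- A)) * ennreal (n * omega TYPE('n) * r powr A / A) = ennreal (n * omega TYPE('n) * (p - 1) / (\<delta> - e))"
  proof -
    have "r powr (- A) * r powr A = 1" using r by (simp add: powr_add[symmetric])
    then have "r powr (- A) * (n * omega TYPE('n) * r powr A / A) = n * omega TYPE('n) / A"
      by (metis (no_types, lifting) mult.assoc mult.commute mult.right_neutral times_divide_eq_right)
    also have "\<dots> = n * omega TYPE('n) * (p - 1) / (\<delta> - e)" using e p1 by (simp add: Aeq)
    finally show ?thesis
      using n A omega_pos[where 'n='n] by (simp add: ennreal_mult[symmetric])
  qed
  finally show ?thesis by (simp add: n_def)
qed

section \<open>Growth of the measure and the weak norm\<close>

lemma le_suminf_ennreal: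
  fixes g :: "nat \<Rightarrow> ennreal"
  shows "g j \<le> (\<Sum>j. g j)"
  using sum_le_suminf[of g "{j}"] by (simp add: summableI)

lemma dyadic_scale_exists:
  fixes s r :: real
  assumes "0 < s" "s < r"
  obtains j :: nat where "(1 / 2) ^ Suc j * r \<le> s" "s < (1 / 2) ^ j * r"
proof -
  obtain m where m: "(1 / 2) ^ m < s / r"
    using real_arch_pow_inv[of "s / r" "1 / 2"] assms by auto
  define P where "P j \<longleftrightarrow> (1 / 2) ^ Suc j * r \<le> s" for j :: nat
  have "(1 / 2) ^ Suc m * r \<le> (1 / 2) ^ m * r" using assms by simp
  also have "\<dots> \<le> s" using m assms by (simp add: field_simps)
  finally have "P m" by (simp add: P_def)
  define j where "j = (LEAST j. P j)"
  have "P j" unfolding j_def using \<open>P m\<close> by (rule LeastI)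
  moreover have "s < (1 / 2) ^ j * r"
  proof (cases j)
    case (Suc i)
    then have "\<not> P i" using not_less_Least[of i P] by (simp add: j_def)
    then show ?thesis using Suc by (simp add: P_def)
  qed (use assms in simp)
  ultimately show ?thesis using that by (simp add: P_def)
qed

lemma suminf_geometric_ennreal:
  fixes q c :: real
  assumes "0 \<le> q" "q < 1" "c \<ge> 0"
  shows "(\<Sum>j. ennreal (c * q ^ j)) = ennreal (c / (1 - q))"
proof -
  have "(\<lambda>j. c * q ^ j) sums (c * (1 / (1 - q)))"
    using assms by (intro sums_mult geometric_sums) simp
  then have s: "(\<lambda>j. c * q ^ j) sums (c / (1 - q))" by simp
  have "(\<Sum>j. ennreal (c * q ^ j)) = ennreal (\<Sum>j. c * q ^ j)"
    by (rule suminf_ennreal2[OF _ sums_summable[OF s]]) (use assms in auto)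
  then show ?thesis using sums_unique[OF s] by simp
qed

text \<open>Dyadic shells around c: on the j-th one the kernel is at most a multiple of 2^(j
  \<delta>) r^(-\<delta>) and the measure at most a multiple of 2^(-j d) r^d, so \<delta> < d makes
  the series geometric.\<close>

lemma growth_kernel_bound:
  fixes \<nu> :: "(real^'n::finite) measure"
  assumes \<nu>: "sets \<nu> = sets borel" and g: "upper_growth \<nu> d C" and C: "C > 0" and \<delta>: "0 < \<delta>" "\<delta> < d" and r: "r > 0"
  shows "(\<integral>\<^sup>+x. ennreal (norm (c - x) powr (- \<delta>)) * indicator (ball 0 r) (c - x) \<partial>\<nu>)
    \<le> ennreal (C * 2 powr \<delta> / (1 - (1 / 2) powr (d - \<delta>)) * r powr (d - \<delta>))"
proof -
  have [measurable_cong]: "sets \<nu> = sets borel" by (rule \<nu>)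
  have b[measurable]: "ball x s \<in> sets borel" for x :: "real^'n" and s by simp
  have "(\<integral>\<^sup>+x. ennreal (norm (c - x) powr (- \<delta>)) * indicator (ball 0 r) (c - x) \<partial>\<nu>)
    \<le> (\<integral>\<^sup>+x. (\<Sum>j. ennreal (((1 / 2) ^ Suc j * r) powr (- \<delta>)) * indicator (ball c ((1 / 2) ^ j * r)) x) \<partial>\<nu>)"
  proof (rule nn_integral_mono)
    fix x
    show "ennreal (norm (c - x) powr (- \<delta>)) * indicator (ball 0 r) (c - x)
      \<le> (\<Sum>j. ennreal (((1 / 2) ^ Suc j * r) powr (- \<delta>)) * indicator (ball c ((1 / 2) ^ j * r)) x)"
    \<comment> \<open>At x = c the kernel is 0 by the convention for \<open>powr\<close>, so only
      positive distances have to be placed in a shell.\<close>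
    proof (cases "0 < norm (c - x) \<and> norm (c - x) < r")
      case True
      then obtain j where j: "(1 / 2) ^ Suc j * r \<le> norm (c - x)" "norm (c - x) < (1 / 2) ^ j * r"
        using dyadic_scale_exists by blast
      have "ennreal (norm (c - x) powr (- \<delta>)) * indicator (ball 0 r) (c - x) \<le> ennreal (((1 / 2) ^ Suc j * r) powr (- \<delta>)) * indicator (ball c ((1 / 2) ^ j * r)) x"
        using j True \<delta> r by (auto simp: dist_norm indicator_def simp del: power_Suc intro!: ennreal_leI powr_mono2')
      also have "\<dots> \<le> (\<Sum>j. ennreal (((1 / 2) ^ Suc j * r) powr (- \<delta>)) * indicator (ball c ((1 / 2) ^ j * r)) x)"
        by (rule le_suminf_ennreal)
      finally show ?thesis .
    qed (auto simp: indicator_def)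
  qed
  also have "\<dots> = (\<Sum>j. \<integral>\<^sup>+x. ennreal (((1 / 2) ^ Suc j * r) powr (- \<delta>)) * indicator (ball c ((1 / 2) ^ j * r)) x \<partial>\<nu>)"
    by (rule nn_integral_suminf) measurable
  also have "\<dots> = (\<Sum>j. ennreal (((1 / 2) ^ Suc j * r) powr (- \<delta>)) * emeasure \<nu> (ball c ((1 / 2) ^ j * r)))"
    by (subst nn_integral_cmult_indicator) (auto simp: \<nu>)
  also have "\<dots> \<le> (\<Sum>j. ennreal ((C * 2 powr \<delta> * r powr (d - \<delta>)) * ((1 / 2) powr (d - \<delta>)) ^ j))"
  proof (rule suminf_le)
    fix j
    define t where "t = (1 / 2 :: real) ^ j * r"
    have t: "t > 0" using r by (simp add: t_def)
    have "ennreal (((1 / 2) ^ Suc j * r) powr (- \<delta>)) * emeasure \<nu> (ball c ((1 / 2) ^ j * r)) \<le> ennreal (((1 / 2) ^ Suc j * r) powr (- \<delta>)) * ennreal (C * t powr d)"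
      using g t unfolding upper_growth_def t_def[symmetric] by (intro mult_left_mono) auto
    also have "\<dots> = ennreal ((1 / 2 * t) powr (- \<delta>) * (C * t powr d))"
      using C by (simp add: ennreal_mult[symmetric] t_def mult.assoc)
    also have "(1 / 2 * t) powr (- \<delta>) * (C * t powr d) = C * 2 powr \<delta> * t powr (d - \<delta>)"
      using t by (simp add: powr_mult powr_diff powr_minus powr_divide field_simps)
    also have "t powr (d - \<delta>) = ((1 / 2) powr (d - \<delta>)) ^ j * r powr (d - \<delta>)"
      using r by (simp add: t_def powr_mult powr_realpow[symmetric] powr_powr mult.commute)
    finally show "ennreal (((1 / 2) ^ Suc j * r) powr (- \<delta>)) * emeasure \<nu> (ball c ((1 / 2) ^ j * r))
      \<le> ennreal ((C * 2 powr \<delta> * r powr (d - \<delta>)) * ((1 / 2) powr (d - \<delta>)) ^ j)"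
      by (simp add: mult_ac)
  qed (auto simp: summableI)
  also have "\<dots> = ennreal (C * 2 powr \<delta> * r powr (d - \<delta>) / (1 - (1 / 2) powr (d - \<delta>)))"
  proof (rule suminf_geometric_ennreal)
    show "(1 / 2) powr (d - \<delta>) < (1 :: real)"
      using \<delta> powr_less_mono2[of "d - \<delta>" "1 / 2" 1] by simp
  qed (use C in auto)
  finally show ?thesis by simp
qed

text \<open>Where 0 < f \<le> 1 the measure is at most M; where 2^j < f \<le> 2^(j+1) the weak bound
  gives a geometric series of ratio 2^(p-q). Its convergence requires p < q, which is the reason for
  the loss e in the exponent.\<close>

lemma Lp_bound_of_weak:
  fixes f :: "real^'n::finite \<Rightarrow> real"
  assumes f[measurable]: "f \<in> borel_measurable borel" and f0: "\<And>x. f x \<ge> 0" and M: "M \<ge> 0"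
    and fM: "emeasure lborel {x. f x > 0} \<le> ennreal M"
    and fb: "\<And>b. b > 0 \<Longrightarrow> emeasure lborel {x. f x > b} \<le> ennreal (b powr (- q))"
    and p: "0 < p" "p < q"
  shows "(\<integral>\<^sup>+x. ennreal (f x powr p) \<partial>lborel) \<le> ennreal (M + 2 powr p / (1 - 2 powr (p - q)))"
proof -
  define S where "S j = {x. f x > 2 ^ j}" for j :: nat
  have S[measurable]: "S j \<in> sets borel" for j unfolding S_def by measurable
  define c where "c j = ennreal ((2 ^ Suc j) powr p)" for j :: nat
  define Z where "Z = {x. f x > 0}"
  have Z[measurable]: "Z \<in> sets borel" unfolding Z_def by measurable
  have "(\<integral>\<^sup>+x. ennreal (f x powr p) \<partial>lborel)
    \<le> (\<integral>\<^sup>+x. indicator Z x + (\<Sum>j. c j * indicator (S j) x) \<partial>lborel)"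
  proof (rule nn_integral_mono)
    fix x
    consider "f x = 0" | "0 < f x" "f x \<le> 1" | "f x > 1" using f0[of x] by linarith
    then show "ennreal (f x powr p) \<le> indicator Z x + (\<Sum>j. c j * indicator (S j) x)"
    proof cases
      case 2
      then have "f x powr p \<le> 1" using p powr_mono2[of p "f x" 1] by simp
      then show ?thesis using 2 by (auto intro!: add_increasing2 simp: ennreal_le_1 Z_def)
    next
      case 3
      have i: "0 < 1 / f x" "1 / f x < 1" using 3 by auto
      obtain m where m: "f x \<le> 2 ^ m" using real_arch_pow[of 2 "f x"] by (auto intro: less_imp_le)
      define P where "P j \<longleftrightarrow> f x \<le> 2 ^ Suc j" for j :: nat
      have "(2::real) ^ m \<le> 2 ^ Suc m" by simp
      with m have "P m" unfolding P_def by (rule order_trans)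
      define j where "j = (LEAST j. P j)"
      have Pj: "P j" unfolding j_def using \<open>P m\<close> by (rule LeastI)
      have lj: "2 ^ j < f x"
      proof (cases j)
        case (Suc i)
        then have "\<not> P i" using not_less_Least[of i P] by (simp add: j_def)
        then show ?thesis using Suc by (simp add: P_def)
      qed (use 3 in simp)
      have "ennreal (f x powr p) \<le> c j * indicator (S j) x"
        using Pj lj p f0 by (auto simp: P_def c_def S_def simp del: power_Suc intro!: ennreal_leI powr_mono2)
      also have "\<dots> \<le> (\<Sum>j. c j * indicator (S j) x)"
        by (rule le_suminf_ennreal)
      finally show ?thesis by (simp add: add_increasing)
    qed simp
  qed
  also have "\<dots> = emeasure lborel Z + (\<Sum>j. \<integral>\<^sup>+x. c j * indicator (S j) x \<partial>lborel)"
    by (simp add: nn_integral_add nn_integral_suminf)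
  also have "\<dots> \<le> ennreal M + (\<Sum>j. ennreal (2 powr p * (2 powr (p - q)) ^ j))"
  proof (rule add_mono[OF fM[folded Z_def] suminf_le])
    fix j :: nat
    have "(\<integral>\<^sup>+x. c j * indicator (S j) x \<partial>lborel) = c j * emeasure lborel (S j)"
      by (rule nn_integral_cmult_indicator) simp
    also have "\<dots> \<le> ennreal ((2 ^ Suc j) powr p) * ennreal ((2 ^ j) powr (- q))"
      unfolding c_def S_def by (intro mult_left_mono fb) auto
    also have "\<dots> = ennreal (2 powr p * (2 powr (p - q)) ^ j)"
      by (simp add: ennreal_mult[symmetric] powr_mult powr_realpow[symmetric] powr_powr powr_add[symmetric] algebra_simps)
    finally show "(\<integral>\<^sup>+x. c j * indicator (S j) x \<partial>lborel) \<le> ennreal (2 powr p * (2 powr (p - q)) ^ j)" .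
  qed (auto simp: summableI)
  also have "(\<Sum>j. ennreal (2 powr p * (2 powr (p - q)) ^ j)) = ennreal (2 powr p / (1 - 2 powr (p - q)))"
    using p powr_less_mono[of "p - q" 0 2] by (intro suminf_geometric_ennreal) auto
  also have "ennreal M + ennreal (2 powr p / (1 - 2 powr (p - q))) = ennreal (M + 2 powr p / (1 - 2 powr (p - q)))"
    using M p powr_less_mono[of "p - q" 0 2] by (intro ennreal_plus[symmetric]) auto
  finally show ?thesis .
qed

text \<open>The norm bounds the rearrangement at s = b^(-p) by b. As the infimum in its definition
  need not be attained, this controls the superlevel sets for levels above b, and b itself is
  reached by continuity of the measure from below.\<close>

lemma weak_Lp_norm_distribution:
  fixes g :: "real^'n::finite \<Rightarrow> real"
  assumes g[measurable]: "g \<in> borel_measurable lebesgue" and \<Omega>[measurable]: "\<Omega> \<in> sets lebesgue" and p: "p > 0"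
    and w: "weak_Lp_norm \<Omega> p g \<le> 1" and b: "b > 0"
  shows "emeasure lebesgue {x\<in>\<Omega>. \<bar>g x\<bar> > b} \<le> ennreal (b powr (- p))"
proof -
  define s where "s = b powr (- p)"
  have s: "s > 0" using b by (simp add: s_def)
  have m: "{x\<in>\<Omega>. \<bar>g x\<bar> > l} \<in> sets lebesgue" for l
  proof -
    have "{x\<in>space lebesgue. \<bar>g x\<bar> > l} \<in> sets lebesgue" by measurable
    then have "\<Omega> \<inter> {x\<in>space lebesgue. \<bar>g x\<bar> > l} \<in> sets lebesgue" using \<Omega> by (rule sets.Int[rotated])
    moreover have "\<Omega> \<inter> {x\<in>space lebesgue. \<bar>g x\<bar> > l} = {x\<in>\<Omega>. \<bar>g x\<bar> > l}" by auto
    ultimately show ?thesis by simp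
  qed
  show ?thesis
  proof (cases "emeasure lebesgue \<Omega> \<le> ennreal s")
    \<comment> \<open>The supremum in the norm runs only over s below the measure of \<Omega>; for
      the other s the claim is monotonicity.\<close>
    case True
    have "emeasure lebesgue {x\<in>\<Omega>. \<bar>g x\<bar> > b} \<le> emeasure lebesgue \<Omega>" by (rule emeasure_mono) auto
    then show ?thesis using True by (simp add: s_def)
  next
    case False
    then have "ennreal (s powr (1 / p)) * rearrangement \<Omega> g s \<le> weak_Lp_norm \<Omega> p g"
      unfolding weak_Lp_norm_def using s by (intro SUP_upper) auto
    also have "\<dots> \<le> 1" by (rule w)
    also have "s powr (1 / p) = b powr (- 1)" unfolding s_def powr_powr using p by simp
    also have "b powr (- 1) = 1 / b" using b by (simp add: powr_minus divide_inverse)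
    finally have R: "ennreal (1 / b) * rearrangement \<Omega> g s \<le> 1" .
    have "rearrangement \<Omega> g s = ennreal b * (ennreal (1 / b) * rearrangement \<Omega> g s)"
      using b by (simp add: mult.assoc[symmetric] ennreal_mult[symmetric])
    also have "\<dots> \<le> ennreal b * 1" by (rule mult_left_mono[OF R]) simp
    finally have R: "rearrangement \<Omega> g s \<le> ennreal b" by simp
    have l: "emeasure lebesgue {x\<in>\<Omega>. \<bar>g x\<bar> > l} \<le> ennreal s" if "l > b" for l
    proof -
      have "ennreal b < ennreal l" using that b by (simp add: ennreal_less_iff)
      with R have "rearrangement \<Omega> g s < ennreal l" by (rule order.strict_trans1)
      then obtain l' where l': "0 < l'" "emeasure lebesgue {x\<in>\<Omega>. \<bar>g x\<bar> > l'} \<le> ennreal s" "ennreal l' < ennreal l"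
        unfolding rearrangement_def Inf_less_iff by auto
      have "l' < l" using l'(1,3) by (simp add: ennreal_less_iff)
      then have "emeasure lebesgue {x\<in>\<Omega>. \<bar>g x\<bar> > l} \<le> emeasure lebesgue {x\<in>\<Omega>. \<bar>g x\<bar> > l'}"
        by (intro emeasure_mono m) auto
      then show ?thesis using l'(2) by (rule order_trans)
    qed
    define A where "A j = {x\<in>\<Omega>. \<bar>g x\<bar> > b + 1 / real (Suc j)}" for j
    have "emeasure lebesgue (\<Union>j. A j) = (SUP j. emeasure lebesgue (A j))"
    proof (rule SUP_emeasure_incseq[symmetric])
      show "range A \<subseteq> sets lebesgue" using m by (auto simp: A_def)
      show "incseq A"
      proof (rule incseq_SucI)
        fix j
        have "1 / real (Suc (Suc j)) \<le> 1 / real (Suc j)" by (simp add: frac_le)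
        then show "A j \<subseteq> A (Suc j)" by (auto simp: A_def)
      qed
    qed
    also have "\<dots> \<le> ennreal s" unfolding A_def by (rule SUP_least, rule l) (use inverse_Suc_pos in simp)
    also have "(\<Union>j. A j) = {x\<in>\<Omega>. \<bar>g x\<bar> > b}"
    proof (intro equalityI subsetI)
      fix x assume x: "x \<in> {x\<in>\<Omega>. \<bar>g x\<bar> > b}"
      then obtain j where "inverse (real (Suc j)) < \<bar>g x\<bar> - b" using reals_Archimedean[of "\<bar>g x\<bar> - b"] by auto
      then have "x \<in> A j" using x by (simp add: A_def inverse_eq_divide)
      then show "x \<in> (\<Union>j. A j)" by blast
    next
      fix x assume "x \<in> (\<Union>j. A j)"
      then obtain j where "x \<in> \<Omega>" "\<bar>g x\<bar> > b + 1 / real (Suc j)" by (auto simp: A_def)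
      moreover have "1 / real (Suc j) > 0" by (rule inverse_Suc_pos)
      ultimately have "\<bar>g x\<bar> > b" by linarith
      with \<open>x \<in> \<Omega>\<close> show "x \<in> {x\<in>\<Omega>. \<bar>g x\<bar> > b}" by blast
    qed
    finally show ?thesis by (simp add: s_def)
  qed
qed

definition near_energy :: "(real^'n::finite \<Rightarrow> real) \<Rightarrow> real \<Rightarrow> real \<Rightarrow> real \<Rightarrow> real^'n \<Rightarrow> ennreal" where
  "near_energy f p \<delta> r z = (\<integral>\<^sup>+y. ennreal (norm y powr (- \<delta>)) * indicator (ball 0 r) y * ennreal (f (z + y) powr p) \<partial>lborel)"

lemma indicator_ball_measurable [measurable]: "(indicator (ball (c::'a::euclidean_space) r) :: 'a \<Rightarrow> ennreal) \<in> borel_measurable borel"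
  by (intro borel_measurable_indicator) simp

lemma near_energy_measurable [measurable]:
  assumes [measurable]: "f \<in> borel_measurable borel"
  shows "near_energy f p \<delta> r \<in> borel_measurable borel"
  unfolding near_energy_def by measurable

text \<open>After Fubini the inner integral is that of the kernel against \<nu>, which is bounded
  uniformly in its centre. The shift w, which comes from the mollification, therefore does no
  harm.\<close>

lemma near_energy_nn_integral:
  fixes \<nu> :: "(real^'n::finite) measure"
  assumes \<nu>: "sets \<nu> = sets borel" "sigma_finite_measure \<nu>" and g: "upper_growth \<nu> d C" and C: "C > 0"
    and \<delta>: "0 < \<delta>" "\<delta> < d" and r: "r > 0"
    and f[measurable]: "f \<in> borel_measurable borel"
  shows "(\<integral>\<^sup>+x. near_energy f p \<delta> r (x - w) \<partial>\<nu>) \<le> ennreal (C * 2 powr \<delta> / (1 - (1 / 2) powr (d - \<delta>)) * r powr (d - \<delta>)) * (\<integral>\<^sup>+x. ennreal (f x powr p) \<partial>lborel)"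
proof -
  interpret \<nu>: sigma_finite_measure \<nu> by (rule \<nu>(2))
  interpret P: pair_sigma_finite \<nu> "lborel :: (real^'n) measure" ..
  have [measurable_cong]: "sets \<nu> = sets borel" by (rule \<nu>)
  define k where "k y = ennreal (norm y powr (- \<delta>)) * indicator (ball 0 r) y" for y :: "real^'n"
  have [measurable]: "k \<in> borel_measurable borel" unfolding k_def by measurable
  have "(\<integral>\<^sup>+x. near_energy f p \<delta> r (x - w) \<partial>\<nu>) = (\<integral>\<^sup>+x. \<integral>\<^sup>+z. k ((z + w) - x) * ennreal (f z powr p) \<partial>lborel \<partial>\<nu>)"
  proof (rule nn_integral_cong)
    fix x
    have "near_energy f p \<delta> r (x - w) = (\<integral>\<^sup>+y. k y * ennreal (f (x - w + y) powr p) \<partial>lborel)"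
      by (simp add: near_energy_def k_def)
    also have "\<dots> = (\<integral>\<^sup>+z. k ((w - x) + z) * ennreal (f (x - w + ((w - x) + z)) powr p) \<partial>lborel)"
      by (rule nn_integral_lborel_translate[symmetric]) measurable
    also have "\<dots> = (\<integral>\<^sup>+z. k ((z + w) - x) * ennreal (f z powr p) \<partial>lborel)"
      by (intro nn_integral_cong) (simp add: algebra_simps)
    finally show "near_energy f p \<delta> r (x - w) = (\<integral>\<^sup>+z. k ((z + w) - x) * ennreal (f z powr p) \<partial>lborel)" .
  qed
  also have "\<dots> = (\<integral>\<^sup>+z. \<integral>\<^sup>+x. k ((z + w) - x) * ennreal (f z powr p) \<partial>\<nu> \<partial>lborel)"
    by (rule P.Fubini'[symmetric]) measurable
  also have "\<dots> \<le> (\<integral>\<^sup>+z. ennreal (C * 2 powr \<delta> / (1 - (1 / 2) powr (d - \<delta>)) * r powr (d - \<delta>)) * ennreal (f z powr p) \<partial>lborel)"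
  proof (rule nn_integral_mono)
    fix z
    have "(\<integral>\<^sup>+x. k ((z + w) - x) * ennreal (f z powr p) \<partial>\<nu>) = (\<integral>\<^sup>+x. k ((z + w) - x) \<partial>\<nu>) * ennreal (f z powr p)"
      by (rule nn_integral_multc) measurable
    also have "\<dots> \<le> ennreal (C * 2 powr \<delta> / (1 - (1 / 2) powr (d - \<delta>)) * r powr (d - \<delta>)) * ennreal (f z powr p)"
      unfolding k_def by (intro mult_right_mono growth_kernel_bound[OF \<nu>(1) g C \<delta> r]) simp
    finally show "(\<integral>\<^sup>+x. k ((z + w) - x) * ennreal (f z powr p) \<partial>\<nu>)
      \<le> ennreal (C * 2 powr \<delta> / (1 - (1 / 2) powr (d - \<delta>)) * r powr (d - \<delta>)) * ennreal (f z powr p)" .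
  qed
  also have "\<dots> = ennreal (C * 2 powr \<delta> / (1 - (1 / 2) powr (d - \<delta>)) * r powr (d - \<delta>)) * (\<integral>\<^sup>+z. ennreal (f z powr p) \<partial>lborel)"
    by (rule nn_integral_cmult) measurable
  finally show ?thesis .
qed

section \<open>Summation over the levels of the function\<close>

lemma exp_step_bound:
  fixes X \<kappa> A B :: real and Y :: "nat \<Rightarrow> ennreal"
  assumes A: "A > 0" and \<kappa>: "\<kappa> \<ge> 0" and Y: "\<And>j. X > A * real j + B \<Longrightarrow> Y j \<ge> 1"
  shows "ennreal (exp (\<kappa> * X)) \<le> ennreal (exp (\<kappa> * B)) + (\<Sum>j. ennreal (exp (\<kappa> * (A * real (Suc j) + B))) * Y j)"
proof (cases "X \<le> B")
  case True
  then have "ennreal (exp (\<kappa> * X)) \<le> ennreal (exp (\<kappa> * B))" using \<kappa> by (intro ennreal_leI) (simp add: mult_left_mono)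
  then show ?thesis by (rule order_trans) simp
next
  case False
  \<comment> \<open>Taking the ceiling and then j = c - 1 gives A j + B < X \<le> A (j + 1) + B. The
    strict left inequality is the premise for \<open>Y j\<close> \<ge> 1, which puts Chebyshev's
    inequality into the sum; the right one bounds the exponential.\<close>
  define c where "c = \<lceil>(X - B) / A\<rceil>"
  have c: "c \<ge> 1" using False A by (simp add: c_def one_le_ceiling)
  define j where "j = nat (c - 1)"
  have j: "real j = of_int c - 1" using c by (simp add: j_def)
  have "of_int c - 1 < (X - B) / A" "(X - B) / A \<le> of_int c" unfolding c_def by linarith+
  then have 1: "A * real j + B < X" and 2: "X \<le> A * real (Suc j) + B"
    using A by (simp_all add: j field_simps)
  have "ennreal (exp (\<kappa> * X)) \<le> ennreal (exp (\<kappa> * (A * real (Suc j) + B)))"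
    using 2 \<kappa> by (intro ennreal_leI) (simp add: mult_left_mono)
  also have "\<dots> \<le> ennreal (exp (\<kappa> * (A * real (Suc j) + B))) * Y j"
    using mult_left_mono[OF Y[OF 1], of "ennreal (exp (\<kappa> * (A * real (Suc j) + B)))"] by simp
  also have "\<dots> \<le> (\<Sum>j. ennreal (exp (\<kappa> * (A * real (Suc j) + B))) * Y j)" by (rule le_suminf_ennreal)
  finally show ?thesis by (simp add: add_increasing)
qed

text \<open>The auxiliary quantities are parameters fixed by equations, so the bound is visibly a
  function of n, k, the domain, d, C, \<gamma> and the chosen e and \<delta>; neither \<nu> nor u
  enters it.\<close>

lemma exponential_integral_bound:
  fixes \<Omega> :: "(real^'n::finite) set" and \<nu> :: "(real^'n) measure" and u :: "real^'n \<Rightarrow> real"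
  assumes \<Omega>: "open \<Omega>" "\<Omega> \<subseteq> ball 0 R" "R > 0" and k: "1 \<le> k" "k < CARD('n)"
    and \<nu>: "borel_measure_on \<Omega> \<nu>" "upper_growth \<nu> d C" and C: "C > 0"
    and u: "u \<in> W0_weak k (real CARD('n) / real k) \<Omega>" "weak_Lp_norm \<Omega> (real CARD('n) / real k) (norm_D k u) \<le> 1"
    and e: "0 < e" "e < real CARD('n) - real k" "e < \<delta>" "\<delta> < d"
    and \<gamma>: "0 \<le> \<gamma>"
    and G_def: "G = riesz_const TYPE('n) k"
    and A_def: "A = real CARD('n) * omega TYPE('n) powr ((real CARD('n) - real k) / real CARD('n))"
    and p_def: "p = (real CARD('n) - e) / real k"
    and M_def: "M = measure lborel \<Omega>"
    and B_def: "B = (real CARD('n) * omega TYPE('n) / real k + M + real k / (real CARD('n) - real k))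
       + real CARD('n) * omega TYPE('n) * (p - 1) / (\<delta> - e) + 1"
    and C3_def: "C3 = C * 2 powr \<delta> / (1 - (1 / 2) powr (d - \<delta>)) * (M + 2 powr p / (1 - 2 powr (p - real CARD('n) / real k)))"
    and conv: "\<gamma> / G * A < d - e"
  shows "(\<integral>\<^sup>+x\<in>\<Omega>. ennreal (exp (\<gamma> * \<bar>precise_rep u x\<bar>)) \<partial>\<nu>)
    \<le> ennreal (exp (\<gamma> / G * B) * (C * R powr d) + exp (\<gamma> / G * (A + B)) * C3 / (1 - exp (\<gamma> / G * A - (d - e))))"
proof -
  define n where "n = real CARD('n)"
  have n: "n > 0" "real k < n" "0 < real k" using k by (auto simp: n_def)
  have G: "G > 0" unfolding G_def by (rule riesz_const_pos[OF k])
  have A: "A > 0" using n omega_pos[where 'n='n] by (simp add: A_def n_def)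
  have p1: "p > 1" "p < n / real k" using e n by (auto simp: p_def n_def field_simps)
  have bd: "bounded \<Omega>" using \<Omega>(2) bounded_ball bounded_subset by blast
  have Ob[measurable]: "\<Omega> \<in> sets borel" using \<Omega>(1) by simp
  have finM: "emeasure lborel \<Omega> = ennreal M"
    using emeasure_bounded_finite[OF bd] by (simp add: M_def emeasure_eq_ennreal_measure less_top)
  have M: "M \<ge> 0" by (simp add: M_def)
  have wd: "weakly_differentiable k u" and u0: "\<And>x. x \<notin> \<Omega> \<Longrightarrow> u x = 0" using u(1) by (auto simp: W0_weak_def)
  have no: "null_off \<Omega> u" using u0 by (simp add: null_off_def)
  have lu: "locally_integrable u" by (rule weakly_differentiable_locally_integrable[OF wd])
  have Dm: "norm_D k u \<in> borel_measurable lebesgue" and Dn: "null_off \<Omega> (norm_D k u)"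
    using norm_D_borel[OF \<Omega>(1) bd wd no] by auto
  obtain g where g[measurable]: "g \<in> borel_measurable borel" and Dg: "AE x in lebesgue. norm_D k u x = g x"
    using lebesgue_borel_representative[OF Dm] by blast
  \<comment> \<open>A Borel version of |D^k u| that is nonnegative and vanishes off \<Omega> at
    every point, so its superlevel sets lie in \<Omega>.\<close>
  define f where "f x = \<bar>g x\<bar> * indicator \<Omega> x" for x
  have f[measurable]: "f \<in> borel_measurable borel" unfolding f_def by measurable
  have f0: "f x \<ge> 0" for x by (simp add: f_def)
  have D0: "norm_D k u x \<ge> 0" for x by (simp add: norm_D_def)
  have Df: "AE x in lebesgue. norm_D k u x = f x"
    using Dg Dn unfolding null_off_def
  proof eventually_elim
    case (elim x)
    then show ?case using D0[of x] by (auto simp: f_def indicator_def)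
  qed
  have fM: "emeasure lborel {x. f x > b} \<le> ennreal M" if "b \<ge> 0" for b
    unfolding finM[symmetric] by (rule emeasure_mono) (use that in \<open>auto simp: f_def indicator_def split: if_splits\<close>)
  have fb: "emeasure lborel {x. f x > b} \<le> ennreal (b powr (- n / real k))" if b: "b > 0" for b
  proof -
    have "emeasure lborel {x. f x > b} = emeasure lebesgue {x. f x > b}" by simp
    also have "\<dots> = emeasure lebesgue {x\<in>\<Omega>. \<bar>norm_D k u x\<bar> > b}"
    proof (rule emeasure_eq_AE)
      show "AE x in lebesgue. (x \<in> {x. f x > b}) = (x \<in> {x\<in>\<Omega>. \<bar>norm_D k u x\<bar> > b})"
        using Df
      proof eventually_elim
        case (elim x)
        then show ?case using b D0[of x] by (auto simp: f_def indicator_def split: if_splits)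
      qed
      have "{x. f x > b} \<in> sets borel" by measurable
      then show "{x. f x > b} \<in> sets lebesgue" by simp
      have "{x\<in>space lebesgue. \<bar>norm_D k u x\<bar> > b} \<in> sets lebesgue" using Dm by measurable
      then have "\<Omega> \<inter> {x\<in>space lebesgue. \<bar>norm_D k u x\<bar> > b} \<in> sets lebesgue" by (intro sets.Int) auto
      moreover have "\<Omega> \<inter> {x\<in>space lebesgue. \<bar>norm_D k u x\<bar> > b} = {x\<in>\<Omega>. \<bar>norm_D k u x\<bar> > b}" by auto
      ultimately show "{x\<in>\<Omega>. \<bar>norm_D k u x\<bar> > b} \<in> sets lebesgue" by simp
    qed
    also have "\<dots> \<le> ennreal (b powr (- (n / real k)))"
      unfolding n_def by (rule weak_Lp_norm_distribution[OF Dm _ _ u(2) b]) (use n in \<open>auto simp: n_def\<close>)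
    finally show ?thesis by simp
  qed
  have s\<nu>: "sets \<nu> = sets borel" and \<nu>0: "emeasure \<nu> (- \<Omega>) = 0" using \<nu>(1) by (auto simp: borel_measure_on_def)
  have [measurable_cong]: "sets \<nu> = sets borel" by (rule s\<nu>)
  \<comment> \<open>The growth on one ball containing \<Omega> makes \<nu> finite, hence
    sigma-finite, as the Fubini arguments require.\<close>
  have \<nu>\<Omega>: "emeasure \<nu> \<Omega> \<le> ennreal (C * R powr d)"
  proof -
    have "emeasure \<nu> \<Omega> \<le> emeasure \<nu> (ball 0 R)" by (rule emeasure_mono[OF \<Omega>(2)]) (simp add: s\<nu>)
    also have "\<dots> \<le> ennreal (C * R powr d)" using \<nu>(2) \<Omega>(3) by (simp add: upper_growth_def)
    finally show ?thesis .
  qed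
  have sp: "space \<nu> = UNIV" using sets_eq_imp_space_eq[OF s\<nu>] by simp
  have "emeasure \<nu> UNIV \<le> emeasure \<nu> \<Omega> + emeasure \<nu> (- \<Omega>)"
    using emeasure_subadditive[of \<Omega> \<nu> "- \<Omega>"] by (simp add: s\<nu>)
  also have "\<dots> < \<infinity>" using \<nu>\<Omega> \<nu>0 by (simp add: order.strict_trans1)
  finally have "finite_measure \<nu>" by (intro finite_measureI) (simp add: sp less_top)
  then have sf: "sigma_finite_measure \<nu>" by (simp add: finite_measure_def)
  interpret \<nu>: sigma_finite_measure \<nu> by (rule sf)
  interpret P: pair_sigma_finite \<nu> "lborel :: (real^'n) measure" ..
  define \<eta> where "\<eta> m = (mollifier (1 / real (Suc m)) :: real^'n \<Rightarrow> real)" for m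
  have \<eta>1: "(\<integral>\<^sup>+w. ennreal (\<eta> m w) \<partial>lborel) = 1" for m unfolding \<eta>_def by (rule nn_integral_mollifier) simp
  have [measurable]: "\<eta> m \<in> borel_measurable borel" for m unfolding \<eta>_def by measurable
  \<comment> \<open>The energy term of the near part, averaged by the mollifier; everything else in
    the bound of the potential is independent of u and x.\<close>
  define Q where "Q r m x = ennreal (r powr (\<delta> - e)) * (\<integral>\<^sup>+w. ennreal (\<eta> m w) * near_energy f p \<delta> r (x - w) \<partial>lborel)" for r m x
  have Qm[measurable]: "Q r m \<in> borel_measurable borel" for r m unfolding Q_def by measurable
  have pot: "ennreal \<bar>G * convolution u (\<eta> m) x\<bar> \<le> ennreal (A * ln (1 / r) + (B - 1)) + Q r m x" if r: "0 < r" "r \<le> 1" for r m x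
  proof -
    define far where "far z = (\<integral>\<^sup>+y. ennreal (norm y powr (real k - n)) * indicator (- ball 0 r) y * ennreal (f (z + y)) \<partial>lborel)" for z
    define near where "near z = (\<integral>\<^sup>+y. ennreal (norm y powr (real k - n)) * indicator (ball 0 r) y * ennreal (f (z + y)) \<partial>lborel)" for z
    define c1 where "c1 = A * ln (1 / r) + (n * omega TYPE('n) / real k + M + real k / (n - real k))"
    define c2 where "c2 = n * omega TYPE('n) * (p - 1) / (\<delta> - e)"
    have far: "far z \<le> ennreal c1" for z
      using riesz_far_bound[OF f f0 _ _ M fM fb[unfolded n_def] r, of z] n
      unfolding far_def c1_def A_def n_def by simp
    have near: "near z \<le> ennreal c2 + ennreal (r powr (\<delta> - e)) * near_energy f p \<delta> r z" for z
      using riesz_near_bound[OF f f0 _ _ e(1,2,3) p_def r(1), of z] n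
      unfolding near_def c2_def n_def near_energy_def by simp
    have split: "(\<integral>\<^sup>+y. ennreal (norm y powr (real k - n)) * ennreal (f (z + y)) \<partial>lborel) = far z + near z" for z
      unfolding far_def near_def
      by (subst nn_integral_add[symmetric]) (auto intro!: nn_integral_cong simp: indicator_def)
    have c0: "0 \<le> c1" "0 \<le> c2"
      using A r n M e p1 omega_pos[where 'n='n] by (auto simp: c1_def c2_def intro!: add_nonneg_nonneg)
    have "ennreal \<bar>G * convolution u (\<eta> m) x\<bar> \<le> (\<integral>\<^sup>+w. ennreal (\<eta> m w) * (far (x - w) + near (x - w)) \<partial>lborel)"
      using riesz_potential_bound_mollified[OF \<Omega>(1) bd wd no k inverse_Suc_pos f Df f0, of m x]
      unfolding split[symmetric] G_def \<eta>_def n_def .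
    also have "\<dots> \<le> (\<integral>\<^sup>+w. ennreal (c1 + c2) * ennreal (\<eta> m w) + ennreal (r powr (\<delta> - e)) * (ennreal (\<eta> m w) * near_energy f p \<delta> r (x - w)) \<partial>lborel)"
    proof (rule nn_integral_mono)
      fix w
      have "far (x - w) + near (x - w) \<le> ennreal c1 + (ennreal c2 + ennreal (r powr (\<delta> - e)) * near_energy f p \<delta> r (x - w))"
        by (intro add_mono far near)
      also have "\<dots> = ennreal (c1 + c2) + ennreal (r powr (\<delta> - e)) * near_energy f p \<delta> r (x - w)"
        using c0 by (simp add: ennreal_plus add.assoc)
      finally have "ennreal (\<eta> m w) * (far (x - w) + near (x - w)) \<le> ennreal (\<eta> m w) * (ennreal (c1 + c2) + ennreal (r powr (\<delta> - e)) * near_energy f p \<delta> r (x - w))"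
        by (rule mult_left_mono) simp
      then show "ennreal (\<eta> m w) * (far (x - w) + near (x - w)) \<le> ennreal (c1 + c2) * ennreal (\<eta> m w) + ennreal (r powr (\<delta> - e)) * (ennreal (\<eta> m w) * near_energy f p \<delta> r (x - w))"
        by (simp only: distrib_left mult_ac)
    qed
    also have "\<dots> = ennreal (c1 + c2) * (\<integral>\<^sup>+w. ennreal (\<eta> m w) \<partial>lborel) + ennreal (r powr (\<delta> - e)) * (\<integral>\<^sup>+w. ennreal (\<eta> m w) * near_energy f p \<delta> r (x - w) \<partial>lborel)"
      by (subst nn_integral_add, measurable, subst (1 2) nn_integral_cmult, measurable)
    also have "c1 + c2 = A * ln (1 / r) + (B - 1)" by (simp add: c1_def c2_def B_def n_def)
    finally show ?thesis unfolding \<eta>1 Q_def by simp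
  qed
  \<comment> \<open>Fatou's lemma is applied to these energies: their lower limit is at least 1
    wherever the limit of the mollifications exceeds the level. The radius exp (-j) turns the
    logarithm in the far part into j.\<close>
  define Y where "Y j x = liminf (\<lambda>m. Q (exp (- real j)) m x)" for j x
  have Ym[measurable]: "Y j \<in> borel_measurable borel" for j unfolding Y_def by measurable
  have Y1: "Y j x \<ge> 1" if X: "G * \<bar>precise_rep u x\<bar> > A * real j + B" for j x
  proof -
    have B: "B \<ge> 0" using M n e p1 omega_pos[where 'n='n] by (auto simp: B_def n_def intro!: add_nonneg_nonneg)
    \<comment> \<open>Where the averages do not converge the representative is 0 by definition and
      cannot exceed a nonnegative level.\<close>
    have "\<exists>l. (ball_average u x \<longlongrightarrow> l) (at_right 0)"
    proof (rule ccontr)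
      assume "\<not> ?thesis"
      then have "precise_rep u x = 0" by (simp add: precise_rep_def)
      moreover have "A * real j \<ge> 0" using A by simp
      ultimately show False using X B by simp
    qed
    then obtain l where l: "(ball_average u x \<longlongrightarrow> l) (at_right 0)" by blast
    have "(\<lambda>m. G * \<bar>convolution u (\<eta> m) x\<bar>) \<longlonglongrightarrow> G * \<bar>l\<bar>"
      unfolding \<eta>_def by (intro tendsto_intros convolution_mollifier_tendsto[OF lu l])
    moreover have "G * \<bar>l\<bar> > A * real j + B" using X precise_rep_eqI[OF l] by simp
    ultimately have "eventually (\<lambda>m. G * \<bar>convolution u (\<eta> m) x\<bar> > A * real j + B) sequentially"
      by (rule order_tendstoD)
    then have "eventually (\<lambda>m. 1 \<le> Q (exp (- real j)) m x) sequentially"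
    proof eventually_elim
      case (elim m)
      \<comment> \<open>The summand 1 in B leaves exactly this room: the constants use up B - 1, so
        the energy must be at least 1.\<close>
      have "ennreal (A * real j + (B - 1)) + 1 = ennreal (A * real j + B)"
      proof -
        have "B - 1 \<ge> 0" using M n e p1 omega_pos[where 'n='n] by (auto simp: B_def n_def intro!: add_nonneg_nonneg)
        then show ?thesis using A by (simp add: ennreal_1[symmetric] ennreal_plus[symmetric] del: ennreal_1 ennreal_plus)
      qed
      also have "\<dots> \<le> ennreal \<bar>G * convolution u (\<eta> m) x\<bar>" using elim G by (intro ennreal_leI) (simp add: abs_mult)
      also have "\<dots> \<le> ennreal (A * ln (1 / exp (- real j)) + (B - 1)) + Q (exp (- real j)) m x" by (rule pot) auto
      also have "ln (1 / exp (- real j)) = real j" by (simp add: ln_div)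
      finally show ?case by (simp add: ennreal_add_left_cancel_le)
    qed
    then show ?thesis unfolding Y_def by (rule Liminf_bounded)
  qed
  have Lp: "(\<integral>\<^sup>+x. ennreal (f x powr p) \<partial>lborel) \<le> ennreal (M + 2 powr p / (1 - 2 powr (p - n / real k)))"
    by (rule Lp_bound_of_weak[OF f f0 M]) (use fM fb p1 in auto)
  have C30: "C3 \<ge> 0"
  proof -
    have "2 powr (p - n / real k) < (1::real)" using p1 powr_less_mono[of "p - n / real k" 0 2] by simp
    moreover have "(1 / 2) powr (d - \<delta>) < (1 :: real)" using e powr_less_mono2[of "d - \<delta>" "1 / 2" 1] by simp
    ultimately show ?thesis using C M by (auto simp: C3_def n_def intro!: mult_nonneg_nonneg divide_nonneg_nonneg add_nonneg_nonneg)
  qed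
  have Yint: "(\<integral>\<^sup>+x. Y j x \<partial>\<nu>) \<le> ennreal (C3 * exp (- real j * (d - e)))" for j
  proof -
    define r where "r = exp (- real j)"
    have r: "r > 0" by (simp add: r_def)
    define c where "c = C * 2 powr \<delta> / (1 - (1 / 2) powr (d - \<delta>)) * r powr (d - \<delta>)"
    have c: "c \<ge> 0"
      using e C powr_less_mono2[of "d - \<delta>" "1 / 2" 1] by (simp add: c_def less_imp_le)
    have ne: "(\<integral>\<^sup>+x. near_energy f p \<delta> r (x - w) \<partial>\<nu>) \<le> ennreal c * ennreal (M + 2 powr p / (1 - 2 powr (p - n / real k)))" for w
      unfolding c_def by (rule order_trans[OF near_energy_nn_integral[OF s\<nu> sf \<nu>(2) C _ e(4) r f] mult_left_mono[OF Lp]]) (use e in auto)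
    have bnd: "(\<integral>\<^sup>+x. Q r m x \<partial>\<nu>) \<le> ennreal (r powr (\<delta> - e)) * (ennreal c * ennreal (M + 2 powr p / (1 - 2 powr (p - n / real k))))" for m
    proof -
      have Q: "(\<integral>\<^sup>+x. Q r m x \<partial>\<nu>) = ennreal (r powr (\<delta> - e)) * (\<integral>\<^sup>+x. \<integral>\<^sup>+w. ennreal (\<eta> m w) * near_energy f p \<delta> r (x - w) \<partial>lborel \<partial>\<nu>)"
        unfolding Q_def by (rule nn_integral_cmult) measurable
      have "(\<integral>\<^sup>+x. \<integral>\<^sup>+w. ennreal (\<eta> m w) * near_energy f p \<delta> r (x - w) \<partial>lborel \<partial>\<nu>)
        = (\<integral>\<^sup>+w. \<integral>\<^sup>+x. ennreal (\<eta> m w) * near_energy f p \<delta> r (x - w) \<partial>\<nu> \<partial>lborel)"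
        by (rule P.Fubini'[symmetric]) measurable
      also have "\<dots> = (\<integral>\<^sup>+w. ennreal (\<eta> m w) * (\<integral>\<^sup>+x. near_energy f p \<delta> r (x - w) \<partial>\<nu>) \<partial>lborel)"
        by (intro nn_integral_cong nn_integral_cmult) measurable
      also have "\<dots> \<le> (\<integral>\<^sup>+w. ennreal (\<eta> m w) * (ennreal c * ennreal (M + 2 powr p / (1 - 2 powr (p - n / real k)))) \<partial>lborel)"
        by (intro nn_integral_mono mult_left_mono ne) simp
      also have "\<dots> = ennreal c * ennreal (M + 2 powr p / (1 - 2 powr (p - n / real k)))"
        by (subst nn_integral_multc) (auto simp: \<eta>1)
      finally show ?thesis unfolding Q by (rule mult_left_mono) simp
    qed
    have "(\<integral>\<^sup>+x. Y j x \<partial>\<nu>) \<le> liminf (\<lambda>m. \<integral>\<^sup>+x. Q r m x \<partial>\<nu>)"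
      unfolding Y_def r_def by (rule nn_integral_liminf) measurable
    also have "\<dots> \<le> ennreal (r powr (\<delta> - e)) * (ennreal c * ennreal (M + 2 powr p / (1 - 2 powr (p - n / real k))))"
      by (rule order_trans[OF Liminf_le_Limsup Limsup_bounded]) (auto intro: always_eventually bnd)
    also have "\<dots> = ennreal (r powr (\<delta> - e) * (c * (M + 2 powr p / (1 - 2 powr (p - n / real k)))))"
      using c by (simp add: ennreal_mult' ennreal_mult'')
    also have "r powr (\<delta> - e) * (c * (M + 2 powr p / (1 - 2 powr (p - n / real k)))) = C3 * (r powr (\<delta> - e) * r powr (d - \<delta>))"
      by (simp add: c_def C3_def n_def)
    \<comment> \<open>Here \<delta> cancels, and the decay r^(d-e) remains.\<close>
    also have "r powr (\<delta> - e) * r powr (d - \<delta>) = exp (- real j * (d - e))"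
      unfolding powr_add[symmetric] by (simp add: r_def powr_def mult.commute)
    finally show ?thesis .
  qed
  define \<kappa> where "\<kappa> = \<gamma> / G"
  have \<kappa>: "\<kappa> \<ge> 0" using \<gamma> G by (simp add: \<kappa>_def)
  have "(\<integral>\<^sup>+x\<in>\<Omega>. ennreal (exp (\<gamma> * \<bar>precise_rep u x\<bar>)) \<partial>\<nu>)
    \<le> (\<integral>\<^sup>+x. ennreal (exp (\<kappa> * B)) * indicator \<Omega> x + (\<Sum>j. ennreal (exp (\<kappa> * (A * real (Suc j) + B))) * Y j x) \<partial>\<nu>)"
  proof (rule nn_integral_mono)
    fix x
    have eq: "\<gamma> * \<bar>precise_rep u x\<bar> = \<kappa> * (G * \<bar>precise_rep u x\<bar>)" using G by (simp add: \<kappa>_def)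
    show "ennreal (exp (\<gamma> * \<bar>precise_rep u x\<bar>)) * indicator \<Omega> x
      \<le> ennreal (exp (\<kappa> * B)) * indicator \<Omega> x + (\<Sum>j. ennreal (exp (\<kappa> * (A * real (Suc j) + B))) * Y j x)"
      unfolding eq using exp_step_bound[OF A \<kappa>, of B "G * \<bar>precise_rep u x\<bar>" "\<lambda>j. Y j x"] Y1
      by (cases "x \<in> \<Omega>") auto
  qed
  also have "\<dots> = ennreal (exp (\<kappa> * B)) * emeasure \<nu> \<Omega> + (\<Sum>j. ennreal (exp (\<kappa> * (A * real (Suc j) + B))) * (\<integral>\<^sup>+x. Y j x \<partial>\<nu>))"
    by (simp add: nn_integral_add nn_integral_suminf nn_integral_cmult nn_integral_cmult_indicator s\<nu>)
  also have "\<dots> \<le> ennreal (exp (\<kappa> * B)) * ennreal (C * R powr d) + (\<Sum>j. ennreal ((exp (\<kappa> * (A + B)) * C3) * (exp (\<kappa> * A - (d - e))) ^ j))"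
  proof (intro add_mono mult_left_mono \<nu>\<Omega> suminf_le)
    fix j
    have "ennreal (exp (\<kappa> * (A * real (Suc j) + B))) * (\<integral>\<^sup>+x. Y j x \<partial>\<nu>) \<le> ennreal (exp (\<kappa> * (A * real (Suc j) + B))) * ennreal (C3 * exp (- real j * (d - e)))"
      by (rule mult_left_mono[OF Yint]) simp
    also have "\<dots> = ennreal ((exp (\<kappa> * (A + B)) * C3) * (exp (\<kappa> * A - (d - e))) ^ j)"
    proof -
      have "exp (\<kappa> * (A * real (Suc j) + B)) * exp (- real j * (d - e)) = exp (\<kappa> * (A + B)) * exp (\<kappa> * A - (d - e)) ^ j"
        unfolding exp_of_nat_mult[symmetric] exp_add[symmetric] by (simp add: algebra_simps)
      then show ?thesis using C30 by (simp add: ennreal_mult[symmetric] mult_ac)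
    qed
    finally show "ennreal (exp (\<kappa> * (A * real (Suc j) + B))) * (\<integral>\<^sup>+x. Y j x \<partial>\<nu>) \<le> ennreal ((exp (\<kappa> * (A + B)) * C3) * (exp (\<kappa> * A - (d - e))) ^ j)" .
  qed (auto simp: summableI)
  \<comment> \<open>The ratio is below 1 by \<gamma> / G * A < d - e; this is where the subcritical
    condition enters.\<close>
  also have "(\<Sum>j. ennreal ((exp (\<kappa> * (A + B)) * C3) * (exp (\<kappa> * A - (d - e))) ^ j)) = ennreal (exp (\<kappa> * (A + B)) * C3 / (1 - exp (\<kappa> * A - (d - e))))"
    using conv C30 by (intro suminf_geometric_ennreal) (auto simp: \<kappa>_def)
  also have "ennreal (exp (\<kappa> * B)) * ennreal (C * R powr d) + ennreal (exp (\<kappa> * (A + B)) * C3 / (1 - exp (\<kappa> * A - (d - e))))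
    = ennreal (exp (\<kappa> * B) * (C * R powr d) + exp (\<kappa> * (A + B)) * C3 / (1 - exp (\<kappa> * A - (d - e))))"
    using conv C30 C by (simp add: ennreal_mult[symmetric] ennreal_plus[symmetric] \<kappa>_def del: ennreal_plus)
  finally show ?thesis by (simp add: \<kappa>_def)
qed

theorem subcritical_bound:
  fixes \<Omega> :: "(real^'n::finite) set" and k :: nat and d :: real
  assumes \<Omega>: "open \<Omega>" "bounded \<Omega>" and k: "1 \<le> k" "k < CARD('n)" and d: "0 < d"
    and C: "C > 0" and \<gamma>: "\<gamma> < beta_infty TYPE('n) k d"
  shows "\<exists>K>0::real. \<forall>\<nu>. borel_measure_on \<Omega> \<nu> \<and> upper_growth \<nu> d C \<longrightarrow>
     (\<forall>u \<in> W0_weak k (real CARD('n) / real k) \<Omega>. weak_Lp_norm \<Omega> (real CARD('n) / real k) (norm_D k u) \<le> 1 \<longrightarrow>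
        (\<integral>\<^sup>+x\<in>\<Omega>. ennreal (exp (\<gamma> * \<bar>precise_rep u x\<bar>)) \<partial>\<nu>) \<le> ennreal K)"
proof -
  \<comment> \<open>For negative \<gamma> the integrand is at most that for 0, and 0 is below the
    threshold as well.\<close>
  define \<gamma>' where "\<gamma>' = max \<gamma> 0"
  define G where "G = riesz_const TYPE('n) k"
  define A where "A = real CARD('n) * omega TYPE('n) powr ((real CARD('n) - real k) / real CARD('n))"
  have G: "G > 0" unfolding G_def by (rule riesz_const_pos[OF k])
  have A: "A > 0" using omega_pos[where 'n='n] by (simp add: A_def)
  have b: "beta_infty TYPE('n) k d = d * G / A" by (simp add: beta_infty_eq G_def A_def)
  have "d * G / A > 0" using d G A by simp
  then have "\<gamma>' < d * G / A" using \<gamma> by (simp add: \<gamma>'_def b)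
  then have conv: "\<gamma>' / G * A < d" using G A by (simp add: field_simps)
  \<comment> \<open>Half of each upper bound that e has to respect: subcriticality, p > 1, and room
    for \<delta> between e and d.\<close>
  define e where "e = min (min ((d - \<gamma>' / G * A) / 2) ((real CARD('n) - real k) / 2)) (d / 2)"
  have e1: "e > 0" unfolding e_def using conv k d by simp
  have e2: "e \<le> (d - \<gamma>' / G * A) / 2" "e \<le> (real CARD('n) - real k) / 2" "e \<le> d / 2"
    unfolding e_def by (auto simp only: min.coboundedI1 min.cobounded1 min.cobounded2 intro: order_trans[OF min.cobounded1])
  have e: "0 < e" "e < real CARD('n) - real k" "e < d" "\<gamma>' / G * A < d - e"
    using e1 e2 k d conv by (auto simp: field_simps)
  define \<delta> where "\<delta> = (e + d) / 2"
  have \<delta>: "e < \<delta>" "\<delta> < d" using e by (auto simp: \<delta>_def)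
  obtain R0 where "\<And>x. x \<in> \<Omega> \<Longrightarrow> norm x \<le> R0" using \<Omega>(2) unfolding bounded_iff by blast
  then have R: "\<Omega> \<subseteq> ball 0 (\<bar>R0\<bar> + 1)" by fastforce
  define p where "p = (real CARD('n) - e) / real k"
  define M where "M = measure lborel \<Omega>"
  define B where "B = (real CARD('n) * omega TYPE('n) / real k + M + real k / (real CARD('n) - real k))
       + real CARD('n) * omega TYPE('n) * (p - 1) / (\<delta> - e) + 1"
  define C3 where "C3 = C * 2 powr \<delta> / (1 - (1 / 2) powr (d - \<delta>)) * (M + 2 powr p / (1 - 2 powr (p - real CARD('n) / real k)))"
  define K where "K = exp (\<gamma>' / G * B) * (C * (\<bar>R0\<bar> + 1) powr d) + exp (\<gamma>' / G * (A + B)) * C3 / (1 - exp (\<gamma>' / G * A - (d - e)))"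
  show ?thesis
  proof (intro exI[of _ "\<bar>K\<bar> + 1"] conjI allI ballI impI)
    show "\<bar>K\<bar> + 1 > 0" by linarith
    fix \<nu> u
    assume \<nu>: "borel_measure_on \<Omega> \<nu> \<and> upper_growth \<nu> d C" and u: "u \<in> W0_weak k (real CARD('n) / real k) \<Omega>"
      "weak_Lp_norm \<Omega> (real CARD('n) / real k) (norm_D k u) \<le> 1"
    have "(\<integral>\<^sup>+x\<in>\<Omega>. ennreal (exp (\<gamma> * \<bar>precise_rep u x\<bar>)) \<partial>\<nu>) \<le> (\<integral>\<^sup>+x\<in>\<Omega>. ennreal (exp (\<gamma>' * \<bar>precise_rep u x\<bar>)) \<partial>\<nu>)"
      by (intro nn_integral_mono mult_right_mono ennreal_leI) (auto simp: \<gamma>'_def intro: mult_right_mono)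
    also have "\<dots> \<le> ennreal K"
      unfolding K_def
      by (rule exponential_integral_bound[OF \<Omega>(1) R _ k conjunct1[OF \<nu>] conjunct2[OF \<nu>] C u e(1,2) \<delta> _ G_def A_def p_def M_def B_def C3_def e(4)])
         (auto simp: \<gamma>'_def)
    also have "\<dots> \<le> ennreal (\<bar>K\<bar> + 1)" by (intro ennreal_leI) linarith
    finally show "(\<integral>\<^sup>+x\<in>\<Omega>. ennreal (exp (\<gamma> * \<bar>precise_rep u x\<bar>)) \<partial>\<nu>) \<le> ennreal (\<bar>K\<bar> + 1)" .
  qed
qed

section \<open>Logarithmic profiles and sharpness\<close>

lemma derivative_sequence_zero:
  fixes F :: "nat \<Rightarrow> real \<Rightarrow> real"
  assumes F: "\<And>j t. (F j has_real_derivative F (Suc j) t) (at t)" and U: "open U" "\<And>t. t \<in> U \<Longrightarrow> F 0 t = 0"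
  shows "t \<in> U \<Longrightarrow> F j t = 0"
proof (induction j arbitrary: t)
  case (Suc j)
  have "((\<lambda>t. 0) has_real_derivative 0) (at t)" by simp
  then have "(F j has_real_derivative 0) (at t)"
    by (rule has_field_derivative_transform_within_open[OF _ U(1)]) (use Suc in auto)
  then show ?case using F DERIV_unique by blast
qed (use U in auto)

text \<open>The primitive of a product of two cutoffs supported in the unit interval. With slope at
  most 1 a smooth step on this interval stays below height 1; a height above 1 - e is obtained by
  dominated convergence, as the cutoffs fill the interval.\<close>

lemma smooth_step_exists:
  fixes e :: real
  assumes e: "e > 0"
  obtains H :: "nat \<Rightarrow> real \<Rightarrow> real" where
    "\<And>j t. (H j has_real_derivative H (Suc j) t) (at t)"
    "\<And>t. 0 \<le> H 1 t \<and> H 1 t \<le> 1" "\<And>t. t \<le> 0 \<Longrightarrow> H 0 t = 0" "\<And>t. t \<ge> 1 \<Longrightarrow> H 0 t = H 0 1"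
    "H 0 1 > 1 - e" "\<And>j. \<exists>B. \<forall>t. \<bar>H (Suc j) t\<bar> \<le> B"
    "\<And>j t. t > 1 \<Longrightarrow> H (Suc j) t = 0"
proof -
  define g where "g m t = exp_cutoff (1 / real (Suc m)) t * exp_cutoff (1 / real (Suc m)) (1 - t)" for m t
  have g01: "0 \<le> g m t" "g m t \<le> 1" for m t unfolding g_def by (auto intro!: mult_le_one exp_cutoff_le_1)
  have g0: "g m t = 0" if "t \<le> 0 \<or> t \<ge> 1" for m t using that by (auto simp: g_def exp_cutoff_def)
  have sg: "smooth_real (g m)" for m
  proof -
    have "smooth_real (\<lambda>t. exp_cutoff (1 / real (Suc m)) ((- 1) * t + 1))"
      by (rule smooth_real_affine[OF smooth_real_exp_cutoff]) simp
    then have "smooth_real (\<lambda>t. exp_cutoff (1 / real (Suc m)) t * exp_cutoff (1 / real (Suc m)) ((- 1) * t + 1))"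
      by (intro smooth_real_mult smooth_real_exp_cutoff) auto
    then show ?thesis by (simp add: g_def[abs_def])
  qed
  have cg: "continuous_on S (g m)" for m S
  proof -
    obtain F where F: "F 0 = g m" "\<And>j t. (F j has_real_derivative F (Suc j) t) (at t)"
      using sg[of m] unfolding smooth_real_def by metis
    have "isCont (g m) t" for t using DERIV_isCont[OF F(2)[of 0 t]] F(1) by simp
    then show ?thesis by (simp add: continuous_at_imp_continuous_on)
  qed
  have [measurable]: "g m \<in> borel_measurable borel" for m by (rule borel_measurable_continuous_onI[OF cg])
  have "(\<lambda>m. LINT t|lborel. g m t) \<longlonglongrightarrow> (LINT t|lborel. indicat_real {0<..} t * indicat_real {0<..} (1 - t :: real))"
  proof (rule integral_dominated_convergence[where w = "indicat_real {0..1}"])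
    show "AE t in lborel. (\<lambda>m. g m t) \<longlonglongrightarrow> indicator {0<..} t * indicator {0<..} (1 - t)"
      unfolding g_def by (intro AE_I2 tendsto_mult exp_cutoff_tendsto_1)
    show "AE t in lborel. norm (g m t) \<le> indicat_real {0..1} t" for m
    proof (intro AE_I2)
      fix t show "norm (g m t) \<le> indicat_real {0..1} t"
        using g01[of m t] g0[of t m] by (cases "t \<in> {0..1}") auto
    qed
  qed auto
  also have "(\<lambda>t :: real. indicat_real {0<..} t * indicat_real {0<..} (1 - t)) = indicat_real {0<..<1}"
    by (auto simp: indicator_def fun_eq_iff)
  also have "(LINT t|lborel. indicat_real {0<..<1::real} t) = 1" by simp
  finally have "eventually (\<lambda>m. dist (LINT t|lborel. g m t) 1 < e) sequentially" using e by (rule tendstoD)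
  then obtain m where "dist (LINT t|lborel. g m t) 1 < e"
    unfolding eventually_sequentially by blast
  then have m: "(LINT t|lborel. g m t) > 1 - e"
    by (simp add: dist_real_def abs_less_iff)
  obtain F where F: "F 0 = g m" "\<And>j t. (F j has_real_derivative F (Suc j) t) (at t)"
    using sg[of m] unfolding smooth_real_def by metis
  \<comment> \<open>The lower limit -1 puts every t \<ge> 0 in the interior of the interval {-1..t +
    1}, so the derivative obtained there is two-sided.\<close>
  define h where "h t = integral {-1..t} (g m)" for t
  have hneg: "h t = 0" if "t \<le> 0" for t
  proof -
    have "h t = integral {-1..t} (\<lambda>_. 0)"
      unfolding h_def by (rule integral_cong) (use that g0 in auto)
    then show ?thesis by simp
  qed
  have hd: "(h has_real_derivative g m t) (at t)" for t
  proof (cases "t < 0")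
    case True
    have "((\<lambda>t. 0) has_real_derivative g m t) (at t)" using g0[of t m] True by simp
    then show ?thesis
      by (rule has_field_derivative_transform_within_open[where S = "{..<0}"]) (use True hneg in auto)
  next
    case False
    have "(h has_real_derivative g m t) (at t within {-1..t + 1})"
      unfolding h_def by (rule integral_has_real_derivative[OF cg]) (use False in auto)
    moreover have "at t within {-1..t + 1} = at t"
      by (rule at_within_interior) (use False in auto)
    ultimately show ?thesis by simp
  qed
  define H where "H j = (case j of 0 \<Rightarrow> h | Suc i \<Rightarrow> F i)" for j
  have Hd: "(H j has_real_derivative H (Suc j) t) (at t)" for j t
    by (cases j) (use hd F in \<open>auto simp: H_def\<close>)
  have h1: "h t = (LINT t|lborel. g m t)" if "t \<ge> 1" for t
  proof -
    have i: "integrable lborel (g m)"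
      by (rule Bochner_Integration.integrable_bound[where f = "indicat_real {0..1}"]) (use g01 g0[of _ m] in \<open>auto simp: indicator_def\<close>)
    have "h t = integral UNIV (\<lambda>s. if s \<in> {-1..t} then g m s else 0)"
      unfolding h_def by (rule integral_restrict_UNIV[symmetric])
    also have "\<dots> = integral UNIV (g m)"
      by (rule integral_cong) (use g0[of _ m] that in auto)
    also have "\<dots> = (LINT t|lborel. g m t)" using integral_lborel[OF i] by simp
    finally show ?thesis .
  qed
  have Fz: "F j t = 0" if "t < 0 \<or> t > 1" for j t
    by (rule derivative_sequence_zero[where F = F, OF F(2), where U = "{..<0} \<union> {1<..}"]) (use F(1) g0[of _ m] that in auto)
  have B: "\<exists>B. \<forall>t. \<bar>F j t\<bar> \<le> B" for j
  proof -
    have "continuous_on {0..1} (F j)"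
      using DERIV_isCont[OF F(2)] by (simp add: continuous_at_imp_continuous_on)
    then have "compact (F j ` {0..1})" by (rule compact_continuous_image) simp
    then obtain B where B: "\<And>t. t \<in> {0..1} \<Longrightarrow> \<bar>F j t\<bar> \<le> B"
      unfolding compact_eq_bounded_closed bounded_iff by (metis imageI real_norm_def)
    have "\<bar>F j t\<bar> \<le> \<bar>B\<bar>" for t
    proof (cases "t \<in> {0..1}")
      case True
      then show ?thesis using B[OF True] by linarith
    next
      case False
      then show ?thesis using Fz[of t j] by auto
    qed
    then show ?thesis by blast
  qed
  show ?thesis
  proof (rule that[of H])
    show "(H j has_real_derivative H (Suc j) t) (at t)" for j t by (rule Hd)
    show "0 \<le> H 1 t \<and> H 1 t \<le> 1" for t using g01 F(1) by (simp add: H_def)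
    show "t \<le> 0 \<Longrightarrow> H 0 t = 0" for t using hneg by (simp add: H_def)
    show "t \<ge> 1 \<Longrightarrow> H 0 t = H 0 1" for t using h1 by (simp add: H_def)
    show "H 0 1 > 1 - e" using h1[of 1] m by (simp add: H_def)
    show "\<exists>B. \<forall>t. \<bar>H (Suc j) t\<bar> \<le> B" for j using B by (simp add: H_def)
    show "t > 1 \<Longrightarrow> H (Suc j) t = 0" for j t using Fz by (simp add: H_def)
  qed
qed

text \<open>In terms of the radius \<rho>, with s = \<rho>^2, this is ln (R / \<rho>) / T: it is 0
  at \<rho> = R and 1 at \<rho> = R exp (-T).\<close>

definition log_scale :: "real \<Rightarrow> real \<Rightarrow> real \<Rightarrow> real" where
  "log_scale T R s = ln (R\<^sup>2 / s) / (2 * T)"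

lemma log_scale_deriv:
  assumes "T > 0" "R > 0" "s > 0"
  shows "(log_scale T R has_real_derivative (- 1 / (2 * T * s))) (at s)"
proof -
  have "((\<lambda>s. (ln (R\<^sup>2) - ln s) / (2 * T)) has_real_derivative (- 1 / (2 * T * s))) (at s)"
    using assms by (auto intro!: derivative_eq_intros simp: field_simps)
  then show ?thesis
    by (rule has_field_derivative_transform_within_open[where S = "{0<..}"])
       (use assms in \<open>auto simp: log_scale_def ln_div\<close>)
qed

lemma inverse_power_deriv:
  fixes s :: real
  assumes "s > 0"
  shows "((\<lambda>s. inverse s ^ l) has_real_derivative - real l * inverse s ^ Suc l) (at s)"
proof (cases l)
  case (Suc k)
  have d: "((\<lambda>s. inverse s ^ l) has_real_derivative real l * (- (inverse s ^ Suc (Suc 0)) * inverse s ^ (l - Suc 0))) (at s)"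
    using DERIV_power[OF DERIV_inverse[of s], of l] assms by simp
  have eq: "real l * (- (inverse s ^ Suc (Suc 0)) * inverse s ^ (l - Suc 0)) = - real l * inverse s ^ Suc l"
    using Suc by (simp add: algebra_simps)
  show ?thesis by (rule d[unfolded eq])
qed simp

lemma log_scale_gt_1: "T > 0 \<Longrightarrow> R > 0 \<Longrightarrow> 0 < s \<Longrightarrow> s < (R * exp (- T))\<^sup>2 \<Longrightarrow> log_scale T R s > 1"
proof -
  assume a: "T > 0" "R > 0" "0 < s" "s < (R * exp (- T))\<^sup>2"
  then have "ln s < ln ((R * exp (- T))\<^sup>2)" by simp
  also have "ln ((R * exp (- T))\<^sup>2) = 2 * ln R - 2 * T" using a by (simp add: ln_mult ln_realpow)
  finally have "2 * T < ln (R\<^sup>2 / s)" using a by (simp add: ln_div ln_realpow)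
  then show ?thesis using a by (simp add: log_scale_def)
qed

lemma log_scale_le_0: "T > 0 \<Longrightarrow> R > 0 \<Longrightarrow> R\<^sup>2 \<le> s \<Longrightarrow> log_scale T R s \<le> 0"
proof -
  assume a: "T > 0" "R > 0" "R\<^sup>2 \<le> s"
  then have s: "s > 0" using less_le_trans[of 0 "R\<^sup>2" s] by simp
  then have "ln (R\<^sup>2 / s) \<le> 0" using a by (simp add: ln_le_zero_iff)
  then show ?thesis using a by (simp add: log_scale_def divide_nonpos_pos)
qed

text \<open>For s \<le> 0 the value is the one attained near s = 0 when the step is constant beyond
  1; the profile is then smooth on the whole line and constant near the origin.\<close>

definition log_profile :: "(nat \<Rightarrow> real \<Rightarrow> real) \<Rightarrow> real \<Rightarrow> real \<Rightarrow> real \<Rightarrow> real" where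
  "log_profile H T R s = (if s > 0 then T * H 0 (log_scale T R s) else T * H 0 1)"

lemma log_profile_smooth:
  fixes H :: "nat \<Rightarrow> real \<Rightarrow> real"
  assumes H: "\<And>j t. (H j has_real_derivative H (Suc j) t) (at t)" "\<And>t. t \<ge> 1 \<Longrightarrow> H 0 t = H 0 1"
    "\<And>j t. t > 1 \<Longrightarrow> H (Suc j) t = 0"
    and T: "T > 0" "R > 0"
  shows "smooth_real (log_profile H T R)"
    and "s > 0 \<Longrightarrow> (log_profile H T R has_real_derivative (- (1 / 2) * (inverse s * H 1 (log_scale T R s)))) (at s)"
proof -
  \<comment> \<open>These functions are closed under differentiation up to linear combinations. For
    s < s0 the scale exceeds 1 and the derivatives of H vanish, so the singularity at 0 is never
    met.\<close>
  define q where "q j l s = (if s > 0 then inverse s ^ l * H (Suc j) (log_scale T R s) else 0)" for j l :: nat and s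
  define s0 where "s0 = (R * exp (- T))\<^sup>2"
  have s0: "s0 > 0" using T by (simp add: s0_def)
  have chain: "((\<lambda>s. H j (log_scale T R s)) has_real_derivative H (Suc j) (log_scale T R s) * (- 1 / (2 * T * s))) (at s)" if "s > 0" for j s
    by (rule DERIV_chain2[OF H(1) log_scale_deriv[OF T that]])
  have small: "log_profile H T R s = T * H 0 1" "q j l s = 0" if "s < s0" for s j l
    using that log_scale_gt_1[OF T, of s] H(2)[of "log_scale T R s"] H(3)[of "log_scale T R s"]
    by (auto simp: log_profile_def q_def s0_def)
  have dq: "(q j l has_real_derivative (- real l * q j (Suc l) s + (- 1 / (2 * T)) * q (Suc j) (Suc l) s)) (at s)" for j l s
  proof (cases "s > 0")
    case True
    have E: "- 1 / (2 * T * s) = (- 1 / (2 * T)) * inverse s"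
      by (simp only: divide_inverse inverse_mult_distrib mult.assoc)
    have qe: "q j (Suc l) s = inverse s ^ Suc l * H (Suc j) (log_scale T R s)"
      "q (Suc j) (Suc l) s = inverse s ^ Suc l * H (Suc (Suc j)) (log_scale T R s)"
      using True by (simp_all only: q_def if_True)
    have eq: "- real l * inverse s ^ Suc l * H (Suc j) (log_scale T R s) + H (Suc (Suc j)) (log_scale T R s) * (- 1 / (2 * T * s)) * inverse s ^ l
      = - real l * q j (Suc l) s + (- 1 / (2 * T)) * q (Suc j) (Suc l) s"
      unfolding qe E power_Suc by (simp only: mult_ac)
    have "((\<lambda>s. inverse s ^ l * H (Suc j) (log_scale T R s)) has_real_derivative
        (- real l * q j (Suc l) s + (- 1 / (2 * T)) * q (Suc j) (Suc l) s)) (at s)"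
      by (rule DERIV_cong[OF DERIV_mult[OF inverse_power_deriv[OF True] chain[OF True, of "Suc j"]] eq])
    then show ?thesis
      by (rule has_field_derivative_transform_within_open[where S = "{0<..}"]) (use True in \<open>auto simp: q_def\<close>)
  next
    case False
    have "((\<lambda>s. 0) has_real_derivative (- real l * q j (Suc l) s + (- 1 / (2 * T)) * q (Suc j) (Suc l) s)) (at s)"
      using False by (simp add: q_def)
    then show ?thesis
      by (rule has_field_derivative_transform_within_open[where S = "{..<s0}"]) (use False s0 small in auto)
  qed
  have dV: "(log_profile H T R has_real_derivative (- (1 / 2) * q 0 1 s)) (at s)" for s
  proof (cases "s > 0")
    case True
    have "((\<lambda>s. T * H 0 (log_scale T R s)) has_real_derivative T * (H (Suc 0) (log_scale T R s) * (- 1 / (2 * T * s)))) (at s)"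
      by (rule DERIV_cmult[OF chain[OF True]])
    moreover have "T * (H (Suc 0) (log_scale T R s) * (- 1 / (2 * T * s))) = - (1 / 2) * q 0 1 s"
      using True T by (simp add: q_def field_simps)
    ultimately have "((\<lambda>s. T * H 0 (log_scale T R s)) has_real_derivative - (1 / 2) * q 0 1 s) (at s)" by (rule DERIV_cong)
    then show ?thesis
      by (rule has_field_derivative_transform_within_open[where S = "{0<..}"]) (use True in \<open>auto simp: log_profile_def\<close>)
  next
    case False
    have "((\<lambda>s. T * H 0 1) has_real_derivative (- (1 / 2) * q 0 1 s)) (at s)"
      using False by (simp add: q_def)
    then show ?thesis
      by (rule has_field_derivative_transform_within_open[where S = "{..<s0}"]) (use False s0 small in auto)
  qed
  show "s > 0 \<Longrightarrow> (log_profile H T R has_real_derivative (- (1 / 2) * (inverse s * H 1 (log_scale T R s)))) (at s)"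
    using dV[of s] by (simp add: q_def)
  define G where "G = insert (log_profile H T R) {q j l | j l. True}"
  have qG: "q j l \<in> function_algebra G" for j l by (rule function_algebra.gen) (auto simp: G_def)
  show "smooth_real (log_profile H T R)"
  proof (rule smooth_real_algebraI[where G = G])
    show "log_profile H T R \<in> function_algebra G" by (rule function_algebra.gen) (simp add: G_def)
    fix g assume "g \<in> G"
    then consider "g = log_profile H T R" | j l where "g = q j l" by (auto simp: G_def)
    then show "\<exists>g'\<in>function_algebra G. \<forall>t. (g has_real_derivative g' t) (at t)"
    proof cases
      case 1
      show ?thesis unfolding 1
        by (rule bexI[of _ "\<lambda>s. - (1 / 2) * q 0 1 s"]) (intro allI dV, rule function_algebra_cmult[OF qG])
    next
      case 2
      show ?thesis unfolding 2
      proof (rule bexI[of _ "\<lambda>s. - real l * q j (Suc l) s + (- 1 / (2 * T)) * q (Suc j) (Suc l) s"])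
        show "(\<lambda>s. - real l * q j (Suc l) s + (- 1 / (2 * T)) * q (Suc j) (Suc l) s) \<in> function_algebra G"
          by (rule function_algebra.add; rule function_algebra_cmult; rule qG)
      qed (use dq in blast)
    qed
  qed
qed

text \<open>Up to a power of \<open>s\<close>, the functions below are \<open>P(D) H'\<close> for a polynomial \<open>P\<close> with
  coefficients \<open>a\<close> and \<open>D = T\<^sup>-\<^sup>1 d/dt\<close>, evaluated at \<open>t = ln (R\<^sup>2 / s) / (2 T)\<close>; in the limit
  \<open>T \<rightarrow> \<infinity>\<close> only \<open>a 0\<close> matters.\<close>

definition log_symbol :: "(nat \<Rightarrow> real \<Rightarrow> real) \<Rightarrow> real \<Rightarrow> (nat \<Rightarrow> real) \<Rightarrow> nat \<Rightarrow> real \<Rightarrow> real" where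
  "log_symbol H T a N t = (\<Sum>j<N. a j * (1 / T) ^ j * H (Suc j) t)"

text \<open>The coefficients of (-m - D / 2) P(D). As t has the derivative -1 / (2 T s) in s, this
  is what differentiation in s does to s^(-m) P(D) H', apart from raising m by one.\<close>

definition symbol_deriv :: "nat \<Rightarrow> (nat \<Rightarrow> real) \<Rightarrow> nat \<Rightarrow> real" where
  "symbol_deriv m a j = - real m * a j - (1 / 2) * (case j of 0 \<Rightarrow> 0 | Suc i \<Rightarrow> a i)"

lemma log_symbol_extend:
  "(\<And>j. j \<ge> N \<Longrightarrow> a j = 0) \<Longrightarrow> N \<le> N' \<Longrightarrow> log_symbol H T a N' t = log_symbol H T a N t"
  unfolding log_symbol_def by (rule sum.mono_neutral_right) auto

lemma log_symbol_lincomb: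
  "log_symbol H T (\<lambda>j. b * a j + c * a' j) N t = b * log_symbol H T a N t + c * log_symbol H T a' N t"
  by (simp add: log_symbol_def sum.distrib sum_distrib_left algebra_simps)

lemma symbol_deriv_zero: "(\<And>j. j \<ge> N \<Longrightarrow> a j = 0) \<Longrightarrow> j \<ge> Suc N \<Longrightarrow> symbol_deriv m a j = 0"
  by (cases j) (auto simp: symbol_deriv_def)

text \<open>Only the term j = 0 lacks a factor 1 / T, and for it 0 \<le> H' \<le> 1 gives the
  coefficient 1 in front of |a 0|. The slope bound of the step is used here.\<close>

lemma log_symbol_bound:
  fixes H :: "nat \<Rightarrow> real \<Rightarrow> real"
  assumes H: "\<And>t. 0 \<le> H 1 t \<and> H 1 t \<le> 1" "\<And>j. \<exists>B. \<forall>t. \<bar>H (Suc j) t\<bar> \<le> B"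
  obtains B where "B \<ge> 0" "\<And>T t. T \<ge> 1 \<Longrightarrow> \<bar>log_symbol H T a N t\<bar> \<le> \<bar>a 0\<bar> + B / T"
proof -
  obtain b where b: "\<And>j t. \<bar>H (Suc j) t\<bar> \<le> b j" using H(2) by metis
  have b0: "b j \<ge> 0" for j using b[of j 0] by linarith
  define B where "B = (\<Sum>j<N. \<bar>a j\<bar> * b j)"
  have "\<bar>log_symbol H T a N t\<bar> \<le> \<bar>a 0\<bar> + B / T" if T: "T \<ge> 1" for T t
  proof -
    have "\<bar>log_symbol H T a N t\<bar> \<le> (\<Sum>j<N. \<bar>a j * (1 / T) ^ j * H (Suc j) t\<bar>)"
      unfolding log_symbol_def by (rule sum_abs)
    also have "\<dots> \<le> (\<Sum>j<N. (if j = 0 then \<bar>a 0\<bar> else 0) + \<bar>a j\<bar> * b j / T)"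
    proof (rule sum_mono)
      fix j
      show "\<bar>a j * (1 / T) ^ j * H (Suc j) t\<bar> \<le> (if j = 0 then \<bar>a 0\<bar> else 0) + \<bar>a j\<bar> * b j / T"
      proof (cases j)
        case 0
        have "\<bar>a 0 * H 1 t\<bar> \<le> \<bar>a 0\<bar>" using H(1)[of t] by (simp add: abs_mult mult_left_le)
        moreover have "\<bar>a 0\<bar> * b 0 / T \<ge> 0" using b0 T by simp
        ultimately show ?thesis using 0 by simp
      next
        case (Suc i)
        have "(1 / T) ^ j \<le> (1 / T) ^ 1" using Suc T by (intro power_decreasing) auto
        then have p: "(1 / T) ^ j \<le> 1 / T" by simp
        have "\<bar>a j * (1 / T) ^ j * H (Suc j) t\<bar> = \<bar>a j\<bar> * ((1 / T) ^ j * \<bar>H (Suc j) t\<bar>)"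
          using T by (simp add: abs_mult)
        also have "\<dots> \<le> \<bar>a j\<bar> * (1 / T * b j)"
          using p b[of j t] T by (intro mult_left_mono mult_mono) auto
        finally show ?thesis using Suc by simp
      qed
    qed
    also have "\<dots> \<le> \<bar>a 0\<bar> + B / T"
      by (cases N) (simp_all add: sum.distrib B_def sum_divide_distrib[symmetric])
    finally show ?thesis .
  qed
  moreover have "B \<ge> 0" unfolding B_def using b0 by (intro sum_nonneg) auto
  ultimately show ?thesis using that by blast
qed

lemma log_symbol_has_derivative:
  fixes H :: "nat \<Rightarrow> real \<Rightarrow> real"
  assumes H: "\<And>j t. (H j has_real_derivative H (Suc j) t) (at t)" and T: "T > 0" "R > 0" and s: "s > 0"
    and a: "\<And>j. j \<ge> N \<Longrightarrow> a j = 0"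
  shows "((\<lambda>s. inverse s ^ m * log_symbol H T a N (log_scale T R s)) has_real_derivative
    inverse s ^ Suc m * log_symbol H T (symbol_deriv m a) (Suc N) (log_scale T R s)) (at s)"
proof -
  define sh where "sh j = (case j of 0 \<Rightarrow> 0 | Suc i \<Rightarrow> a i)" for j
  have "(log_symbol H T a N has_real_derivative (\<Sum>j<N. a j * (1 / T) ^ j * H (Suc (Suc j)) t)) (at t)" for t
    unfolding log_symbol_def[abs_def] by (intro DERIV_sum DERIV_cmult H)
  moreover have "(\<Sum>j<N. a j * (1 / T) ^ j * H (Suc (Suc j)) t) = T * log_symbol H T sh (Suc N) t" for t
    using T unfolding log_symbol_def sum.lessThan_Suc_shift
    by (simp add: sh_def sum_distrib_left field_simps)
  ultimately have d: "(log_symbol H T a N has_real_derivative T * log_symbol H T sh (Suc N) t) (at t)" for t by simp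
  have 1: "((\<lambda>s. inverse s ^ m) has_real_derivative - real m * inverse s ^ Suc m) (at s)"
    by (rule inverse_power_deriv[OF s])
  have 2: "((\<lambda>s. log_symbol H T a N (log_scale T R s)) has_real_derivative
      T * log_symbol H T sh (Suc N) (log_scale T R s) * (- 1 / (2 * T * s))) (at s)"
    by (rule DERIV_chain2[OF d log_scale_deriv[OF T s]])
  have D: "log_symbol H T (symbol_deriv m a) (Suc N) t = - real m * log_symbol H T a N t - (1 / 2) * log_symbol H T sh (Suc N) t" for t
  proof -
    have "symbol_deriv m a = (\<lambda>j. (- real m) * a j + (- (1 / 2)) * sh j)"
      by (simp add: symbol_deriv_def sh_def fun_eq_iff)
    then have "log_symbol H T (symbol_deriv m a) (Suc N) t = (- real m) * log_symbol H T a (Suc N) t + (- (1 / 2)) * log_symbol H T sh (Suc N) t"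
      by (simp only: log_symbol_lincomb)
    then show ?thesis using log_symbol_extend[of N a "Suc N" H T t] a by simp
  qed
  have X: "T * X * (- 1 / (2 * T * s)) = - (1 / 2) * (inverse s * X)" for X
    using T s by (simp add: field_simps)
  have eq: "- real m * inverse s ^ Suc m * log_symbol H T a N (log_scale T R s)
      + T * log_symbol H T sh (Suc N) (log_scale T R s) * (- 1 / (2 * T * s)) * inverse s ^ m
    = inverse s ^ Suc m * log_symbol H T (symbol_deriv m a) (Suc N) (log_scale T R s)"
    unfolding D X by (simp add: algebra_simps)
  show ?thesis using DERIV_mult[OF 1 2] unfolding eq .
qed

lemma neg_lap_radial:
  fixes c :: "real^'n::finite" and F :: "nat \<Rightarrow> real \<Rightarrow> real"
  assumes F: "\<And>j t. (F j has_real_derivative F (Suc j) t) (at t)"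
  shows "neg_lap (\<lambda>x. F 0 ((norm (x - c))\<^sup>2)) x
    = - 4 * (norm (x - c))\<^sup>2 * F 2 ((norm (x - c))\<^sup>2) - 2 * real CARD('n) * F 1 ((norm (x - c))\<^sup>2)"
proof -
  have p1: "partials [i] (\<lambda>x. F 0 ((norm (x - c))\<^sup>2)) = (\<lambda>x. (2 * F 1 ((norm (x - c))\<^sup>2)) * (x $ i + - c $ i))" for i
    by (rule ext, subst partials_radial[OF F]) simp
  have p2: "partials [i] (\<lambda>x. (2 * F 1 ((norm (x - c))\<^sup>2)) * (x $ i + - c $ i)) x
     = 2 * F 1 ((norm (x - c))\<^sup>2) + 4 * F 2 ((norm (x - c))\<^sup>2) * ((x - c) $ i)\<^sup>2" for i x
  proof -
    have d1: "((\<lambda>t. 2 * F 1 t) has_real_derivative 2 * F 2 t) (at t)" for t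
      using DERIV_cmult[OF F[of 1 t], of 2] by (simp add: numeral_2_eq_2)
    have d2: "((\<lambda>x::real^'n. x $ i + - c $ i) has_derivative (\<lambda>h. h $ i)) (at x)"
    proof -
      have "((\<lambda>x::real^'n. x $ i + - c $ i) has_derivative (\<lambda>h. h $ i + 0)) (at x)"
        by (rule has_derivative_add[OF bounded_linear_imp_has_derivative[OF bounded_linear_vec_nth] has_derivative_const])
      then show ?thesis by simp
    qed
    have "partials [i] (\<lambda>x. (2 * F 1 ((norm (x - c))\<^sup>2)) * (x $ i + - c $ i)) x
      = (2 * F 1 ((norm (x - c))\<^sup>2)) * partials [i] (\<lambda>x. x $ i + - c $ i) x
        + partials [i] (\<lambda>x. 2 * F 1 ((norm (x - c))\<^sup>2)) x * (x $ i + - c $ i)"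
      by (rule partials_mult) (use has_derivative_radial[OF d1] d2 in \<open>auto simp: differentiable_def\<close>)
    also have "partials [i] (\<lambda>x. x $ i + - c $ i) x = 1" using partials_eqI[OF d2, of i] by simp
    also have "partials [i] (\<lambda>x. 2 * F 1 ((norm (x - c))\<^sup>2)) x = 2 * (2 * F 2 ((norm (x - c))\<^sup>2)) * (x - c) $ i"
      by (rule partials_radial[OF d1])
    finally show ?thesis by (simp add: power2_eq_square algebra_simps)
  qed
  have "partials [i, i] (\<lambda>x. F 0 ((norm (x - c))\<^sup>2)) x = 2 * F 1 ((norm (x - c))\<^sup>2) + 4 * F 2 ((norm (x - c))\<^sup>2) * ((x - c) $ i)\<^sup>2" for i
    using p2[of i x] unfolding p1[symmetric] by simp
  moreover have "(\<Sum>i\<in>UNIV. ((x - c) $ i)\<^sup>2) = (norm (x - c))\<^sup>2"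
    by (simp add: norm_vec_def L2_set_def sum_nonneg)
  ultimately show ?thesis
    by (simp add: neg_lap_def sum.distrib sum_distrib_left[symmetric] del: partials.simps)
qed

text \<open>The coefficient of \<open>H'\<close> in the derivative of \<open>(-\<Delta>)\<^sup>m\<close> of the logarithmic profile with
  respect to \<open>s = |x - c|\<^sup>2\<close>.\<close>

fun lead_coefficient :: "nat \<Rightarrow> nat \<Rightarrow> real" where
  "lead_coefficient n 0 = - (1 / 2)"
| "lead_coefficient n (Suc m) = real (Suc m) * (2 * lead_coefficient n m * (real n - 2 * real m - 2))"

text \<open>The induction carries \<open>F 1\<close> along with \<open>F 0\<close>: for m = 0 the
  profile itself is not of the symbol form, while its derivative is. The coefficients are chosen
  before T and R, which makes the later bounds uniform in them.\<close>

lemma log_profile_laplacians: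
  fixes c :: "real^'n::finite" and H :: "nat \<Rightarrow> real \<Rightarrow> real"
  assumes H: "\<And>j t. (H j has_real_derivative H (Suc j) t) (at t)" "\<And>t. t \<ge> 1 \<Longrightarrow> H 0 t = H 0 1"
    "\<And>j t. t > 1 \<Longrightarrow> H (Suc j) t = 0"
  shows "\<exists>a b N. (\<forall>j\<ge>N. a j = 0) \<and> (\<forall>j\<ge>N. b j = 0) \<and> b 0 = lead_coefficient CARD('n) m
    \<and> (m \<ge> 1 \<longrightarrow> - real m * a 0 = lead_coefficient CARD('n) m)
    \<and> (\<forall>T>0. \<forall>R>0. \<exists>F. (\<forall>j t. (F j has_real_derivative F (Suc j) t) (at t))
      \<and> (neg_lap ^^ m) (\<lambda>x. log_profile H T R ((norm (x - c))\<^sup>2)) = (\<lambda>x. F 0 ((norm (x - c))\<^sup>2))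
      \<and> (\<forall>s>0. F 1 s = inverse s ^ Suc m * log_symbol H T b N (log_scale T R s))
      \<and> (m \<ge> 1 \<longrightarrow> (\<forall>s>0. F 0 s = inverse s ^ m * log_symbol H T a N (log_scale T R s))))"
proof (induction m)
  case 0
  define b where "b j = (if j = 0 then - (1 / 2) else 0 :: real)" for j :: nat
  have ex: "\<exists>F. (\<forall>j t. (F j has_real_derivative F (Suc j) t) (at t))
      \<and> (\<lambda>x :: real^'n. log_profile H T R ((norm (x - c))\<^sup>2)) = (\<lambda>x. F 0 ((norm (x - c))\<^sup>2))
      \<and> (\<forall>s>0. F 1 s = inverse s ^ Suc 0 * log_symbol H T b 1 (log_scale T R s))" if T: "T > 0" "R > 0" for T R
  proof -
    obtain F where F: "F 0 = log_profile H T R" "\<And>j t. (F j has_real_derivative F (Suc j) t) (at t)"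
      using log_profile_smooth(1)[OF H T] unfolding smooth_real_def by metis
    have "F 1 s = inverse s ^ Suc 0 * log_symbol H T b 1 (log_scale T R s)" if s: "s > 0" for s
    proof -
      have "F 1 s = - (1 / 2) * (inverse s * H 1 (log_scale T R s))"
        using DERIV_unique[OF F(2)[of 0 s, unfolded F(1)] log_profile_smooth(2)[OF H T s]] by simp
      then show ?thesis by (simp add: log_symbol_def b_def)
    qed
    then show ?thesis using F by (intro exI[of _ F]) simp
  qed
  have "\<exists>F. (\<forall>j t. (F j has_real_derivative F (Suc j) t) (at t))
      \<and> (neg_lap ^^ 0) (\<lambda>x. log_profile H T R ((norm (x - c))\<^sup>2)) = (\<lambda>x. F 0 ((norm (x - c))\<^sup>2))
      \<and> (\<forall>s>0. F 1 s = inverse s ^ Suc 0 * log_symbol H T b 1 (log_scale T R s))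
      \<and> ((0::nat) \<ge> 1 \<longrightarrow> (\<forall>s>0. F 0 s = inverse s ^ 0 * log_symbol H T (\<lambda>_. 0) 1 (log_scale T R s)))" if "T > 0" "R > 0" for T R
    using ex[OF that] by simp
  moreover have "\<forall>j\<ge>1. b j = 0" "b 0 = lead_coefficient CARD('n) 0" by (auto simp: b_def)
  ultimately show ?case
    by (intro exI[of _ "\<lambda>_. 0"] exI[of _ b] exI[of _ 1]) simp
next
  case (Suc m)
  obtain a b N where b0: "\<forall>j\<ge>N. b j = 0" "b 0 = lead_coefficient CARD('n) m"
    and FF0: "\<forall>T>0. \<forall>R>0. \<exists>F. (\<forall>j t. (F j has_real_derivative F (Suc j) t) (at t))
      \<and> (neg_lap ^^ m) (\<lambda>x. log_profile H T R ((norm (x - c))\<^sup>2)) = (\<lambda>x. F 0 ((norm (x - c))\<^sup>2))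
      \<and> (\<forall>s>0. F 1 s = inverse s ^ Suc m * log_symbol H T b N (log_scale T R s))
      \<and> (m \<ge> 1 \<longrightarrow> (\<forall>s>0. F 0 s = inverse s ^ m * log_symbol H T a N (log_scale T R s)))"
    using Suc.IH by (elim exE conjE) (rule that; assumption)
  have b: "b j = 0" if "j \<ge> N" for j using b0(1) that by blast
  have FF: "\<exists>F. (\<forall>j t. (F j has_real_derivative F (Suc j) t) (at t))
      \<and> (neg_lap ^^ m) (\<lambda>x. log_profile H T R ((norm (x - c))\<^sup>2)) = (\<lambda>x. F 0 ((norm (x - c))\<^sup>2))
      \<and> (\<forall>s>0. F 1 s = inverse s ^ Suc m * log_symbol H T b N (log_scale T R s))" if T: "T > 0" "R > 0" for T R
    using FF0[rule_format, OF T] by (elim exE conjE) (rule exI; intro conjI; assumption)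
  define n where "n = real CARD('n)"
  \<comment> \<open>From the negative Laplacian -4 s F'' - 2 n F' of a function of s = |x - c|^2;
    the factor s absorbs one of the powers of 1 / s in F''.\<close>
  define a' where "a' j = (- 4) * symbol_deriv (Suc m) b j + (- 2 * n) * b j" for j
  define b' where "b' = symbol_deriv (Suc m) a'"
  have a'0: "a' j = 0" if "j \<ge> Suc N" for j using that b symbol_deriv_zero[of N b j "Suc m"] by (simp add: a'_def)
  have b'0: "b' j = 0" if "j \<ge> Suc (Suc N)" for j using that symbol_deriv_zero[of "Suc N" a' j "Suc m"] a'0 by (simp add: b'_def)
  have lead_b: "b' 0 = lead_coefficient CARD('n) (Suc m)"
    by (simp add: b'_def a'_def symbol_deriv_def b0(2) n_def algebra_simps)
  have lead_a: "- real (Suc m) * a' 0 = lead_coefficient CARD('n) (Suc m)"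
    unfolding lead_b[symmetric] by (simp add: b'_def symbol_deriv_def)
  have "\<exists>F'. (\<forall>j t. (F' j has_real_derivative F' (Suc j) t) (at t))
      \<and> (neg_lap ^^ Suc m) (\<lambda>x. log_profile H T R ((norm (x - c))\<^sup>2)) = (\<lambda>x. F' 0 ((norm (x - c))\<^sup>2))
      \<and> (\<forall>s>0. F' 1 s = inverse s ^ Suc (Suc m) * log_symbol H T b' (Suc (Suc N)) (log_scale T R s))
      \<and> (\<forall>s>0. F' 0 s = inverse s ^ Suc m * log_symbol H T a' (Suc (Suc N)) (log_scale T R s))" if T: "T > 0" "R > 0" for T R
  proof -
    obtain F where F: "\<And>j t. (F j has_real_derivative F (Suc j) t) (at t)"
      "(neg_lap ^^ m) (\<lambda>x. log_profile H T R ((norm (x - c))\<^sup>2)) = (\<lambda>x. F 0 ((norm (x - c))\<^sup>2))"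
      "\<And>s. s > 0 \<Longrightarrow> F 1 s = inverse s ^ Suc m * log_symbol H T b N (log_scale T R s)"
      using FF[OF T] by blast
    define W where "W s = (- 4 * s) * F 2 s + (- 2 * n) * F 1 s" for s
    have "smooth_real W"
    proof (rule smooth_real_algebraI[where G = "insert (\<lambda>s. s) (range F)"])
      show "W \<in> function_algebra (insert (\<lambda>s. s) (range F))"
        unfolding W_def[abs_def]
        by (rule function_algebra.add[OF function_algebra.mult[OF function_algebra_cmult[OF function_algebra.gen] function_algebra.gen]
              function_algebra_cmult[OF function_algebra.gen]]) auto
      fix g assume "g \<in> insert (\<lambda>s. s) (range F)"
      then consider "g = (\<lambda>s. s)" | j where "g = F j" by auto
      then show "\<exists>g'\<in>function_algebra (insert (\<lambda>s. s) (range F)). \<forall>t. (g has_real_derivative g' t) (at t)"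
      proof cases
        case 1
        show ?thesis unfolding 1
          by (rule bexI[of _ "\<lambda>_. 1"]) (auto intro: function_algebra.const)
      next
        case 2
        show ?thesis unfolding 2
          by (rule bexI[of _ "F (Suc j)"]) (use F(1) in \<open>auto intro: function_algebra.gen\<close>)
      qed
    qed
    then obtain F' where F': "F' 0 = W" "\<And>j t. (F' j has_real_derivative F' (Suc j) t) (at t)"
      unfolding smooth_real_def by metis
    have F2: "F 2 s = inverse s ^ Suc (Suc m) * log_symbol H T (symbol_deriv (Suc m) b) (Suc N) (log_scale T R s)" if s: "s > 0" for s
    proof -
      have "(F 1 has_real_derivative inverse s ^ Suc (Suc m) * log_symbol H T (symbol_deriv (Suc m) b) (Suc N) (log_scale T R s)) (at s)"
        by (rule has_field_derivative_transform_within_open[OF log_symbol_has_derivative[where H = H and a = b and N = N, OF H(1) T s b], where S = "{0<..}"])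
           (use s F(3) in auto)
      from DERIV_unique[OF F(1)[of 1 s] this] show ?thesis by (simp only: Suc_1)
    qed
    have F'0: "F' 0 s = inverse s ^ Suc m * log_symbol H T a' (Suc N) (log_scale T R s)" if s: "s > 0" for s
    proof -
      have l: "log_symbol H T a' (Suc N) t = (- 4) * log_symbol H T (symbol_deriv (Suc m) b) (Suc N) t + (- 2 * n) * log_symbol H T b N t" for t
        unfolding a'_def[abs_def] log_symbol_lincomb using log_symbol_extend[of N b "Suc N" H T t] b(1) by simp
      have "F' 0 s = (- 4) * (s * inverse s) * (inverse s ^ Suc m * log_symbol H T (symbol_deriv (Suc m) b) (Suc N) (log_scale T R s))
          + (- 2 * n) * (inverse s ^ Suc m * log_symbol H T b N (log_scale T R s))"
        unfolding F'(1) W_def F2[OF s] F(3)[OF s] by simp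
      also have "s * inverse s = 1" using s by simp
      finally show ?thesis unfolding l by (simp only: distrib_left mult_ac mult_1_left mult_1_right)
    qed
    have F'1: "F' 1 s = inverse s ^ Suc (Suc m) * log_symbol H T b' (Suc (Suc N)) (log_scale T R s)" if s: "s > 0" for s
    proof -
      have "(F' 0 has_real_derivative inverse s ^ Suc (Suc m) * log_symbol H T b' (Suc (Suc N)) (log_scale T R s)) (at s)"
        unfolding b'_def
        by (rule has_field_derivative_transform_within_open[OF log_symbol_has_derivative[where H = H and a = a' and N = "Suc N", OF H(1) T s a'0], where S = "{0<..}"])
           (use s F'0 in auto)
      from DERIV_unique[OF F'(2)[of 0 s] this] show ?thesis by (simp only: One_nat_def)
    qed
    have "(neg_lap ^^ Suc m) (\<lambda>x. log_profile H T R ((norm (x - c))\<^sup>2)) = neg_lap (\<lambda>x. F 0 ((norm (x - c))\<^sup>2))"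
      using F(2) by simp
    also have "\<dots> = (\<lambda>x. F' 0 ((norm (x - c))\<^sup>2))"
      by (rule ext) (simp add: neg_lap_radial[where F = F, OF F(1)] F'(1) W_def n_def)
    finally have lap: "(neg_lap ^^ Suc m) (\<lambda>x. log_profile H T R ((norm (x - c))\<^sup>2)) = (\<lambda>x. F' 0 ((norm (x - c))\<^sup>2))" .
    have "F' 0 s = inverse s ^ Suc m * log_symbol H T a' (Suc (Suc N)) (log_scale T R s)" if "s > 0" for s
      using F'0[OF that] log_symbol_extend[of "Suc N" a' "Suc (Suc N)" H T] a'0 by simp
    then show ?thesis using F'(2) lap F'1 by (intro exI[of _ F']) blast
  qed
  then show ?case
    using a'0 b'0 lead_a lead_b by (intro exI[of _ a'] exI[of _ b'] exI[of _ "Suc (Suc N)"]) auto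
qed

text \<open>After division by m both sides obey the recursion with the factor 2 m (n - 2 m - 2), on
  the left from the Laplacian of the logarithm and on the right from
  \<open>riesz_gamma_add_2\<close>.\<close>

lemma lead_coefficient_riesz_even:
  "1 \<le> m \<Longrightarrow> 2 * m < CARD('n::finite) \<Longrightarrow>
    lead_coefficient CARD('n) m = - real m * (riesz_gamma CARD('n) (real (2 * m)) / (real CARD('n) * omega TYPE('n)))"
proof (induction m)
  case (Suc m)
  have w: "omega TYPE('n) \<noteq> 0" using omega_pos[where 'n='n] by simp
  show ?case
  proof (cases "m = 0")
    case True
    then show ?thesis using Suc.prems riesz_gamma_2[where 'n='n] w by simp
  next
    case False
    have R: "riesz_gamma CARD('n) (real (2 * m) + 2) = (real CARD('n) - real (2 * m) - 2) * (real (2 * m) * riesz_gamma CARD('n) (real (2 * m)))"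
      using Suc.prems False by (intro riesz_gamma_add_2) auto
    have S: "real (2 * Suc m) = real (2 * m) + 2" by simp
    have L: "lead_coefficient CARD('n) m = - real m * (riesz_gamma CARD('n) (real (2 * m)) / (real CARD('n) * omega TYPE('n)))"
      using Suc False by simp
    have "a * (2 * (- b * (G / X)) * (n - 2 * b - 2)) = - a * ((n - 2 * b - 2) * (2 * b * G) / X)" for a b G X n :: real
      by (simp add: divide_inverse algebra_simps)
    then show ?thesis unfolding lead_coefficient.simps(2) L S R unfolding of_nat_mult of_nat_numeral .
  qed
qed simp


text \<open>The right side is the coefficient of |x|^(-k) in |D^k ln (1 / |x|)|, from the iterated
  Laplacian for even k and from its gradient for odd k. The equality makes the lower bound meet the
  upper one.\<close>

lemma riesz_const_lead_coefficient:
  assumes "1 \<le> k" "k < CARD('n::finite)"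
  shows "riesz_const TYPE('n) k / (real CARD('n) * omega TYPE('n)) =
    (if even k then - lead_coefficient CARD('n) (k div 2) / real (k div 2) else - 2 * lead_coefficient CARD('n) (k div 2))"
proof (cases "even k")
  case True
  then obtain m where m: "k = 2 * m" by (auto elim: evenE)
  then show ?thesis using lead_coefficient_riesz_even[where 'n='n, of m] assms by (simp add: riesz_const_def)
next
  case False
  then obtain m where m: "k = 2 * m + 1" by (auto elim: oddE)
  have w: "omega TYPE('n) \<noteq> 0" using omega_pos[where 'n='n] by simp
  show ?thesis
  proof (cases "m = 0")
    case True
    then show ?thesis using m w by (simp add: riesz_const_def riesz_gamma_tilde_def unit_ball_measure_eq)
  next
    case False
    then show ?thesis using lead_coefficient_riesz_even[where 'n='n, of m] assms m
      by (simp add: riesz_const_def riesz_gamma_tilde_def)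
  qed
qed

section \<open>The logarithmic profiles in the weak Sobolev class\<close>

definition classical_norm_D :: "nat \<Rightarrow> (real^'n::finite \<Rightarrow> real) \<Rightarrow> real^'n \<Rightarrow> real" where
  "classical_norm_D k g x =
     (if odd k then norm (\<chi> i. partials [i] ((neg_lap ^^ (k div 2)) g) x) else \<bar>(neg_lap ^^ (k div 2)) g x\<bar>)"

lemma neg_lap_cmult:
  assumes g: "test_function g"
  shows "neg_lap (\<lambda>x. c * g x) = (\<lambda>x. c * neg_lap g x)"
proof
  fix x
  have p: "partials [i] (\<lambda>x. c * f x) y = c * partials [i] f y" if "test_function f" for f i y
  proof -
    have "partials [i] (\<lambda>x. c * f x) y = c * partials [i] f y + partials [i] (\<lambda>_. c) y * f y"
      by (rule partials_mult) (use that in \<open>auto intro: smooth_differentiable test_function_smooth\<close>)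
    then show ?thesis by (simp only: partials_const mult_zero_left add_0_right)
  qed
  have "partials [i, i] (\<lambda>x. c * g x) x = c * partials [i, i] g x" for i
  proof -
    have "partials [i, i] (\<lambda>x. c * g x) x = partials [i] (partials [i] (\<lambda>x. c * g x)) x" by simp
    also have "partials [i] (\<lambda>x. c * g x) = (\<lambda>x. c * partials [i] g x)" by (intro ext p g)
    also have "partials [i] (\<lambda>x. c * partials [i] g x) x = c * partials [i] (partials [i] g) x"
      by (rule p[OF test_function_partials[OF g]])
    finally show ?thesis by simp
  qed
  then show "neg_lap (\<lambda>x. c * g x) x = c * neg_lap g x"
    by (simp add: neg_lap_def sum_distrib_left del: partials.simps)
qed

lemma classical_norm_D_cmult:
  assumes g: "test_function g"
  shows "classical_norm_D k (\<lambda>x. c * g x) x = \<bar>c\<bar> * classical_norm_D k g x"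
proof -
  have l: "(neg_lap ^^ m) (\<lambda>x. c * g x) = (\<lambda>x. c * (neg_lap ^^ m) g x)" for m
  proof (induction m)
    case (Suc m)
    then show ?case using neg_lap_cmult[OF test_function_neg_lap_funpow[OF g, of m]] by simp
  qed simp
  have "partials [i] (\<lambda>x. c * (neg_lap ^^ m) g x) x = c * partials [i] ((neg_lap ^^ m) g) x" for i m
  proof -
    have "partials [i] (\<lambda>x. c * (neg_lap ^^ m) g x) x = c * partials [i] ((neg_lap ^^ m) g) x + partials [i] (\<lambda>_. c) x * (neg_lap ^^ m) g x"
      by (rule partials_mult) (use test_function_neg_lap_funpow[OF g] in \<open>auto intro: smooth_differentiable test_function_smooth\<close>)
    then show ?thesis by (simp only: partials_const mult_zero_left add_0_right)
  qed
  then have "(\<chi> i. partials [i] ((neg_lap ^^ (k div 2)) (\<lambda>x. c * g x)) x) = c *\<^sub>R (\<chi> i. partials [i] ((neg_lap ^^ (k div 2)) g) x)"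
    unfolding l by (simp add: vec_eq_iff del: partials.simps)
  then show ?thesis by (simp add: classical_norm_D_def l abs_mult del: partials.simps)
qed

text \<open>In even order the leading coefficient is \<open>a 0\<close>; in odd order the gradient 2
  F' (x - c) brings 2 \<open>b 0\<close>. Both have the same known absolute value, and B collects
  the lower-order terms of the symbols, uniformly in T, R and x.\<close>

lemma log_profile_norm_D_bound:
  fixes c :: "real^'n::finite" and H :: "nat \<Rightarrow> real \<Rightarrow> real"
  assumes H: "\<And>j t. (H j has_real_derivative H (Suc j) t) (at t)" "\<And>t. t \<ge> 1 \<Longrightarrow> H 0 t = H 0 1"
    "\<And>j t. t > 1 \<Longrightarrow> H (Suc j) t = 0"
    "\<And>t. 0 \<le> H 1 t \<and> H 1 t \<le> 1" "\<And>j. \<exists>B. \<forall>t. \<bar>H (Suc j) t\<bar> \<le> B"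
    and k: "1 \<le> k" "k < CARD('n)"
  obtains B where "B \<ge> 0" "\<And>T R x. T \<ge> 1 \<Longrightarrow> R > 0 \<Longrightarrow> x \<noteq> c \<Longrightarrow>
    classical_norm_D k (\<lambda>x. log_profile H T R ((norm (x - c))\<^sup>2)) x
      \<le> (riesz_const TYPE('n) k / (real CARD('n) * omega TYPE('n)) + B / T) * norm (x - c) powr (- real k)"
proof -
  define m where "m = k div 2"
  define E where "E = riesz_const TYPE('n) k / (real CARD('n) * omega TYPE('n))"
  have E0: "E > 0" using riesz_const_pos[OF k] omega_pos[where 'n='n] by (simp add: E_def)
  obtain a b N where ab: "b 0 = lead_coefficient CARD('n) m" "m \<ge> 1 \<Longrightarrow> - real m * a 0 = lead_coefficient CARD('n) m"
    and FF: "\<And>T R. T > 0 \<Longrightarrow> R > 0 \<Longrightarrow> \<exists>F. (\<forall>j t. (F j has_real_derivative F (Suc j) t) (at t))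
      \<and> (neg_lap ^^ m) (\<lambda>x. log_profile H T R ((norm (x - c))\<^sup>2)) = (\<lambda>x. F 0 ((norm (x - c))\<^sup>2))
      \<and> (\<forall>s>0. F 1 s = inverse s ^ Suc m * log_symbol H T b N (log_scale T R s))
      \<and> (m \<ge> 1 \<longrightarrow> (\<forall>s>0. F 0 s = inverse s ^ m * log_symbol H T a N (log_scale T R s)))"
    using log_profile_laplacians[where H = H, OF H(1,2,3), of m c] by blast
  obtain Ba where Ba: "Ba \<ge> 0" "\<And>T t. T \<ge> 1 \<Longrightarrow> \<bar>log_symbol H T a N t\<bar> \<le> \<bar>a 0\<bar> + Ba / T"
    using log_symbol_bound[where H = H, OF H(4,5)] by blast
  obtain Bb where Bb: "Bb \<ge> 0" "\<And>T t. T \<ge> 1 \<Longrightarrow> \<bar>log_symbol H T b N t\<bar> \<le> \<bar>b 0\<bar> + Bb / T"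
    using log_symbol_bound[where H = H, OF H(4,5)] by blast
  have "classical_norm_D k (\<lambda>x. log_profile H T R ((norm (x - c))\<^sup>2)) x \<le> (E + (Ba + 2 * Bb) / T) * norm (x - c) powr (- real k)"
    if T: "T \<ge> 1" and R: "R > 0" and x: "x \<noteq> c" for T R x
  proof -
    obtain F where F: "\<And>j t. (F j has_real_derivative F (Suc j) t) (at t)"
      "(neg_lap ^^ m) (\<lambda>x. log_profile H T R ((norm (x - c))\<^sup>2)) = (\<lambda>x. F 0 ((norm (x - c))\<^sup>2))"
      "\<And>s. s > 0 \<Longrightarrow> F 1 s = inverse s ^ Suc m * log_symbol H T b N (log_scale T R s)"
      "\<And>s. m \<ge> 1 \<Longrightarrow> s > 0 \<Longrightarrow> F 0 s = inverse s ^ m * log_symbol H T a N (log_scale T R s)"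
    proof -
      have "T > 0" using T by simp
      from FF[OF this R] show ?thesis using that by blast
    qed
    define \<rho> where "\<rho> = norm (x - c)"
    define s where "s = \<rho>\<^sup>2"
    have \<rho>: "\<rho> > 0" using x by (simp add: \<rho>_def)
    have s: "s > 0" using \<rho> by (simp add: s_def)
    show ?thesis
    proof (cases "even k")
      case True
      then have k2: "k = 2 * m" "m \<ge> 1" using k by (auto simp: m_def)
      have "a 0 = - lead_coefficient CARD('n) m / real m" using ab(2)[OF k2(2)] k2(2) by (simp add: field_simps)
      then have "a 0 = E" using riesz_const_lead_coefficient[OF k] True by (simp add: m_def E_def)
      then have aE: "\<bar>a 0\<bar> = E" using E0 by simp
      have "classical_norm_D k (\<lambda>x. log_profile H T R ((norm (x - c))\<^sup>2)) x = \<bar>inverse s ^ m * log_symbol H T a N (log_scale T R s)\<bar>"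
        using True F(2) F(4)[OF k2(2) s] by (simp add: classical_norm_D_def m_def s_def \<rho>_def)
      also have "\<dots> = inverse s ^ m * \<bar>log_symbol H T a N (log_scale T R s)\<bar>" using s by (simp add: abs_mult)
      also have "\<dots> \<le> inverse s ^ m * (E + Ba / T)"
        using Ba(2)[OF T, of "log_scale T R s"] s unfolding aE by (intro mult_left_mono) auto
      also have "\<dots> \<le> inverse s ^ m * (E + (Ba + 2 * Bb) / T)"
        using Bb(1) T s by (intro mult_left_mono add_left_mono divide_right_mono) auto
      also have "inverse s ^ m = \<rho> powr (- real k)"
      proof -
        have "inverse s ^ m = inverse (\<rho> ^ k)"
          by (simp only: s_def k2 power_inverse power_mult)
        then show ?thesis using \<rho> by (simp add: powr_minus powr_realpow)
      qed
      finally show ?thesis by (simp add: \<rho>_def mult.commute)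
    next
      case False
      then have k2: "k = 2 * m + 1" by (auto simp: m_def elim: oddE)
      have bE: "2 * \<bar>b 0\<bar> = E"
        using riesz_const_lead_coefficient[OF k] False E0 ab(1) by (simp add: m_def E_def)
      have "(\<chi> i. partials [i] (\<lambda>x. F 0 ((norm (x - c))\<^sup>2)) x) = (2 * F 1 s) *\<^sub>R (x - c)"
        using partials_radial[where x = x and c = c, OF F(1)[of 0]] by (simp add: vec_eq_iff s_def \<rho>_def del: partials.simps)
      then have "classical_norm_D k (\<lambda>x. log_profile H T R ((norm (x - c))\<^sup>2)) x = \<bar>2 * F 1 s\<bar> * \<rho>"
        using False F(2) by (simp add: classical_norm_D_def m_def \<rho>_def del: partials.simps)
      also have "\<dots> = (inverse s ^ Suc m * \<rho>) * (2 * \<bar>log_symbol H T b N (log_scale T R s)\<bar>)"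
        unfolding F(3)[OF s] using s by (simp add: abs_mult)
      also have "\<dots> \<le> (inverse s ^ Suc m * \<rho>) * (2 * (\<bar>b 0\<bar> + Bb / T))"
        using Bb(2)[OF T, of "log_scale T R s"] s \<rho> by (intro mult_left_mono) auto
      also have "2 * (\<bar>b 0\<bar> + Bb / T) = E + 2 * Bb / T" using bE by simp
      also have "(inverse s ^ Suc m * \<rho>) * (E + 2 * Bb / T) \<le> (inverse s ^ Suc m * \<rho>) * (E + (Ba + 2 * Bb) / T)"
        using Ba(1) T s \<rho> by (intro mult_left_mono add_left_mono divide_right_mono) auto
      also have "inverse s ^ Suc m * \<rho> = \<rho> powr (- real k)"
      proof -
        have "\<rho> ^ k * \<rho> = s ^ Suc m"
          unfolding s_def k2 power_mult[symmetric] power_Suc2[symmetric] by simp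
        then have "inverse s ^ Suc m = inverse (\<rho> ^ k * \<rho>)" by (simp only: power_inverse)
        then show ?thesis using \<rho> by (simp add: powr_minus powr_realpow)
      qed
      finally show ?thesis by (simp add: \<rho>_def mult.commute)
    qed
  qed
  then show ?thesis using that[of "Ba + 2 * Bb"] Ba(1) Bb(1) by (simp add: E_def)
qed

text \<open>Mixed partial derivatives need not be commuted: the weak derivative along \<open>is\<close> is
  represented by the classical one in the reverse order.\<close>

lemma has_weak_deriv_test_function:
  fixes g w :: "real^'n::finite \<Rightarrow> real"
  assumes g: "test_function g" and w: "locally_integrable w" "AE x in lebesgue. w x = g x"
  shows "has_weak_deriv w is (partials (rev is) g)"
proof -
  have main: "(LINT x|lborel. g x * partials is f x) = (- 1) ^ length is * (LINT x|lborel. partials (rev is) g x * f x)"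
    if "test_function g" "test_function f" for f g :: "real^'n \<Rightarrow> real"
    using that
  proof (induction "is" arbitrary: g)
    case (Cons i js)
    have "(LINT x|lborel. g x * partials (i # js) f x) = (LINT x|lborel. partials [i] (partials js f) x * g x)"
      by (simp add: mult.commute)
    also have "\<dots> = - (LINT x|lborel. partials js f x * partials [i] g x)"
      by (rule integration_by_parts_partial[OF test_function_partials[OF Cons.prems(2)] test_function_smooth[OF Cons.prems(1)]])
    also have "(LINT x|lborel. partials js f x * partials [i] g x) = (LINT x|lborel. partials [i] g x * partials js f x)"
      by (simp add: mult.commute)
    also have "\<dots> = (- 1) ^ length js * (LINT x|lborel. partials (rev js) (partials [i] g) x * f x)"
      by (rule Cons.IH[OF test_function_partials[OF Cons.prems(1)] Cons.prems(2)])
    finally show ?case by (simp add: partials_append)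
  qed simp
  show ?thesis
    unfolding has_weak_deriv_def
  proof (intro conjI allI impI w(1))
    show "locally_integrable (partials (rev is) g)"
      by (rule test_function_locally_integrable[OF test_function_partials[OF g]])
    fix f :: "real^'n \<Rightarrow> real" assume f: "test_function f"
    note [measurable] = test_function_borel[OF g] test_function_borel[OF f] test_function_borel[OF test_function_partials[OF f]]
      test_function_borel[OF test_function_partials[OF g]]
    have "(LINT x|lebesgue. w x * partials is f x) = (LINT x|lborel. g x * partials is f x)"
    proof (rule lebesgue_integral_AE_borel)
      show "(\<lambda>x. w x * partials is f x) \<in> borel_measurable lebesgue"
        by (rule borel_measurable_integrable[OF integrable_lebesgue_mult_test[OF w(1) test_function_partials[OF f]]])
      show "AE x in lebesgue. w x * partials is f x = g x * partials is f x" using w(2) by eventually_elim simp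
    qed measurable
    also have "\<dots> = (- 1) ^ length is * (LINT x|lborel. partials (rev is) g x * f x)" by (rule main[OF g f])
    also have "(LINT x|lborel. partials (rev is) g x * f x) = (LINT x|lebesgue. partials (rev is) g x * f x)"
      by (rule integral_completion[symmetric]) measurable
    finally show "(LINT x|lebesgue. w x * partials is f x) = (- 1) ^ length is * (LINT x|lebesgue. partials (rev is) g x * f x)" .
  qed
qed

text \<open>Iterated weak Laplacians are built from arbitrarily chosen representatives, so agreement
  with the classical ones holds almost everywhere and is carried through the induction together with
  local integrability.\<close>

lemma neg_laplacian_funpow_test:
  fixes g :: "real^'n::finite \<Rightarrow> real"
  assumes g: "test_function g"
  shows "locally_integrable ((neg_laplacian ^^ m) g) \<and> (AE x in lebesgue. (neg_laplacian ^^ m) g x = (neg_lap ^^ m) g x)"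
proof (induction m)
  case (Suc m)
  define w where "w = (neg_laplacian ^^ m) g"
  define h where "h = (neg_lap ^^ m) g"
  have h: "test_function h" unfolding h_def by (rule test_function_neg_lap_funpow[OF g])
  have w: "locally_integrable w" "AE x in lebesgue. w x = h x" using Suc by (auto simp: w_def h_def)
  have wd: "has_weak_deriv w [i, i] (partials [i, i] h)" for i
    using has_weak_deriv_test_function[OF h w, of "[i, i]"] by simp
  have li: "locally_integrable (weak_deriv [i, i] w)" for i
    using has_weak_deriv_weak_deriv[OF wd] by (simp add: has_weak_deriv_def)
  have "AE x in lebesgue. weak_deriv [i, i] w x = partials [i, i] h x" for i by (rule weak_deriv_AE_eq[OF wd])
  then have "AE x in lebesgue. \<forall>i\<in>UNIV. weak_deriv [i, i] w x = partials [i, i] h x"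
    by (intro AE_finite_allI) auto
  then have "AE x in lebesgue. neg_laplacian w x = neg_lap h x"
    by eventually_elim (simp add: neg_laplacian_def neg_lap_def del: partials.simps)
  moreover have "locally_integrable (neg_laplacian w)"
    unfolding neg_laplacian_eq by (intro locally_integrable_cmult locally_integrable_sum li)
  ultimately show ?case by (simp add: w_def h_def)
qed (use test_function_locally_integrable[OF g] in simp)

lemma norm_D_test_function:
  fixes g :: "real^'n::finite \<Rightarrow> real"
  assumes g: "test_function g"
  shows "AE x in lebesgue. norm_D k g x = classical_norm_D k g x"
proof (cases "odd k")
  case True
  define m where "m = k div 2"
  have m: "(k - Suc 0) div 2 = m" using True by (auto simp: m_def elim: oddE)
  define w where "w = (neg_laplacian ^^ m) g"
  define h where "h = (neg_lap ^^ m) g"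
  have h: "test_function h" unfolding h_def by (rule test_function_neg_lap_funpow[OF g])
  have w: "locally_integrable w" "AE x in lebesgue. w x = h x"
    using neg_laplacian_funpow_test[OF g, of m] by (auto simp: w_def h_def)
  have "AE x in lebesgue. weak_deriv [i] w x = partials [i] h x" for i
    using weak_deriv_AE_eq[OF has_weak_deriv_test_function[OF h w, of "[i]"]] by simp
  then have "AE x in lebesgue. \<forall>i\<in>UNIV. weak_deriv [i] w x = partials [i] h x"
    by (intro AE_finite_allI) auto
  then show ?thesis
    by eventually_elim (simp add: norm_D_def classical_norm_D_def True m w_def[symmetric] m_def[symmetric] h_def[symmetric] weak_gradient_def del: partials.simps)
next
  case False
  have "AE x in lebesgue. (neg_laplacian ^^ (k div 2)) g x = (neg_lap ^^ (k div 2)) g x"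
    using neg_laplacian_funpow_test[OF g] by blast
  then show ?thesis
    by eventually_elim (use False in \<open>simp add: norm_D_def classical_norm_D_def\<close>)
qed

lemma weak_Lp_norm_bounded:
  fixes \<Omega> :: "(real^'n::finite) set"
  assumes \<Omega>: "emeasure lebesgue \<Omega> < \<infinity>" and p: "p > 0" and B: "AE x in lebesgue. \<bar>g x\<bar> \<le> B"
  shows "weak_Lp_norm \<Omega> p g < \<infinity>"
proof -
  define M where "M = measure lebesgue \<Omega>"
  have M: "emeasure lebesgue \<Omega> = ennreal M" using \<Omega> by (simp add: M_def emeasure_eq_ennreal_measure less_top)
  define l where "l = \<bar>B\<bar> + 1"
  have l: "l > 0" by (simp add: l_def)
  have "emeasure lebesgue {x\<in>\<Omega>. \<bar>g x\<bar> > l} \<le> emeasure lebesgue ({} :: (real^'n) set)"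
    by (rule emeasure_mono_AE) (use B in \<open>auto simp: l_def elim!: eventually_mono\<close>)
  then have z: "emeasure lebesgue {x\<in>\<Omega>. \<bar>g x\<bar> > l} = 0" by simp
  have r: "rearrangement \<Omega> g s \<le> ennreal l" for s
    unfolding rearrangement_def using l z by (intro Inf_lower) auto
  have "weak_Lp_norm \<Omega> p g \<le> ennreal (M powr (1 / p)) * ennreal l"
    unfolding weak_Lp_norm_def
  proof (rule SUP_least)
    fix s assume "s \<in> {s. 0 < s \<and> ennreal s < emeasure lebesgue \<Omega>}"
    then have "0 < s" "s < M" by (auto simp: M ennreal_less_iff)
    then show "ennreal (s powr (1 / p)) * rearrangement \<Omega> g s \<le> ennreal (M powr (1 / p)) * ennreal l"
      using p by (intro mult_mono r ennreal_leI powr_mono2) auto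
  qed
  also have "\<dots> < \<infinity>" by (simp add: ennreal_mult_less_top)
  finally show ?thesis .
qed

text \<open>The superlevel sets of the majorant are balls, and its constant is such that the level
  s^(-k/n) is exceeded exactly on a ball of volume s. It is the extremal function of the weak norm:
  every s gives at most 1.\<close>

lemma weak_Lp_norm_power_le_1:
  fixes \<Omega> :: "(real^'n::finite) set"
  assumes k: "k > 0" and g: "AE x in lebesgue. \<bar>g x\<bar> \<le> omega TYPE('n) powr (- real k / real CARD('n)) * norm (x - c) powr (- real k)"
  shows "weak_Lp_norm \<Omega> (real CARD('n) / real k) g \<le> 1"
  unfolding weak_Lp_norm_def
proof (rule SUP_least)
  define n where "n = real CARD('n)"
  have n: "n > 0" by (simp add: n_def)
  define w where "w = omega TYPE('n)"
  have w: "w > 0" by (simp add: w_def omega_pos)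
  fix s assume "s \<in> {s. 0 < s \<and> ennreal s < emeasure lebesgue \<Omega>}"
  then have s: "s > 0" by simp
  define l where "l = s powr (- real k / n)"
  have l: "l > 0" using s by (simp add: l_def)
  define \<rho> where "\<rho> = (s / w) powr (1 / n)"
  have \<rho>: "\<rho> > 0" using s w by (simp add: \<rho>_def)
  have "AE x in lebesgue. x \<in> {x\<in>\<Omega>. \<bar>g x\<bar> > l} \<longrightarrow> x \<in> ball c \<rho>"
    using g
  proof eventually_elim
    case (elim x)
    show ?case
    proof (rule impI, rule ccontr)
      assume x: "x \<in> {x\<in>\<Omega>. \<bar>g x\<bar> > l}" "x \<notin> ball c \<rho>"
      then have "\<rho> \<le> norm (x - c)" by (simp add: dist_norm norm_minus_commute)
      then have "norm (x - c) powr (- real k) \<le> \<rho> powr (- real k)" using \<rho> by (intro powr_mono2') auto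
      also have "\<rho> powr (- real k) = (s / w) powr (- real k / n)" unfolding \<rho>_def powr_powr by simp
      finally have "w powr (- real k / n) * norm (x - c) powr (- real k) \<le> w powr (- real k / n) * (s / w) powr (- real k / n)"
        by (rule mult_left_mono) simp
      also have "\<dots> = l" unfolding l_def using s w by (simp add: powr_divide)
      finally show False using elim x by (simp add: w_def n_def)
    qed
  qed
  then have "emeasure lebesgue {x\<in>\<Omega>. \<bar>g x\<bar> > l} \<le> emeasure lebesgue (ball c \<rho>)"
    by (rule emeasure_mono_AE) simp
  also have "\<dots> = ennreal (w * \<rho> ^ CARD('n))" using \<rho> by (simp add: emeasure_lborel_ball w_def)
  also have "w * \<rho> ^ CARD('n) = s"
  proof -
    have "\<rho> ^ CARD('n) = \<rho> powr n" using \<rho> by (simp add: n_def powr_realpow)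
    also have "\<dots> = s / w" unfolding \<rho>_def powr_powr using n s w by simp
    finally show ?thesis using w by simp
  qed
  finally have "rearrangement \<Omega> g s \<le> ennreal l"
    unfolding rearrangement_def using l by (intro Inf_lower) auto
  then have "ennreal (s powr (1 / (real CARD('n) / real k))) * rearrangement \<Omega> g s \<le> ennreal (s powr (real k / n)) * ennreal l"
    by (simp add: n_def mult_left_mono)
  also have "\<dots> = 1" using s unfolding l_def by (simp add: ennreal_mult[symmetric] powr_add[symmetric])
  finally show "ennreal (s powr (1 / (real CARD('n) / real k))) * rearrangement \<Omega> g s \<le> 1" .
qed

lemma test_function_in_W0_weak:
  fixes g :: "real^'n::finite \<Rightarrow> real"
  assumes g: "test_function g" and \<Omega>: "bounded \<Omega>" "\<And>x. x \<notin> \<Omega> \<Longrightarrow> g x = 0" and p: "p > 0"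
  shows "g \<in> W0_weak k p \<Omega>"
proof -
  have wd: "has_weak_deriv g is (partials (rev is) g)" for "is"
    by (rule has_weak_deriv_test_function[OF g test_function_locally_integrable[OF g]]) simp
  have "\<exists>B. \<forall>x. \<bar>partials is g x\<bar> \<le> B" for "is"
    using test_function_bounded[OF test_function_partials[OF g]] by metis
  then obtain B where B: "\<And>is x. \<bar>partials is g x\<bar> \<le> B is" by metis
  have fin: "finite {is :: 'n list. length is = k}"
    using finite_lists_length_eq[of "UNIV :: 'n set" k] by simp
  have "AE x in lebesgue. weak_deriv is g x = partials (rev is) g x" for "is" by (rule weak_deriv_AE_eq[OF wd])
  then have "AE x in lebesgue. \<forall>is\<in>{is :: 'n list. length is = k}. weak_deriv is g x = partials (rev is) g x"
    by (intro AE_finite_allI fin)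
  then have b: "AE x in lebesgue. \<bar>norm_nabla k g x\<bar> \<le> sqrt (\<Sum>is | length is = k. (B (rev is))\<^sup>2)"
  proof eventually_elim
    case (elim x)
    have "(\<Sum>is | length is = k. (weak_deriv is g x)\<^sup>2) \<le> (\<Sum>is | length is = k. (B (rev is))\<^sup>2)"
    proof (rule sum_mono)
      fix "is" :: "'n list" assume "is \<in> {is. length is = k}"
      then have "\<bar>weak_deriv is g x\<bar> \<le> B (rev is)" using elim B by simp
      then show "(weak_deriv is g x)\<^sup>2 \<le> (B (rev is))\<^sup>2" by (simp add: power2_le_iff_abs_le abs_le_square_iff[symmetric])
    qed
    then show ?case by (simp add: norm_nabla_def sum_nonneg)
  qed
  obtain r where "\<Omega> \<subseteq> ball 0 r" using bounded_subset_ballD[OF \<Omega>(1), of 0] by blast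
  then have "emeasure lebesgue \<Omega> \<le> emeasure lebesgue (ball (0::real^'n) r)" by (rule emeasure_mono) simp
  also have "\<dots> < \<infinity>" using emeasure_lborel_ball_finite[of "0::real^'n" r] by simp
  finally have "emeasure lebesgue \<Omega> < \<infinity>" .
  then have "weak_Lp_norm \<Omega> p (norm_nabla k g) < \<infinity>" by (rule weak_Lp_norm_bounded[OF _ p b])
  then show ?thesis
    using \<Omega>(2) wd unfolding W0_weak_def weakly_differentiable_def by blast
qed

lemma precise_rep_locally_constant:
  fixes g :: "real^'n::finite \<Rightarrow> real"
  assumes g: "\<And>y. y \<in> ball c \<rho> \<Longrightarrow> g y = v" and x: "x \<in> ball c \<rho>"
  shows "precise_rep g x = v"
proof (rule precise_rep_eqI)
  define q where "q = \<rho> - dist c x"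
  have q: "q > 0" using x by (simp add: q_def)
  have "ball_average g x r = v" if r: "0 < r" "r < q" for r
  proof -
    have sub: "ball x r \<subseteq> ball c \<rho>"
    proof
      fix y assume "y \<in> ball x r"
      then show "y \<in> ball c \<rho>" using r dist_triangle[of c y x] by (simp add: q_def)
    qed
    have "(LINT y:ball x r|lebesgue. g y) = (LINT y:ball x r|lebesgue. v)"
      by (rule set_lebesgue_integral_cong) (use sub g in auto)
    also have "\<dots> = measure lebesgue (ball x r) * v"
      by (simp add: set_lebesgue_integral_def)
    finally show ?thesis using content_ball_pos[OF r(1), of x] by (simp add: ball_average_def)
  qed
  then have "eventually (\<lambda>r. ball_average g x r = v) (at_right 0)"
    unfolding eventually_at_right_field using q by blast
  then show "(ball_average g x \<longlongrightarrow> v) (at_right 0)" by (rule tendsto_eventually)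
qed

section \<open>Failure above the threshold\<close>

theorem supercritical_unbounded:
  fixes \<Omega> :: "(real^'n::finite) set" and k :: nat and d :: real
  assumes \<Omega>: "open \<Omega>" "bounded \<Omega>" and k: "1 \<le> k" "k < CARD('n)" and d: "0 < d"
    and \<nu>: "borel_measure_on \<Omega> \<nu>" "lower_growth \<Omega> \<nu> d" and \<gamma>: "\<gamma> > beta_infty TYPE('n) k d"
  shows "\<exists>u \<in> W0_weak k (real CARD('n) / real k) \<Omega>. weak_Lp_norm \<Omega> (real CARD('n) / real k) (norm_D k u) \<le> 1 \<and>
     \<not> (\<integral>\<^sup>+x\<in>\<Omega>. ennreal (exp (\<gamma> * \<bar>precise_rep u x\<bar>)) \<partial>\<nu>) \<le> ennreal C"
proof -
  define n where "n = real CARD('n)"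
  define w where "w = omega TYPE('n)"
  have n: "n > 0" "real k > 0" using k by (auto simp: n_def)
  have w: "w > 0" by (simp add: w_def omega_pos)
  define E where "E = riesz_const TYPE('n) k / (n * w)"
  have E: "E > 0" using riesz_const_pos[OF k] n w by (simp add: E_def)
  define W where "W = w powr (real k / n)"
  have W: "W > 0" using w by (simp add: W_def)
  \<comment> \<open>E W is the ratio of |D^k ln (1 / |x|)| to the extremal function of weak norm 1,
    so the threshold is d times this ratio.\<close>
  have \<beta>: "beta_infty TYPE('n) k d = d * (E * W)"
  proof -
    have "w powr ((n - real k) / n) = w / W"
      unfolding W_def using w n by (simp add: diff_divide_distrib powr_diff)
    then show ?thesis
      unfolding beta_infty_eq E_def using n w W by (simp add: n_def[symmetric] w_def[symmetric] field_simps)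
  qed
  have \<gamma>0: "\<gamma> > 0" and \<gamma>1: "d * (E * W) < \<gamma>" using \<gamma> d E W unfolding \<beta> by (auto intro: less_trans[of 0 "d * (E * W)"])
  \<comment> \<open>Since 1 - 2 e = d E W / \<gamma>, a step of height h > 1 - e still satisfies d E
    W < \<gamma> h.\<close>
  define e where "e = (1 - d * (E * W) / \<gamma>) / 2"
  have e: "e > 0" using \<gamma>0 \<gamma>1 by (simp add: e_def)
  obtain H :: "nat \<Rightarrow> real \<Rightarrow> real" where
    H: "\<And>j t. (H j has_real_derivative H (Suc j) t) (at t)"
    "\<And>t. 0 \<le> H 1 t \<and> H 1 t \<le> 1" "\<And>t. t \<le> 0 \<Longrightarrow> H 0 t = 0" "\<And>t. t \<ge> 1 \<Longrightarrow> H 0 t = H 0 1"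
    "H 0 1 > 1 - e" "\<And>j. \<exists>B. \<forall>t. \<bar>H (Suc j) t\<bar> \<le> B"
    "\<And>j t. t > 1 \<Longrightarrow> H (Suc j) t = 0"
    using smooth_step_exists[OF e] by metis
  define h where "h = H 0 1"
  have h: "d * (E * W) < \<gamma> * h" "h > 0"
  proof -
    have "x = 1 - 2 * ((1 - x) / 2)" for x :: real by (simp add: field_simps)
    then have eq: "d * (E * W) / \<gamma> = 1 - 2 * e" unfolding e_def .
    have "0 < d * (E * W) / \<gamma>" using d E W \<gamma>0 by simp
    then have "1 - 2 * e > 0" by (simp add: eq)
    then show "h > 0" using H(5) e by (simp add: h_def)
    have "d * (E * W) / \<gamma> < h" using H(5) e by (simp add: eq h_def)
    then show "d * (E * W) < \<gamma> * h" using \<gamma>0 by (simp add: field_simps)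
  qed
  obtain x0 \<rho>0 C0 where x0: "x0 \<in> \<Omega>" and \<rho>0: "\<rho>0 > 0" and C0: "C0 > 0"
    and low: "\<And>\<rho>. 0 < \<rho> \<Longrightarrow> \<rho> \<le> \<rho>0 \<Longrightarrow> ennreal (C0 * \<rho> powr d) \<le> emeasure \<nu> (ball x0 \<rho> \<inter> \<Omega>)"
    using \<nu>(2) unfolding lower_growth_def by blast
  obtain R where R: "R > 0" "ball x0 R \<subseteq> \<Omega>" using \<Omega>(1) x0 unfolding open_contains_ball by blast
  obtain B where B: "B \<ge> 0" "\<And>T R x. T \<ge> 1 \<Longrightarrow> R > 0 \<Longrightarrow> x \<noteq> x0 \<Longrightarrow>
    classical_norm_D k (\<lambda>x. log_profile H T R ((norm (x - x0))\<^sup>2)) x \<le> (E + B / T) * norm (x - x0) powr (- real k)"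
    using log_profile_norm_D_bound[where H = H, OF H(1,4,7,2,6) k, of x0] unfolding E_def n_def w_def by blast
  \<comment> \<open>The normalization that brings the bound (E + B / T) |x - x0|^(-k) down to
    omega^(-k/n) |x - x0|^(-k).\<close>
  define \<theta> where "\<theta> T = 1 / ((E + B / T) * W)" for T
  have lim: "((\<lambda>T. \<gamma> * (\<theta> T * h) - d) \<longlongrightarrow> \<gamma> * (1 / ((E + 0) * W) * h) - d) at_top"
    unfolding \<theta>_def
    by (intro tendsto_intros real_tendsto_divide_at_top[OF tendsto_const filterlim_ident]) (use E W in auto)
  \<comment> \<open>Half of the limit of \<gamma> \<theta>(T) h - d for large T. It is positive
    above the threshold and leaves room for a finite T.\<close>
  define q where "q = (\<gamma> * (1 / ((E + 0) * W) * h) - d) / 2"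
  have "d < \<gamma> * h / (E * W)" using h(1) E W by (simp add: field_simps)
  then have q: "q > 0" by (simp add: q_def)
  have ev1: "eventually (\<lambda>T. \<gamma> * (\<theta> T * h) - d > q) at_top"
  proof (rule order_tendstoD(1)[OF lim])
    have "x > x / 2" if "x / 2 > 0" for x :: real using that by simp
    from this[of "\<gamma> * (1 / ((E + 0) * W) * h) - d"] show "q < \<gamma> * (1 / ((E + 0) * W) * h) - d"
      using q unfolding q_def by blast
  qed
  have "filterlim (\<lambda>T. C0 * R powr d * exp (q * T)) at_top at_top"
    by (intro filterlim_tendsto_pos_mult_at_top[OF tendsto_const] filterlim_compose[OF exp_at_top]
        filterlim_ident) (use C0 R q in auto)
  then have ev2: "eventually (\<lambda>T. C0 * R powr d * exp (q * T) > \<bar>C\<bar>) at_top"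
    by (simp add: filterlim_at_top_dense)
  have "((\<lambda>T. R * exp (- T)) \<longlongrightarrow> R * 0) at_top"
    by (intro tendsto_mult tendsto_const filterlim_compose[OF exp_at_bot filterlim_uminus_at_bot_at_top])
  then have ev3: "eventually (\<lambda>T. R * exp (- T) < \<rho>0) at_top"
    by (rule order_tendstoD(2)) (use \<rho>0 in simp)
  have "eventually (\<lambda>T. T \<ge> 1 \<and> \<gamma> * (\<theta> T * h) - d > q \<and> C0 * R powr d * exp (q * T) > \<bar>C\<bar> \<and> R * exp (- T) < \<rho>0) at_top"
    using eventually_ge_at_top[of 1] ev1 ev2 ev3 by eventually_elim simp
  then obtain T where T: "T \<ge> 1" "\<gamma> * (\<theta> T * h) - d > q" "C0 * R powr d * exp (q * T) > \<bar>C\<bar>" "R * exp (- T) < \<rho>0"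
    by (auto simp: eventually_at_top_linorder)
  define EB where "EB = E + B / T"
  have EB: "EB > 0" using E B(1) T(1) by (simp add: EB_def add_pos_nonneg)
  have \<theta>: "\<theta> T > 0" "\<theta> T * EB = 1 / W" using EB W by (auto simp: \<theta>_def EB_def[symmetric])
  define v where "v x = log_profile H T R ((norm (x - x0))\<^sup>2)" for x
  define u where "u x = \<theta> T * v x" for x
  have v: "test_function v"
  proof -
    obtain F where F: "F 0 = log_profile H T R" "\<And>j t. (F j has_real_derivative F (Suc j) t) (at t)"
      using log_profile_smooth(1)[where H = H, OF H(1,4,7), of T R] T(1) R(1) unfolding smooth_real_def by (metis zero_less_one order_less_le_trans)
    have s: "smooth v" using smooth_radial[of F x0, OF F(2)] by (simp add: F(1) v_def[abs_def])
    have "v x = 0" if "norm x > norm x0 + R" for x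
    proof -
      have "norm (x - x0) \<ge> R" using norm_triangle_ineq2[of x x0] that by linarith
      then have "R\<^sup>2 \<le> (norm (x - x0))\<^sup>2" "x \<noteq> x0" using R(1) by (auto intro: power_mono)
      then show ?thesis using log_scale_le_0[of T R "(norm (x - x0))\<^sup>2"] H(3) T(1) R(1) less_le_trans[of 0 "R\<^sup>2"]
        by (simp add: v_def log_profile_def)
    qed
    then show ?thesis by (rule test_functionI[OF s])
  qed
  have u: "test_function u" unfolding u_def[abs_def] by (rule test_function_cmult[OF v])
  have u0: "u x = 0" if "x \<notin> \<Omega>" for x
  proof -
    have "norm (x - x0) \<ge> R" using R(2) that by (auto simp: dist_norm norm_minus_commute subset_iff not_less)
    then have "R\<^sup>2 \<le> (norm (x - x0))\<^sup>2" "x \<noteq> x0" using R(1) by (auto intro: power_mono)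
    then show ?thesis using log_scale_le_0[of T R "(norm (x - x0))\<^sup>2"] H(3) T(1) R(1) less_le_trans[of 0 "R\<^sup>2"]
      by (simp add: u_def v_def log_profile_def)
  qed
  have uW: "u \<in> W0_weak k (real CARD('n) / real k) \<Omega>"
    by (rule test_function_in_W0_weak[OF u \<Omega>(2) u0]) (use n in \<open>auto simp: n_def\<close>)
  have cu: "classical_norm_D k u x = \<theta> T * classical_norm_D k v x" for x
    unfolding u_def[abs_def] using classical_norm_D_cmult[OF v, where c = "\<theta> T" and k = k and x = x] \<theta>(1) by simp
  have "AE x in lebesgue. \<bar>norm_D k u x\<bar> \<le> omega TYPE('n) powr (- real k / real CARD('n)) * norm (x - x0) powr (- real k)"
  proof -
    have "AE x in lebesgue. x \<noteq> x0" by (rule AE_completion[OF AE_lborel_singleton])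
    then show ?thesis
      using norm_D_test_function[OF u, of k]
    proof eventually_elim
      case (elim x)
      have "norm_D k u x \<ge> 0" by (simp add: norm_D_def)
      then have "\<bar>norm_D k u x\<bar> = \<theta> T * classical_norm_D k v x" using elim cu by simp
      also have "\<dots> \<le> \<theta> T * (EB * norm (x - x0) powr (- real k))"
        unfolding EB_def v_def[abs_def] using \<theta>(1) by (intro mult_left_mono B(2) T(1) R(1) elim) auto
      also have "\<dots> = 1 / W * norm (x - x0) powr (- real k)" unfolding mult.assoc[symmetric] \<theta>(2) ..
      also have "1 / W = omega TYPE('n) powr (- real k / real CARD('n))"
        by (simp add: W_def n_def w_def powr_minus divide_inverse)
      finally show ?case .
    qed
  qed
  then have uN: "weak_Lp_norm \<Omega> (real CARD('n) / real k) (norm_D k u) \<le> 1"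
    by (rule weak_Lp_norm_power_le_1[rotated]) (use k in simp)
  define \<rho> where "\<rho> = R * exp (- T)"
  have \<rho>: "0 < \<rho>" "\<rho> \<le> \<rho>0" "\<rho> \<le> R" using R(1) T(1,4) by (auto simp: \<rho>_def)
  \<comment> \<open>On the inner ball the step has reached its full height, so the function is
    constant there and its precise representative is known at every point.\<close>
  have uc: "u y = \<theta> T * (T * h)" if "y \<in> ball x0 \<rho>" for y
  proof (cases "y = x0")
    case False
    have "norm (y - x0) < \<rho>" using that by (simp add: dist_norm norm_minus_commute)
    then have "(norm (y - x0))\<^sup>2 < (R * exp (- T))\<^sup>2" unfolding \<rho>_def by (intro power_strict_mono) auto
    from log_scale_gt_1[OF _ R(1) _ this] have "log_scale T R ((norm (y - x0))\<^sup>2) > 1" using T(1) False by simp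
    then show ?thesis using H(4)[of "log_scale T R ((norm (y - x0))\<^sup>2)"] False by (simp add: u_def v_def log_profile_def h_def)
  qed (simp add: u_def v_def log_profile_def h_def)
  have pr: "precise_rep u x = \<theta> T * (T * h)" if "x \<in> ball x0 \<rho>" for x
    by (rule precise_rep_locally_constant[OF uc that])
  have s\<nu>: "sets \<nu> = sets borel" using \<nu>(1) by (simp add: borel_measure_on_def)
  \<comment> \<open>The constant value contributes exp (\<gamma> \<theta>(T) h T), the measure of
    the inner ball at least C0 R^d exp (-d T); their product is at least C0 R^d exp (q T), which
    exceeds |C| by the choice of T.\<close>
  have "ennreal \<bar>C\<bar> < ennreal (C0 * R powr d * exp (q * T))" using T(3) by (simp add: ennreal_less_iff)
  also have "\<dots> \<le> ennreal (exp (\<gamma> * (\<theta> T * (T * h))) * (C0 * \<rho> powr d))"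
  proof (rule ennreal_leI)
    have "\<rho> powr d = R powr d * exp (- (T * d))"
      using R(1) by (simp add: \<rho>_def powr_mult exp_powr_real)
    moreover have "exp ((\<gamma> * (\<theta> T * h) - d) * T) = exp (\<gamma> * (\<theta> T * (T * h))) * exp (- (T * d))"
      unfolding exp_add[symmetric] by (simp add: algebra_simps)
    ultimately have "exp (\<gamma> * (\<theta> T * (T * h))) * (C0 * \<rho> powr d) = C0 * R powr d * exp ((\<gamma> * (\<theta> T * h) - d) * T)"
      by (simp only: mult_ac)
    moreover have "q * T \<le> (\<gamma> * (\<theta> T * h) - d) * T" using T(1,2) by (intro mult_right_mono) auto
    ultimately show "C0 * R powr d * exp (q * T) \<le> exp (\<gamma> * (\<theta> T * (T * h))) * (C0 * \<rho> powr d)"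
      using C0 by (simp add: mult_left_mono)
  qed
  also have "\<dots> = ennreal (exp (\<gamma> * (\<theta> T * (T * h)))) * ennreal (C0 * \<rho> powr d)"
    using C0 by (intro ennreal_mult) auto
  also have "\<dots> \<le> ennreal (exp (\<gamma> * (\<theta> T * (T * h)))) * emeasure \<nu> (ball x0 \<rho> \<inter> \<Omega>)"
    by (intro mult_left_mono low \<rho>) simp
  also have "\<dots> = (\<integral>\<^sup>+x. ennreal (exp (\<gamma> * (\<theta> T * (T * h)))) * indicator (ball x0 \<rho> \<inter> \<Omega>) x \<partial>\<nu>)"
    using \<Omega>(1) by (subst nn_integral_cmult_indicator) (auto simp: s\<nu>)
  also have "\<dots> \<le> (\<integral>\<^sup>+x\<in>\<Omega>. ennreal (exp (\<gamma> * \<bar>precise_rep u x\<bar>)) \<partial>\<nu>)"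
  proof (rule nn_integral_mono)
    fix x
    show "ennreal (exp (\<gamma> * (\<theta> T * (T * h)))) * indicator (ball x0 \<rho> \<inter> \<Omega>) x \<le> ennreal (exp (\<gamma> * \<bar>precise_rep u x\<bar>)) * indicator \<Omega> x"
      using pr[of x] \<theta>(1) T(1) h(2) by (auto simp: indicator_def abs_mult)
  qed
  finally have "ennreal \<bar>C\<bar> < (\<integral>\<^sup>+x\<in>\<Omega>. ennreal (exp (\<gamma> * \<bar>precise_rep u x\<bar>)) \<partial>\<nu>)" .
  moreover have "ennreal C \<le> ennreal \<bar>C\<bar>" by (intro ennreal_leI) simp
  ultimately have "\<not> (\<integral>\<^sup>+x\<in>\<Omega>. ennreal (exp (\<gamma> * \<bar>precise_rep u x\<bar>)) \<partial>\<nu>) \<le> ennreal C"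
    by (meson not_less order.strict_trans1)
  then show ?thesis using uW uN by blast
qed

theorem theorem1p6:
  fixes \<Omega> :: "(real^'n::finite) set" and k :: nat and d :: real
  assumes "2 \<le> CARD('n)" and "open \<Omega>" and "bounded \<Omega>"
    and "1 \<le> k" and "k < CARD('n)" and "0 < d" and "d \<le> real CARD('n)"
  shows "(\<forall>C'>0. \<forall>\<gamma><beta_infty TYPE('n) k d. \<exists>C>0::real. \<forall>\<nu>.
            borel_measure_on \<Omega> \<nu> \<and> upper_growth \<nu> d C' \<and> lower_growth \<Omega> \<nu> d \<longrightarrow>
            (\<forall>u \<in> W0_weak k (real CARD('n) / real k) \<Omega>.
               weak_Lp_norm \<Omega> (real CARD('n) / real k) (norm_D k u) \<le> 1 \<longrightarrow>
               (\<integral>\<^sup>+x\<in>\<Omega>. ennreal (exp (\<gamma> * \<bar>precise_rep u x\<bar>)) \<partial>\<nu>) \<le> ennreal C)) \<and>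
         (\<forall>\<nu>. borel_measure_on \<Omega> \<nu> \<and> (\<exists>C'>0. upper_growth \<nu> d C') \<and> lower_growth \<Omega> \<nu> d \<longrightarrow>
            (\<forall>\<gamma>>beta_infty TYPE('n) k d. \<not> (\<exists>C::real.
               \<forall>u \<in> W0_weak k (real CARD('n) / real k) \<Omega>.
                 weak_Lp_norm \<Omega> (real CARD('n) / real k) (norm_D k u) \<le> 1 \<longrightarrow>
                 (\<integral>\<^sup>+x\<in>\<Omega>. ennreal (exp (\<gamma> * \<bar>precise_rep u x\<bar>)) \<partial>\<nu>) \<le> ennreal C)))"
proof (intro conjI allI impI)
  fix C' \<gamma> :: real
  assume "C' > 0" "\<gamma> < beta_infty TYPE('n) k d"
  from subcritical_bound[OF assms(2-6) this]
  show "\<exists>C>0::real. \<forall>\<nu>. borel_measure_on \<Omega> \<nu> \<and> upper_growth \<nu> d C' \<and> lower_growth \<Omega> \<nu> d \<longrightarrow>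
      (\<forall>u \<in> W0_weak k (real CARD('n) / real k) \<Omega>.
         weak_Lp_norm \<Omega> (real CARD('n) / real k) (norm_D k u) \<le> 1 \<longrightarrow>
         (\<integral>\<^sup>+x\<in>\<Omega>. ennreal (exp (\<gamma> * \<bar>precise_rep u x\<bar>)) \<partial>\<nu>) \<le> ennreal C)"
    by blast
next
  fix \<nu> :: "(real^'n) measure" and \<gamma> :: real
  assume \<nu>: "borel_measure_on \<Omega> \<nu> \<and> (\<exists>C'>0. upper_growth \<nu> d C') \<and> lower_growth \<Omega> \<nu> d"
    and \<gamma>: "\<gamma> > beta_infty TYPE('n) k d"
  show "\<not> (\<exists>C::real. \<forall>u \<in> W0_weak k (real CARD('n) / real k) \<Omega>.
      weak_Lp_norm \<Omega> (real CARD('n) / real k) (norm_D k u) \<le> 1 \<longrightarrow>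
      (\<integral>\<^sup>+x\<in>\<Omega>. ennreal (exp (\<gamma> * \<bar>precise_rep u x\<bar>)) \<partial>\<nu>) \<le> ennreal C)"
    using supercritical_unbounded[OF assms(2-6) conjunct1[OF \<nu>] conjunct2[OF conjunct2[OF \<nu>]] \<gamma>] by blast
qed

end
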